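(* Let $B$ be a finite set of Boolean functions such that $\mathrm{S}_1\subseteq[B]$. Then $\mathrm{SAT}(\{\mathsf{G},\mathsf{X}\},B)$ and $\mathrm{SAT}(\{\mathsf{F},\mathsf{X}\},B)$ are $\mathrm{PSPACE}$-complete.
   Context: A Boolean function is a map $f:\{0,1\}^n\to\{0,1\}$; each is used as an $n$-ary propositional connective. For a set $B$ of Boolean functions, $[B]$ denotes the clone generated by $B$: the smallest set of Boolean functions containing $B$ and all projections and closed under composition (equivalently, the functions representable by propositional formulae built from $B$). $\mathrm{S}_1$ is the clone of 1-separating functions, i.e. those $n$-ary $f$ for which there is $i$ such that $f(a_1,\dots,a_n)=1$ implies $a_i=1$; equivalently $\mathrm{S}_1=[\{x\wedge\neg y\}]$. Temporal operators: unary $\mathsf{X}$, $\mathsf{F}$, $\mathsf{G}$, binary $\mathsf{U}$, $\mathsf{S}$. A temporal $B$-formula over a set $M$ of temporal operators is built from propositional variables using connectives from $B$ and operators from $M$. A structure $S=(s,V,\xi)$ is an infinite sequence $(s_i)_{i\in\mathbb N}$ of distinct states, a variable set $V$, and $\xi$ assigning to each state the set of variables true there. Semantics: $S,s_i\models x$ iff $x\in\xi(s_i)$; Boolean connectives pointwise; $S,s_i\models\mathsf{X}\varphi$ iff $S,s_{i+1}\models\varphi$; $S,s_i\models\varphi_1\mathsf{U}\varphi_2$ iff some $k\ge i$ has $S,s_k\models\varphi_2$ and $S,s_j\models\varphi_1$ for all $i\le j<k$; $S,s_i\models\varphi_1\mathsf{S}\varphi_2$ iff some $k\le i$ has $S,s_k\models\varphi_2$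 and $S,s_j\models\varphi_1$ for all $k<j\le i$; $\mathsf{F}\varphi=\mathrm{true}\,\mathsf{U}\,\varphi$, $\mathsf{G}\varphi=\neg\mathsf{F}\neg\varphi$. A formula is satisfiable if it holds at some state of some structure. $\mathrm{SAT}(M,B)$ is the problem of deciding satisfiability of temporal $B$-formulae over $M$. *)

theory Defs
  imports "HOL-Computational_Algebra.Polynomial"
begin

section \<open>Boolean functions and clones\<close>

text \<open>
  A Boolean function is an arity together with a map on argument lists of that length.
  Off these lists the map is fixed to \<^term>\<open>False\<close>, so that equality is equality of
  Boolean functions. Arity 0 (a nullary connective) is allowed.
\<close>

typedef bool_fun = "{(n :: nat, f :: bool list \<Rightarrow> bool). \<forall>as. length as \<noteq> n \<longrightarrow> \<not> f as}"
  by (rule exI[of _ "(0, \<lambda>_. False)"]) simp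

definition arity :: "bool_fun \<Rightarrow> nat" where
  "arity f = fst (Rep_bool_fun f)"

definition app :: "bool_fun \<Rightarrow> bool list \<Rightarrow> bool" where
  "app f = snd (Rep_bool_fun f)"

definition bool_fun_of :: "nat \<Rightarrow> (bool list \<Rightarrow> bool) \<Rightarrow> bool_fun" where
  "bool_fun_of n f = Abs_bool_fun (n, \<lambda>as. length as = n \<and> f as)"

lemma arity_bool_fun_of [simp]: "arity (bool_fun_of n f) = n"
  by (simp add: arity_def bool_fun_of_def Abs_bool_fun_inverse)

lemma app_bool_fun_of [simp]: "app (bool_fun_of n f) as \<longleftrightarrow> length as = n \<and> f as"
  by (simp add: app_def bool_fun_of_def Abs_bool_fun_inverse)

lemma bool_fun_eqI:
  assumes "arity f = arity g" "\<And>as. length as = arity f \<Longrightarrow> app f as = app g as"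
  shows "f = g"
proof -
  have off: "\<not> app h as" if "length as \<noteq> arity h" for h as
    using Rep_bool_fun[of h] that by (auto simp: arity_def app_def)
  have "app f as = app g as" for as
    using assms off[of as f] off[of as g] by (cases "length as = arity f") auto
  then have "Rep_bool_fun f = Rep_bool_fun g"
    using assms(1) by (intro prod_eqI) (auto simp: arity_def app_def)
  then show ?thesis by (simp add: Rep_bool_fun_inject)
qed

definition projection :: "nat \<Rightarrow> nat \<Rightarrow> bool_fun" where
  "projection n i = bool_fun_of n (\<lambda>as. as ! i)"

definition compose :: "nat \<Rightarrow> bool_fun \<Rightarrow> bool_fun list \<Rightarrow> bool_fun" where
  "compose n f gs = bool_fun_of n (\<lambda>as. app f (map (\<lambda>g. app g as) gs))"

inductive_set clone :: "bool_fun set \<Rightarrow> bool_fun set" for B :: "bool_fun set" where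
  base: "f \<in> B \<Longrightarrow> f \<in> clone B"
| projection: "i < n \<Longrightarrow> projection n i \<in> clone B"
| compose: "f \<in> clone B \<Longrightarrow> length gs = arity f \<Longrightarrow>
    (\<And>g. g \<in> set gs \<Longrightarrow> g \<in> clone B \<and> arity g = n) \<Longrightarrow> compose n f gs \<in> clone B"

definition S1 :: "bool_fun set" where
  "S1 = {f. \<exists>i < arity f. \<forall>as. length as = arity f \<longrightarrow> app f as \<longrightarrow> as ! i}"


section \<open>Temporal formulae\<close>

datatype temporal_op = Op_X | Op_F | Op_G | Op_U | Op_S

datatype formula =
    Var nat
  | Conn bool_fun "formula list"
  | Next formula
  | Finally formula
  | Globally formula
  | Until formula formula
  | Since formula formula

inductive_set formulas :: "temporal_op set \<Rightarrow> bool_fun set \<Rightarrow> formula set"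
  for M :: "temporal_op set" and B :: "bool_fun set" where
  Var: "Var x \<in> formulas M B"
| Conn: "f \<in> B \<Longrightarrow> length \<phi>s = arity f \<Longrightarrow> (\<And>\<phi>. \<phi> \<in> set \<phi>s \<Longrightarrow> \<phi> \<in> formulas M B) \<Longrightarrow>
    Conn f \<phi>s \<in> formulas M B"
| Next: "Op_X \<in> M \<Longrightarrow> \<phi> \<in> formulas M B \<Longrightarrow> Next \<phi> \<in> formulas M B"
| Finally: "Op_F \<in> M \<Longrightarrow> \<phi> \<in> formulas M B \<Longrightarrow> Finally \<phi> \<in> formulas M B"
| Globally: "Op_G \<in> M \<Longrightarrow> \<phi> \<in> formulas M B \<Longrightarrow> Globally \<phi> \<in> formulas M B"
| Until: "Op_U \<in> M \<Longrightarrow> \<phi> \<in> formulas M B \<Longrightarrow> \<psi> \<in> formulas M B \<Longrightarrow> Until \<phi> \<psi> \<in> formulas M B"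
| Since: "Op_S \<in> M \<Longrightarrow> \<phi> \<in> formulas M B \<Longrightarrow> \<psi> \<in> formulas M B \<Longrightarrow> Since \<phi> \<psi> \<in> formulas M B"

record 's ltl_structure =
  states :: "nat \<Rightarrow> 's"
  vars :: "nat set"
  label :: "'s \<Rightarrow> nat set"

definition is_structure :: "'s ltl_structure \<Rightarrow> bool" where
  "is_structure S \<longleftrightarrow> inj (states S) \<and> (\<forall>i. label S (states S i) \<subseteq> vars S)"

definition until :: "(nat \<Rightarrow> bool) \<Rightarrow> (nat \<Rightarrow> bool) \<Rightarrow> nat \<Rightarrow> bool" where
  "until P Q i \<longleftrightarrow> (\<exists>k \<ge> i. Q k \<and> (\<forall>j. i \<le> j \<and> j < k \<longrightarrow> P j))"

definition since :: "(nat \<Rightarrow> bool) \<Rightarrow> (nat \<Rightarrow> bool) \<Rightarrow> nat \<Rightarrow> bool" where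
  "since P Q i \<longleftrightarrow> (\<exists>k \<le> i. Q k \<and> (\<forall>j. k < j \<and> j \<le> i \<longrightarrow> P j))"

text \<open>
  The states being distinct, the state \<^term>\<open>states S i\<close> is given by its index \<^term>\<open>i\<close>.
  The clauses for F and G unfold true U \<open>\<phi>\<close> and not F not \<open>\<phi>\<close>.
\<close>

fun sat :: "'s ltl_structure \<Rightarrow> nat \<Rightarrow> formula \<Rightarrow> bool" where
  "sat S i (Var x) \<longleftrightarrow> x \<in> label S (states S i)"
| "sat S i (Conn f \<phi>s) \<longleftrightarrow> app f (map (sat S i) \<phi>s)"
| "sat S i (Next \<phi>) \<longleftrightarrow> sat S (i + 1) \<phi>"
| "sat S i (Finally \<phi>) \<longleftrightarrow> until (\<lambda>_. True) (\<lambda>j. sat S j \<phi>) i"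
| "sat S i (Globally \<phi>) \<longleftrightarrow> \<not> until (\<lambda>_. True) (\<lambda>j. \<not> sat S j \<phi>) i"
| "sat S i (Until \<phi> \<psi>) \<longleftrightarrow> until (\<lambda>j. sat S j \<phi>) (\<lambda>j. sat S j \<psi>) i"
| "sat S i (Since \<phi> \<psi>) \<longleftrightarrow> since (\<lambda>j. sat S j \<phi>) (\<lambda>j. sat S j \<psi>) i"

text \<open>HOL cannot quantify over the type of states here; by \<open>satisfiable_any_state\<close> below,
  fixing it to \<^typ>\<open>nat\<close> loses nothing.\<close>

definition satisfiable :: "formula \<Rightarrow> bool" where
  "satisfiable \<phi> \<longleftrightarrow> (\<exists>(S :: nat ltl_structure) i. is_structure S \<and> sat S i \<phi>)"

lemma satisfiable_any_state:
  fixes S :: "'s ltl_structure"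
  assumes "is_structure S" "sat S i \<phi>"
  shows "satisfiable \<phi>"
proof -
  define T :: "nat ltl_structure" where
    "T = \<lparr>states = id, vars = vars S, label = (\<lambda>j. label S (states S j))\<rparr>"
  have "sat T j \<psi> = sat S j \<psi>" for j \<psi>
  proof (induction \<psi> arbitrary: j)
    case (Conn f \<phi>s)
    then show ?case by (auto cong: map_cong)
  qed (simp_all add: T_def)
  moreover have "is_structure T"
    using assms(1) by (simp add: is_structure_def T_def)
  ultimately show ?thesis
    using assms(2) unfolding satisfiable_def by blast
qed


section \<open>Formulae as bit strings\<close>

fun binary :: "nat \<Rightarrow> bool list" where
  "binary n = (if n = 0 then [] else odd n # binary (n div 2))"

declare binary.simps [simp del]

definition encode_nat :: "nat \<Rightarrow> bool list" where
  "encode_nat n = concat (map (\<lambda>b. [True, b]) (binary n)) @ [False]"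

text \<open>
  A connective is written down as its arity and truth table; for a fixed finite set of
  connectives this has bounded length.
\<close>

definition encode_bool_fun :: "bool_fun \<Rightarrow> bool list" where
  "encode_bool_fun f = encode_nat (arity f) @ map (app f) (List.n_lists (arity f) [False, True])"

fun encode :: "formula \<Rightarrow> bool list" where
  "encode (Var x) = [False, False, False] @ encode_nat x"
| "encode (Conn f \<phi>s) = [False, False, True] @ encode_bool_fun f @ concat (map encode \<phi>s)"
| "encode (Next \<phi>) = [False, True, False] @ encode \<phi>"
| "encode (Finally \<phi>) = [False, True, True] @ encode \<phi>"
| "encode (Globally \<phi>) = [True, False, False] @ encode \<phi>"
| "encode (Until \<phi> \<psi>) = [True, False, True] @ encode \<phi> @ encode \<psi>"
| "encode (Since \<phi> \<psi>) = [True, True, False] @ encode \<phi> @ encode \<psi>"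

lemma binary_inj: "binary m = binary n \<Longrightarrow> m = n"
proof (induction m arbitrary: n rule: less_induct)
  case (less m)
  show ?case
  proof (cases "m = 0 \<or> n = 0")
    case True
    then show ?thesis
      using less.prems by (subst (asm) (1 2) binary.simps) (auto split: if_splits)
  next
    case False
    then have "odd m = odd n" "binary (m div 2) = binary (n div 2)"
      using less.prems by (subst (asm) (1 2) binary.simps; simp)+
    then have "m mod 2 = n mod 2" "m div 2 = n div 2"
      using less.IH[of "m div 2" "n div 2"] False by (auto simp: odd_iff_mod_2_eq_one even_iff_mod_2_eq_zero)
    then show ?thesis by (metis div_mult_mod_eq)
  qed
qed

lemma encode_nat_prefix:
  assumes "encode_nat m @ u = encode_nat n @ v"
  shows "m = n \<and> u = v"
proof -
  have "xs = ys \<and> u = v"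
    if "concat (map (\<lambda>b. [True, b]) xs) @ [False] @ u = concat (map (\<lambda>b. [True, b]) ys) @ [False] @ v"
    for xs ys :: "bool list"
    using that
  proof (induction xs arbitrary: ys)
    case Nil
    then show ?case by (cases ys) auto
  next
    case (Cons x xs)
    then show ?case by (cases ys) auto
  qed
  from this[of "binary m" "binary n"] show ?thesis
    using assms binary_inj by (auto simp: encode_nat_def)
qed

lemma encode_bool_fun_prefix:
  assumes "encode_bool_fun f @ u = encode_bool_fun g @ v"
  shows "f = g \<and> u = v"
proof -
  from assms have *: "arity f = arity g"
    "map (app f) (List.n_lists (arity f) [False, True]) @ u
      = map (app g) (List.n_lists (arity g) [False, True]) @ v"
    unfolding encode_bool_fun_def append_assoc using encode_nat_prefix by blast+
  then have eq: "map (app f) (List.n_lists (arity f) [False, True])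
      = map (app g) (List.n_lists (arity f) [False, True])" "u = v"
    by auto
  have "app f as = app g as" if "length as = arity f" for as
  proof -
    have "as \<in> set (List.n_lists (arity f) [False, True])"
      using that by (auto simp: set_n_lists)
    with eq(1)[unfolded map_eq_conv] show ?thesis by blast
  qed
  then show ?thesis using *(1) eq(2) bool_fun_eqI by blast
qed

lemma encode_prefix:
  assumes "\<phi> \<in> formulas M B" "\<psi> \<in> formulas M B" "encode \<phi> @ u = encode \<psi> @ v"
  shows "\<phi> = \<psi> \<and> u = v"
  using assms
proof (induction \<phi> arbitrary: \<psi> u v rule: formulas.induct)
  case (Var x)
  then show ?case
    by (cases \<psi>) (auto dest: encode_nat_prefix)
next
  case (Conn f \<phi>s)
  from Conn.prems(1) obtain g \<psi>s where \<psi>: "\<psi> = Conn g \<psi>s"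
    and g: "length \<psi>s = arity g" "\<And>\<chi>. \<chi> \<in> set \<psi>s \<Longrightarrow> \<chi> \<in> formulas M B"
    by cases (use Conn.prems(2) in simp_all)
  have *: "f = g" "concat (map encode \<phi>s) @ u = concat (map encode \<psi>s) @ v"
    using Conn.prems(2) encode_bool_fun_prefix by (auto simp: \<psi>)
  have "\<phi>s = \<psi>s \<and> u = v"
    if "length \<phi>s = length \<psi>s" "concat (map encode \<phi>s) @ u = concat (map encode \<psi>s) @ v"
       "set \<psi>s \<subseteq> formulas M B"
       "\<And>\<phi> \<psi> u v. \<phi> \<in> set \<phi>s \<Longrightarrow> \<psi> \<in> formulas M B \<Longrightarrow> encode \<phi> @ u = encode \<psi> @ v \<Longrightarrow> \<phi> = \<psi> \<and> u = v"
    for \<phi>s \<psi>s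
    using that
  proof (induction \<phi>s \<psi>s rule: list_induct2)
    case Nil
    then show ?case by simp
  next
    case (Cons a as b bs)
    have "a = b \<and> concat (map encode as) @ u = concat (map encode bs) @ v"
      using Cons.prems by (intro Cons.prems(3)) auto
    moreover have "as = bs \<and> u = v"
    proof (rule Cons.IH)
      show "concat (map encode as) @ u = concat (map encode bs) @ v"
        using calculation by simp
      show "set bs \<subseteq> formulas M B"
        using Cons.prems(2) by simp
      show "\<phi> = \<psi> \<and> u = v"
        if "\<phi> \<in> set as" "\<psi> \<in> formulas M B" "encode \<phi> @ u = encode \<psi> @ v" for \<phi> \<psi> u v
        using that by (intro Cons.prems(3)) auto
    qed
    ultimately show ?case by simp
  qed
  from this[of \<phi>s \<psi>s] show ?case
    using * g Conn.hyps Conn.IH by (auto simp: \<psi>)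
next
  case (Next \<phi>)
  from Next.prems(1) show ?case
    by cases (use Next.prems(2) in \<open>auto dest: Next.IH\<close>)
next
  case (Finally \<phi>)
  from Finally.prems(1) show ?case
    by cases (use Finally.prems(2) in \<open>auto dest: Finally.IH\<close>)
next
  case (Globally \<phi>)
  from Globally.prems(1) show ?case
    by cases (use Globally.prems(2) in \<open>auto dest: Globally.IH\<close>)
next
  case (Until \<phi>1 \<phi>2)
  from Until.prems(1) show ?case
    by cases (use Until.prems(2) in \<open>auto dest: Until.IH(1) Until.IH(2)\<close>)
next
  case (Since \<phi>1 \<phi>2)
  from Since.prems(1) show ?case
    by cases (use Since.prems(2) in \<open>auto dest: Since.IH(1) Since.IH(2)\<close>)
qed

definition SAT :: "temporal_op set \<Rightarrow> bool_fun set \<Rightarrow> bool list set" where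
  "SAT M B = encode ` {\<phi> \<in> formulas M B. satisfiable \<phi>}"

lemma encode_in_SAT_iff:
  assumes "\<phi> \<in> formulas M B"
  shows "encode \<phi> \<in> SAT M B \<longleftrightarrow> satisfiable \<phi>"
proof
  assume "encode \<phi> \<in> SAT M B"
  then obtain \<psi> where \<psi>: "\<psi> \<in> formulas M B" "satisfiable \<psi>" "encode \<phi> = encode \<psi>"
    by (auto simp: SAT_def)
  then show "satisfiable \<phi>"
    using encode_prefix[OF assms \<psi>(1), of "[]" "[]"] by simp
qed (use assms in \<open>simp add: SAT_def\<close>)


section \<open>Turing machines\<close>

text \<open>
  Deterministic multi-tape Turing machines. Each tape is two-way infinite, with cells indexed
  by integers. States are the numbers below \<open>num_states\<close> and tape symbols those below
  \<open>num_symbols\<close>, with 0 the blank and 1, 2 the two input bits. The transition function maps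
  a state and the list of scanned symbols to a new state and, for each tape, the symbol to
  write and the head move.
\<close>

datatype move = Move_Left | Stay | Move_Right

record tm =
  num_tapes :: nat
  num_symbols :: nat
  num_states :: nat
  start_state :: nat
  accept_state :: nat
  reject_state :: nat
  trans :: "nat \<Rightarrow> nat list \<Rightarrow> nat \<times> (nat \<times> move) list"

definition halting :: "tm \<Rightarrow> nat \<Rightarrow> bool" where
  "halting M q \<longleftrightarrow> q = accept_state M \<or> q = reject_state M"

definition is_tm :: "tm \<Rightarrow> bool" where
  "is_tm M \<longleftrightarrow>
    num_tapes M \<ge> 1 \<and> num_symbols M \<ge> 3 \<and>
    start_state M < num_states M \<and> accept_state M < num_states M \<and>
    reject_state M < num_states M \<and> accept_state M \<noteq> reject_state M \<and>
    (\<forall>q < num_states M. \<forall>as. \<not> halting M q \<and> length as = num_tapes M \<and> set as \<subseteq> {..<num_symbols M} \<longrightarrow>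
      fst (trans M q as) < num_states M \<and>
      length (snd (trans M q as)) = num_tapes M \<and>
      fst ` set (snd (trans M q as)) \<subseteq> {..<num_symbols M})"

type_synonym tape = "(int \<Rightarrow> nat) \<times> int"
type_synonym config = "nat \<times> tape list"

definition bit_symbol :: "bool \<Rightarrow> nat" where
  "bit_symbol b = (if b then 2 else 1)"

definition word_tape :: "bool list \<Rightarrow> int \<Rightarrow> nat" where
  "word_tape w i = (if 0 \<le> i \<and> i < int (length w) then bit_symbol (w ! nat i) else 0)"

definition initial :: "tm \<Rightarrow> bool list \<Rightarrow> config" where
  "initial M w = (start_state M, (word_tape w, 0) # replicate (num_tapes M - 1) (\<lambda>_. 0, 0))"

definition scanned :: "tape \<Rightarrow> nat" where
  "scanned = (\<lambda>(t, h). t h)"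

definition act :: "tape \<Rightarrow> nat \<times> move \<Rightarrow> tape" where
  "act = (\<lambda>(t, h) (a, d). (t(h := a),
    case d of Move_Left \<Rightarrow> h - 1 | Stay \<Rightarrow> h | Move_Right \<Rightarrow> h + 1))"

definition step :: "tm \<Rightarrow> config \<Rightarrow> config" where
  "step M = (\<lambda>(q, ts). if halting M q then (q, ts)
    else (let (q', acts) = trans M q (map scanned ts) in (q', map2 act ts acts)))"

definition run :: "tm \<Rightarrow> bool list \<Rightarrow> nat \<Rightarrow> config" where
  "run M w t = (step M ^^ t) (initial M w)"

definition cells_visited :: "tm \<Rightarrow> bool list \<Rightarrow> nat \<Rightarrow> (nat \<times> int) set" where
  "cells_visited M w t = {(j, snd (snd (run M w i) ! j)) |i j. i \<le> t \<and> j < num_tapes M}"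


section \<open>PSPACE-completeness\<close>

text \<open>Languages are sets of bit strings; deciders halt on every input.\<close>

definition PSPACE :: "bool list set set" where
  "PSPACE = {L. \<exists>M (p :: nat poly). is_tm M \<and>
    (\<forall>w. (\<exists>t. fst (run M w t) = (if w \<in> L then accept_state M else reject_state M)) \<and>
         (\<forall>t. card (cells_visited M w t) \<le> poly p (length w)))}"

text \<open>The output of a transducer is the word on its last tape, from cell 0 up to the first blank.\<close>

definition polytime_computable :: "(bool list \<Rightarrow> bool list) \<Rightarrow> bool" where
  "polytime_computable f \<longleftrightarrow> (\<exists>M (p :: nat poly). is_tm M \<and>
    (\<forall>w. \<exists>t \<le> poly p (length w). halting M (fst (run M w t)) \<and>
      (\<forall>i \<le> length (f w).
        fst (last (snd (run M w t))) (int i) = word_tape (f w) (int i))))"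

definition polytime_reducible :: "bool list set \<Rightarrow> bool list set \<Rightarrow> bool" where
  "polytime_reducible L K \<longleftrightarrow>
    (\<exists>f. polytime_computable f \<and> (\<forall>w. w \<in> L \<longleftrightarrow> f w \<in> K))"

definition PSPACE_complete :: "bool list set \<Rightarrow> bool" where
  "PSPACE_complete K \<longleftrightarrow> K \<in> PSPACE \<and> (\<forall>L \<in> PSPACE. polytime_reducible L K)"

end

theory Submission
  imports Defs
begin

text \<open>
  Membership: write a formula in postfix order as a list of tokens and guess a lasso-shaped model
  one state at a time. A state is a vector of cells, one for each token, which records the truth
  values and, on the loop, also the values at its entry and the eventualities already fulfilled. The formula is satisfiable iff one vector is reachable from another by edges that are
  checked locally, and Savitch's algorithm decides this as the value of a quantifier tree of
  polynomial depth, searched depth-first.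

  Hardness: the computation of a machine in polynomial space is a tiling of the time line, one
  column for each state. Since \<open>S\<^sub>1\<close> contains only functions below one of their
  arguments, a clone above it yields conjunction and negation only relative to a variable for
  truth, which is conjoined to the formula. A conjunction template with a single occurrence of
  each argument keeps the nested conjunctions of polynomial size.
\<close>

section \<open>Stack programs\<close>

text \<open>Both directions end in multi-tape machines, and one programming language serves for
  both: \<open>exec\<close> counts machine steps exactly and carries a predicate on stack lengths,
  so a single compilation theorem yields time bounds for the reductions and space bounds for the
  decision procedure. The input encoding is prefix, so pushing its tokens on a stack turns it into
  the postfix order that a stack evaluates directly. What a path must remember about the loop is its
  entry values and one mark per subformula, which gives 12 possible cells. Since 12 * 12 is at most
  2 ^ 8, eight halvings per token reach every vector. Recursion is avoided: a leaf of the quantifier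
  tree rebuilds its two vectors from the list of choices made so far. The obstacle in the hardness
  proof is formula size, because a formula for conjunction found by composing functions of the base
  may repeat its arguments, and nesting it along the input could multiply the size at every level.
  The missing truth constant is the mark of the tiled part of the time line, and the constraints
  themselves carry the mark forward until acceptance.\<close>

datatype cmd = Skip | Push nat nat | Write nat nat | Pop nat | Append nat
  | Seq cmd cmd | Switch nat "nat \<Rightarrow> cmd" | While nat cmd

type_synonym stacks = "nat \<Rightarrow> nat list"

definition hd0 :: "nat list \<Rightarrow> nat" where "hd0 xs = (case xs of [] \<Rightarrow> 0 | x # _ \<Rightarrow> x)"

lemma hd0_simps [simp]: "hd0 [] = 0" "hd0 (x # xs) = x"
  by (simp_all add: hd0_def)

text \<open>The count is the exact number of machine steps: two for \<open>Push\<close>, which moves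
  before it writes, and one for every control step. \<open>P\<close> is demanded of each new stack
  length, so it acts as a space bound; with \<open>P\<close> always true only the time is recorded.
  \<open>Write\<close> has no rule because it occurs only inside an unfinished
  \<open>Push\<close>.\<close>

inductive exec :: "(nat \<Rightarrow> bool) \<Rightarrow> cmd \<Rightarrow> stacks \<Rightarrow> nat \<Rightarrow> stacks \<Rightarrow> bool" for P where
  Skip: "exec P Skip \<sigma> 0 \<sigma>"
| Push: "P (Suc (length (\<sigma> j))) \<Longrightarrow> exec P (Push j a) \<sigma> 2 (\<sigma>(j := a # \<sigma> j))"
| Pop: "exec P (Pop j) \<sigma> 1 (\<sigma>(j := tl (\<sigma> j)))"
| Append: "P (Suc (length (\<sigma> 0))) \<Longrightarrow> exec P (Append a) \<sigma> 1 (\<sigma>(0 := \<sigma> 0 @ [a]))"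
| Seq: "exec P c \<sigma> m \<sigma>1 \<Longrightarrow> exec P d \<sigma>1 n \<sigma>2 \<Longrightarrow> exec P (Seq c d) \<sigma> (m + 1 + n) \<sigma>2"
| Switch: "exec P (f (hd0 (\<sigma> j))) \<sigma> n \<sigma>' \<Longrightarrow> exec P (Switch j f) \<sigma> (n + 1) \<sigma>'"
| While_end: "\<sigma> j = [] \<Longrightarrow> exec P (While j c) \<sigma> 1 \<sigma>"
| While_step: "\<sigma> j \<noteq> [] \<Longrightarrow> exec P c \<sigma> m \<sigma>1 \<Longrightarrow> exec P (While j c) \<sigma>1 n \<sigma>2
    \<Longrightarrow> exec P (While j c) \<sigma> (m + n + 2) \<sigma>2"

text \<open>\<open>wf_cmd n K c\<close>: \<open>c\<close> uses the symbols below \<open>n\<close> and the stacks \<open>0, \<dots>, K\<close>,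
  stack 0 only for output.\<close>

primrec wf_cmd :: "nat \<Rightarrow> nat \<Rightarrow> cmd \<Rightarrow> bool" where
  "wf_cmd n K Skip = True"
| "wf_cmd n K (Push j a) = (0 < j \<and> j \<le> K \<and> 0 < a \<and> a < n)"
| "wf_cmd n K (Write j a) = (0 < j \<and> j \<le> K \<and> 0 < a \<and> a < n)"
| "wf_cmd n K (Pop j) = (0 < j \<and> j \<le> K)"
| "wf_cmd n K (Append a) = (0 < a \<and> a < n)"
| "wf_cmd n K (Seq c d) = (wf_cmd n K c \<and> wf_cmd n K d)"
| "wf_cmd n K (Switch j f) = (0 < j \<and> j \<le> K \<and> (\<forall>a. wf_cmd n K (f a)))"
| "wf_cmd n K (While j c) = (0 < j \<and> j \<le> K \<and> wf_cmd n K c)"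

lemma wf_cmd_mono: "wf_cmd n K c \<Longrightarrow> n \<le> n' \<Longrightarrow> K \<le> K' \<Longrightarrow> wf_cmd n' K' c"
  by (induction c) auto

section \<open>Small steps of programs\<close>

type_synonym tapes = "nat \<Rightarrow> tape"
type_synonym acts = "nat \<Rightarrow> nat \<times> move"

definition idle :: "(nat \<Rightarrow> nat) \<Rightarrow> acts" where "idle s = (\<lambda>j. (s j, Stay))"

text \<open>One small step is one machine step. Symbol 0 is the blank and is never stored on a
  stack, so scanning 0 means that the stack is empty, and the scanned symbols determine the
  step.\<close>

primrec next_cmd :: "cmd \<Rightarrow> (nat \<Rightarrow> nat) \<Rightarrow> cmd \<times> acts" where
  "next_cmd Skip s = (Skip, idle s)"
| "next_cmd (Push j a) s = (Write j a, (idle s)(j := (s j, Move_Left)))"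
| "next_cmd (Write j a) s = (Skip, (idle s)(j := (a, Stay)))"
| "next_cmd (Pop j) s = (Skip, if s j = 0 then idle s else (idle s)(j := (0, Move_Right)))"
| "next_cmd (Append a) s = (Skip, (idle s)(0 := (a, Move_Right)))"
| "next_cmd (Seq c d) s = (if c = Skip then (d, idle s)
      else (Seq (fst (next_cmd c s)) d, snd (next_cmd c s)))"
| "next_cmd (Switch j f) s = (f (s j), idle s)"
| "next_cmd (While j c) s = (if s j = 0 then Skip else Seq c (While j c), idle s)"

definition cstep :: "cmd \<times> tapes \<Rightarrow> cmd \<times> tapes" where
  "cstep = (\<lambda>(c, ts). let s = (\<lambda>j. scanned (ts j)) in
    (fst (next_cmd c s), \<lambda>j. act (ts j) (snd (next_cmd c s) j)))"

text \<open>These become the control states of the machine. A \<open>Switch\<close> has infinitely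
  many branches, but only those for the \<open>n\<close> tape symbols can be taken, which keeps the
  set finite.\<close>

primrec residuals :: "nat \<Rightarrow> cmd \<Rightarrow> cmd set" where
  "residuals n Skip = {Skip}"
| "residuals n (Push j a) = {Push j a, Write j a, Skip}"
| "residuals n (Write j a) = {Write j a, Skip}"
| "residuals n (Pop j) = {Pop j, Skip}"
| "residuals n (Append a) = {Append a, Skip}"
| "residuals n (Seq c d) = (\<lambda>r. Seq r d) ` residuals n c \<union> residuals n d"
| "residuals n (Switch j f) = insert (Switch j f) (\<Union>a<n. residuals n (f a))"
| "residuals n (While j c) = {While j c, Skip} \<union> (\<lambda>r. Seq r (While j c)) ` residuals n c"

lemma finite_residuals [simp]: "finite (residuals n c)"
  by (induction c) auto

lemma residuals_refl [simp]: "c \<in> residuals n c"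
  by (induction c) auto

lemma residuals_next:
  assumes "r \<in> residuals n c" "\<And>j. s j < n"
  shows "fst (next_cmd r s) \<in> residuals n c"
  using assms(1)
proof (induction c arbitrary: r)
  case (Switch j f)
  show ?case
  proof (cases "r = Switch j f")
    case True
    have "f (s j) \<in> (\<Union>a<n. residuals n (f a))"
      using assms(2)[of j] by (intro UN_I[of "s j"]) auto
    then show ?thesis using True by simp
  next
    case False
    then show ?thesis using Switch by auto
  qed
next
  case (Seq c d)
  then show ?case by auto
next
  case (While j c)
  consider "r = While j c" | "r = Skip" | r' where "r = Seq r' (While j c)" "r' \<in> residuals n c"
    using While.prems by auto
  then show ?case
  proof cases
    case 1
    then show ?thesis using residuals_refl[of c n] by simp
  next
    case 3
    then show ?thesis using While.IH[of r'] by simp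
  qed simp
qed auto

lemma wf_residuals:
  assumes "r \<in> residuals n c" "wf_cmd m K c"
  shows "wf_cmd m K r"
  using assms
proof (induction c arbitrary: r)
  case (Seq c d)
  from Seq.prems(1) consider r' where "r = Seq r' d" "r' \<in> residuals n c" | "r \<in> residuals n d"
    by auto
  then show ?case
  proof cases
    case 1
    then show ?thesis using Seq.IH(1)[OF 1(2)] Seq.prems(2) by simp
  next
    case 2
    then show ?thesis using Seq.IH(2)[OF 2] Seq.prems(2) by simp
  qed
next
  case (While j c)
  from While.prems(1) consider r' where "r = Seq r' (While j c)" "r' \<in> residuals n c"
    | "r = While j c" | "r = Skip"
    by auto
  then show ?case
  proof cases
    case 1
    then show ?thesis using While.IH[OF 1(2)] While.prems(2) by simp
  qed (use While.prems in simp_all)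
next
  case (Switch j f)
  from Switch.prems(1) consider a where "r \<in> residuals n (f a)" | "r = Switch j f" by auto
  then show ?case
  proof cases
    case 1
    then show ?thesis using Switch.IH[OF rangeI 1] Switch.prems(2) by simp
  qed (use Switch.prems in simp)
qed auto

lemma next_cmd_acts:
  assumes "wf_cmd n K r" "\<And>j. s j < n" "0 < n"
  shows "fst (snd (next_cmd r s) j) < n"
  using assms by (induction r) (auto simp: idle_def)

text \<open>A well-formed program looks at the tapes \<open>0, ..., K\<close> only, hence the total
  functions used for tapes may be replaced by the finite lists of a machine.\<close>

lemma next_cmd_cong:
  assumes "wf_cmd n K r" "\<And>j. j \<le> K \<Longrightarrow> s j = s' j"
  shows "fst (next_cmd r s) = fst (next_cmd r s') \<and>
    (\<forall>j\<le>K. snd (next_cmd r s) j = snd (next_cmd r s') j)"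
  using assms by (induction r) (auto simp: idle_def)

text \<open>Stack \<open>j \<ge> 1\<close> occupies the cells from the head to the right; \<open>b j\<close> is the position just
  right of its bottom. Stack 0 is written left to right from cell 0 with the head behind it.\<close>

definition stack_tape :: "int \<Rightarrow> tape \<Rightarrow> nat list \<Rightarrow> bool" where
  "stack_tape b t xs \<longleftrightarrow> snd t = b - int (length xs) \<and>
    (\<forall>i. fst t (snd t + int i) = (if i < length xs then xs ! i else 0))"

definition output_tape :: "tape \<Rightarrow> nat list \<Rightarrow> bool" where
  "output_tape t xs \<longleftrightarrow> snd t = int (length xs) \<and>
    (\<forall>i. fst t (int i) = (if i < length xs then xs ! i else 0))"

definition represents :: "nat \<Rightarrow> (nat \<Rightarrow> int) \<Rightarrow> tapes \<Rightarrow> stacks \<Rightarrow> bool" where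
  "represents n b ts \<sigma> \<longleftrightarrow>
    (\<forall>j. set (\<sigma> j) \<subseteq> {0<..<n} \<and> (\<forall>p. fst (ts j) p < n)) \<and>
    (\<forall>j>0. stack_tape (b j) (ts j) (\<sigma> j)) \<and> output_tape (ts 0) (\<sigma> 0)"

lemma represents_scanned:
  assumes "represents n b ts \<sigma>" "0 < j"
  shows "scanned (ts j) = hd0 (\<sigma> j)"
proof -
  have "fst (ts j) (snd (ts j) + int 0) = (if 0 < length (\<sigma> j) then \<sigma> j ! 0 else 0)"
    using assms unfolding represents_def stack_tape_def by blast
  then show ?thesis by (cases "\<sigma> j") (auto simp: scanned_def split: prod.splits)
qed

lemma represents_hd0_0:
  assumes "represents n b ts \<sigma>"
  shows "hd0 (\<sigma> j) = 0 \<longleftrightarrow> \<sigma> j = []"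
proof -
  have "set (\<sigma> j) \<subseteq> {0<..<n}" using assms by (simp add: represents_def)
  then show ?thesis by (cases "\<sigma> j") auto
qed

lemma represents_scanned_less:
  assumes "represents n b ts \<sigma>"
  shows "scanned (ts j) < n"
  using assms by (simp add: represents_def scanned_def case_prod_beta)

lemma act_idle: "act (ts j) (idle (\<lambda>j. scanned (ts j)) j) = ts j"
  by (cases "ts j") (simp add: act_def idle_def scanned_def)

section \<open>Simulation of programs on tapes\<close>

definition head_ok :: "(nat \<Rightarrow> bool) \<Rightarrow> (nat \<Rightarrow> int) \<Rightarrow> tapes \<Rightarrow> bool" where
  "head_ok P b ts \<longleftrightarrow> (\<forall>j. \<exists>l. P l \<and> snd (ts j) = (if j = 0 then int l else b j - int l))"

text \<open>Every intermediate configuration is controlled: \<open>head_ok\<close> restricts the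
  heads to admissible displacements, which later bounds the visited cells, and the program is
  unfinished before the last step, so each step is one of the compiled machine.\<close>

definition reaches :: "(nat \<Rightarrow> bool) \<Rightarrow> (nat \<Rightarrow> int) \<Rightarrow> nat \<Rightarrow> nat \<Rightarrow> cmd \<times> tapes \<Rightarrow> cmd \<times> tapes \<Rightarrow> bool" where
  "reaches P b n m x y \<longleftrightarrow> (cstep ^^ m) x = y \<and>
     (\<forall>i\<le>m. head_ok P b (snd ((cstep ^^ i) x)) \<and> (\<forall>j. scanned (snd ((cstep ^^ i) x) j) < n)
       \<and> (i < m \<longrightarrow> fst ((cstep ^^ i) x) \<noteq> Skip))"

lemma reaches_refl: "head_ok P b (snd x) \<Longrightarrow> (\<forall>j. scanned (snd x j) < n) \<Longrightarrow> reaches P b n 0 x x"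
  by (simp add: reaches_def)

lemma reaches_trans:
  assumes "reaches P b n m x y" "reaches P b n m' y z"
  shows "reaches P b n (m + m') x z"
proof -
  have y: "(cstep ^^ m) x = y" using assms(1) by (simp add: reaches_def)
  have eq: "(cstep ^^ (i + m)) x = (cstep ^^ i) y" for i
    by (simp add: funpow_add y)
  have "head_ok P b (snd ((cstep ^^ i) x)) \<and> (\<forall>j. scanned (snd ((cstep ^^ i) x) j) < n)
       \<and> (i < m + m' \<longrightarrow> fst ((cstep ^^ i) x) \<noteq> Skip)" if "i \<le> m + m'" for i
  proof (cases "i < m")
    case True
    then show ?thesis using assms(1) unfolding reaches_def by simp
  next
    case False
    then obtain k where "i = k + m" by (metis add.commute le_Suc_ex not_less)
    then show ?thesis using that assms(2) eq[of k] unfolding reaches_def by simp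
  qed
  moreover have "(cstep ^^ (m + m')) x = z"
    using assms(2) eq[of m'] by (simp add: reaches_def add.commute)
  ultimately show ?thesis by (simp add: reaches_def)
qed

lemma reaches_step:
  assumes "cstep x = y" "fst x \<noteq> Skip" "head_ok P b (snd x)" "\<forall>j. scanned (snd x j) < n"
    "head_ok P b (snd y)" "\<forall>j. scanned (snd y j) < n"
  shows "reaches P b n 1 x y"
  unfolding reaches_def using assms by (auto simp: le_Suc_eq)

lemma cstep_Seq: "c \<noteq> Skip \<Longrightarrow> cstep (Seq c d, ts) = (Seq (fst (cstep (c, ts))) d, snd (cstep (c, ts)))"
  by (simp add: cstep_def Let_def)

lemma reaches_Seq:
  assumes "reaches P b n m (c, ts) (Skip, ts')"
  shows "reaches P b n m (Seq c d, ts) (Seq Skip d, ts')"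
proof -
  have "i \<le> m \<Longrightarrow> (cstep ^^ i) (Seq c d, ts) = (Seq (fst ((cstep ^^ i) (c, ts))) d, snd ((cstep ^^ i) (c, ts)))" for i
  proof (induction i)
    case (Suc i)
    then show ?case using assms cstep_Seq[of "fst ((cstep ^^ i) (c, ts))" d "snd ((cstep ^^ i) (c, ts))"]
      by (simp add: reaches_def)
  qed simp
  then show ?thesis using assms by (auto simp: reaches_def)
qed

lemma represents_head_ok:
  assumes "represents n b ts \<sigma>" "\<forall>j. P (length (\<sigma> j))"
  shows "head_ok P b ts"
  unfolding head_ok_def
proof
  fix j
  show "\<exists>l. P l \<and> snd (ts j) = (if j = 0 then int l else b j - int l)"
    using assms by (intro exI[of _ "length (\<sigma> j)"]) (auto simp: represents_def stack_tape_def output_tape_def)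
qed

lemma reaches_idle:
  assumes "next_cmd c (\<lambda>j. scanned (ts j)) = (c', idle (\<lambda>j. scanned (ts j)))" "c \<noteq> Skip"
    "represents n b ts \<sigma>" "\<forall>j. P (length (\<sigma> j))" "0 < n"
  shows "reaches P b n 1 (c, ts) (c', ts)"
proof (rule reaches_step)
  show "cstep (c, ts) = (c', ts)"
    using assms(1) by (simp add: cstep_def Let_def act_idle)
qed (use assms represents_head_ok[OF assms(3,4)] represents_scanned_less[OF assms(3)] in auto)

lemma stack_tape_Push:
  assumes "stack_tape b t xs"
  shows "stack_tape b ((fst t)(snd t - 1 := a), snd t - 1) (a # xs)"
proof -
  have "((fst t)(snd t - 1 := a)) (snd t - 1 + int i) = (if i < length (a # xs) then (a # xs) ! i else 0)" for i
  proof (cases i)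
    case (Suc i')
    have "fst t (snd t + int i') = (if i' < length xs then xs ! i' else 0)"
      using assms unfolding stack_tape_def by blast
    then show ?thesis using Suc by (simp add: algebra_simps)
  qed simp
  then show ?thesis using assms unfolding stack_tape_def by (intro conjI allI) simp_all
qed

lemma stack_tape_Pop:
  assumes "stack_tape b t (x # xs)"
  shows "stack_tape b ((fst t)(snd t := 0), snd t + 1) xs"
proof -
  have "((fst t)(snd t := 0)) (snd t + 1 + int i) = (if i < length xs then xs ! i else 0)" for i
  proof -
    have "fst t (snd t + int (Suc i)) = (if Suc i < length (x # xs) then (x # xs) ! Suc i else 0)"
      using assms unfolding stack_tape_def by blast
    then show ?thesis by (simp add: algebra_simps)
  qed
  then show ?thesis using assms by (simp add: stack_tape_def)
qed

lemma output_tape_Append: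
  assumes "output_tape t xs"
  shows "output_tape ((fst t)(snd t := a), snd t + 1) (xs @ [a])"
  using assms by (auto simp: output_tape_def nth_append less_Suc_eq)

lemma represents_Push:
  assumes "represents n b ts \<sigma>" "0 < j" "0 < a" "a < n"
  shows "represents n b (ts(j := ((fst (ts j))(snd (ts j) - 1 := a), snd (ts j) - 1))) (\<sigma>(j := a # \<sigma> j))"
  using assms by (auto simp: represents_def intro: stack_tape_Push)

lemma represents_Pop:
  assumes "represents n b ts \<sigma>" "0 < j" "\<sigma> j \<noteq> []" "0 < n"
  shows "represents n b (ts(j := ((fst (ts j))(snd (ts j) := 0), snd (ts j) + 1))) (\<sigma>(j := tl (\<sigma> j)))"
proof -
  obtain x xs where x: "\<sigma> j = x # xs" using assms(3) by (cases "\<sigma> j") auto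
  have "set (\<sigma> j) \<subseteq> {0<..<n}" "stack_tape (b j) (ts j) (\<sigma> j)"
    using assms by (simp_all add: represents_def)
  with x have "set (x # xs) \<subseteq> {0<..<n}" "stack_tape (b j) (ts j) (x # xs)" by metis+
  then show ?thesis using assms x by (auto simp: represents_def intro: stack_tape_Pop)
qed

lemma represents_Append:
  assumes "represents n b ts \<sigma>" "0 < a" "a < n"
  shows "represents n b (ts(0 := ((fst (ts 0))(snd (ts 0) := a), snd (ts 0) + 1))) (\<sigma>(0 := \<sigma> 0 @ [a]))"
  using assms by (auto simp: represents_def intro: output_tape_Append)

lemma exec_length:
  assumes "exec P c \<sigma> m \<sigma>'" "\<forall>j. P (length (\<sigma> j))" "\<And>l. P (Suc l) \<Longrightarrow> P l"
  shows "\<forall>j. P (length (\<sigma>' j))"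
  using assms(1,2)
proof induction
  case (Pop j \<sigma>)
  then have "P (length (tl (\<sigma> j)))"
    using Pop[rule_format, of j] assms(3) by (cases "\<sigma> j") auto
  then show ?case using Pop by simp
qed auto

lemma exec_reaches:
  assumes "exec P c \<sigma> m \<sigma>'" "represents n b ts \<sigma>" "wf_cmd n K c" "0 < n"
    "\<forall>j. P (length (\<sigma> j))" "\<And>l. P (Suc l) \<Longrightarrow> P l"
  shows "\<exists>ts'. reaches P b n m (c, ts) (Skip, ts') \<and> represents n b ts' \<sigma>'"
  using assms(1,2,3,5)
proof (induction arbitrary: ts)
  case (Skip \<sigma>)
  then have "reaches P b n 0 (Skip, ts) (Skip, ts)"
    by (intro reaches_refl) (auto intro: represents_head_ok represents_scanned_less)
  then show ?case using Skip by blast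
next
  case (Push \<sigma> j a)
  note len = exec_length[OF exec.Push[where P = P and \<sigma> = \<sigma> and j = j and a = a, OF Push.hyps] Push.prems(3) assms(6)]
  define ts1 where "ts1 = ts(j := (fst (ts j), snd (ts j) - 1))"
  define ts2 where "ts2 = ts(j := ((fst (ts j))(snd (ts j) - 1 := a), snd (ts j) - 1))"
  have j: "0 < j" "0 < a" "a < n" using Push.prems by auto
  have r2: "represents n b ts2 (\<sigma>(j := a # \<sigma> j))"
    unfolding ts2_def using represents_Push[OF Push.prems(1) j] .
  have h0: "head_ok P b ts" "\<forall>i. scanned (ts i) < n"
    using represents_head_ok[OF Push.prems(1,3)] represents_scanned_less[OF Push.prems(1)] by auto
  have h2: "head_ok P b ts2" "\<forall>i. scanned (ts2 i) < n"
    using represents_head_ok[OF r2 len] represents_scanned_less[OF r2] by blast+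
  \<comment> \<open>Between the move and the write the tapes represent no stacks; the head is
    already where it will be after the write, so its bound is taken from \<open>ts2\<close>.\<close>
  have h1: "head_ok P b ts1"
    unfolding head_ok_def
  proof
    fix i
    show "\<exists>l. P l \<and> snd (ts1 i) = (if i = 0 then int l else b i - int l)"
      using h2(1)[unfolded head_ok_def, rule_format, of i] by (auto simp: ts1_def ts2_def split: if_splits)
  qed
  have h1': "scanned (ts1 i) < n" for i
    using Push.prems(1) by (simp add: represents_def scanned_def case_prod_beta ts1_def)
  have "reaches P b n 1 (Push j a, ts) (Write j a, ts1)"
  proof (rule reaches_step)
    show "cstep (Push j a, ts) = (Write j a, ts1)"
      by (auto simp: cstep_def Let_def ts1_def act_def idle_def scanned_def split: prod.splits)
  qed (use h0 h1 h1' in auto)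
  moreover have "reaches P b n 1 (Write j a, ts1) (Skip, ts2)"
  proof (rule reaches_step)
    show "cstep (Write j a, ts1) = (Skip, ts2)"
      by (auto simp: cstep_def Let_def ts1_def ts2_def act_def idle_def scanned_def split: prod.splits)
  qed (use h2 h1 h1' in auto)
  ultimately have "reaches P b n (1 + 1) (Push j a, ts) (Skip, ts2)"
    by (rule reaches_trans)
  then show ?case using r2 unfolding one_add_one by blast
next
  case (Pop j \<sigma>)
  show ?case
  proof (cases "\<sigma> j = []")
    case True
    then have "next_cmd (Pop j) (\<lambda>j. scanned (ts j)) = (Skip, idle (\<lambda>j. scanned (ts j)))"
      using represents_scanned[OF Pop.prems(1)] Pop.prems(2) by simp
    from reaches_idle[OF this _ Pop.prems(1,3) assms(4)] show ?thesis
      using True Pop.prems(1) by (auto simp: fun_upd_idem)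
  next
    case False
    define ts1 where "ts1 = ts(j := ((fst (ts j))(snd (ts j) := 0), snd (ts j) + 1))"
    have r: "represents n b ts1 (\<sigma>(j := tl (\<sigma> j)))"
      using represents_Pop[OF Pop.prems(1) _ False assms(4)] Pop.prems(2) by (simp add: ts1_def)
    note len = exec_length[OF exec.Pop[where P = P and \<sigma> = \<sigma> and j = j] Pop.prems(3) assms(6)]
    have "scanned (ts j) \<noteq> 0"
      using represents_scanned[OF Pop.prems(1)] Pop.prems(2) False represents_hd0_0[OF Pop.prems(1)] by simp
    then have "cstep (Pop j, ts) = (Skip, ts1)"
      by (auto simp: cstep_def Let_def ts1_def act_def idle_def scanned_def split: prod.splits)
    then have "reaches P b n 1 (Pop j, ts) (Skip, ts1)"
      by (rule reaches_step)
        (use represents_head_ok[OF Pop.prems(1,3)] represents_head_ok[OF r len]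
          represents_scanned_less[OF Pop.prems(1)] represents_scanned_less[OF r] in auto)
    then show ?thesis using r by blast
  qed
next
  case (Append \<sigma> a)
  note len = exec_length[OF exec.Append[where P = P and \<sigma> = \<sigma> and a = a, OF Append.hyps] Append.prems(3) assms(6)]
  define ts1 where "ts1 = ts(0 := ((fst (ts 0))(snd (ts 0) := a), snd (ts 0) + 1))"
  have r: "represents n b ts1 (\<sigma>(0 := \<sigma> 0 @ [a]))"
    using represents_Append[OF Append.prems(1)] Append.prems(2) by (simp add: ts1_def)
  have "cstep (Append a, ts) = (Skip, ts1)"
    by (auto simp: cstep_def Let_def ts1_def act_def idle_def scanned_def split: prod.splits)
  then have "reaches P b n 1 (Append a, ts) (Skip, ts1)"
    by (rule reaches_step)
      (use represents_head_ok[OF Append.prems(1,3)] represents_head_ok[OF r len]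
        represents_scanned_less[OF Append.prems(1)] represents_scanned_less[OF r] in auto)
  then show ?case using r by blast
next
  case (Seq c \<sigma> m \<sigma>1 d n' \<sigma>2)
  from Seq.IH(1)[OF Seq.prems(1)] Seq.prems obtain ts1 where
    1: "reaches P b n m (c, ts) (Skip, ts1)" "represents n b ts1 \<sigma>1" by auto
  note len = exec_length[OF Seq.hyps(1) Seq.prems(3) assms(6)]
  from Seq.IH(2)[OF 1(2)] Seq.prems len obtain ts2 where
    2: "reaches P b n n' (d, ts1) (Skip, ts2)" "represents n b ts2 \<sigma>2" by auto
  have "reaches P b n 1 (Seq Skip d, ts1) (d, ts1)"
    by (rule reaches_idle[OF _ _ 1(2) len assms(4)]) auto
  from reaches_trans[OF reaches_trans[OF reaches_Seq[OF 1(1)] this] 2(1)] 2(2) show ?case by blast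
next
  case (Switch f \<sigma> j m \<sigma>')
  have "hd0 (\<sigma> j) = scanned (ts j)"
    using represents_scanned[OF Switch.prems(1)] Switch.prems(2) by simp
  then have "reaches P b n 1 (Switch j f, ts) (f (hd0 (\<sigma> j)), ts)"
    by (intro reaches_idle[OF _ _ Switch.prems(1,3) assms(4)]) auto
  moreover from Switch.IH[OF Switch.prems(1) _ Switch.prems(3)] Switch.prems(2) obtain ts' where
    "represents n b ts' \<sigma>'" "reaches P b n m (f (hd0 (\<sigma> j)), ts) (Skip, ts')" by auto
  ultimately have "reaches P b n (1 + m) (Switch j f, ts) (Skip, ts')"
    using reaches_trans by blast
  then show ?case using \<open>represents n b ts' \<sigma>'\<close> by (auto simp: add.commute)
next
  case (While_end \<sigma> j c)
  then have "scanned (ts j) = 0" using represents_scanned[OF While_end.prems(1)] by simp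
  then have "reaches P b n 1 (While j c, ts) (Skip, ts)"
    by (intro reaches_idle[OF _ _ While_end.prems(1,3) assms(4)]) auto
  then show ?case using While_end by blast
next
  case (While_step \<sigma> j c m \<sigma>1 k \<sigma>2)
  from While_step.IH(1)[OF While_step.prems(1)] While_step.prems obtain ts1 where
    1: "reaches P b n m (c, ts) (Skip, ts1)" "represents n b ts1 \<sigma>1" by auto
  note len = exec_length[OF While_step.hyps(2) While_step.prems(3) assms(6)]
  from While_step.IH(2)[OF 1(2) While_step.prems(2) len] obtain ts2 where
    2: "reaches P b n k (While j c, ts1) (Skip, ts2)" "represents n b ts2 \<sigma>2" by auto
  have "scanned (ts j) \<noteq> 0"
    using represents_scanned[OF While_step.prems(1)] While_step.prems(2) While_step.hyps(1)
      represents_hd0_0[OF While_step.prems(1)] by simp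
  then have "reaches P b n 1 (While j c, ts) (Seq c (While j c), ts)"
    by (intro reaches_idle[OF _ _ While_step.prems(1,3) assms(4)]) auto
  moreover have "reaches P b n 1 (Seq Skip (While j c), ts1) (While j c, ts1)"
    by (rule reaches_idle[OF _ _ 1(2) len assms(4)]) auto
  ultimately have "reaches P b n (1 + (m + (1 + k))) (While j c, ts) (Skip, ts2)"
    by (rule reaches_trans[OF _ reaches_trans[OF reaches_Seq[OF 1(1)] reaches_trans[OF _ 2(1)]]])
  moreover have "1 + (m + (1 + k)) = m + k + 2" by simp
  ultimately have "reaches P b n (m + k + 2) (While j c, ts) (Skip, ts2)" by (simp only:)
  then show ?case using 2(2) by blast
qed


section \<open>Compilation into Turing machines\<close>

definition tape_order :: "nat \<Rightarrow> nat list" where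
  "tape_order K = [1..<Suc K] @ [0]"

lemma length_tape_order [simp]: "length (tape_order K) = Suc K"
  by (simp add: tape_order_def)

lemma nth_tape_order: "i \<le> K \<Longrightarrow> tape_order K ! i = (if i < K then Suc i else 0)"
  by (auto simp: tape_order_def nth_append)

lemma set_tape_order [simp]: "set (tape_order K) = {..K}"
  by (auto simp: tape_order_def)

text \<open>Stack 1 lies on the first tape, which holds the input, and stack 0 on the last one,
  where a transducer leaves its output; \<open>scans\<close> undoes this order.\<close>

definition scans :: "nat \<Rightarrow> nat list \<Rightarrow> nat \<Rightarrow> nat" where
  "scans K as j = (if j = 0 then as ! K else if j \<le> K then as ! (j - 1) else 0)"

lemma scans_map: "j \<le> K \<Longrightarrow> scans K (map f (tape_order K)) j = f j"
  by (cases j) (auto simp: scans_def nth_tape_order)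

lemma scans_less:
  assumes "length as = Suc K" "set as \<subseteq> {..<n}" "0 < n"
  shows "scans K as j < n"
proof -
  have "as ! i < n" if "i \<le> K" for i
    using that assms(1,2) nth_mem[of i as] by (metis le_imp_less_Suc lessThan_iff subsetD)
  then show ?thesis using assms(3) by (auto simp: scans_def)
qed

text \<open>States 0 and 1 accept and reject, state \<open>e r + 2\<close> stands for the residual program \<open>r\<close>.
  At the end the top of stack \<open>v\<close> decides.\<close>

definition compile :: "nat \<Rightarrow> nat \<Rightarrow> nat \<Rightarrow> (cmd \<Rightarrow> nat) \<Rightarrow> cmd \<Rightarrow> tm" where
  "compile n K v e c = \<lparr>num_tapes = Suc K, num_symbols = n, num_states = card (residuals n c) + 2,
     start_state = e c + 2, accept_state = 0, reject_state = 1,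
     trans = (\<lambda>q as. let s = scans K as; r = inv_into (residuals n c) e (q - 2) in
       if r = Skip then (if s v = 2 then 0 else 1, map (idle s) (tape_order K))
       else (e (fst (next_cmd r s)) + 2, map (snd (next_cmd r s)) (tape_order K)))\<rparr>"

locale compilation =
  fixes n K v :: nat and e :: "cmd \<Rightarrow> nat" and c :: cmd
  assumes wf: "wf_cmd n K c" and n: "3 \<le> n" and K: "0 < v" "v \<le> K"
    and e: "bij_betw e (residuals n c) {0..<card (residuals n c)}"
begin

abbreviation "M \<equiv> compile n K v e c"

lemma e_less: "r \<in> residuals n c \<Longrightarrow> e r < card (residuals n c)"
  using e by (auto simp: bij_betw_def)

lemma inv_e: "r \<in> residuals n c \<Longrightarrow> inv_into (residuals n c) e (e r) = r"
  using e by (simp add: bij_betw_def)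

lemma is_tm: "is_tm M"
proof -
  have "fst (trans M q as) < num_states M \<and> length (snd (trans M q as)) = num_tapes M \<and>
      fst ` set (snd (trans M q as)) \<subseteq> {..<num_symbols M}"
    if q: "q < num_states M" "\<not> halting M q" and as: "length as = num_tapes M" "set as \<subseteq> {..<num_symbols M}" for q as
  proof -
    define r where "r = inv_into (residuals n c) e (q - 2)"
    have "q - 2 \<in> e ` residuals n c"
      using q e by (auto simp: bij_betw_def compile_def halting_def)
    then have r: "r \<in> residuals n c" unfolding r_def by (rule inv_into_into)
    have s: "scans K as j < n" for j
      using as n by (intro scans_less) (auto simp: compile_def)
    have "fst (next_cmd r (scans K as)) \<in> residuals n c"
      using residuals_next[OF r s] .
    then have "e (fst (next_cmd r (scans K as))) < card (residuals n c)" by (rule e_less)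
    moreover have "fst (snd (next_cmd r (scans K as)) j) < n" for j
      using next_cmd_acts[OF wf_residuals[OF r wf] s] n by simp
    ultimately show ?thesis
      using s by (auto simp: compile_def Let_def r_def[symmetric] idle_def)
  qed
  moreover have "0 < card (residuals n c)"
    using residuals_refl[of c n] by (metis card_gt_0_iff empty_iff finite_residuals)
  ultimately show ?thesis
    using n e_less[OF residuals_refl] by (simp add: is_tm_def compile_def)
qed

definition config_of :: "cmd \<times> tapes \<Rightarrow> config" where
  "config_of x = (e (fst x) + 2, map (snd x) (tape_order K))"

lemma map2_act: "(\<And>j. j \<le> K \<Longrightarrow> f j = g j) \<Longrightarrow>
    map2 act (map ts (tape_order K)) (map f (tape_order K)) = map (\<lambda>j. act (ts j) (g j)) (tape_order K)"
  by (auto simp: zip_map_map zip_same_conv_map)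

lemma step_config_of:
  assumes "r \<in> residuals n c" "r \<noteq> Skip"
  shows "step M (config_of (r, ts)) = config_of (cstep (r, ts))"
proof -
  define s where "s = (\<lambda>j. scanned (ts j))"
  have s': "scans K (map scanned (map ts (tape_order K))) j = s j" if "j \<le> K" for j
    unfolding s_def map_map using scans_map[OF that, of "scanned \<circ> ts"] by simp
  note cong = next_cmd_cong[OF wf_residuals[OF assms(1) wf] s', THEN conjunct1]
    next_cmd_cong[OF wf_residuals[OF assms(1) wf] s', THEN conjunct2, rule_format]
  have "step M (config_of (r, ts)) = (e (fst (next_cmd r s)) + 2,
     map2 act (map ts (tape_order K)) (map (snd (next_cmd r (scans K (map scanned (map ts (tape_order K)))))) (tape_order K)))"
    using assms cong(1)
    by (simp add: step_def config_of_def compile_def halting_def inv_e Let_def)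
  also have "\<dots> = config_of (cstep (r, ts))"
    using cong(2) by (subst map2_act) (auto simp: config_of_def cstep_def Let_def s_def)
  finally show ?thesis .
qed

text \<open>One more step turns the top of stack \<open>v\<close> into the final state. The tapes
  stay as they are, so no new cell is visited.\<close>

lemma step_config_of_Skip:
  assumes "Skip \<in> residuals n c"
  shows "step M (config_of (Skip, ts)) =
    (if scanned (ts v) = 2 then 0 else 1, map ts (tape_order K))"
proof -
  have s': "scans K (map scanned (map ts (tape_order K))) j = scanned (ts j)" if "j \<le> K" for j
    unfolding map_map using scans_map[OF that, of "scanned \<circ> ts"] by simp
  have "map2 act (map ts (tape_order K)) (map (idle (scans K (map scanned (map ts (tape_order K))))) (tape_order K))
    = map (\<lambda>j. act (ts j) (idle (\<lambda>j. scanned (ts j)) j)) (tape_order K)"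
    by (intro map2_act) (simp only: idle_def s')
  then show ?thesis
    using assms s' K by (simp add: step_def config_of_def compile_def halting_def inv_e Let_def act_idle)
qed

lemma cstep_residuals:
  assumes "reaches P b n m (c, ts) y" "i \<le> m"
  shows "fst ((cstep ^^ i) (c, ts)) \<in> residuals n c"
  using assms(2)
proof (induction i)
  case (Suc i)
  then have "\<forall>j. scanned (snd ((cstep ^^ i) (c, ts)) j) < n" "fst ((cstep ^^ i) (c, ts)) \<in> residuals n c"
    using assms(1) by (auto simp: reaches_def)
  then show ?case
    using residuals_next[of "fst ((cstep ^^ i) (c, ts))" n c "\<lambda>j. scanned (snd ((cstep ^^ i) (c, ts)) j)"]
    by (cases "(cstep ^^ i) (c, ts)") (simp add: cstep_def Let_def)
qed simp

definition initial_tapes :: "bool list \<Rightarrow> tapes" where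
  "initial_tapes w = (\<lambda>j. if j = 1 then (word_tape w, 0) else (\<lambda>_. 0, 0))"

text \<open>The input word with the head on cell 0 already is a stack whose bottom lies behind the
  last bit; the other stacks start empty at 0.\<close>

definition bottoms :: "bool list \<Rightarrow> nat \<Rightarrow> int" where
  "bottoms w j = (if j = 1 then int (length w) else 0)"

lemma initial_config: "initial M w = config_of (c, initial_tapes w)"
proof -
  obtain K' where K': "K = Suc K'" using K by (cases K) auto
  have "tape_order K = 1 # [2..<Suc K] @ [0]"
    by (simp add: tape_order_def K' upt_conv_Cons numeral_2_eq_2 del: upt_Suc)
  moreover have "map (initial_tapes w) ([2..<Suc K] @ [0]) = replicate K (\<lambda>_. 0, 0)"
  proof -
    have "map (initial_tapes w) ([2..<Suc K] @ [0]) = map (\<lambda>_. (\<lambda>_. 0, 0)) ([2..<Suc K] @ [0])"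
      unfolding map_eq_conv by (auto simp: initial_tapes_def)
    then show ?thesis by (simp add: map_replicate_const K' del: upt_Suc)
  qed
  ultimately show ?thesis
    by (simp add: initial_def config_of_def compile_def initial_tapes_def)
qed

lemma represents_initial:
  "represents n (bottoms w) (initial_tapes w) ((\<lambda>_. [])(1 := map bit_symbol w))"
  using n by (auto simp: represents_def stack_tape_def output_tape_def initial_tapes_def bottoms_def
      word_tape_def bit_symbol_def)

lemma run_reaches:
  assumes "reaches P b n m (c, initial_tapes w) y" "i \<le> m"
  shows "run M w i = config_of ((cstep ^^ i) (c, initial_tapes w))"
  using assms(2)
proof (induction i)
  case 0
  then show ?case by (simp add: run_def initial_config)
next
  case (Suc i)
  let ?x = "(cstep ^^ i) (c, initial_tapes w)"
  have "fst ?x \<in> residuals n c" "fst ?x \<noteq> Skip"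
    using cstep_residuals[OF assms(1), of i] Suc.prems assms(1) by (auto simp: reaches_def)
  from step_config_of[OF this, of "snd ?x"] Suc show ?case
    by (simp add: run_def)
qed

lemma run_halted:
  assumes "halting M (fst (run M w m))" "m \<le> i"
  shows "run M w i = run M w m"
  using assms(2)
proof (induction i rule: dec_induct)
  case (step i)
  then show ?case using assms(1) by (simp add: run_def step_def case_prod_beta)
qed simp

text \<open>The bound on the heads is stated for all times, also after halting, because space is
  measured over the whole infinite run.\<close>

lemma run_compile:
  assumes "exec P c ((\<lambda>_. [])(1 := map bit_symbol w)) m \<sigma>'" "P 0" "P (length w)" "\<And>l. P (Suc l) \<Longrightarrow> P l"
  obtains ts where "run M w (Suc m) = (if hd0 (\<sigma>' v) = 2 then 0 else 1, map ts (tape_order K))"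
    "output_tape (ts 0) (\<sigma>' 0)"
    "\<And>i j. j \<le> K \<Longrightarrow> \<exists>l. P l \<and> (snd (snd (run M w i) ! j) = (if j = K then int l else bottoms w (Suc j) - int l))"
proof -
  have P: "\<forall>j. P (length (((\<lambda>_. [])(1 := map bit_symbol w)) j))" using assms(2,3) by simp
  have n0: "0 < n" using n by simp
  from exec_reaches[OF assms(1) represents_initial wf n0 P assms(4)] obtain ts where
    r: "reaches P (bottoms w) n m (c, initial_tapes w) (Skip, ts)" "represents n (bottoms w) ts \<sigma>'" by blast
  have m: "run M w m = config_of (Skip, ts)"
    using run_reaches[OF r(1), of m] r(1) by (simp add: reaches_def)
  have "Skip \<in> residuals n c"
    using cstep_residuals[OF r(1), of m] r(1) by (simp add: reaches_def)
  from step_config_of_Skip[OF this, of ts] m have fin: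
    "run M w (Suc m) = (if hd0 (\<sigma>' v) = 2 then 0 else 1, map ts (tape_order K))"
    using represents_scanned[OF r(2) K(1)] by (simp add: run_def)
  have halt: "halting M (fst (run M w (Suc m)))" unfolding fin by (simp add: halting_def compile_def)
  have heads: "\<exists>l. P l \<and> (snd (snd (run M w i) ! j) = (if j = K then int l else bottoms w (Suc j) - int l))"
    if j: "j \<le> K" for i j
  proof -
    have *: "snd (snd (run M w i) ! j) = snd (snd ((cstep ^^ i) (c, initial_tapes w)) (tape_order K ! j))"
      "head_ok P (bottoms w) (snd ((cstep ^^ i) (c, initial_tapes w)))" if "i \<le> m" for i
      using run_reaches[OF r(1) that] r(1) that j by (simp_all add: config_of_def reaches_def)
    have **: "\<exists>l. P l \<and> (snd (snd (run M w i) ! j) = (if j = K then int l else bottoms w (Suc j) - int l))"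
      if "i \<le> m" for i
      using *(1)[OF that] *(2)[OF that, unfolded head_ok_def, rule_format, of "tape_order K ! j"] j
      by (simp add: nth_tape_order split: if_splits)
    show ?thesis
    proof (cases "i \<le> m")
      case False
      then have "run M w i = run M w (Suc m)"
        using run_halted[OF halt, of i] by simp
      then have "snd (run M w i) = snd (run M w m)"
        unfolding fin m by (simp add: config_of_def)
      then show ?thesis using **[of m] by simp
    qed (rule **)
  qed
  show ?thesis by (rule that[OF fin _ heads]) (use r(2) in \<open>simp add: represents_def\<close>)
qed

end


section \<open>Complexity classes from programs\<close>

definition input_stacks :: "bool list \<Rightarrow> stacks" where
  "input_stacks w = (\<lambda>_. [])(1 := map bit_symbol w)"

lemma compilationE:
  assumes "wf_cmd n K c" "3 \<le> n" "0 < v" "v \<le> K"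
  obtains e where "compilation n K v e c"
proof -
  obtain e where "bij_betw e (residuals n c) {0..<card (residuals n c)}"
    using ex_bij_betw_finite_nat[OF finite_residuals] by blast
  then show ?thesis using that assms by (simp add: compilation_def)
qed

lemma PSPACE_program:
  fixes p :: "nat poly"
  assumes wf: "wf_cmd n K c" "3 \<le> n" "0 < v" "v \<le> K"
    and exec: "\<And>w. \<exists>m \<sigma>. exec (\<lambda>l. l \<le> poly p (length w)) c (input_stacks w) m \<sigma> \<and>
      (hd0 (\<sigma> v) = 2 \<longleftrightarrow> w \<in> L)"
    and p: "\<And>w :: bool list. length w \<le> poly p (length w)"
  shows "L \<in> PSPACE"
proof -
  obtain e where "compilation n K v e c" by (rule compilationE[OF wf])
  then interpret compilation n K v e c .
  \<comment> \<open>There are \<open>Suc K\<close> heads, and each has at most p + 1 positions, one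
    for every displacement up to the bound.\<close>
  define q where "q = [:Suc K:] * (p + 1)"
  have "(\<exists>t. fst (run M w t) = (if w \<in> L then accept_state M else reject_state M)) \<and>
         (\<forall>t. card (cells_visited M w t) \<le> poly q (length w))" for w
  proof -
    define P where "P = (\<lambda>l. l \<le> poly p (length w))"
    obtain m \<sigma> where m: "exec P c ((\<lambda>_. [])(1 := map bit_symbol w)) m \<sigma>" "hd0 (\<sigma> v) = 2 \<longleftrightarrow> w \<in> L"
      using exec[of w] by (auto simp: P_def input_stacks_def)
    obtain ts where ts: "run M w (Suc m) = (if hd0 (\<sigma> v) = 2 then 0 else 1, map ts (tape_order K))"
      "\<And>i j. j \<le> K \<Longrightarrow> \<exists>l. P l \<and> (snd (snd (run M w i) ! j) = (if j = K then int l else bottoms w (Suc j) - int l))"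
      by (rule run_compile[OF m(1)]) (use p[of w] in \<open>auto simp: P_def\<close>)
    have "fst (run M w (Suc m)) = (if w \<in> L then accept_state M else reject_state M)"
      using ts(1) m(2) by (simp add: compile_def)
    moreover have "card (cells_visited M w t) \<le> poly q (length w)" for t
    proof -
      define f where "f = (\<lambda>(j, l :: nat). (j, if j = K then int l else bottoms w (Suc j) - int l))"
      have "cells_visited M w t \<subseteq> f ` ({..K} \<times> {..poly p (length w)})"
      proof
        fix x assume "x \<in> cells_visited M w t"
        then obtain i j where x: "x = (j, snd (snd (run M w i) ! j))" "j \<le> K"
          by (auto simp: cells_visited_def compile_def)
        then show "x \<in> f ` ({..K} \<times> {..poly p (length w)})"
          using ts(2)[OF x(2), of i] by (force simp: f_def P_def)
      qed
      from surj_card_le[OF _ this] show ?thesis by (simp add: q_def algebra_simps)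
    qed
    ultimately show ?thesis by blast
  qed
  then show ?thesis using is_tm unfolding PSPACE_def by blast
qed

lemma polytime_program:
  fixes p :: "nat poly"
  assumes wf: "wf_cmd n K c" "3 \<le> n" "0 < K"
    and exec: "\<And>w. \<exists>m \<sigma>. exec (\<lambda>_. True) c (input_stacks w) m \<sigma> \<and>
      m \<le> poly p (length w) \<and> \<sigma> 0 = map bit_symbol (f w)"
  shows "polytime_computable f"
proof -
  obtain e where "compilation n K 1 e c" by (rule compilationE[OF wf(1,2), of 1]) (use wf in auto)
  then interpret compilation n K 1 e c .
  have "\<exists>t \<le> poly (p + 1) (length w). halting M (fst (run M w t)) \<and>
      (\<forall>i \<le> length (f w). fst (last (snd (run M w t))) (int i) = word_tape (f w) (int i))" for w
  proof -
    obtain m \<sigma> where m: "exec (\<lambda>_. True) c ((\<lambda>_. [])(1 := map bit_symbol w)) m \<sigma>"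
      "m \<le> poly p (length w)" "\<sigma> 0 = map bit_symbol (f w)"
      using exec[of w] by (auto simp: input_stacks_def)
    obtain ts where ts: "run M w (Suc m) = (if hd0 (\<sigma> 1) = 2 then 0 else 1, map ts (tape_order K))"
      "output_tape (ts 0) (\<sigma> 0)"
      by (rule run_compile[OF m(1)]) auto
    have "halting M (fst (run M w (Suc m)))"
      unfolding ts(1) by (simp add: halting_def compile_def)
    moreover have "fst (last (snd (run M w (Suc m)))) (int i) = word_tape (f w) (int i)" if "i \<le> length (f w)" for i
      unfolding ts(1) using ts(2) that by (simp add: tape_order_def output_tape_def m(3) word_tape_def)
    ultimately show ?thesis using m(2) by (intro exI[of _ "Suc m"]) simp
  qed
  then show ?thesis using is_tm unfolding polytime_computable_def by blast
qed

section \<open>Word functions computed by stack programs\<close>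

definition For :: "nat \<Rightarrow> (nat \<Rightarrow> cmd) \<Rightarrow> cmd" where
  "For j f = While j (Switch j (\<lambda>a. Seq (Pop j) (f a)))"

lemma wf_For [simp]: "wf_cmd n K (For j f) \<longleftrightarrow> 0 < j \<and> j \<le> K \<and> (\<forall>a. wf_cmd n K (f a))"
  by (auto simp: For_def)

text \<open>\<open>S xs\<close> describes the stacks once the prefix \<open>xs\<close> is processed;
  the consumed stack \<open>j\<close> is threaded separately. The overhead 5 of a round is one step
  each for \<open>Pop\<close>, \<open>Seq\<close> and \<open>Switch\<close> and two for
  \<open>While\<close>.\<close>

lemma exec_For:
  assumes "\<And>xs a ys. zs = xs @ a # ys \<Longrightarrow> \<exists>m\<le>t. exec P (f a) ((S xs)(j := ys)) m ((S (xs @ [a]))(j := ys))"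
  shows "\<exists>m \<le> (t + 5) * length zs + 1. exec P (For j f) ((S [])(j := zs)) m ((S zs)(j := []))"
proof -
  have "zs = xs @ ys \<Longrightarrow> \<exists>m \<le> (t + 5) * length ys + 1. exec P (For j f) ((S xs)(j := ys)) m ((S zs)(j := []))" for xs ys
  proof (induction ys arbitrary: xs)
    case Nil
    then have "zs = xs" by simp
    have "exec P (For j f) ((S xs)(j := [])) 1 ((S xs)(j := []))"
      unfolding For_def by (rule exec.While_end) simp
    moreover have "1 \<le> (t + 5) * length ([] :: nat list) + 1" by simp
    ultimately show ?case unfolding \<open>zs = xs\<close> by blast
  next
    case (Cons a ys)
    then obtain m where m: "m \<le> t" "exec P (f a) ((S xs)(j := ys)) m ((S (xs @ [a]))(j := ys))"
      using assms by blast
    obtain k where k: "k \<le> (t + 5) * length ys + 1" "exec P (For j f) ((S (xs @ [a]))(j := ys)) k ((S zs)(j := []))"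
      using Cons.IH[of "xs @ [a]"] Cons.prems by (auto simp del: fun_upd_apply)
    have "exec P (Pop j) ((S xs)(j := a # ys)) 1 ((S xs)(j := ys))"
      using exec.Pop[of P j "(S xs)(j := a # ys)"] by simp
    from exec.Seq[OF this m(2)]
    have "exec P (Switch j (\<lambda>a. Seq (Pop j) (f a))) ((S xs)(j := a # ys)) (1 + 1 + m + 1) ((S (xs @ [a]))(j := ys))"
      by (intro exec.Switch) simp
    from exec.While_step[OF _ this k(2)[unfolded For_def]]
    have "exec P (For j f) ((S xs)(j := a # ys)) (1 + 1 + m + 1 + k + 2) ((S zs)(j := []))"
      unfolding For_def by simp
    moreover have "1 + 1 + m + 1 + k + 2 \<le> (t + 5) * length (a # ys) + 1"
      using m(1) k(1) by (simp add: algebra_simps)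
    ultimately show ?case by blast
  qed
  from this[of "[]" zs] show ?thesis by simp
qed

section \<open>Word functions in polynomial time\<close>

abbreviation exec_any :: "cmd \<Rightarrow> stacks \<Rightarrow> nat \<Rightarrow> stacks \<Rightarrow> bool" where
  "exec_any \<equiv> exec (\<lambda>_. True)"

text \<open>The output is only appended and all other stacks are restored, so programs can be put
  one after the other. The parameter \<open>d\<close> is the first free stack; since it is
  arbitrary, a loop can reserve some stacks and hand the rest to its body.\<close>

definition emits :: "(bool list \<Rightarrow> bool list) \<Rightarrow> bool" where
  "emits f \<longleftrightarrow> (\<forall>d\<ge>2. \<exists>c n K. \<exists>p :: nat poly. wf_cmd n K c \<and>
    (\<forall>w \<sigma>. \<sigma> 1 = map bit_symbol w \<longrightarrow> (\<forall>j\<ge>d. \<sigma> j = []) \<longrightarrow>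
      (\<exists>m \<le> poly p (length w). exec_any c \<sigma> m (\<sigma>(0 := \<sigma> 0 @ map bit_symbol (f w))))))"

lemma emits_polytime_computable:
  assumes "emits f"
  shows "polytime_computable f"
proof -
  obtain c n K and p :: "nat poly" where c: "wf_cmd n K c"
    "\<And>w \<sigma>. \<sigma> 1 = map bit_symbol w \<Longrightarrow> (\<forall>j\<ge>2. \<sigma> j = []) \<Longrightarrow>
      \<exists>m \<le> poly p (length w). exec_any c \<sigma> m (\<sigma>(0 := \<sigma> 0 @ map bit_symbol (f w)))"
    using assms unfolding emits_def by blast
  have "wf_cmd (n + 3) (K + 1) c" using wf_cmd_mono[OF c(1)] by simp
  then show ?thesis
  proof (rule polytime_program)
    show "\<exists>m \<sigma>. exec_any c (input_stacks w) m \<sigma> \<and> m \<le> poly p (length w) \<and> \<sigma> 0 = map bit_symbol (f w)" for w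
      using c(2)[of "input_stacks w" w] unfolding input_stacks_def by fastforce
  qed auto
qed

lemma emits_Nil: "emits (\<lambda>_. [])"
  unfolding emits_def
proof (intro allI impI)
  show "\<exists>c n K. \<exists>p :: nat poly. wf_cmd n K c \<and>
    (\<forall>w \<sigma>. \<sigma> 1 = map bit_symbol w \<longrightarrow> (\<forall>j\<ge>d. \<sigma> j = []) \<longrightarrow>
      (\<exists>m \<le> poly p (length w). exec_any c \<sigma> m (\<sigma>(0 := \<sigma> 0 @ map bit_symbol []))))" for d :: nat
    by (rule exI[of _ Skip], rule exI[of _ 0], rule exI[of _ 0], rule exI[of _ 0]) (simp add: exec.Skip)
qed

lemma emits_bit: "emits (\<lambda>_. [b])"
  unfolding emits_def
proof (intro allI impI)
  show "\<exists>c n K. \<exists>p :: nat poly. wf_cmd n K c \<and>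
    (\<forall>w \<sigma>. \<sigma> 1 = map bit_symbol w \<longrightarrow> (\<forall>j\<ge>d. \<sigma> j = []) \<longrightarrow>
      (\<exists>m \<le> poly p (length w). exec_any c \<sigma> m (\<sigma>(0 := \<sigma> 0 @ map bit_symbol [b]))))" for d :: nat
    using exec.Append[of "\<lambda>_. True" _ "bit_symbol b"]
    by (intro exI[of _ "Append (bit_symbol b)"] exI[of _ 3] exI[of _ 0] exI[of _ 1])
      (fastforce simp: bit_symbol_def)
qed

lemma emits_append:
  assumes "emits f" "emits g"
  shows "emits (\<lambda>w. f w @ g w)"
  unfolding emits_def
proof (intro allI impI)
  fix d :: nat assume d: "2 \<le> d"
  obtain c n K and p :: "nat poly" where c: "wf_cmd n K c"
    "\<And>w \<sigma>. \<sigma> 1 = map bit_symbol w \<Longrightarrow> (\<forall>j\<ge>d. \<sigma> j = []) \<Longrightarrow>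
      \<exists>m \<le> poly p (length w). exec_any c \<sigma> m (\<sigma>(0 := \<sigma> 0 @ map bit_symbol (f w)))"
    using assms(1) d unfolding emits_def by blast
  obtain c' n' K' and p' :: "nat poly" where c': "wf_cmd n' K' c'"
    "\<And>w \<sigma>. \<sigma> 1 = map bit_symbol w \<Longrightarrow> (\<forall>j\<ge>d. \<sigma> j = []) \<Longrightarrow>
      \<exists>m \<le> poly p' (length w). exec_any c' \<sigma> m (\<sigma>(0 := \<sigma> 0 @ map bit_symbol (g w)))"
    using assms(2) d unfolding emits_def by blast
  have "\<exists>m \<le> poly (p + p' + 1) (length w). exec_any (Seq c c') \<sigma> m (\<sigma>(0 := \<sigma> 0 @ map bit_symbol (f w @ g w)))"
    if \<sigma>: "\<sigma> 1 = map bit_symbol w" "\<forall>j\<ge>d. \<sigma> j = []" for w \<sigma>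
  proof -
    obtain m where m: "m \<le> poly p (length w)" "exec_any c \<sigma> m (\<sigma>(0 := \<sigma> 0 @ map bit_symbol (f w)))"
      using c(2)[OF \<sigma>(1,2)] by blast
    obtain m' where "m' \<le> poly p' (length w)"
      "exec_any c' (\<sigma>(0 := \<sigma> 0 @ map bit_symbol (f w))) m' (\<sigma>(0 := \<sigma> 0 @ map bit_symbol (f w @ g w)))"
      using c'(2)[of "\<sigma>(0 := \<sigma> 0 @ map bit_symbol (f w))" w] \<sigma> d by auto
    then show ?thesis
      using m exec.Seq[OF m(2)] by (intro exI[of _ "m + 1 + m'"]) auto
  qed
  moreover have "wf_cmd (max n n') (max K K') (Seq c c')"
    using wf_cmd_mono[OF c(1)] wf_cmd_mono[OF c'(1)] by simp
  ultimately show "\<exists>c n K. \<exists>p :: nat poly. wf_cmd n K c \<and>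
    (\<forall>w \<sigma>. \<sigma> 1 = map bit_symbol w \<longrightarrow> (\<forall>j\<ge>d. \<sigma> j = []) \<longrightarrow>
      (\<exists>m \<le> poly p (length w). exec_any c \<sigma> m (\<sigma>(0 := \<sigma> 0 @ map bit_symbol (f w @ g w)))))"
    by blast
qed

lemma emits_const: "emits (\<lambda>_. xs)"
proof (induction xs)
  case (Cons b xs)
  then show ?case using emits_append[OF emits_bit[of b] Cons] by simp
qed (rule emits_Nil)

text \<open>\<open>copy_input r d\<close> copies the input stack to stack \<open>d\<close>, reversed if \<open>r\<close>, using stack \<open>d + 1\<close>.\<close>

definition copy_input :: "bool \<Rightarrow> nat \<Rightarrow> cmd" where
  "copy_input r d = Seq (For 1 (\<lambda>a. Seq (Push (d + 1) (bit_symbol (a = 2))) (if r then Push d (bit_symbol (a = 2)) else Skip)))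
     (For (d + 1) (\<lambda>a. Seq (Push 1 (bit_symbol (a = 2))) (if r then Skip else Push d (bit_symbol (a = 2)))))"

lemma bit_symbol_eq_2 [simp]: "bit_symbol b = 2 \<longleftrightarrow> b"
  by (simp add: bit_symbol_def)

lemma exec_copy_input:
  assumes \<sigma>: "\<sigma> 1 = map bit_symbol w" "\<sigma> d = []" "\<sigma> (d + 1) = []" and d: "2 \<le> d"
  shows "\<exists>m \<le> 22 * length w + 3. exec_any (copy_input r d) \<sigma> m (\<sigma>(d := map bit_symbol (if r then rev w else w)))"
proof -
  let ?b = "\<lambda>a. bit_symbol (a = 2)"
  let ?zs = "map bit_symbol w"
  have b: "map ?b xs = xs" if "set xs \<subseteq> set ?zs" for xs
    using that by (induction xs) auto
  define S :: "nat list \<Rightarrow> stacks" where "S = (\<lambda>xs. \<sigma>(d + 1 := rev (map ?b xs), d := if r then rev (map ?b xs) else []))"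
  have 1: "\<exists>m \<le> (5 + 5) * length ?zs + 1. exec_any (For 1 (\<lambda>a. Seq (Push (d + 1) (?b a)) (if r then Push d (?b a) else Skip)))
      ((S [])(1 := ?zs)) m ((S ?zs)(1 := []))"
  proof (rule exec_For)
    fix xs a ys assume "?zs = xs @ a # ys"
    define \<sigma>1 where "\<sigma>1 = (S xs)(1 := ys)"
    have p: "exec_any (Push (d + 1) (?b a)) \<sigma>1 2 (\<sigma>1(d + 1 := ?b a # \<sigma>1 (d + 1)))"
      by (rule exec.Push) simp
    show "\<exists>m\<le>5. exec_any (Seq (Push (d + 1) (?b a)) (if r then Push d (?b a) else Skip))
      ((S xs)(1 := ys)) m ((S (xs @ [a]))(1 := ys))"
    proof (cases r)
      case True
      let ?\<sigma>2 = "\<sigma>1(d + 1 := ?b a # \<sigma>1 (d + 1))"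
      have "exec_any (Push d (?b a)) ?\<sigma>2 2 (?\<sigma>2(d := ?b a # ?\<sigma>2 d))"
        by (rule exec.Push) simp
      from exec.Seq[OF p this] show ?thesis
        using True d by (intro exI[of _ 5]) (auto simp: \<sigma>1_def S_def fun_upd_twist)
    next
      case False
      from exec.Seq[OF p exec.Skip] show ?thesis
        using False d by (intro exI[of _ 3]) (auto simp: \<sigma>1_def S_def fun_upd_twist)
    qed
  qed
  define S' :: "nat list \<Rightarrow> stacks" where "S' = (\<lambda>xs. \<sigma>(1 := rev (map ?b xs), d := if r then rev ?zs else rev (map ?b xs)))"
  have 2: "\<exists>m \<le> (5 + 5) * length (rev ?zs) + 1. exec_any (For (d + 1) (\<lambda>a. Seq (Push 1 (?b a)) (if r then Skip else Push d (?b a))))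
      ((S' [])(d + 1 := rev ?zs)) m ((S' (rev ?zs))(d + 1 := []))"
  proof (rule exec_For)
    fix xs a ys assume "rev ?zs = xs @ a # ys"
    define \<sigma>1 where "\<sigma>1 = (S' xs)(d + 1 := ys)"
    have p: "exec_any (Push 1 (?b a)) \<sigma>1 2 (\<sigma>1(1 := ?b a # \<sigma>1 1))"
      by (rule exec.Push) simp
    show "\<exists>m\<le>5. exec_any (Seq (Push 1 (?b a)) (if r then Skip else Push d (?b a)))
      ((S' xs)(d + 1 := ys)) m ((S' (xs @ [a]))(d + 1 := ys))"
    proof (cases r)
      case False
      let ?\<sigma>2 = "\<sigma>1(1 := ?b a # \<sigma>1 1)"
      have "exec_any (Push d (?b a)) ?\<sigma>2 2 (?\<sigma>2(d := ?b a # ?\<sigma>2 d))"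
        by (rule exec.Push) simp
      from exec.Seq[OF p this] show ?thesis
        using False d by (intro exI[of _ 5]) (auto simp: \<sigma>1_def S'_def fun_upd_twist)
    next
      case True
      from exec.Seq[OF p exec.Skip] show ?thesis
        using True d by (intro exI[of _ 3]) (auto simp: \<sigma>1_def S'_def fun_upd_twist)
    qed
  qed
  have e1: "(S [])(1 := ?zs) = \<sigma>" using \<sigma> d by (auto simp: S_def fun_eq_iff)
  have e2: "(S ?zs)(1 := []) = (S' [])(d + 1 := rev ?zs)"
    using d b[of ?zs] by (auto simp: S_def S'_def fun_eq_iff rev_map)
  have e3: "(S' (rev ?zs))(d + 1 := []) = \<sigma>(d := map bit_symbol (if r then rev w else w))"
    using \<sigma> d b[of "rev ?zs"] by (auto simp: S'_def fun_eq_iff rev_map)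
  obtain m1 m2 where "m1 \<le> 10 * length w + 1" "m2 \<le> 10 * length w + 1"
    and m: "exec_any (For 1 (\<lambda>a. Seq (Push (d + 1) (?b a)) (if r then Push d (?b a) else Skip))) \<sigma> m1 ((S' [])(d + 1 := rev ?zs))"
     "exec_any (For (d + 1) (\<lambda>a. Seq (Push 1 (?b a)) (if r then Skip else Push d (?b a))))
      ((S' [])(d + 1 := rev ?zs)) m2 (\<sigma>(d := map bit_symbol (if r then rev w else w)))"
    using 1 2 unfolding e1 e2 e3 by auto
  with exec.Seq[OF m] show ?thesis
    unfolding copy_input_def by (intro exI[of _ "m1 + 1 + m2"]) auto
qed

text \<open>The loop runs over a copy of the word on stack \<open>d\<close> and its bodies receive
  the stacks from \<open>d + 1\<close> on, so loops nest. The reversed order is needed for the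
  closing halves of nested conjunctions.\<close>

lemma emits_loop:
  assumes "\<And>b. emits (f b)"
  shows "emits (\<lambda>w. concat (map (\<lambda>b. f b w) (if r then rev w else w)))"
  unfolding emits_def
proof (intro allI impI)
  fix d :: nat assume d: "2 \<le> d"
  have "\<exists>c n K. \<exists>p :: nat poly. wf_cmd n K c \<and>
    (\<forall>w \<sigma>. \<sigma> 1 = map bit_symbol w \<longrightarrow> (\<forall>j\<ge>d+1. \<sigma> j = []) \<longrightarrow>
      (\<exists>m \<le> poly p (length w). exec_any c \<sigma> m (\<sigma>(0 := \<sigma> 0 @ map bit_symbol (f b w)))))" for b
    using assms[of b] d unfolding emits_def by (meson trans_le_add1)
  then obtain c n K and p :: "bool \<Rightarrow> nat poly" where c: "\<And>b. wf_cmd (n b) (K b) (c b)"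
    "\<And>b w \<sigma>. \<sigma> 1 = map bit_symbol w \<Longrightarrow> (\<forall>j\<ge>d+1. \<sigma> j = []) \<Longrightarrow>
      \<exists>m \<le> poly (p b) (length w). exec_any (c b) \<sigma> m (\<sigma>(0 := \<sigma> 0 @ map bit_symbol (f b w)))"
    by metis
  define prog where "prog = Seq (copy_input r d) (For d (\<lambda>a. c (a = 2)))"
  define q where "q = (22 * [:0, 1:] + 3) + 1 + ((p True + p False + 5) * [:0, 1:] + 1)"
  have "\<exists>m \<le> poly q (length w). exec_any prog \<sigma> m
      (\<sigma>(0 := \<sigma> 0 @ map bit_symbol (concat (map (\<lambda>b. f b w) (if r then rev w else w)))))"
    if \<sigma>: "\<sigma> 1 = map bit_symbol w" "\<forall>j\<ge>d. \<sigma> j = []" for w \<sigma>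
  proof -
    let ?v = "if r then rev w else w"
    let ?zs = "map bit_symbol ?v"
    obtain m1 where m1: "m1 \<le> 22 * length w + 3" "exec_any (copy_input r d) \<sigma> m1 (\<sigma>(d := ?zs))"
      using exec_copy_input[of \<sigma> w d r] \<sigma> d by auto
    define S :: "nat list \<Rightarrow> stacks" where "S = (\<lambda>xs. \<sigma>(0 := \<sigma> 0 @ map bit_symbol (concat (map (\<lambda>a. f (a = 2) w) xs))))"
    have "\<exists>m \<le> (poly (p True + p False) (length w) + 5) * length ?zs + 1.
      exec_any (For d (\<lambda>a. c (a = 2))) ((S [])(d := ?zs)) m ((S ?zs)(d := []))"
    proof (rule exec_For)
      fix xs ys :: "nat list" and a :: nat
      obtain m where m: "m \<le> poly (p (a = 2)) (length w)" "exec_any (c (a = 2)) ((S xs)(d := ys)) m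
        (((S xs)(d := ys))(0 := ((S xs)(d := ys)) 0 @ map bit_symbol (f (a = 2) w)))"
        using c(2)[of "(S xs)(d := ys)" w "a = 2"] \<sigma> d by (auto simp: S_def)
      have eq: "((S xs)(d := ys))(0 := ((S xs)(d := ys)) 0 @ map bit_symbol (f (a = 2) w)) =
          (S (xs @ [a]))(d := ys)"
        using d by (auto simp: S_def fun_eq_iff)
      have "poly (p (a = 2)) (length w) \<le> poly (p True + p False) (length w)"
        by (cases "a = 2") auto
      with m(1) have "m \<le> poly (p True + p False) (length w)" by simp
      then show "\<exists>m \<le> poly (p True + p False) (length w).
          exec_any (c (a = 2)) ((S xs)(d := ys)) m ((S (xs @ [a]))(d := ys))"
        using m(2) unfolding eq by blast
    qed
    moreover have "(S [])(d := ?zs) = \<sigma>(d := ?zs)" by (simp add: S_def)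
    moreover have "(S ?zs)(d := []) = \<sigma>(0 := \<sigma> 0 @ map bit_symbol (concat (map (\<lambda>b. f b w) ?v)))"
      using \<sigma> d by (auto simp: S_def fun_eq_iff comp_def)
    moreover have "length ?zs = length w" by simp
    ultimately obtain m2 where "m2 \<le> (poly (p True + p False) (length w) + 5) * length w + 1"
      "exec_any (For d (\<lambda>a. c (a = 2))) (\<sigma>(d := ?zs)) m2
         (\<sigma>(0 := \<sigma> 0 @ map bit_symbol (concat (map (\<lambda>b. f b w) ?v))))"
      by metis
    moreover from calculation m1(1) have "m1 + 1 + m2 \<le> poly q (length w)"
      by (simp add: q_def algebra_simps)
    ultimately show ?thesis using exec.Seq[OF m1(2)] unfolding prog_def by blast
  qed
  moreover have "wf_cmd (n True + n False + 3) (K True + K False + d + 1) prog"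
  proof -
    have "wf_cmd (n True + n False + 3) (K True + K False + d + 1) (c b)" for b
      by (rule wf_cmd_mono[OF c(1)]; cases b) auto
    then show ?thesis using d by (auto simp: prog_def copy_input_def bit_symbol_def)
  qed
  ultimately show "\<exists>c n K. \<exists>p :: nat poly. wf_cmd n K c \<and>
    (\<forall>w \<sigma>. \<sigma> 1 = map bit_symbol w \<longrightarrow> (\<forall>j\<ge>d. \<sigma> j = []) \<longrightarrow>
      (\<exists>m \<le> poly p (length w). exec_any c \<sigma> m
        (\<sigma>(0 := \<sigma> 0 @ map bit_symbol (concat (map (\<lambda>b. f b w) (if r then rev w else w)))))))"
    by blast
qed

lemma emits_replicate:
  assumes "emits f"
  shows "emits (\<lambda>w. concat (replicate k (f w)))"
proof (induction k)
  case (Suc k)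
  then show ?case using emits_append[OF assms] by simp
qed (simp add: emits_Nil)

text \<open>Horner's scheme: multiplication by the length of the input is one more loop over the
  input.\<close>

lemma emits_replicate_poly:
  assumes "emits f"
  shows "emits (\<lambda>w. concat (replicate (poly p (length w)) (f w)))"
proof (induction p)
  case (pCons a p)
  have "emits (\<lambda>w. concat (map (\<lambda>_. concat (replicate (poly p (length w)) (f w))) (if False then rev w else w)))"
    using emits_loop[of "\<lambda>_ w. concat (replicate (poly p (length w)) (f w))" False] pCons.IH by simp
  moreover have "concat (map (\<lambda>_. concat (replicate m xs)) (w :: bool list)) = concat (replicate (length w * m) xs)"
    for m w and xs :: "bool list"
    by (induction w) (simp_all add: replicate_add)
  ultimately have "emits (\<lambda>w. concat (replicate (length w * poly p (length w)) (f w)))" by simp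
  from emits_append[OF emits_replicate[OF assms, of a] this] show ?case
    by (simp add: replicate_add)
qed (simp add: emits_Nil)

section \<open>Conjunction as a formula template\<close>

primrec subst :: "(nat \<Rightarrow> formula) \<Rightarrow> formula \<Rightarrow> formula" where
  "subst \<theta> (Var x) = \<theta> x"
| "subst \<theta> (Conn f \<phi>s) = Conn f (map (subst \<theta>) \<phi>s)"
| "subst \<theta> (Next \<phi>) = Next (subst \<theta> \<phi>)"
| "subst \<theta> (Finally \<phi>) = Finally (subst \<theta> \<phi>)"
| "subst \<theta> (Globally \<phi>) = Globally (subst \<theta> \<phi>)"
| "subst \<theta> (Until \<phi> \<psi>) = Until (subst \<theta> \<phi>) (subst \<theta> \<psi>)"
| "subst \<theta> (Since \<phi> \<psi>) = Since (subst \<theta> \<phi>) (subst \<theta> \<psi>)"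

primrec prop_eval :: "(nat \<Rightarrow> bool) \<Rightarrow> formula \<Rightarrow> bool" where
  "prop_eval \<rho> (Var x) = \<rho> x"
| "prop_eval \<rho> (Conn f \<phi>s) = app f (map (prop_eval \<rho>) \<phi>s)"
| "prop_eval \<rho> (Next \<phi>) = False"
| "prop_eval \<rho> (Finally \<phi>) = False"
| "prop_eval \<rho> (Globally \<phi>) = False"
| "prop_eval \<rho> (Until \<phi> \<psi>) = False"
| "prop_eval \<rho> (Since \<phi> \<psi>) = False"

fun fv :: "formula \<Rightarrow> nat set" where
  "fv (Var x) = {x}"
| "fv (Conn f \<phi>s) = (\<Union>\<phi>\<in>set \<phi>s. fv \<phi>)"
| "fv (Next \<phi>) = fv \<phi>"
| "fv (Finally \<phi>) = fv \<phi>"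
| "fv (Globally \<phi>) = fv \<phi>"
| "fv (Until \<phi> \<psi>) = fv \<phi> \<union> fv \<psi>"
| "fv (Since \<phi> \<psi>) = fv \<phi> \<union> fv \<psi>"

abbreviation prop_formulas :: "bool_fun set \<Rightarrow> formula set" where
  "prop_formulas B \<equiv> formulas {} B"

lemma subst_formulas:
  assumes "\<phi> \<in> prop_formulas B" "\<And>x. x \<in> fv \<phi> \<Longrightarrow> \<theta> x \<in> formulas M B"
  shows "subst \<theta> \<phi> \<in> formulas M B"
  using assms
proof (induction \<phi> rule: formulas.induct)
  case (Conn f \<phi>s)
  have "subst \<theta> \<phi> \<in> formulas M B" if "\<phi> \<in> set \<phi>s" for \<phi>
    using Conn.IH[OF that] Conn.prems that by auto
  then show ?case using Conn.hyps(1,2) by (auto intro!: formulas.Conn)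
qed auto

lemma sat_subst:
  assumes "\<phi> \<in> prop_formulas B"
  shows "sat S i (subst \<theta> \<phi>) = prop_eval (\<lambda>x. sat S i (\<theta> x)) \<phi>"
  using assms by (induction \<phi> rule: formulas.induct) (auto cong: map_cong)

lemma prop_eval_subst:
  assumes "\<phi> \<in> prop_formulas B"
  shows "prop_eval \<rho> (subst \<theta> \<phi>) = prop_eval (\<lambda>x. prop_eval \<rho> (\<theta> x)) \<phi>"
  using assms by (induction \<phi> rule: formulas.induct) (auto cong: map_cong)

lemma prop_eval_cong:
  assumes "\<And>x. x \<in> fv \<phi> \<Longrightarrow> \<rho> x = \<rho>' x"
  shows "prop_eval \<rho> \<phi> = prop_eval \<rho>' \<phi>"
  using assms
proof (induction \<phi>)
  case (Conn f \<phi>s)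
  have "map (prop_eval \<rho>) \<phi>s = map (prop_eval \<rho>') \<phi>s"
    using Conn.IH Conn.prems by auto
  then show ?case by (simp del: map_eq_conv)
qed auto

lemma subst_cong:
  assumes "\<And>x. x \<in> fv \<phi> \<Longrightarrow> \<theta> x = \<theta>' x"
  shows "subst \<theta> \<phi> = subst \<theta>' \<phi>"
  using assms
proof (induction \<phi>)
  case (Conn f \<phi>s)
  have "map (subst \<theta>) \<phi>s = map (subst \<theta>') \<phi>s"
    using Conn.IH Conn.prems by auto
  then show ?case by simp
qed auto

lemma fv_subst: "fv (subst \<theta> \<phi>) = (\<Union>x\<in>fv \<phi>. fv (\<theta> x))"
  by (induction \<phi>) auto

text \<open>Composition in the clone is substitution. The formula may be large and may repeat its
  variables, which is harmless for a fixed function but not for nested use.\<close>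

lemma clone_formula:
  assumes "f \<in> clone B"
  shows "\<exists>\<phi> \<in> prop_formulas B. fv \<phi> \<subseteq> {..<arity f} \<and> (\<forall>\<rho>. prop_eval \<rho> \<phi> = app f (map \<rho> [0..<arity f]))"
  using assms
proof induction
  case (base f)
  show ?case
    by (rule bexI[of _ "Conn f (map Var [0..<arity f])"])
      (auto simp: comp_def base intro!: formulas.intros)
next
  case (projection i n)
  then show ?case
    by (intro bexI[of _ "Var i"]) (auto simp: projection_def intro: formulas.intros)
next
  case (compose f gs n)
  obtain \<phi> where \<phi>: "\<phi> \<in> prop_formulas B" "fv \<phi> \<subseteq> {..<arity f}"
    "\<And>\<rho>. prop_eval \<rho> \<phi> = app f (map \<rho> [0..<arity f])"
    using compose.IH(1) by blast
  have "\<forall>g\<in>set gs. \<exists>\<psi>. \<psi> \<in> prop_formulas B \<and> fv \<psi> \<subseteq> {..<n} \<and>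
      (\<forall>\<rho>. prop_eval \<rho> \<psi> = app g (map \<rho> [0..<n]))"
    using compose.IH(2) by blast
  then obtain \<psi> where \<psi>: "\<And>g. g \<in> set gs \<Longrightarrow> \<psi> g \<in> prop_formulas B \<and> fv (\<psi> g) \<subseteq> {..<n} \<and>
      (\<forall>\<rho>. prop_eval \<rho> (\<psi> g) = app g (map \<rho> [0..<n]))"
    by metis
  define \<theta> where "\<theta> = (\<lambda>k. \<psi> (gs ! k))"
  have \<theta>: "\<theta> k \<in> prop_formulas B" "fv (\<theta> k) \<subseteq> {..<n}"
    "prop_eval \<rho> (\<theta> k) = app (gs ! k) (map \<rho> [0..<n])" if "k < arity f" for k \<rho>
    using \<psi>[of "gs ! k"] that compose.hyps by (auto simp: \<theta>_def)
  have "prop_eval \<rho> (subst \<theta> \<phi>) = app (compose n f gs) (map \<rho> [0..<n])" for \<rho>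
  proof -
    have "map (\<lambda>k. prop_eval \<rho> (\<theta> k)) [0..<arity f] = map (\<lambda>g. app g (map \<rho> [0..<n])) gs"
      by (rule nth_equalityI) (use compose.hyps \<theta>(3) in auto)
    then show ?thesis by (simp add: prop_eval_subst[OF \<phi>(1)] \<phi>(3) compose_def)
  qed
  moreover have "fv (subst \<theta> \<phi>) \<subseteq> {..<n}"
    using \<phi>(2) \<theta>(2) by (fastforce simp: fv_subst)
  moreover have "subst \<theta> \<phi> \<in> prop_formulas B"
    by (rule subst_formulas[OF \<phi>(1)]) (use \<theta>(1) \<phi>(2) in auto)
  ultimately show ?case
    by (intro bexI[of _ "subst \<theta> \<phi>"]) (auto simp: compose_def)
qed

lemma S1_formula:
  assumes "S1 \<subseteq> clone B" "i < n" "\<And>bs. length bs = n \<Longrightarrow> P bs \<Longrightarrow> bs ! i"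
  obtains \<phi> where "\<phi> \<in> prop_formulas B" "fv \<phi> \<subseteq> {..<n}" "\<And>\<rho>. prop_eval \<rho> \<phi> = P (map \<rho> [0..<n])"
proof -
  have "bool_fun_of n P \<in> S1"
    unfolding S1_def using assms(2,3) by auto
  then have "bool_fun_of n P \<in> clone B" using assms(1) by blast
  from clone_formula[OF this] show ?thesis using that by auto
qed

lemma emits_concat:
  assumes "\<And>x. x \<in> set xs \<Longrightarrow> emits (\<lambda>w. g w x)"
  shows "emits (\<lambda>w. concat (map (g w) xs))"
  using assms by (induction xs) (auto intro: emits_Nil emits_append)

text \<open>The template is fixed, so everything except the substituted formulas is a constant
  word.\<close>

lemma emits_subst:
  assumes "\<phi> \<in> prop_formulas B" "\<And>x. emits (\<lambda>w. encode (\<theta> w x))"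
  shows "emits (\<lambda>w. encode (subst (\<theta> w) \<phi>))"
  using assms(1)
proof (induction \<phi> rule: formulas.induct)
  case (Conn f \<phi>s)
  have "emits (\<lambda>w. [False, False, True] @ encode_bool_fun f @ concat (map (\<lambda>\<phi>. encode (subst (\<theta> w) \<phi>)) \<phi>s))"
    by (intro emits_append emits_const emits_concat Conn.IH)
  then show ?case by (simp add: comp_def)
qed (use assms(2) in auto)

text \<open>There is exactly one hole, so filling it adds a fixed number of bits to the encoding of
  the argument. This is what keeps nested conjunctions linear.\<close>

inductive context_of :: "bool_fun set \<Rightarrow> formula set \<Rightarrow> (formula \<Rightarrow> formula) \<Rightarrow> bool" for B F where
  hole: "context_of B F (\<lambda>x. x)"
| conn: "context_of B F K \<Longrightarrow> f \<in> B \<Longrightarrow> length \<phi>s + 1 + length \<psi>s = arity f \<Longrightarrow>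
    set \<phi>s \<subseteq> F \<Longrightarrow> set \<psi>s \<subseteq> F \<Longrightarrow> context_of B F (\<lambda>x. Conn f (\<phi>s @ K x # \<psi>s))"

lemma context_of_comp:
  assumes "context_of B F K" "context_of B F K'"
  shows "context_of B F (\<lambda>x. K (K' x))"
  using assms(1) by induction (auto intro: assms(2) context_of.conn)

lemma context_of_formulas:
  assumes "context_of B F K" "F \<subseteq> formulas M B" "x \<in> formulas M B"
  shows "K x \<in> formulas M B"
  using assms(1)
proof induction
  case (conn K f \<phi>s \<psi>s)
  then have "set \<phi>s \<union> set \<psi>s \<subseteq> formulas M B" using assms(2) by blast
  then show ?case using conn.hyps(2,3) conn.IH by (intro formulas.Conn) auto
qed (rule assms(3))

text \<open>The leaves of \<open>\<phi>\<close> are switched from \<open>\<theta>\<close> to \<open>\<theta>'\<close> one after the other; each step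
  changes the argument of a one-hole context.\<close>

lemma context_hybrid:
  assumes refl: "\<And>x. R x x" and trans: "\<And>x y z. R x y \<Longrightarrow> R y z \<Longrightarrow> R x z"
    and F: "\<And>\<phi>. \<phi> \<in> prop_formulas B \<Longrightarrow> subst \<theta> \<phi> \<in> F \<and> subst \<theta>' \<phi> \<in> F"
    and step: "\<And>K x. context_of B F K \<Longrightarrow> R (K (\<theta> x)) (K (\<theta>' x))"
    and \<phi>: "\<phi> \<in> prop_formulas B"
  shows "R (subst \<theta> \<phi>) (subst \<theta>' \<phi>)"
proof -
  have "context_of B F K \<Longrightarrow> R (K (subst \<theta> \<phi>)) (K (subst \<theta>' \<phi>))" for K
    using \<phi>
  proof (induction \<phi> arbitrary: K rule: formulas.induct)
    case (Var x)
    then show ?case using step by simp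
  next
    case (Conn f \<phi>s)
    have "R (K (Conn f (map (subst \<theta>') \<psi>s @ map (subst \<theta>) \<chi>s))) (K (Conn f (map (subst \<theta>') (\<psi>s @ \<chi>s))))"
      if "\<phi>s = \<psi>s @ \<chi>s" for \<psi>s \<chi>s
      using that
    proof (induction \<chi>s arbitrary: \<psi>s)
      case Nil
      then show ?case using refl by simp
    next
      case (Cons \<chi> \<chi>s)
      have in_\<phi>s: "\<chi> \<in> set \<phi>s" using Cons.prems by simp
      have "set (map (subst \<theta>') \<psi>s) \<subseteq> F" "set (map (subst \<theta>) \<chi>s) \<subseteq> F"
        using F Conn.hyps(3) Cons.prems by auto
      then have "context_of B F (\<lambda>x. Conn f (map (subst \<theta>') \<psi>s @ x # map (subst \<theta>) \<chi>s))"
        using Conn.hyps(1,2) Cons.prems by (intro context_of.conn[OF context_of.hole]) auto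
      from context_of_comp[OF Conn.prems this]
      have "R (K (Conn f (map (subst \<theta>') \<psi>s @ subst \<theta> \<chi> # map (subst \<theta>) \<chi>s)))
          (K (Conn f (map (subst \<theta>') \<psi>s @ subst \<theta>' \<chi> # map (subst \<theta>) \<chi>s)))"
        by (rule Conn.IH[OF in_\<phi>s])
      moreover have "R (K (Conn f (map (subst \<theta>') (\<psi>s @ [\<chi>]) @ map (subst \<theta>) \<chi>s)))
          (K (Conn f (map (subst \<theta>') ((\<psi>s @ [\<chi>]) @ \<chi>s))))"
        by (rule Cons.IH) (use Cons.prems in simp)
      ultimately show ?case using trans by simp
    qed
    from this[of "[]" \<phi>s] show ?case by simp
  qed auto
  from this[OF context_of.hole] show ?thesis .
qed

lemma context_of_mono: "context_of B F K \<Longrightarrow> F \<subseteq> F' \<Longrightarrow> context_of B F' K"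
  by (induction rule: context_of.induct) (auto intro!: context_of.intros)

abbreviation prop_formulas_over :: "bool_fun set \<Rightarrow> nat set \<Rightarrow> formula set" where
  "prop_formulas_over B V \<equiv> {\<phi> \<in> prop_formulas B. fv \<phi> \<subseteq> V}"

lemma prop_eval_context:
  assumes "context_of B (prop_formulas_over B V) K" "\<And>x. x \<in> V \<Longrightarrow> \<rho> x = \<rho>' x"
    "prop_eval \<rho> x = prop_eval \<rho>' y"
  shows "prop_eval \<rho> (K x) = prop_eval \<rho>' (K y)"
  using assms(1)
proof induction
  case (conn K f \<phi>s \<psi>s)
  have "prop_eval \<rho> \<phi> = prop_eval \<rho>' \<phi>" if "\<phi> \<in> prop_formulas_over B V" for \<phi>
    by (rule prop_eval_cong) (use that assms(2) in auto)
  then have "map (prop_eval \<rho>) \<phi>s = map (prop_eval \<rho>') \<phi>s" "map (prop_eval \<rho>) \<psi>s = map (prop_eval \<rho>') \<psi>s"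
    using conn.hyps(4,5) by (auto simp only: map_eq_conv subset_iff)
  then show ?case using conn.IH by (simp del: map_eq_conv)
qed (use assms(3) in simp)

lemma subst_prop_formulas_over:
  assumes "\<phi> \<in> prop_formulas B" "\<And>x. x \<in> fv \<phi> \<Longrightarrow> \<theta> x \<in> prop_formulas_over B V"
  shows "subst \<theta> \<phi> \<in> prop_formulas_over B V"
  using subst_formulas[OF assms(1)] assms(2) by (auto simp: fv_subst)

section \<open>Negation and conjunction as one-hole contexts\<close>

lemma false_formula:
  assumes "S1 \<subseteq> clone B"
  obtains Z where "Z \<in> prop_formulas_over B {0}" "\<And>\<rho>. prop_eval \<rho> Z = False"
  by (rule S1_formula[OF assms, of 0 1 "\<lambda>_. False"]) auto

text \<open>Falsity is vacuously 1-separating and so has a formula \<open>Z\<close>; truth is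
  represented by \<open>Var 0\<close>. In a formula for x and not y with x true, switching the
  leaves for y from \<open>Z\<close> to \<open>Var 0\<close> turns the value from true to false, so
  it drops at a single leaf. The context of that leaf negates.\<close>

lemma negation_context:
  assumes S1: "S1 \<subseteq> clone B"
  obtains N where "context_of B (prop_formulas_over B {0}) N"
    "\<And>\<rho> x. \<rho> 0 \<Longrightarrow> prop_eval \<rho> (N x) = (\<not> prop_eval \<rho> x)"
proof -
  let ?F = "prop_formulas_over B {0}"
  obtain Z where Z: "Z \<in> ?F" "\<And>\<rho>. prop_eval \<rho> Z = False"
    by (rule false_formula[OF S1]) auto
  obtain \<phi> where \<phi>: "\<phi> \<in> prop_formulas B" "\<And>\<rho>. prop_eval \<rho> \<phi> = (\<rho> 0 \<and> \<not> \<rho> 1)"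
    by (rule S1_formula[OF S1, of 0 2 "\<lambda>bs. bs ! 0 \<and> \<not> bs ! 1"]) auto
  define \<theta> where "\<theta> = (\<lambda>a (x :: nat). if x = 1 then a else Var 0)"
  \<comment> \<open>All side formulas contain only variable 0, so one assignment with variable 0
    true stands for all of them.\<close>
  let ?e = "prop_eval (\<lambda>_. True)"
  have F: "Var 0 \<in> ?F" by (simp add: formulas.Var)
  have "\<exists>K x. context_of B ?F K \<and> \<not> (?e (K (\<theta> Z x)) \<longrightarrow> ?e (K (\<theta> (Var 0) x)))"
  proof (rule ccontr)
    assume *: "\<not> ?thesis"
    have "?e (subst (\<theta> Z) \<phi>) \<longrightarrow> ?e (subst (\<theta> (Var 0)) \<phi>)"
    proof (rule context_hybrid[where R = "\<lambda>x y. ?e x \<longrightarrow> ?e y" and F = ?F and B = B])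
      show "subst (\<theta> Z) \<psi> \<in> ?F \<and> subst (\<theta> (Var 0)) \<psi> \<in> ?F" if "\<psi> \<in> prop_formulas B" for \<psi>
        by (intro conjI subst_prop_formulas_over[OF that]) (use F Z(1) in \<open>simp_all add: \<theta>_def\<close>)
    qed (use * \<phi>(1) in auto)
    then show False using Z by (simp add: prop_eval_subst[OF \<phi>(1)] \<phi>(2) \<theta>_def)
  qed
  then obtain K x where K: "context_of B ?F K" "?e (K (\<theta> Z x))" "\<not> ?e (K (\<theta> (Var 0) x))"
    by blast
  have "x = 1" using K(2,3) by (auto simp: \<theta>_def split: if_splits)
  with K have K': "?e (K Z)" "\<not> ?e (K (Var 0))" by (simp_all add: \<theta>_def)
  have "prop_eval \<rho> (K y) = (\<not> prop_eval \<rho> y)" if "\<rho> 0" for \<rho> y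
  proof -
    have "prop_eval \<rho> (K y) = ?e (K (if prop_eval \<rho> y then Var 0 else Z))"
      by (rule prop_eval_context[OF K(1)]) (use that Z in auto)
    then show ?thesis using K' by simp
  qed
  then show ?thesis using that K(1) by blast
qed

text \<open>The second argument of a context can be negated without copying the hole: variable 1 is
  replaced by its relative negation \<open>NB\<close> in the side formulas only.\<close>

lemma flip_context:
  assumes "context_of B (prop_formulas_over B {0, 1}) K" "NB \<in> prop_formulas_over B {0, 1}"
    "\<And>\<rho>. \<rho> 0 \<Longrightarrow> prop_eval \<rho> NB = (\<not> \<rho> 1)"
  shows "\<exists>K'. context_of B (prop_formulas_over B {0, 1}) K' \<and>
    (\<forall>\<rho> x y. \<rho> 0 \<longrightarrow> prop_eval \<rho> x = prop_eval (\<rho>(1 := \<not> \<rho> 1)) y \<longrightarrow>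
       prop_eval \<rho> (K' x) = prop_eval (\<rho>(1 := \<not> \<rho> 1)) (K y))"
  using assms(1)
proof induction
  case hole
  then show ?case by (intro exI[of _ "\<lambda>x. x"]) (simp add: context_of.hole)
next
  case (conn K f \<phi>s \<psi>s)
  let ?F = "prop_formulas_over B {0, 1}"
  define \<theta> where "\<theta> = (\<lambda>x :: nat. if x = 0 then Var 0 else NB)"
  have \<theta>: "subst \<theta> \<phi> \<in> ?F" "\<And>\<rho>. \<rho> 0 \<Longrightarrow> prop_eval \<rho> (subst \<theta> \<phi>) = prop_eval (\<rho>(1 := \<not> \<rho> 1)) \<phi>"
    if \<phi>: "\<phi> \<in> ?F" for \<phi>
  proof -
    show "subst \<theta> \<phi> \<in> ?F"
      by (rule subst_prop_formulas_over) (use \<phi> assms(2) in \<open>auto simp: \<theta>_def intro: formulas.Var\<close>)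
    show "prop_eval \<rho> (subst \<theta> \<phi>) = prop_eval (\<rho>(1 := \<not> \<rho> 1)) \<phi>" if "\<rho> 0" for \<rho>
    proof -
      have "prop_eval \<rho> (subst \<theta> \<phi>) = prop_eval (\<lambda>x. prop_eval \<rho> (\<theta> x)) \<phi>"
        using \<phi> by (intro prop_eval_subst[where B = B]) simp
      also have "\<dots> = prop_eval (\<rho>(1 := \<not> \<rho> 1)) \<phi>"
        by (rule prop_eval_cong) (use \<phi> that assms(3)[of \<rho>] in \<open>auto simp: \<theta>_def\<close>)
      finally show ?thesis .
    qed
  qed
  obtain K' where K': "context_of B ?F K'" "\<And>\<rho> x y. \<rho> 0 \<Longrightarrow> prop_eval \<rho> x = prop_eval (\<rho>(1 := \<not> \<rho> 1)) y \<Longrightarrow>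
       prop_eval \<rho> (K' x) = prop_eval (\<rho>(1 := \<not> \<rho> 1)) (K y)"
    using conn.IH by blast
  have sub: "\<phi> \<in> set \<phi>s \<or> \<phi> \<in> set \<psi>s \<Longrightarrow> \<phi> \<in> ?F" for \<phi> using conn.hyps(4,5) by blast
  have "context_of B ?F (\<lambda>x. Conn f (map (subst \<theta>) \<phi>s @ K' x # map (subst \<theta>) \<psi>s))"
    by (rule context_of.conn[OF K'(1) conn.hyps(2)]) (use conn.hyps(3) \<theta>(1) sub in auto)
  moreover have "prop_eval \<rho> (Conn f (map (subst \<theta>) \<phi>s @ K' x # map (subst \<theta>) \<psi>s)) =
      prop_eval (\<rho>(1 := \<not> \<rho> 1)) (Conn f (\<phi>s @ K y # \<psi>s))"
    if "\<rho> 0" "prop_eval \<rho> x = prop_eval (\<rho>(1 := \<not> \<rho> 1)) y" for \<rho> x y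
  proof -
    have "map (prop_eval \<rho>) (map (subst \<theta>) xs) = map (prop_eval (\<rho>(1 := \<not> \<rho> 1))) xs" if "set xs \<subseteq> ?F" for xs
      using that \<theta>(2)[of _ \<rho>] \<open>\<rho> 0\<close> by (auto simp: subset_iff)
    from this[OF conn.hyps(4)] this[OF conn.hyps(5)] show ?thesis
      by (simp only: prop_eval.simps map_append list.map K'(2)[OF that])
  qed
  ultimately show ?case by blast
qed

text \<open>Variable 0 stands for truth and variable 1 for the second conjunct; the first conjunct fills
  the hole. Switching the leaves for \<open>x\<close> in a formula for \<open>x \<and> y\<close> from true to false changes the
  parity of its truth table in \<open>y\<close>, so this happens at one leaf. The truth table in that leaf
  and \<open>y\<close> then has odd weight, that is, it is a conjunction up to negations.\<close>

lemma conjunction_context: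
  assumes S1: "S1 \<subseteq> clone B"
  obtains K where "context_of B (prop_formulas_over B {0, 1}) K"
    "\<And>\<rho> x. \<rho> 0 \<Longrightarrow> prop_eval \<rho> (K x) \<longleftrightarrow> prop_eval \<rho> x \<and> \<rho> 1"
proof -
  let ?F = "prop_formulas_over B {0, 1}"
  obtain Z where Z: "Z \<in> prop_formulas_over B {0}" "\<And>\<rho>. prop_eval \<rho> Z = False"
    by (rule false_formula[OF S1]) auto
  obtain N where N: "context_of B ?F N" "\<And>\<rho> x. \<rho> 0 \<Longrightarrow> prop_eval \<rho> (N x) = (\<not> prop_eval \<rho> x)"
  proof -
    obtain N where "context_of B (prop_formulas_over B {0}) N"
      "\<And>\<rho> x. \<rho> 0 \<Longrightarrow> prop_eval \<rho> (N x) = (\<not> prop_eval \<rho> x)"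
      by (rule negation_context[OF S1]) blast
    moreover have "prop_formulas_over B {0} \<subseteq> ?F" by auto
    ultimately show ?thesis using that context_of_mono by blast
  qed
  obtain NB where NB: "NB \<in> ?F" "\<And>\<rho>. \<rho> 0 \<Longrightarrow> prop_eval \<rho> NB = (\<not> \<rho> 1)"
    by (rule S1_formula[OF S1, of 0 2 "\<lambda>bs. bs ! 0 \<and> \<not> bs ! 1"]) (auto simp: lessThan_Suc numeral_2_eq_2)
  have F: "Var 0 \<in> ?F" "Var 1 \<in> ?F" "Z \<in> ?F" using Z(1) by (auto intro: formulas.Var)
  define v where "v = (\<lambda>b :: bool. \<lambda>x :: nat. x = 0 \<or> b)"
  \<comment> \<open>The truth table of a context in the value \<open>a\<close> of the hole and the
    value \<open>b\<close> of variable 1, with variable 0 true; \<open>Var 0\<close> and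
    \<open>Z\<close> serve as the constants in the hole.\<close>
  define t where "t = (\<lambda>K (a :: bool) b. prop_eval (v b) (K (if a then Var 0 else Z)))"
  have t: "prop_eval \<rho> (K x) = t K (prop_eval \<rho> x) (\<rho> 1)" if "context_of B ?F K" "\<rho> 0" for K \<rho> x
    unfolding t_def by (rule prop_eval_context[OF that(1)]) (use that(2) Z in \<open>auto simp: v_def\<close>)
  obtain K1 where K1: "context_of B ?F K1"
    "(t K1 True True \<noteq> t K1 True False) \<noteq> (t K1 False True \<noteq> t K1 False False)"
  proof -
    obtain \<phi> where \<phi>: "\<phi> \<in> prop_formulas B" "\<And>\<rho>. prop_eval \<rho> \<phi> = (\<rho> 0 \<and> \<rho> 1 \<and> \<rho> 2)"
      by (rule S1_formula[OF S1, of 0 3 "\<lambda>bs. bs ! 0 \<and> bs ! 1 \<and> bs ! 2"]) (auto simp: numeral_2_eq_2 numeral_3_eq_3)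
    define \<theta> where "\<theta> = (\<lambda>a (x :: nat). if x = 2 then a else if x = 1 then Var 1 else Var 0)"
    \<comment> \<open>Dependence on variable 1, that is, the parity of the column. For the
      conjunction it holds when \<open>Var 0\<close> fills the leaves of variable 2 and fails when
      \<open>Z\<close> does, so it changes at some leaf.\<close>
    define e where "e = (\<lambda>x. prop_eval (v True) x \<noteq> prop_eval (v False) x)"
    have "\<exists>K x. context_of B ?F K \<and> e (K (\<theta> (Var 0) x)) \<noteq> e (K (\<theta> Z x))"
    proof (rule ccontr)
      assume *: "\<not> ?thesis"
      have "e (subst (\<theta> (Var 0)) \<phi>) = e (subst (\<theta> Z) \<phi>)"
      proof (rule context_hybrid[where R = "\<lambda>x y. e x = e y" and F = ?F and B = B])
        show "subst (\<theta> (Var 0)) \<psi> \<in> ?F \<and> subst (\<theta> Z) \<psi> \<in> ?F" if "\<psi> \<in> prop_formulas B" for \<psi>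
          by (intro conjI subst_prop_formulas_over[OF that]) (use F in \<open>simp_all add: \<theta>_def\<close>)
      qed (use * \<phi>(1) in auto)
      then show False using Z by (simp add: e_def prop_eval_subst[OF \<phi>(1)] \<phi>(2) \<theta>_def v_def)
    qed
    then obtain K x where K: "context_of B ?F K" "e (K (\<theta> (Var 0) x)) \<noteq> e (K (\<theta> Z x))"
      by blast
    then have "x = 2" by (auto simp: \<theta>_def split: if_splits)
    with K have "e (K (Var 0)) \<noteq> e (K Z)" by (simp add: \<theta>_def)
    then show ?thesis using that K(1) by (simp add: e_def t_def)
  qed
  \<comment> \<open>Odd weight means that the hole matters for exactly one value of variable 1. If
    that value is false, flipping variable 1 makes it true.\<close>
  have "\<exists>K2. context_of B ?F K2 \<and> t K2 True True \<noteq> t K2 False True \<and> t K2 True False = t K2 False False"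
  proof (cases "t K1 True True \<noteq> t K1 False True")
    case False
    obtain K' where K': "context_of B ?F K'" "\<And>\<rho> x y. \<rho> 0 \<Longrightarrow> prop_eval \<rho> x = prop_eval (\<rho>(1 := \<not> \<rho> 1)) y \<Longrightarrow>
       prop_eval \<rho> (K' x) = prop_eval (\<rho>(1 := \<not> \<rho> 1)) (K1 y)"
      using flip_context[OF K1(1) NB] by blast
    have "t K' a b = t K1 a (\<not> b)" for a b
    proof -
      have "t K' a b = prop_eval ((v b)(1 := \<not> v b 1)) (K1 (if a then Var 0 else Z))"
        unfolding t_def by (rule K'(2)) (use Z in \<open>auto simp: v_def\<close>)
      also have "\<dots> = t K1 a (\<not> b)"
        unfolding t_def by (rule prop_eval_context[OF K1(1)]) (use Z in \<open>auto simp: v_def\<close>)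
      finally show ?thesis .
    qed
    then show ?thesis using False K1(2) K'(1) by (intro exI[of _ K']) auto
  qed (use K1 in auto)
  then obtain K2 where K2: "context_of B ?F K2" "t K2 True True \<noteq> t K2 False True"
    "t K2 True False = t K2 False False" by blast
  \<comment> \<open>With variable 1 false the value is constant, and \<open>outer\<close> makes this
    constant false. With variable 1 true the value is the hole or its negation, and
    \<open>inner\<close> corrects the sign.\<close>
  define outer where "outer = (if t K2 True False then N else (\<lambda>x. x))"
  define inner where "inner = (if t K2 True True = t K2 True False then N else (\<lambda>x. x))"
  have "context_of B ?F outer" "context_of B ?F inner"
    unfolding outer_def inner_def using N(1) context_of.hole by simp_all
  from context_of_comp[OF this(1) context_of_comp[OF K2(1) this(2)]]
  have "context_of B ?F (\<lambda>x. outer (K2 (inner x)))" .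
  moreover have "prop_eval \<rho> (outer (K2 (inner x))) \<longleftrightarrow> prop_eval \<rho> x \<and> \<rho> 1" if "\<rho> 0" for \<rho> x
    using K2 t[of K2 \<rho>] \<open>\<rho> 0\<close> N(2)[of \<rho>]
    by (cases "prop_eval \<rho> x"; cases "\<rho> 1") (auto simp: outer_def inner_def)
  ultimately show ?thesis using that by blast
qed

text \<open>The hole is named \<open>Var 2\<close>, which no side formula contains, so the argument
  enters the encoding once, between a fixed prefix and a fixed suffix.\<close>

lemma encode_context:
  assumes "context_of B (prop_formulas_over B {0, 1}) K"
  shows "\<exists>\<alpha> \<beta>. \<forall>x. encode (subst ((\<lambda>_. b)(0 := Var 0, 2 := x)) (K (Var 2))) = \<alpha> @ encode x @ \<beta>"
  using assms
proof induction
  case hole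
  then show ?case by (intro exI[of _ "[]"]) simp
next
  case (conn K f \<phi>s \<psi>s)
  then obtain \<alpha> \<beta> where IH: "\<And>x. encode (subst ((\<lambda>_. b)(0 := Var 0, 2 := x)) (K (Var 2))) = \<alpha> @ encode x @ \<beta>"
    by blast
  have "map (subst ((\<lambda>_. b)(0 := Var 0, 2 := x))) xs = map (subst ((\<lambda>_. b)(0 := Var 0))) xs"
    if "set xs \<subseteq> prop_formulas_over B {0, 1}" for xs x
    unfolding map_eq_conv
  proof (intro ballI subst_cong)
    fix \<phi> y assume "\<phi> \<in> set xs" "y \<in> fv \<phi>"
    then have "y \<noteq> 2" using that by fastforce
    then show "((\<lambda>_. b)(0 := Var 0, 2 := x)) y = ((\<lambda>_. b)(0 := Var 0)) y" by simp
  qed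
  note eqs = this[OF conn.hyps(4)] this[OF conn.hyps(5)]
  show ?case
    by (rule exI[of _ "[False, False, True] @ encode_bool_fun f @ concat (map encode (map (subst ((\<lambda>_. b)(0 := Var 0))) \<phi>s)) @ \<alpha>"],
        rule exI[of _ "\<beta> @ concat (map encode (map (subst ((\<lambda>_. b)(0 := Var 0))) \<psi>s))"])
      (simp only: eqs subst.simps encode.simps map_append list.map IH concat_append concat.simps append_assoc simp_thms)
qed

text \<open>The truth constant \<open>Var 0\<close> is assumed to hold at the state in question.\<close>

lemma conjunction_with:
  assumes S1: "S1 \<subseteq> clone B" and b: "b \<in> formulas M B"
  shows "\<exists>C \<alpha> \<beta>. (\<forall>x\<in>formulas M B. C x \<in> formulas M B) \<and> (\<forall>x. encode (C x) = \<alpha> @ encode x @ \<beta>) \<and>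
    (\<forall>(S :: nat ltl_structure) i x. sat S i (Var 0) \<longrightarrow> (sat S i (C x) \<longleftrightarrow> sat S i x \<and> sat S i b))"
proof -
  obtain K where K: "context_of B (prop_formulas_over B {0, 1}) K"
    "\<And>\<rho> x. \<rho> 0 \<Longrightarrow> prop_eval \<rho> (K x) \<longleftrightarrow> prop_eval \<rho> x \<and> \<rho> 1"
    by (rule conjunction_context[OF S1]) blast
  define C where "C = (\<lambda>x. subst ((\<lambda>_. b)(0 := Var 0, 2 := x)) (K (Var 2)))"
  obtain \<alpha> \<beta> where "\<And>x. encode (C x) = \<alpha> @ encode x @ \<beta>"
    using encode_context[OF K(1), of b] unfolding C_def by blast
  moreover have K2: "K (Var 2) \<in> prop_formulas B"
    by (rule context_of_formulas[OF K(1)]) (auto intro: formulas.Var)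
  moreover have "C x \<in> formulas M B" if "x \<in> formulas M B" for x
    unfolding C_def by (rule subst_formulas[OF K2]) (use that b in \<open>auto intro: formulas.Var\<close>)
  moreover have "sat S i (C x) \<longleftrightarrow> sat S i x \<and> sat S i b" if "sat S i (Var 0)" for x i and S :: "nat ltl_structure"
    unfolding C_def sat_subst[OF K2] by (subst K(2)) (use that in auto)
  ultimately show ?thesis by blast
qed

section \<open>Formulae describing tilings\<close>

lemma sat_Next_pow: "sat S i ((Next ^^ k) \<phi>) = sat S (i + k) \<phi>"
  by (induction k arbitrary: i) simp_all

lemma encode_Next_pow: "encode ((Next ^^ k) \<phi>) = concat (replicate k [False, True, False]) @ encode \<phi>"
  by (induction k) simp_all

lemma Next_pow_formulas: "Op_X \<in> M \<Longrightarrow> \<phi> \<in> formulas M B \<Longrightarrow> (Next ^^ k) \<phi> \<in> formulas M B"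
  by (induction k) (auto intro: formulas.Next)

lemma sat_Finally: "sat S i (Finally \<phi>) \<longleftrightarrow> (\<exists>j\<ge>i. sat S j \<phi>)"
  by (simp add: until_def)

lemma sat_Globally: "sat S i (Globally \<phi>) \<longleftrightarrow> (\<forall>j\<ge>i. sat S j \<phi>)"
  by (simp add: until_def)

text \<open>
  A tiling of the line by columns from \<open>C\<close>: the first columns follow the pattern of the input
  and each column has to fit its right neighbour and the column one row later.
\<close>

locale tiling =
  fixes C :: "'c set" and Hor :: "'c \<Rightarrow> 'c \<Rightarrow> bool" and Ver :: "'c \<Rightarrow> 'c \<Rightarrow> 'c \<Rightarrow> 'c \<Rightarrow> bool"
    and Acc :: "'c set" and p :: "nat poly"
    and pre blank start :: "'c set" and bit :: "bool \<Rightarrow> 'c set" and L :: "bool list set"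
  assumes finite_C: "finite C"
begin

text \<open>One column more than a period: the first \<open>pre\<close> is a left neighbour for the
  column that begins the first row, so that \<open>Ver\<close> can be imposed on it as well. The
  padding on both sides leaves room for the heads.\<close>

definition pattern :: "bool list \<Rightarrow> 'c set list" where
  "pattern w = [pre, pre] @ replicate (poly p (length w)) blank @ [start] @ map bit w
     @ replicate (poly p (length w)) blank"

definition period :: "bool list \<Rightarrow> nat" where
  "period w = 2 * poly p (length w) + length w + 2"

lemma length_pattern: "length (pattern w) = period w + 1"
  by (simp add: pattern_def period_def)

definition tiles :: "bool list \<Rightarrow> (nat \<Rightarrow> 'c) \<Rightarrow> nat \<Rightarrow> bool" where
  "tiles w c T \<longleftrightarrow> (\<forall>i\<le>T. c i \<in> C) \<and> (\<forall>i\<le>T. i < length (pattern w) \<longrightarrow> c i \<in> pattern w ! i) \<and>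
     (\<forall>i<T. Hor (c i) (c (i + 1))) \<and>
     (\<forall>i. i + period w + 1 \<le> T \<longrightarrow> Ver (c i) (c (i + 1)) (c (i + 2)) (c (i + period w + 1)))"

text \<open>Variable 0 marks the part of the time line that is tiled; one variable for each column.\<close>

definition num :: nat where "num = card C"

definition code :: "'c \<Rightarrow> nat" where
  "code = (SOME f. bij_betw f C {0..<num})"

lemma code: "bij_betw code C {0..<num}"
  unfolding code_def num_def using ex_bij_betw_finite_nat[OF finite_C] by (rule someI_ex)

definition codes :: "(nat \<Rightarrow> bool) \<Rightarrow> 'c \<Rightarrow> bool" where
  "codes \<rho> a \<longleftrightarrow> a \<in> C \<and> (\<forall>l<num. \<rho> (Suc l) \<longleftrightarrow> l = code a)"

lemma codes_unique: "codes \<rho> a \<Longrightarrow> codes \<rho> b \<Longrightarrow> a = b"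
proof -
  assume *: "codes \<rho> a" "codes \<rho> b"
  then have "code a < num" using code by (auto simp: codes_def bij_betw_def)
  with * have "code a = code b" by (auto simp: codes_def)
  then show "a = b" using * code by (auto simp: codes_def bij_betw_def inj_on_def)
qed

lemma codes_cong: "(\<And>v. v \<le> num \<Longrightarrow> \<rho> v = \<rho>' v) \<Longrightarrow> codes \<rho> a = codes \<rho>' a"
  by (auto simp: codes_def)

text \<open>The argument \<open>k\<close> of \<open>\<beta>\<close> selects one of four positions:
  this one, the next two, and the one below the next. A marked position must carry a column, and
  unless it accepts the next position must be marked too; neighbours are constrained only if marked.
  Together with the mark in \<open>bad\<close>, the failure of this condition lies below
  \<open>Var 0\<close>, hence is 1-separating.\<close>

definition fits :: "(nat \<Rightarrow> nat \<Rightarrow> bool) \<Rightarrow> bool" where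
  "fits \<beta> \<longleftrightarrow> (\<exists>a. codes (\<beta> 0) a \<and> (a \<in> Acc \<or> \<beta> 1 0) \<and>
     (\<forall>b. \<beta> 1 0 \<and> codes (\<beta> 1) b \<longrightarrow> Hor a b) \<and>
     (\<forall>b d e. \<beta> 1 0 \<and> \<beta> 2 0 \<and> \<beta> 3 0 \<and> codes (\<beta> 1) b \<and> codes (\<beta> 2) d \<and> codes (\<beta> 3) e \<longrightarrow> Ver a b d e))"

lemma fits_cong:
  assumes "\<And>k v. k < 4 \<Longrightarrow> v \<le> num \<Longrightarrow> \<beta> k v = \<beta>' k v"
  shows "fits \<beta> = fits \<beta>'"
  unfolding fits_def using assms codes_cong[of "\<beta> 0" "\<beta>' 0"] codes_cong[of "\<beta> 1" "\<beta>' 1"]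
    codes_cong[of "\<beta> 2" "\<beta>' 2"] codes_cong[of "\<beta> 3" "\<beta>' 3"] by simp

definition offset :: "bool list \<Rightarrow> nat \<Rightarrow> nat" where
  "offset w k = (if k < 3 then k else period w + 1)"

abbreviation bits :: "nat ltl_structure \<Rightarrow> nat \<Rightarrow> nat \<Rightarrow> bool" where
  "bits S i \<equiv> (\<lambda>v. sat S i (Var v))"

definition bad :: "bool list \<Rightarrow> nat ltl_structure \<Rightarrow> nat \<Rightarrow> bool" where
  "bad w S i \<longleftrightarrow> bits S i 0 \<and> \<not> fits (\<lambda>k. bits S (i + offset w k))"

definition accepting :: "nat ltl_structure \<Rightarrow> nat \<Rightarrow> bool" where
  "accepting S i \<longleftrightarrow> bits S i 0 \<and> (\<exists>a\<in>Acc. codes (bits S i) a)"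

definition describes :: "bool list \<Rightarrow> nat ltl_structure \<Rightarrow> nat \<Rightarrow> bool" where
  "describes w S i \<longleftrightarrow> bits S i 0 \<and> (\<forall>j\<ge>i. \<not> bad w S j) \<and> (\<exists>j\<ge>i. accepting S j)"

definition matches :: "'c set list \<Rightarrow> nat ltl_structure \<Rightarrow> nat \<Rightarrow> bool" where
  "matches As S i \<longleftrightarrow> (\<forall>T. (\<forall>j\<le>T. bits S (i + j) 0) \<longrightarrow> T < length As \<longrightarrow> (\<exists>a\<in>As ! T. codes (bits S (i + T)) a))"

text \<open>Relative conjunction and negation can be trusted only at marked positions. Up to the
  first accepting position \<open>T\<close> the mark is propagated by \<open>fits\<close>; behind it
  nothing is known, so the tiling is cut there.\<close>

lemma describes_tiles:
  assumes "describes w S i" "matches (pattern w) S i"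
  obtains T c where "tiles w c T" "c T \<in> Acc"
proof -
  define T where "T = (LEAST j. accepting S (i + j))"
  define c where "c = (\<lambda>j. THE a. codes (bits S (i + j)) a)"
  obtain j where "accepting S (i + j)"
    using assms(1) unfolding describes_def by (metis le_iff_add)
  then have acc: "accepting S (i + T)" unfolding T_def by (rule LeastI)
  have not_acc: "\<not> accepting S (i + j)" if "j < T" for j
    using that not_less_Least unfolding T_def by blast
  have codes_c: "c j = a" if "codes (bits S (i + j)) a" for j a
    unfolding c_def using that codes_unique by blast
  have step: "\<exists>a. codes (bits S (i + j)) a \<and> bits S (i + Suc j) 0" if "j < T" "bits S (i + j) 0" for j
  proof -
    have "fits (\<lambda>k. bits S (i + j + offset w k))"
      using assms(1) that by (auto simp: describes_def bad_def)
    then obtain a where "codes (bits S (i + j)) a" "a \<in> Acc \<or> bits S (i + Suc j) 0"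
      by (auto simp: fits_def offset_def)
    then show ?thesis using not_acc[OF that(1)] that(2) by (auto simp: accepting_def)
  qed
  have t: "bits S (i + j) 0" if "j \<le> T" for j
    using that
  proof (induction j)
    case 0
    then show ?case using assms(1) by (simp add: describes_def)
  next
    case (Suc j)
    then show ?case using step[of j] by auto
  qed
  have codes: "codes (bits S (i + j)) (c j)" if "j \<le> T" for j
  proof (cases "j = T")
    case True
    then show ?thesis using acc codes_c by (auto simp: accepting_def)
  next
    case False
    then show ?thesis using step[of j] t[of j] codes_c that by fastforce
  qed
  have fit: "(\<forall>b. bits S (i + j + 1) 0 \<and> codes (bits S (i + j + 1)) b \<longrightarrow> Hor (c j) b) \<and>
     (\<forall>b d e. bits S (i + j + 1) 0 \<and> bits S (i + j + 2) 0 \<and> bits S (i + j + (period w + 1)) 0 \<and>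
        codes (bits S (i + j + 1)) b \<and> codes (bits S (i + j + 2)) d \<and> codes (bits S (i + j + (period w + 1))) e
        \<longrightarrow> Ver (c j) b d e)" if "j \<le> T" for j
  proof -
    have "fits (\<lambda>k. bits S (i + j + offset w k))"
      using assms(1) t[OF that] by (auto simp: describes_def bad_def)
    then show ?thesis using codes_unique[OF codes[OF that]] by (auto simp: fits_def offset_def)
  qed
  have "tiles w c T"
    unfolding tiles_def
  proof (intro conjI allI impI)
    fix j assume "j \<le> T"
    then show "c j \<in> C" using codes by (auto simp: codes_def)
  next
    fix j assume j: "j \<le> T" "j < length (pattern w)"
    then obtain a where "a \<in> pattern w ! j" "codes (bits S (i + j)) a"
      using assms(2)[unfolded matches_def, rule_format, of j] t by fastforce
    then show "c j \<in> pattern w ! j" using codes_c by blast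
  next
    fix j assume "j < T"
    then show "Hor (c j) (c (j + 1))"
      using fit[of j] t[of "j + 1"] codes[of "j + 1"] by (simp add: add.assoc)
  next
    fix j assume "j + period w + 1 \<le> T"
    then show "Ver (c j) (c (j + 1)) (c (j + 2)) (c (j + period w + 1))"
      using fit[of j] t[of "j + 1"] t[of "j + 2"] t[of "j + period w + 1"]
        codes[of "j + 1"] codes[of "j + 2"] codes[of "j + period w + 1"]
      by (simp add: add.assoc period_def)
  qed
  moreover have "c T \<in> Acc" using acc codes_c by (auto simp: accepting_def)
  ultimately show ?thesis using that by blast
qed

definition tiling_structure :: "(nat \<Rightarrow> 'c) \<Rightarrow> nat ltl_structure" where
  "tiling_structure c = \<lparr>states = id, vars = UNIV, label = (\<lambda>j. {0, Suc (code (c j))})\<rparr>"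

text \<open>All positions are marked here, so none may violate a constraint; therefore the tiling
  has to go on beyond acceptance.\<close>

lemma tiles_describes:
  assumes "\<And>T. tiles w c T" "c T \<in> Acc"
  shows "is_structure (tiling_structure c)" "describes w (tiling_structure c) 0"
    "\<And>j. bits (tiling_structure c) j 0"
    "\<And>j. j < length (pattern w) \<Longrightarrow> \<exists>a\<in>pattern w ! j. codes (bits (tiling_structure c) j) a"
proof -
  let ?S = "tiling_structure c"
  show "is_structure ?S" by (simp add: is_structure_def tiling_structure_def)
  show t: "bits ?S j 0" for j by (simp add: tiling_structure_def)
  have c: "codes (bits ?S j) (c j)" for j
    using assms(1)[of j] by (auto simp: codes_def tiles_def tiling_structure_def)
  have c_unique: "b = c j" if "codes (bits ?S j) b" for b j
    using codes_unique[OF that c] .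
  have "fits (\<lambda>k. bits ?S (j + offset w k))" for j
    unfolding fits_def
  proof (intro exI conjI)
    show "codes (bits ?S (j + offset w 0)) (c j)" using c[of j] by (simp add: offset_def)
    show "c j \<in> Acc \<or> bits ?S (j + offset w 1) 0" using t by blast
    show "\<forall>b. bits ?S (j + offset w 1) 0 \<and> codes (bits ?S (j + offset w 1)) b \<longrightarrow> Hor (c j) b"
      using assms(1)[of "j + 1"] by (auto dest!: c_unique simp: offset_def tiles_def simp del: sat.simps(1))
    show "\<forall>b d e. bits ?S (j + offset w 1) 0 \<and> bits ?S (j + offset w 2) 0 \<and> bits ?S (j + offset w 3) 0 \<and>
        codes (bits ?S (j + offset w 1)) b \<and> codes (bits ?S (j + offset w 2)) d \<and> codes (bits ?S (j + offset w 3)) e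
        \<longrightarrow> Ver (c j) b d e"
      using assms(1)[of "j + period w + 1"] by (auto dest!: c_unique simp: offset_def tiles_def simp del: sat.simps(1))
  qed
  then have "\<not> bad w ?S j" for j by (simp add: bad_def)
  moreover have "accepting ?S T" using c[of T] t assms(2) by (auto simp: accepting_def)
  ultimately show "describes w ?S 0" using t by (auto simp: describes_def)
  show "\<exists>a\<in>pattern w ! j. codes (bits ?S j) a" if "j < length (pattern w)" for j
    using c[of j] assms(1)[of j] that by (auto simp: tiles_def)
qed

section \<open>Formulas that describe a tiling\<close>

lemma literal:
  assumes "S1 \<subseteq> clone B"
  obtains \<phi> where "\<phi> \<in> prop_formulas B"
    "\<And>\<rho>. prop_eval \<rho> \<phi> \<longleftrightarrow> \<rho> 0 \<and> ((\<exists>a\<in>A. codes \<rho> a) \<longleftrightarrow> pos)"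
proof -
  define P where "P = (\<lambda>bs. bs ! 0 \<and> ((\<exists>a\<in>A. codes ((!) bs) a) \<longleftrightarrow> pos))"
  obtain \<phi> where \<phi>: "\<phi> \<in> prop_formulas B" "\<And>\<rho>. prop_eval \<rho> \<phi> = P (map \<rho> [0..<Suc num])"
    by (rule S1_formula[OF assms, of 0 "Suc num" P]) (auto simp: P_def)
  have "codes ((!) (map \<rho> [0..<Suc num])) a = codes \<rho> a" for \<rho> a
    by (rule codes_cong) (simp del: upt_Suc)
  then show ?thesis using that \<phi> by (simp add: P_def del: upt_Suc)
qed

lemma emits_pattern:
  assumes "\<And>A. emits (\<lambda>_. f A)"
  shows "emits (\<lambda>w. concat (map f (pattern w)))" "emits (\<lambda>w. concat (map f (rev (pattern w))))"
proof -
  have bits: "emits (\<lambda>w. concat (map f (map bit w)))" "emits (\<lambda>w. concat (map f (map bit (rev w))))"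
    using emits_loop[of "\<lambda>b _. f (bit b)" False] emits_loop[of "\<lambda>b _. f (bit b)" True] assms
    by (simp_all add: comp_def)
  have rep: "emits (\<lambda>w. concat (replicate (poly p (length w)) (f blank)))"
    using assms by (rule emits_replicate_poly)
  show "emits (\<lambda>w. concat (map f (pattern w)))"
    unfolding pattern_def map_append concat_append map_replicate
    by (intro emits_append bits rep) (simp_all add: emits_append assms)
  show "emits (\<lambda>w. concat (map f (rev (pattern w))))"
    unfolding pattern_def rev_append rev_replicate rev_map map_append concat_append map_replicate
    by (intro emits_append bits rep) (simp_all add: emits_append assms)
qed

text \<open>The conjunctions are nested along the time line, one inside the next operator of the
  other, to the depth of the pattern. As each uses its argument once, the encoding is a row of
  prefixes in the order of the pattern followed by a row of suffixes in reverse order. It enforces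
  the pattern only as long as the mark is present.\<close>

lemma chain:
  assumes S1: "S1 \<subseteq> clone B" and X: "Op_X \<in> M"
  obtains \<chi> where "\<And>w. \<chi> w \<in> formulas M B" "emits (\<lambda>w. encode (\<chi> w))"
    "\<And>S i w. sat S i (\<chi> w) \<Longrightarrow> matches (pattern w) S i"
    "\<And>S i w. (\<And>j. bits S j 0) \<Longrightarrow> (\<And>j. j < length (pattern w) \<Longrightarrow> \<exists>a\<in>pattern w ! j. codes (bits S (i + j)) a)
       \<Longrightarrow> sat S i (\<chi> w)"
proof -
  have "\<exists>F \<alpha> \<beta>. (\<forall>x. x \<in> formulas M B \<longrightarrow> F x \<in> formulas M B) \<and> (\<forall>x. encode (F x) = \<alpha> @ encode x @ \<beta>) \<and>
    (\<forall>(S :: nat ltl_structure) i x. bits S i 0 \<longrightarrow> (sat S i (F x) \<longleftrightarrow> sat S i x \<and> (\<exists>a\<in>A. codes (bits S i) a)))" for A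
  proof -
    obtain \<phi> where \<phi>: "\<phi> \<in> prop_formulas B"
      "\<And>\<rho>. prop_eval \<rho> \<phi> \<longleftrightarrow> \<rho> 0 \<and> ((\<exists>a\<in>A. codes \<rho> a) \<longleftrightarrow> True)"
      using literal[OF S1, of A True] by blast
    have lit: "subst Var \<phi> \<in> formulas M B" "sat S i (subst Var \<phi>) \<longleftrightarrow> bits S i 0 \<and> (\<exists>a\<in>A. codes (bits S i) a)"
      for i and S :: "nat ltl_structure"
      using sat_subst[OF \<phi>(1), of S i Var] \<phi>(2) subst_formulas[OF \<phi>(1), of Var M] by (auto intro: formulas.Var)
    obtain F \<alpha> \<beta> where F: "\<forall>x\<in>formulas M B. F x \<in> formulas M B" "\<forall>x. encode (F x) = \<alpha> @ encode x @ \<beta>"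
      "\<forall>(S :: nat ltl_structure) i x. bits S i 0 \<longrightarrow> (sat S i (F x) \<longleftrightarrow> sat S i x \<and> sat S i (subst Var \<phi>))"
      using conjunction_with[OF S1 lit(1)] by (elim exE conjE)
    show ?thesis
    proof (intro exI conjI)
      show "\<forall>x. x \<in> formulas M B \<longrightarrow> F x \<in> formulas M B" "\<forall>x. encode (F x) = \<alpha> @ encode x @ \<beta>"
        using F by auto
      show "\<forall>(S :: nat ltl_structure) i x. bits S i 0 \<longrightarrow> (sat S i (F x) \<longleftrightarrow> sat S i x \<and> (\<exists>a\<in>A. codes (bits S i) a))"
        using F(3) lit(2) by (simp del: sat.simps)
    qed
  qed
  then obtain F \<alpha> \<beta> where F: "\<And>A x. x \<in> formulas M B \<Longrightarrow> F A x \<in> formulas M B"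
    "\<And>A x. encode (F A x) = \<alpha> A @ encode x @ \<beta> A"
    "\<And>A (S :: nat ltl_structure) i x. bits S i 0 \<Longrightarrow>
       sat S i (F A x) \<longleftrightarrow> sat S i x \<and> (\<exists>a\<in>A. codes (bits S i) a)"
    by metis
  define ch where "ch = (\<lambda>As. foldr (\<lambda>A x. F A (Next x)) As (Var 0))"
  have "ch As \<in> formulas M B" for As
    by (induction As) (auto simp: ch_def intro: formulas.Var formulas.Next[OF X] F(1))
  moreover have "encode (ch As) = concat (map (\<lambda>A. \<alpha> A @ [False, True, False]) As) @ encode (Var 0) @
      concat (map \<beta> (rev As))" for As
    by (induction As) (simp_all add: ch_def F(2))
  then have "emits (\<lambda>w. encode (ch (pattern w)))"
    by (simp only:) (intro emits_append emits_const emits_pattern)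
  moreover have "matches As S i" if "sat S i (ch As)" for As S i
    using that
  proof (induction As arbitrary: i)
    case (Cons A As)
    show ?case
      unfolding matches_def
    proof (intro allI impI)
      fix T assume T: "\<forall>j\<le>T. bits S (i + j) 0" "T < length (A # As)"
      then have t: "bits S i 0" by (metis add_0_right le0)
      from Cons.prems F(3)[OF t, of A "Next (ch As)"] have *: "sat S (i + 1) (ch As)" "\<exists>a\<in>A. codes (bits S i) a"
        by (simp_all add: ch_def)
      show "\<exists>a\<in>(A # As) ! T. codes (bits S (i + T)) a"
      proof (cases T)
        case (Suc T')
        have "\<forall>j\<le>T'. bits S (i + 1 + j) 0"
        proof (intro allI impI)
          fix j assume "j \<le> T'"
          then show "bits S (i + 1 + j) 0" using T(1)[rule_format, of "Suc j"] Suc by simp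
        qed
        then show ?thesis using Cons.IH[OF *(1)] T(2) Suc by (simp add: matches_def)
      qed (use * in simp)
    qed
  qed (simp add: matches_def)
  moreover have "sat S i (ch As)"
    if "\<And>j. bits S j 0" "\<And>j. j < length As \<Longrightarrow> \<exists>a\<in>As ! j. codes (bits S (i + j)) a" for As S i
    using that(2)
  proof (induction As arbitrary: i)
    case (Cons A As)
    have "\<exists>a\<in>As ! j. codes (bits S (i + 1 + j)) a" if "j < length As" for j
      using Cons.prems[of "Suc j"] that by simp
    from Cons.IH[OF this] have "sat S i (Next (ch As))" by simp
    moreover have "\<exists>a\<in>A. codes (bits S i) a" using Cons.prems[of 0] by simp
    ultimately show ?case using F(3)[OF that(1)] by (simp add: ch_def)
  qed (use that(1) in \<open>simp add: ch_def\<close>)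
  ultimately show ?thesis by (intro that[of "\<lambda>w. ch (pattern w)"]) auto
qed

text \<open>The constraint concerns boundedly many variables at four offsets, so a fixed template
  suffices and only the offset of the row below depends on the input. \<open>pos\<close> chooses the
  polarity: violations are excluded by a negated F, their relative complement is asserted under
  G.\<close>

lemma fits_formula:
  assumes S1: "S1 \<subseteq> clone B" and X: "Op_X \<in> M"
  obtains \<chi> where "\<And>w. \<chi> w \<in> formulas M B" "emits (\<lambda>w. encode (\<chi> w))"
    "\<And>(S :: nat ltl_structure) i w. sat S i (\<chi> w) \<longleftrightarrow> bits S i 0 \<and> (bad w S i \<longleftrightarrow> pos)"
proof -
  \<comment> \<open>Argument \<open>k * Suc num + v\<close> of the template stands for variable
    \<open>v\<close> at the offset with number \<open>k\<close>.\<close>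
  define P where "P = (\<lambda>bs. bs ! 0 \<and> (\<not> fits (\<lambda>k v. bs ! (k * Suc num + v)) \<longleftrightarrow> pos))"
  obtain \<phi> where \<phi>: "\<phi> \<in> prop_formulas B" "\<And>\<rho>. prop_eval \<rho> \<phi> = P (map \<rho> [0..<4 * Suc num])"
    by (rule S1_formula[OF S1, of 0 "4 * Suc num" P]) (auto simp: P_def)
  define \<theta> where "\<theta> = (\<lambda>w j. (Next ^^ offset w (j div Suc num)) (Var (j mod Suc num)))"
  have "subst (\<theta> w) \<phi> \<in> formulas M B" for w
    using subst_formulas[OF \<phi>(1)] Next_pow_formulas[OF X formulas.Var] by (simp add: \<theta>_def)
  moreover have "sat S i (subst (\<theta> w) \<phi>) \<longleftrightarrow> bits S i 0 \<and> (bad w S i \<longleftrightarrow> pos)" for S :: "nat ltl_structure" and i w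
  proof -
    let ?bs = "map (\<lambda>x. sat S i (\<theta> w x)) [0..<4 * Suc num]"
    have bs: "?bs ! (k * Suc num + v) = bits S (i + offset w k) v" if "k < 4" "v \<le> num" for k v
    proof -
      have "k * Suc num + v < 4 * Suc num"
      proof -
        have "k * Suc num \<le> 3 * Suc num" using that by (intro mult_right_mono) auto
        then show ?thesis using that by simp
      qed
      moreover have "(k * Suc num + v) div Suc num = k" "(k * Suc num + v) mod Suc num = v"
        using that by (metis div_mult_self3 add.commute add_0_right div_less le_imp_less_Suc nat.distinct(1),
            metis mod_mult_self3 mod_less le_imp_less_Suc)
      ultimately show ?thesis by (simp add: \<theta>_def sat_Next_pow del: sat.simps)
    qed
    have "fits (\<lambda>k v. ?bs ! (k * Suc num + v)) = fits (\<lambda>k. bits S (i + offset w k))"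
      by (rule fits_cong) (rule bs)
    moreover have "?bs ! 0 = bits S i 0" using bs[of 0 0] by (simp add: offset_def)
    ultimately show ?thesis unfolding sat_subst[OF \<phi>(1)] \<phi>(2) P_def bad_def by (auto simp del: sat.simps)
  qed
  moreover have "emits (\<lambda>w. encode (subst (\<theta> w) \<phi>))"
  proof (rule emits_subst[OF \<phi>(1)])
    fix x
    have "emits (\<lambda>w. concat (replicate (offset w (x div Suc num)) [False, True, False]))"
    proof (cases "x div Suc num < 3")
      case True
      then show ?thesis
        using emits_const[of "concat (replicate (x div Suc num) [False, True, False])"] by (simp add: offset_def)
    next
      case False
      \<comment> \<open>The distance to the column below the next one, as a polynomial in the input
        length.\<close>
      have "poly (2 * p + [:3, 1:]) (length w) = period w + 1" for w :: "bool list"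
        by (simp add: period_def)
      with False emits_replicate_poly[OF emits_const[of "[False, True, False]"], of "2 * p + [:3, 1:]"]
      show ?thesis by (simp only: offset_def if_False)
    qed
    then show "emits (\<lambda>w. encode (\<theta> w x))"
      unfolding \<theta>_def encode_Next_pow by (intro emits_append emits_const)
  qed
  ultimately show ?thesis by (intro that[of "\<lambda>w. subst (\<theta> w) \<phi>"])
qed

lemma polytime_reducible_SAT:
  assumes "\<And>w. \<Phi> w \<in> formulas M B" "emits (\<lambda>w. encode (\<Phi> w))" "\<And>w. w \<in> L \<longleftrightarrow> satisfiable (\<Phi> w)"
  shows "polytime_reducible L (SAT M B)"
  unfolding polytime_reducible_def
  using emits_polytime_computable[OF assms(2)] encode_in_SAT_iff[OF assms(1)] assms(3) by blast

text \<open>A word in \<open>L\<close> must provide an infinite tiling, which is turned into a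
  model; a model returns only a finite tiling that ends in acceptance. Hence the different shapes of
  \<open>complete\<close> and \<open>sound\<close>.\<close>

lemma reducible:
  assumes S1: "S1 \<subseteq> clone B"
    and complete: "\<And>w. w \<in> L \<Longrightarrow> \<exists>c T. (\<forall>T'. tiles w c T') \<and> c T \<in> Acc"
    and sound: "\<And>w c T. tiles w c T \<Longrightarrow> c T \<in> Acc \<Longrightarrow> w \<in> L"
  shows "polytime_reducible L (SAT {Op_F, Op_X} B)" "polytime_reducible L (SAT {Op_G, Op_X} B)"
proof -
  have iff: "w \<in> L \<longleftrightarrow> satisfiable \<Phi>"
    if \<chi>: "\<And>S i. sat S i \<chi> \<Longrightarrow> matches (pattern w) S i"
      "\<And>S i. (\<And>j. bits S j 0) \<Longrightarrow> (\<And>j. j < length (pattern w) \<Longrightarrow> \<exists>a\<in>pattern w ! j. codes (bits S (i + j)) a)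
         \<Longrightarrow> sat S i \<chi>"
     and \<Phi>: "\<And>S i. sat S i \<Phi> \<Longrightarrow> describes w S i \<and> sat S i \<chi>"
       "\<And>S i. describes w S i \<Longrightarrow> sat S i \<chi> \<Longrightarrow> (\<And>j. bits S j 0) \<Longrightarrow> sat S i \<Phi>" for w \<Phi> \<chi>
  proof
    assume "w \<in> L"
    then obtain c T where c: "\<And>T. tiles w c T" "c T \<in> Acc" using complete by blast
    note * = tiles_describes[OF c]
    have "sat (tiling_structure c) 0 \<Phi>"
      using \<Phi>(2)[OF *(2) _ *(3)] \<chi>(2)[of "tiling_structure c" 0] *(3,4) by simp
    then show "satisfiable \<Phi>" using *(1) by (auto simp: satisfiable_def)
  next
    assume "satisfiable \<Phi>"
    then obtain S :: "nat ltl_structure" and i where "sat S i \<Phi>" by (auto simp: satisfiable_def)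
    then have "describes w S i" "matches (pattern w) S i" using \<Phi>(1) \<chi>(1) by blast+
    then show "w \<in> L" using describes_tiles sound by metis
  qed
  show "polytime_reducible L (SAT {Op_F, Op_X} B)"
  proof -
    let ?M = "{Op_F, Op_X}"
    obtain \<chi> where \<chi>: "\<And>w. \<chi> w \<in> formulas ?M B" "emits (\<lambda>w. encode (\<chi> w))"
      "\<And>S i w. sat S i (\<chi> w) \<Longrightarrow> matches (pattern w) S i"
      "\<And>S i w. (\<And>j. bits S j 0) \<Longrightarrow> (\<And>j. j < length (pattern w) \<Longrightarrow> \<exists>a\<in>pattern w ! j. codes (bits S (i + j)) a)
         \<Longrightarrow> sat S i (\<chi> w)"
      by (rule chain[OF S1, of ?M]) auto
    obtain \<beta> where \<beta>: "\<And>w. \<beta> w \<in> formulas ?M B" "emits (\<lambda>w. encode (\<beta> w))"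
      "\<And>(S :: nat ltl_structure) i w. sat S i (\<beta> w) \<longleftrightarrow> bits S i 0 \<and> (bad w S i \<longleftrightarrow> True)"
      by (rule fits_formula[OF S1, of ?M True]) auto
    obtain \<alpha> where \<alpha>: "\<alpha> \<in> prop_formulas B" "\<And>\<rho>. prop_eval \<rho> \<alpha> \<longleftrightarrow> \<rho> 0 \<and> ((\<exists>a\<in>Acc. codes \<rho> a) \<longleftrightarrow> True)"
      using literal[OF S1, of Acc True] by blast
    have acc: "subst Var \<alpha> \<in> formulas ?M B" "sat S i (subst Var \<alpha>) \<longleftrightarrow> accepting S i"
      for i and S :: "nat ltl_structure"
      using sat_subst[OF \<alpha>(1), of S i Var] \<alpha>(2) subst_formulas[OF \<alpha>(1), of Var ?M]
      by (auto simp: accepting_def intro: formulas.Var)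
    \<comment> \<open>The negation stands in front of F applied to \<open>bad\<close>; the conjunct
      for variable 0 keeps the template 1-separating.\<close>
    obtain \<tau> where \<tau>: "\<tau> \<in> prop_formulas B" "\<And>\<rho>. prop_eval \<rho> \<tau> = (\<rho> 0 \<and> \<rho> 1 \<and> \<not> \<rho> 2 \<and> \<rho> 3)"
      by (rule S1_formula[OF S1, of 0 4 "\<lambda>bs. bs ! 0 \<and> bs ! 1 \<and> \<not> bs ! 2 \<and> bs ! 3"])
        (auto simp: numeral_2_eq_2 numeral_3_eq_3 eval_nat_numeral)
    define \<theta> where "\<theta> = (\<lambda>w. (\<lambda>_ :: nat. Finally (subst Var \<alpha>))(0 := Var 0, 1 := \<chi> w, 2 := Finally (\<beta> w)))"
    show ?thesis
    proof (rule polytime_reducible_SAT)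
      show "subst (\<theta> w) \<tau> \<in> formulas ?M B" for w
        by (rule subst_formulas[OF \<tau>(1)]) (auto simp: \<theta>_def intro!: formulas.Var formulas.Finally \<chi>(1) \<beta>(1) acc(1))
      show "emits (\<lambda>w. encode (subst (\<theta> w) \<tau>))"
      proof (rule emits_subst[OF \<tau>(1)])
        fix x
        have "emits (\<lambda>w. encode (Finally (\<beta> w)))"
          using emits_append[OF emits_const[of "[False, True, True]"] \<beta>(2)] by simp
        then show "emits (\<lambda>w. encode (\<theta> w x))"
          using emits_const \<chi>(2) by (cases "x = 0"; cases "x = 1"; cases "x = 2") (simp_all add: \<theta>_def)
      qed
      show "w \<in> L \<longleftrightarrow> satisfiable (subst (\<theta> w) \<tau>)" for w
        by (rule iff[of "\<chi> w"])
          (use \<chi>(3,4) in \<open>auto simp: sat_subst[OF \<tau>(1)] \<tau>(2) \<theta>_def sat_Finally \<beta>(3) acc(2) describes_def bad_def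
            simp del: sat.simps(4)\<close>)
    qed
  qed
  show "polytime_reducible L (SAT {Op_G, Op_X} B)"
  proof -
    let ?M = "{Op_G, Op_X}"
    obtain \<chi> where \<chi>: "\<And>w. \<chi> w \<in> formulas ?M B" "emits (\<lambda>w. encode (\<chi> w))"
      "\<And>S i w. sat S i (\<chi> w) \<Longrightarrow> matches (pattern w) S i"
      "\<And>S i w. (\<And>j. bits S j 0) \<Longrightarrow> (\<And>j. j < length (pattern w) \<Longrightarrow> \<exists>a\<in>pattern w ! j. codes (bits S (i + j)) a)
         \<Longrightarrow> sat S i (\<chi> w)"
      by (rule chain[OF S1, of ?M]) auto
    obtain \<beta> where \<beta>: "\<And>w. \<beta> w \<in> formulas ?M B" "emits (\<lambda>w. encode (\<beta> w))"
      "\<And>(S :: nat ltl_structure) i w. sat S i (\<beta> w) \<longleftrightarrow> bits S i 0 \<and> (bad w S i \<longleftrightarrow> False)"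
      by (rule fits_formula[OF S1, of ?M False]) auto
    obtain \<alpha> where \<alpha>: "\<alpha> \<in> prop_formulas B" "\<And>\<rho>. prop_eval \<rho> \<alpha> \<longleftrightarrow> \<rho> 0 \<and> ((\<exists>a\<in>Acc. codes \<rho> a) \<longleftrightarrow> False)"
      using literal[OF S1, of Acc False] by blast
    have acc: "subst Var \<alpha> \<in> formulas ?M B" "sat S i (subst Var \<alpha>) \<longleftrightarrow> bits S i 0 \<and> \<not> accepting S i"
      for i and S :: "nat ltl_structure"
      using sat_subst[OF \<alpha>(1), of S i Var] \<alpha>(2) subst_formulas[OF \<alpha>(1), of Var ?M]
      by (auto simp: accepting_def intro: formulas.Var)
    \<comment> \<open>Without F, the existence of an accepting column is the negation of G applied
      to the relative complement of acceptance. The other G forces the mark everywhere, so the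
      relative complement is the true one.\<close>
    obtain \<tau> where \<tau>: "\<tau> \<in> prop_formulas B" "\<And>\<rho>. prop_eval \<rho> \<tau> = (\<rho> 0 \<and> \<rho> 1 \<and> \<rho> 2 \<and> \<not> \<rho> 3)"
      by (rule S1_formula[OF S1, of 0 4 "\<lambda>bs. bs ! 0 \<and> bs ! 1 \<and> bs ! 2 \<and> \<not> bs ! 3"])
        (auto simp: numeral_2_eq_2 numeral_3_eq_3 eval_nat_numeral)
    define \<theta> where "\<theta> = (\<lambda>w. (\<lambda>_ :: nat. Globally (subst Var \<alpha>))(0 := Var 0, 1 := \<chi> w, 2 := Globally (\<beta> w)))"
    show ?thesis
    proof (rule polytime_reducible_SAT)
      show "subst (\<theta> w) \<tau> \<in> formulas ?M B" for w
        by (rule subst_formulas[OF \<tau>(1)]) (auto simp: \<theta>_def intro!: formulas.Var formulas.Globally \<chi>(1) \<beta>(1) acc(1))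
      show "emits (\<lambda>w. encode (subst (\<theta> w) \<tau>))"
      proof (rule emits_subst[OF \<tau>(1)])
        fix x
        have "emits (\<lambda>w. encode (Globally (\<beta> w)))"
          using emits_append[OF emits_const[of "[True, False, False]"] \<beta>(2)] by simp
        then show "emits (\<lambda>w. encode (\<theta> w x))"
          using emits_const \<chi>(2) by (cases "x = 0"; cases "x = 1"; cases "x = 2") (simp_all add: \<theta>_def)
      qed
      show "w \<in> L \<longleftrightarrow> satisfiable (subst (\<theta> w) \<tau>)" for w
        by (rule iff[of "\<chi> w"])
          (use \<chi>(3,4) in \<open>auto simp: sat_subst[OF \<tau>(1)] \<tau>(2) \<theta>_def sat_Globally \<beta>(3) acc(2) describes_def
            simp del: sat.simps(5)\<close>)
    qed
  qed
qed

end

section \<open>Computations as tilings\<close>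

text \<open>A column holds one cell of every tape. The state and the scanned symbols are repeated in
  all columns of a row, since a move depends on symbols that are scanned far apart. A flag sits on
  the cell to the left of the head, so the initial heads are announced by the start column and all
  input columns look alike, even if there are none.\<close>

datatype column = Column (mark: bool) (ctl: nat) (scan: "nat list") (syms: "nat list") (flags: "bool list")

text \<open>Halted configurations repeat, so that an accepting computation still tiles the whole
  time line.\<close>

definition delta :: "tm \<Rightarrow> nat \<Rightarrow> nat list \<Rightarrow> nat \<times> (nat \<times> move) list" where
  "delta M q as = (if halting M q then (q, map (\<lambda>s. (s, Stay)) as) else trans M q as)"

lemma map2_act_Stay: "map2 act ts (map (\<lambda>s. (s, Stay)) (map scanned ts)) = ts"
  by (induction ts) (auto simp: act_def scanned_def)

lemma step_delta:
  "step M (q, ts) = (fst (delta M q (map scanned ts)), map2 act ts (snd (delta M q (map scanned ts))))"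
  using map2_act_Stay[of ts] by (auto simp: step_def delta_def Let_def case_prod_beta)

locale bounded_machine =
  fixes M :: tm and p :: "nat poly" and L :: "bool list set"
  assumes tm: "is_tm M"
    and decides: "\<And>w. \<exists>t. fst (run M w t) = (if w \<in> L then accept_state M else reject_state M)"
    and space: "\<And>w t. card (cells_visited M w t) \<le> poly p (length w)"
begin

abbreviation "K \<equiv> num_tapes M"

definition cols :: "column set" where
  "cols = {Column m q sc sy hd |m q sc sy hd. q < num_states M \<and> length sc = K \<and> set sc \<subseteq> {..<num_symbols M} \<and>
     length sy = K \<and> set sy \<subseteq> {..<num_symbols M} \<and> length hd = K}"

lemma finite_cols: "finite cols"
proof -
  let ?A = "{xs. set xs \<subseteq> {..<num_symbols M} \<and> length xs = K}"
  let ?H = "{xs. set xs \<subseteq> (UNIV :: bool set) \<and> length xs = K}"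
  have "finite ?A" "finite ?H" by (intro finite_lists_length_eq; simp)+
  then have "finite ((UNIV :: bool set) \<times> {..<num_states M} \<times> ?A \<times> ?A \<times> ?H)"
    by (intro finite_cartesian_product) auto
  moreover have "cols \<subseteq> (\<lambda>(m, q, sc, sy, hd). Column m q sc sy hd) `
      ((UNIV :: bool set) \<times> {..<num_states M} \<times> ?A \<times> ?A \<times> ?H)"
  proof
    fix c assume "c \<in> cols"
    then show "c \<in> (\<lambda>(m, q, sc, sy, hd). Column m q sc sy hd) `
      ((UNIV :: bool set) \<times> {..<num_states M} \<times> ?A \<times> ?A \<times> ?H)"
      by (intro image_eqI[of _ _ "(mark c, ctl c, scan c, syms c, flags c)"]) (auto simp: cols_def)
  qed
  ultimately show ?thesis by (rule finite_surj)
qed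

definition hor :: "column \<Rightarrow> column \<Rightarrow> bool" where
  "hor a b \<longleftrightarrow> (\<not> mark b \<longrightarrow> ctl a = ctl b \<and> scan a = scan b) \<and>
     (\<forall>j<K. flags a ! j \<longrightarrow> syms b ! j = scan b ! j)"

text \<open>\<open>d\<close> is below \<open>c\<close>, whose neighbours are \<open>l\<close> and
  \<open>r\<close>. On the time line the neighbours may belong to other rows: \<open>l\<close>
  counts only if \<open>c\<close> does not begin a row, and \<open>r\<close> only if it does not
  begin one itself.\<close>

definition ver :: "column \<Rightarrow> column \<Rightarrow> column \<Rightarrow> column \<Rightarrow> bool" where
  "ver l c r d \<longleftrightarrow> mark d = mark c \<and> ctl d = fst (delta M (ctl c) (scan c)) \<and>
     (\<forall>j<K. let (a, m) = snd (delta M (ctl c) (scan c)) ! j in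
        syms d ! j = (if \<not> mark c \<and> flags l ! j then a else syms c ! j) \<and>
        flags d ! j = (flags c ! j \<and> m = Stay \<or> \<not> mark c \<and> flags l ! j \<and> m = Move_Right \<or>
           \<not> mark r \<and> flags r ! j \<and> m = Move_Left))"

definition row0 :: "bool \<Rightarrow> bool \<Rightarrow> nat \<Rightarrow> column set" where
  "row0 m h s = {c. mark c = m \<and> ctl c = start_state M \<and> syms c = s # replicate (K - 1) 0 \<and> flags c = replicate K h}"

sublocale tiling cols hor ver "{c. ctl c = accept_state M}" p "row0 True False 0" "row0 False False 0"
  "row0 False True 0" "\<lambda>b. row0 False False (bit_symbol b)" L
  by unfold_locales (rule finite_cols)

section \<open>Configurations as rows of columns\<close>

context
  fixes w :: "bool list"
begin

definition "P = poly p (length w)"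
definition "N = period w"
definition "state r = fst (run M w r)"
definition "cell r j = fst (snd (run M w r) ! j)"
definition "head r j = snd (snd (run M w r) ! j)"

lemma N: "N = 2 * P + length w + 2"
  by (simp add: N_def P_def period_def)

lemma K: "0 < K"
  using tm by (simp add: is_tm_def)

definition "good ts \<longleftrightarrow> length ts = K \<and> (\<forall>j<K. \<forall>y. fst (ts ! j) y < num_symbols M)"

definition "reads r = map (\<lambda>j. cell r j (head r j)) [0..<K]"

lemma run_0: "state 0 = start_state M" "cell 0 j y = (if j = 0 then word_tape w y else 0)" "head 0 j = 0" if "j < K"
  using that K by (auto simp: state_def cell_def head_def run_def initial_def nth_Cons')

lemma delta_ok:
  assumes "q < num_states M" "length as = K" "set as \<subseteq> {..<num_symbols M}"
  shows "fst (delta M q as) < num_states M" "length (snd (delta M q as)) = K"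
    "j < K \<Longrightarrow> fst (snd (delta M q as) ! j) < num_symbols M"
proof -
  have *: "\<not> halting M q \<Longrightarrow> fst (trans M q as) < num_states M \<and> length (snd (trans M q as)) = K \<and>
      fst ` set (snd (trans M q as)) \<subseteq> {..<num_symbols M}"
    using tm assms unfolding is_tm_def by blast
  show "fst (delta M q as) < num_states M" "length (snd (delta M q as)) = K"
    using * assms by (auto simp: delta_def)
  show "fst (snd (delta M q as) ! j) < num_symbols M" if "j < K"
    using * assms that by (auto simp: delta_def subset_iff image_subset_iff)
qed

lemma run_ok: "state r < num_states M \<and> good (snd (run M w r))"
proof (induction r)
  case 0
  have "num_symbols M \<ge> 3" "start_state M < num_states M" using tm by (auto simp: is_tm_def)
  then show ?case using K
    by (auto simp: state_def good_def run_def initial_def nth_Cons' word_tape_def bit_symbol_def)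
next
  case (Suc r)
  obtain q ts where r: "run M w r = (q, ts)" by fastforce
  have q: "q < num_states M" "length ts = K" "\<And>j y. j < K \<Longrightarrow> fst (ts ! j) y < num_symbols M"
    using Suc r by (auto simp: state_def good_def)
  have as: "length (map scanned ts) = K" "set (map scanned ts) \<subseteq> {..<num_symbols M}"
    using q by (auto simp: scanned_def in_set_conv_nth split: prod.splits) (metis fst_conv)
  note d = delta_ok[OF q(1) as]
  have "run M w (Suc r) = (fst (delta M q (map scanned ts)), map2 act ts (snd (delta M q (map scanned ts))))"
    using r step_delta[of M q ts] by (simp add: run_def)
  then show ?case
    using d q by (auto simp: state_def good_def act_def case_prod_beta)
qed

lemma run_Suc:
  shows "state (Suc r) = fst (delta M (state r) (reads r))"
    and "j < K \<Longrightarrow> cell (Suc r) j = (cell r j)(head r j := fst (snd (delta M (state r) (reads r)) ! j))"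
    and "j < K \<Longrightarrow> head (Suc r) j = (case snd (snd (delta M (state r) (reads r)) ! j) of
        Move_Left \<Rightarrow> head r j - 1 | Stay \<Rightarrow> head r j | Move_Right \<Rightarrow> head r j + 1)"
proof -
  obtain q ts where r: "run M w r = (q, ts)" by fastforce
  have q: "q < num_states M" "length ts = K" "\<And>j y. j < K \<Longrightarrow> fst (ts ! j) y < num_symbols M"
    using run_ok[of r] r by (auto simp: state_def good_def)
  have reads: "map scanned ts = reads r"
    by (rule nth_equalityI) (auto simp: reads_def cell_def head_def r q scanned_def case_prod_beta)
  have "set (reads r) \<subseteq> {..<num_symbols M}" "length (reads r) = K"
    using run_ok[of r] by (auto simp: reads_def cell_def good_def)
  note d = delta_ok[OF q(1) this(2,1)]
  have s: "run M w (Suc r) = (fst (delta M q (reads r)), map2 act ts (snd (delta M q (reads r))))"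
    using r step_delta[of M q ts] reads by (simp add: run_def)
  show "state (Suc r) = fst (delta M (state r) (reads r))" by (simp add: state_def s r)
  show "j < K \<Longrightarrow> cell (Suc r) j = (cell r j)(head r j := fst (snd (delta M (state r) (reads r)) ! j))"
    using d q by (simp add: cell_def head_def s r state_def act_def case_prod_beta)
  show "j < K \<Longrightarrow> head (Suc r) j = (case snd (snd (delta M (state r) (reads r)) ! j) of
        Move_Left \<Rightarrow> head r j - 1 | Stay \<Rightarrow> head r j | Move_Right \<Rightarrow> head r j + 1)"
    using d q by (simp add: head_def s r state_def act_def case_prod_beta split: move.splits)
qed

text \<open>A head moves by at most one cell, so on its way it visits all smaller distances from
  cell 0 as well; their number is bounded by the space.\<close>

lemma head_bound:
  assumes "j < K"
  shows "\<bar>head r j\<bar> < int P"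
proof -
  have step: "\<bar>head (Suc i) j - head i j\<bar> \<le> 1" for i
    using run_Suc(3)[OF assms, of i] by (auto split: move.splits)
  have "\<exists>i\<le>r. \<bar>head i j\<bar> = int k" if "int k \<le> \<bar>head r j\<bar>" for k
  proof -
    have "\<bar>\<bar>head (Suc i) j\<bar> - \<bar>head i j\<bar>\<bar> \<le> 1" for i using step[of i] by linarith
    then show ?thesis
      using nat_intermed_int_val[of 0 r "\<lambda>i. \<bar>head i j\<bar>" "int k"] run_0(3)[OF assms] that by auto
  qed
  moreover have "(j, head i j) \<in> cells_visited M w r" if "i \<le> r" for i
    using that assms by (auto simp: cells_visited_def head_def)
  ultimately have "k \<in> (\<lambda>x. nat \<bar>snd x\<bar>) ` cells_visited M w r" if "k \<le> nat \<bar>head r j\<bar>" for k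
    using that by (metis (no_types, lifting) image_eqI nat_int snd_conv le_nat_iff abs_ge_zero)
  then have "{..nat \<bar>head r j\<bar>} \<subseteq> (\<lambda>x. nat \<bar>snd x\<bar>) ` cells_visited M w r" by blast
  moreover have "cells_visited M w r \<subseteq> (\<lambda>(i, j). (j, head i j)) ` ({..r} \<times> {..<K})"
    by (force simp: cells_visited_def head_def)
  then have "finite (cells_visited M w r)" by (rule finite_surj[rotated]) simp
  ultimately have "card {..nat \<bar>head r j\<bar>} \<le> card (cells_visited M w r)"
    by (meson card_image_le card_mono finite_imageI le_trans)
  also have "\<dots> \<le> P" unfolding P_def by (rule space)
  finally show ?thesis by simp
qed

text \<open>A row covers the cells from -P - 2 to P + length w - 1. With heads at distance less than
  \<open>P\<close> from cell 0, no flag is in the first or the last column, so no head crosses from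
  one row into another.\<close>

definition position :: "nat \<Rightarrow> int" where
  "position x = int x - int P - 2"

definition col :: "nat \<Rightarrow> nat \<Rightarrow> column" where
  "col r x = Column (x = 0) (state r) (reads r) (map (\<lambda>j. cell r j (position x)) [0..<K])
     (map (\<lambda>j. head r j = position x + 1) [0..<K])"

lemma col_simps [simp]:
  "mark (col r x) \<longleftrightarrow> x = 0" "ctl (col r x) = state r" "scan (col r x) = reads r"
  "j < K \<Longrightarrow> syms (col r x) ! j = cell r j (position x)"
  "j < K \<Longrightarrow> flags (col r x) ! j \<longleftrightarrow> head r j = position x + 1"
  "length (syms (col r x)) = K" "length (flags (col r x)) = K"
  by (simp_all add: col_def)

lemma length_reads [simp]: "length (reads r) = K"
  by (simp add: reads_def)

lemma col_in_cols: "col r x \<in> cols"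
  using run_ok[of r] by (auto simp: cols_def col_def reads_def cell_def good_def)

text \<open>The scanned symbols of a column are guessed, the other components are determined.\<close>

definition similar :: "column \<Rightarrow> column \<Rightarrow> bool" where
  "similar a b \<longleftrightarrow> mark a = mark b \<and> ctl a = ctl b \<and> syms a = syms b \<and> flags a = flags b"

lemma pattern_0: "c \<in> pattern w ! 0 \<longleftrightarrow> similar c (col 0 0)"
  and pattern_Suc: "x < N \<Longrightarrow> c \<in> pattern w ! Suc x \<longleftrightarrow> similar c (col 0 x)"
proof -
  have syms: "syms (col 0 x) = word_tape w (position x) # replicate (K - 1) 0" for x
    using K by (intro nth_equalityI) (auto simp: run_0 nth_Cons')
  have flags: "flags (col 0 x) = replicate K (position x = -1)" for x
    by (intro nth_equalityI) (auto simp: run_0)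
  have state: "state 0 = start_state M" using run_0(1)[OF K] .
  have row: "c \<in> row0 (x = 0) (position x = -1) (word_tape w (position x)) \<longleftrightarrow> similar c (col 0 x)" for x
    by (simp add: row0_def similar_def syms flags state)
  have "pattern w ! 0 = row0 True False 0" by (simp add: pattern_def)
  then show "c \<in> pattern w ! 0 \<longleftrightarrow> similar c (col 0 0)"
    using row[of 0] by (simp add: position_def word_tape_def)
  assume x: "x < N"
  have "pattern w ! Suc x = row0 (x = 0) (position x = -1) (word_tape w (position x))"
  proof -
    \<comment> \<open>These are the marked column, the left padding, cell -1 with the flags of all
      heads, the input, and the right padding.\<close>
    consider "x = 0" | "0 < x" "x \<le> P" | "x = P + 1" | "P + 1 < x" "x < P + 2 + length w"
      | "P + 2 + length w \<le> x" by linarith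
    then show ?thesis
    proof cases
      case 4
      then obtain y where "x = P + 2 + y" by (metis add.commute le_Suc_ex Suc_leI add_2_eq_Suc' plus_1_eq_Suc)
      then show ?thesis using 4
        by (simp add: pattern_def P_def[symmetric] nth_append nth_Cons' word_tape_def position_def)
    qed (use x N in \<open>auto simp: pattern_def P_def[symmetric] nth_append nth_Cons' word_tape_def position_def\<close>)
  qed
  then show "c \<in> pattern w ! Suc x \<longleftrightarrow> similar c (col 0 x)" using row[of x] by simp
qed

lemma head_interior:
  assumes "j < K"
  shows "0 < head r j + int P" "head r j < int P"
  using head_bound[OF assms, of r] by auto

lemma not_flag_0: "j < K \<Longrightarrow> head r j \<noteq> position 0 + 1"
  using head_interior[of j r] by (auto simp: position_def)

text \<open>Three correct columns and a correct guess of the scanned symbols determine the column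
  below, except for its own guess. At the ends of a row the missing neighbour is masked by the mark,
  which loses nothing because the heads keep away from there.\<close>

lemma ver_similar:
  assumes "0 < x \<Longrightarrow> similar l (col r (x - 1))" "similar c (col r x)" "scan c = reads r"
    "x + 1 < N \<Longrightarrow> similar t (col r (x + 1))" "x + 1 = N \<Longrightarrow> mark t" "x < N"
    and d: "length (syms d) = K" "length (flags d) = K"
  shows "ver l c t d \<longleftrightarrow> similar d (col (Suc r) x)"
proof -
  have c: "mark c \<longleftrightarrow> x = 0" "ctl c = state r" "scan c = reads r"
    "\<And>j. j < K \<Longrightarrow> syms c ! j = cell r j (position x)"
    "\<And>j. j < K \<Longrightarrow> flags c ! j \<longleftrightarrow> head r j = position x + 1"
    using assms(2,3) by (simp_all add: similar_def)
  have l: "\<not> mark c \<and> flags l ! j \<longleftrightarrow> head r j = position x" if "j < K" for j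
  proof (cases "x = 0")
    case True
    then show ?thesis using c(1) head_interior[OF that, of r] by (auto simp: position_def)
  next
    case False
    then show ?thesis using c(1) assms(1) that by (auto simp: similar_def position_def)
  qed
  have t: "\<not> mark t \<and> flags t ! j \<longleftrightarrow> head r j = position x + 2" if "j < K" for j
  proof (cases "x + 1 < N")
    case True
    then show ?thesis using assms(4) that by (auto simp: similar_def position_def)
  next
    case False
    then show ?thesis using assms(5,6) head_interior[OF that, of r] N by (auto simp: position_def)
  qed
  have eq: "(let (a, m) = snd (delta M (ctl c) (scan c)) ! j in
        syms d ! j = (if \<not> mark c \<and> flags l ! j then a else syms c ! j) \<and>
        flags d ! j = (flags c ! j \<and> m = Stay \<or> \<not> mark c \<and> flags l ! j \<and> m = Move_Right \<or>
           \<not> mark t \<and> flags t ! j \<and> m = Move_Left)) \<longleftrightarrow>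
      syms d ! j = syms (col (Suc r) x) ! j \<and> flags d ! j = flags (col (Suc r) x) ! j" if j: "j < K" for j
  proof -
    obtain a m where am: "snd (delta M (state r) (reads r)) ! j = (a, m)" by fastforce
    have "cell (Suc r) j (position x) = (if head r j = position x then a else cell r j (position x))"
      using run_Suc(2)[OF j, of r] am by auto
    moreover have "head (Suc r) j = position x + 1 \<longleftrightarrow>
        head r j = position x + 1 \<and> m = Stay \<or> head r j = position x \<and> m = Move_Right \<or>
        head r j = position x + 2 \<and> m = Move_Left"
      using run_Suc(3)[OF j, of r] am by (auto split: move.splits)
    ultimately show ?thesis
      using j by (simp add: c(2,3) c(4,5)[OF j] l[OF j] t[OF j] am conj_assoc[symmetric] del: conj_assoc)
  qed
  have "ver l c t d \<longleftrightarrow> mark d = (x = 0) \<and> ctl d = state (Suc r) \<and>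
      (\<forall>j<K. syms d ! j = syms (col (Suc r) x) ! j \<and> flags d ! j = flags (col (Suc r) x) ! j)"
    unfolding ver_def using eq c by (simp add: run_Suc(1))
  also have "\<dots> \<longleftrightarrow> similar d (col (Suc r) x)"
    using d by (auto simp: similar_def list_eq_iff_nth_eq)
  finally show ?thesis .
qed

section \<open>Correctness of the tiling\<close>

lemma N_pos: "0 < N" using N by simp

text \<open>The rows of the infinite run are written one behind the other after the extra first
  column.\<close>

lemma tiles_complete:
  assumes "w \<in> L"
  shows "\<exists>c T. (\<forall>T'. tiles w c T') \<and> c T \<in> {c. ctl c = accept_state M}"
proof -
  define c where "c = (\<lambda>i. if i = 0 then col 0 0 else col ((i - 1) div N) ((i - 1) mod N))"
  have c: "c (1 + (r * N + x)) = col r x" if "x < N" for r x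
    using that by (simp add: c_def div_mult_self3)
  have split: "\<exists>r x. i = r * N + x \<and> x < N" for i
    using mod_less_divisor[OF N_pos, of i] div_mult_mod_eq[of i N] by metis
  have next_row: "c (1 + (r * N + N)) = col (Suc r) 0" for r
    using c[OF N_pos, of "Suc r"] by (simp add: algebra_simps)
  have "tiles w c T" for T
    unfolding tiles_def
  proof (intro conjI allI impI)
    show "c i \<in> cols" for i by (simp add: c_def col_in_cols)
  next
    fix i assume "i < length (pattern w)"
    then show "c i \<in> pattern w ! i"
      using pattern_0 pattern_Suc[of "i - 1"] length_pattern[of w]
      by (cases i) (auto simp: c_def similar_def N_def)
  next
    fix i
    show "hor (c i) (c (i + 1))"
    proof (cases i)
      case 0
      then show ?thesis using N_pos not_flag_0[of _ 0] by (auto simp: c_def hor_def)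
    next
      case (Suc i')
      obtain r x where x: "i' = r * N + x" "x < N" using split by blast
      have flag: "cell r j (position (Suc x)) = reads r ! j" if "j < K" "head r j = position x + 1" for j
        using that by (simp add: reads_def position_def)
      show ?thesis
      proof (cases "Suc x < N")
        case True
        then show ?thesis using c[of x r] c[of "Suc x" r] x Suc flag by (simp add: hor_def)
      next
        case False
        then have "Suc x = N" using x by simp
        have "head r j \<noteq> position x + 1" if "j < K" for j
          using head_interior[OF that, of r] N \<open>Suc x = N\<close> by (auto simp: position_def)
        moreover have "i + 1 = 1 + (r * N + N)" using x Suc \<open>Suc x = N\<close> by simp
        then have "c (i + 1) = col (Suc r) 0" using next_row[of r] by (simp only:)
        moreover have "c i = col r x" using c[of x r] x Suc by simp
        ultimately show ?thesis by (simp add: hor_def)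
      qed
    qed
  next
    fix i
    obtain r x where x: "i = r * N + x" "x < N" using split by blast
    have "ver (c i) (col r x) (c (i + 2)) (col (Suc r) x)"
    proof (subst ver_similar[of x _ r])
      show "0 < x \<Longrightarrow> similar (c i) (col r (x - 1))"
        using c[of "x - 1" r] x by (simp add: similar_def)
      show "x + 1 < N \<Longrightarrow> similar (c (i + 2)) (col r (x + 1))"
        using c[of "Suc x" r] x by (simp add: similar_def)
      show "mark (c (i + 2))" if "x + 1 = N"
      proof -
        have "i + 2 = 1 + (r * N + N)" using x that by simp
        then show ?thesis using next_row[of r] by (simp only: col_simps)
      qed
    qed (use x in \<open>simp_all add: similar_def\<close>)
    moreover have "c (i + period w + 1) = col (Suc r) x"
      using c[OF x(2), of "Suc r"] x by (simp add: N_def algebra_simps)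
    ultimately show "ver (c i) (c (i + 1)) (c (i + 2)) (c (i + period w + 1))"
      using c[OF x(2), of r] x by simp
  qed
  moreover obtain t where "state t = accept_state M" using decides[of w] assms by (auto simp: state_def)
  then have "ctl (c (1 + (t * N + 0))) = accept_state M" using c[OF N_pos, of t] by simp
  ultimately show ?thesis by blast
qed

text \<open>The guess is constant along a row and is confirmed, tape by tape, in the column of the
  head. So it is certain only for complete rows; this is enough, since \<open>ver\<close> looks back
  into the previous row. The tiling may stop within a row, where the state is already
  correct.\<close>

lemma tiles_sound:
  assumes "tiles w c T" "ctl (c T) = accept_state M"
  shows "w \<in> L"
proof -
  have c: "\<And>i. i \<le> T \<Longrightarrow> c i \<in> cols" "\<And>i. i \<le> T \<Longrightarrow> i < length (pattern w) \<Longrightarrow> c i \<in> pattern w ! i"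
    "\<And>i. i < T \<Longrightarrow> hor (c i) (c (i + 1))"
    "\<And>i. i + N + 1 \<le> T \<Longrightarrow> ver (c i) (c (i + 1)) (c (i + 2)) (c (i + N + 1))"
    using assms(1) by (auto simp: tiles_def N_def)
  have len: "length (syms (c i)) = K" "length (flags (c i)) = K" "length (scan (c i)) = K" if "i \<le> T" for i
    using c(1)[OF that] by (auto simp: cols_def)
  have scans: "scan (c (1 + r * N + x)) = reads r"
    if r: "\<And>x. x < N \<Longrightarrow> 1 + r * N + x \<le> T \<and> similar (c (1 + r * N + x)) (col r x)" and x: "x < N" for r x
  proof -
    have same: "scan (c (1 + r * N + x)) = scan (c (1 + r * N))" if "x < N" for x
      using that
    proof (induction x)
      case (Suc x)
      have "hor (c (1 + r * N + x)) (c (1 + r * N + Suc x))" "\<not> mark (c (1 + r * N + Suc x))"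
        using c(3)[of "1 + r * N + x"] r[of "Suc x"] Suc.prems by (auto simp: similar_def)
      then show ?case using Suc by (simp add: hor_def)
    qed simp
    have "scan (c (1 + r * N)) ! j = reads r ! j" if j: "j < K" for j
    proof -
      \<comment> \<open>The column that carries the flag of head \<open>j\<close>, hence with
        \<open>position y = head r j - 1\<close>.\<close>
      define y where "y = nat (head r j + int P + 1)"
      have y: "position y + 1 = head r j" "Suc y < N"
        using head_interior[OF j, of r] N by (auto simp: y_def position_def)
      have "hor (c (1 + r * N + y)) (c (1 + r * N + Suc y))"
        using c(3)[of "1 + r * N + y"] r[of "Suc y"] y(2) by simp
      moreover have "flags (c (1 + r * N + y)) ! j"
        using r[of y] y j by (simp add: similar_def)
      ultimately have "syms (c (1 + r * N + Suc y)) ! j = scan (c (1 + r * N + Suc y)) ! j"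
        using j by (simp add: hor_def)
      moreover have "syms (c (1 + r * N + Suc y)) ! j = cell r j (head r j)"
        using r[of "Suc y"] y j by (simp add: similar_def position_def)
      ultimately show ?thesis using same[of "Suc y"] y(2) j by (simp add: reads_def)
    qed
    then have "scan (c (1 + r * N)) = reads r"
      using len(3)[of "1 + r * N"] r[of 0] N_pos by (intro nth_equalityI) auto
    then show ?thesis using same[OF x] by simp
  qed
  have row: "x < N \<Longrightarrow> 1 + r * N + x \<le> T \<Longrightarrow> similar (c (1 + r * N + x)) (col r x)" for r x
  proof (induction r arbitrary: x)
    case 0
    then show ?case
      using c(2)[of "Suc x"] pattern_Suc[of x] length_pattern[of w] by (simp add: N_def)
  next
    case (Suc r)
    \<comment> \<open>A column of row \<open>Suc r\<close> lies within the tiling, so all of row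
      \<open>r\<close> does.\<close>
    have full: "1 + r * N + x' \<le> T \<and> similar (c (1 + r * N + x')) (col r x')" if "x' < N" for x'
      using Suc.IH[of x'] Suc.prems(2) that by simp
    have v: "ver (c (r * N + x')) (c (1 + r * N + x')) (c (2 + r * N + x')) (c (1 + Suc r * N + x'))"
      if "x' \<le> x" for x'
      using c(4)[of "r * N + x'"] Suc.prems(2) that by (simp add: algebra_simps)
    have "similar (c (1 + Suc r * N + x)) (col (Suc r) x)"
    proof (subst ver_similar[of x "c (r * N + x)" r "c (1 + r * N + x)" "c (2 + r * N + x)", symmetric])
      show "0 < x \<Longrightarrow> similar (c (r * N + x)) (col r (x - 1))"
        using full[of "x - 1"] Suc.prems(1) by (simp add: Suc_diff_1)
      show "x + 1 < N \<Longrightarrow> similar (c (2 + r * N + x)) (col r (x + 1))"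
        using full[of "x + 1"] by simp
      show "mark (c (2 + r * N + x))" if "x + 1 = N"
      proof -
        \<comment> \<open>The right neighbour of the last column already belongs to the next row; it
          is its first column and inherits the mark from the column above.\<close>
        have "2 + r * N + x = 1 + Suc r * N + 0" using that by simp
        moreover have "mark (c (1 + Suc r * N + 0))"
          using v[of 0] full[OF N_pos] by (simp add: ver_def similar_def)
        ultimately show ?thesis by metis
      qed
      show "scan (c (1 + r * N + x)) = reads r" by (rule scans[OF full Suc.prems(1)])
      show "ver (c (r * N + x)) (c (1 + r * N + x)) (c (2 + r * N + x)) (c (1 + Suc r * N + x))"
        by (rule v) simp
    qed (use full Suc.prems len in auto)
    then show ?case .
  qed
  have "ctl (c T) = state (case T of 0 \<Rightarrow> 0 | Suc T' \<Rightarrow> T' div N)"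
  proof (cases T)
    case 0
    then show ?thesis using c(2)[of 0] pattern_0 length_pattern[of w] by (simp add: similar_def)
  next
    case (Suc T')
    then have "similar (c T) (col (T' div N) (T' mod N))"
      using row[of "T' mod N" "T' div N"] N_pos div_mult_mod_eq[of T' N] by (simp add: add.assoc del: div_mult_mod_eq)
    then show ?thesis using Suc by (simp add: similar_def)
  qed
  then obtain r where r: "state r = accept_state M" using assms(2) by metis
  \<comment> \<open>Halting states are absorbing, so acceptance and rejection would meet at the
    later of the two times.\<close>
  have stays: "run M w s' = run M w s" if "halting M (state s)" "s \<le> s'" for s s'
    using that(2)
  proof (induction s' rule: dec_induct)
    case (step i)
    then show ?case using that(1) by (simp add: run_def state_def step_def case_prod_beta)
  qed simp
  show ?thesis
  proof (rule ccontr)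
    assume "w \<notin> L"
    then obtain t where t: "state t = reject_state M" using decides[of w] by (auto simp: state_def)
    have "state (max r t) = state r" "state (max r t) = state t"
      using stays[of r "max r t"] stays[of t "max r t"] r t by (simp_all add: halting_def state_def)
    then show False using r t tm by (simp add: is_tm_def)
  qed
qed

end

end

lemma PSPACE_reducible:
  assumes "L \<in> PSPACE" "S1 \<subseteq> clone B"
  shows "polytime_reducible L (SAT {Op_F, Op_X} B)" "polytime_reducible L (SAT {Op_G, Op_X} B)"
proof -
  obtain M and p :: "nat poly" where M: "is_tm M"
    "\<And>w. \<exists>t. fst (run M w t) = (if w \<in> L then accept_state M else reject_state M)"
    "\<And>w t. card (cells_visited M w t) \<le> poly p (length w)"
    using assms(1) unfolding PSPACE_def by blast
  interpret bounded_machine M p L by unfold_locales (fact M)+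
  show "polytime_reducible L (SAT {Op_F, Op_X} B)" "polytime_reducible L (SAT {Op_G, Op_X} B)"
    using reducible[OF assms(2)] tiles_complete tiles_sound by blast+
qed

section \<open>Satisfiability as reachability between cell vectors\<close>

datatype token = TVar nat | TConn bool_fun | TNext | TFin | TGlob

fun ar :: "token \<Rightarrow> nat" where
  "ar (TVar x) = 0" | "ar (TConn f) = arity f" | "ar TNext = 1" | "ar TFin = 1" | "ar TGlob = 1"

fun mk :: "token \<Rightarrow> formula list \<Rightarrow> formula" where
  "mk (TVar x) \<phi>s = Var x"
| "mk (TConn f) \<phi>s = Conn f \<phi>s"
| "mk TNext \<phi>s = Next (hd \<phi>s)"
| "mk TFin \<phi>s = Finally (hd \<phi>s)"
| "mk TGlob \<phi>s = Globally (hd \<phi>s)"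

fun encode_token :: "token \<Rightarrow> bool list" where
  "encode_token (TVar x) = [False, False, False] @ encode_nat x"
| "encode_token (TConn f) = [False, False, True] @ encode_bool_fun f"
| "encode_token TNext = [False, True, False]"
| "encode_token TFin = [False, True, True]"
| "encode_token TGlob = [True, False, False]"

fun allowed :: "temporal_op set \<Rightarrow> bool_fun set \<Rightarrow> token \<Rightarrow> bool" where
  "allowed M B (TVar x) = True"
| "allowed M B (TConn f) = (f \<in> B)"
| "allowed M B TNext = (Op_X \<in> M)"
| "allowed M B TFin = (Op_F \<in> M)"
| "allowed M B TGlob = (Op_G \<in> M)"

section \<open>Token lists as formulas\<close>

definition build :: "token \<Rightarrow> formula list \<Rightarrow> formula list" where
  "build t st = mk t (take (ar t) st) # drop (ar t) st"

fun enough :: "token list \<Rightarrow> nat \<Rightarrow> bool" where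
  "enough [] n = True"
| "enough (t # ts) n = (ar t \<le> n \<and> enough ts (n - ar t + 1))"

text \<open>The reversal of the tokens in the prefix encoding, which is what reading the input onto
  a stack produces. The arguments come in reverse, so that the first one is on top when its
  connective is applied.\<close>

fun postfix :: "formula \<Rightarrow> token list" where
  "postfix (Var x) = [TVar x]"
| "postfix (Conn f \<phi>s) = concat (rev (map postfix \<phi>s)) @ [TConn f]"
| "postfix (Next \<phi>) = postfix \<phi> @ [TNext]"
| "postfix (Finally \<phi>) = postfix \<phi> @ [TFin]"
| "postfix (Globally \<phi>) = postfix \<phi> @ [TGlob]"
| "postfix _ = []"

lemma fold_build_postfix:
  assumes "\<phi> \<in> formulas M B" "M \<subseteq> {Op_X, Op_F, Op_G}"
  shows "fold build (postfix \<phi>) st = \<phi> # st \<and> (enough (postfix \<phi> @ us) n \<longleftrightarrow> enough us (n + 1)) \<and>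
    (\<forall>t\<in>set (postfix \<phi>). allowed M B t)"
  using assms
proof (induction \<phi> arbitrary: st us n rule: formulas.induct)
  case (Conn f \<phi>s)
  have "fold build (concat (rev (map postfix \<psi>s))) st = \<psi>s @ st \<and>
     (enough (concat (rev (map postfix \<psi>s)) @ us) n \<longleftrightarrow> enough us (n + length \<psi>s)) \<and>
     (\<forall>t\<in>set (concat (rev (map postfix \<psi>s))). allowed M B t)"
    if "set \<psi>s \<subseteq> set \<phi>s" for \<psi>s st us n
    using that
  proof (induction \<psi>s arbitrary: st us n)
    case (Cons \<psi> \<psi>s)
    have \<psi>: "\<psi> \<in> set \<phi>s" using Cons.prems by simp
    show ?case using Conn.IH[OF \<psi> Conn.prems] Cons.IH Cons.prems by auto
  qed simp
  from this[of \<phi>s] show ?case using Conn.hyps(1,2) by (simp add: build_def[of "TConn f"])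
qed (auto simp: build_def[of "TVar _"] build_def[of TNext] build_def[of TFin] build_def[of TGlob])

lemma enough_iff:
  "enough ts (length st) \<longleftrightarrow> (\<forall>k<length ts. ar (ts ! k) \<le> length (fold build (take k ts) st))"
proof (induction ts arbitrary: st)
  case (Cons t ts)
  show ?case
  proof (cases "ar t \<le> length st")
    case True
    then have "enough (t # ts) (length st) \<longleftrightarrow> enough ts (length (build t st))"
      by (simp add: build_def)
    also have "\<dots> \<longleftrightarrow> (\<forall>k<length ts. ar (ts ! k) \<le> length (fold build (take k ts) (build t st)))"
      by (rule Cons.IH)
    also have "\<dots> \<longleftrightarrow> (\<forall>k<length (t # ts). ar ((t # ts) ! k) \<le> length (fold build (take k (t # ts)) st))"
      using True by (auto simp: less_Suc_eq_0_disj)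
    finally show ?thesis .
  qed force
qed simp

text \<open>The evaluation by \<open>build\<close> with positions in place of formulas. It is
  defined for every token list, so well-formedness and the tree structure can be expressed before a
  formula is available.\<close>

fun position_stack :: "token list \<Rightarrow> nat \<Rightarrow> nat list" where
  "position_stack ts 0 = []"
| "position_stack ts (Suc k) = k # drop (ar (ts ! k)) (position_stack ts k)"

definition children :: "token list \<Rightarrow> nat \<Rightarrow> nat list" where
  "children ts k = take (ar (ts ! k)) (position_stack ts k)"

definition node :: "token list \<Rightarrow> nat \<Rightarrow> formula" where
  "node ts k = hd (fold build (take (Suc k) ts) [])"

definition well_formed :: "token list \<Rightarrow> bool" where
  "well_formed ts \<longleftrightarrow> (\<forall>k<length ts. ar (ts ! k) \<le> length (position_stack ts k)) \<and>
     length (position_stack ts (length ts)) = 1"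

lemma position_stack_less: "j \<in> set (position_stack ts k) \<Longrightarrow> j < k"
  by (induction k) (auto dest!: in_set_dropD simp: less_Suc_eq)

lemma children_less: "j \<in> set (children ts k) \<Longrightarrow> j < k"
  unfolding children_def by (auto dest!: in_set_takeD position_stack_less)

lemma fold_build_node:
  "k \<le> length ts \<Longrightarrow> fold build (take k ts) [] = map (node ts) (position_stack ts k)"
proof (induction k)
  case (Suc k)
  have "fold build (take (Suc k) ts) [] = build (ts ! k) (fold build (take k ts) [])"
    using Suc.prems by (simp add: take_Suc_conv_app_nth)
  moreover have "node ts k = hd (build (ts ! k) (fold build (take k ts) []))"
    using Suc.prems by (simp add: node_def take_Suc_conv_app_nth)
  ultimately show ?case using Suc by (simp add: build_def[of "ts ! k"] drop_map)
qed simp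

lemma node_eq:
  assumes "k < length ts"
  shows "node ts k = mk (ts ! k) (map (node ts) (children ts k))"
proof -
  have "node ts k = hd (build (ts ! k) (fold build (take k ts) []))"
    using assms by (simp add: node_def take_Suc_conv_app_nth)
  then show ?thesis using fold_build_node[of k ts] assms
    by (simp add: build_def[of "ts ! k"] children_def take_map)
qed

lemma well_formed_length_children: "well_formed ts \<Longrightarrow> k < length ts \<Longrightarrow> length (children ts k) = ar (ts ! k)"
  by (simp add: well_formed_def children_def)

lemma well_formed_root:
  assumes "well_formed ts"
  shows "ts \<noteq> []" "position_stack ts (length ts) = [length ts - 1]"
proof -
  show "ts \<noteq> []" using assms by (auto simp: well_formed_def)
  then obtain k where k: "length ts = Suc k" by (cases ts) auto
  then show "position_stack ts (length ts) = [length ts - 1]"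
    using assms by (auto simp: well_formed_def simp del: length_drop)
qed

text \<open>A position leaves the stack only as an argument of a later token, and at the end only
  the root is left.\<close>

lemma parent_exists:
  assumes "well_formed ts" "k < length ts - 1"
  obtains k' where "k < k'" "k' < length ts" "k \<in> set (children ts k')"
proof -
  have "\<exists>k'. k < k' \<and> k' < m \<and> k \<in> set (children ts k')"
    if "k < m" "k \<notin> set (position_stack ts m)" for m
    using that
  proof (induction m)
    case (Suc m)
    show ?case
    proof (cases "k < m \<and> k \<notin> set (position_stack ts m)")
      case False
      then have "k \<in> set (position_stack ts m)" "k < m" using Suc.prems by auto
      moreover have "set (position_stack ts m) = set (children ts m) \<union> set (drop (ar (ts ! m)) (position_stack ts m))"
        unfolding children_def by (metis append_take_drop_id set_append)
      ultimately show ?thesis using Suc.prems by auto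
    qed (use Suc.IH less_SucI in blast)
  qed simp
  moreover have "k < length ts" "k \<notin> set (position_stack ts (length ts))"
    using assms(2) well_formed_root(2)[OF assms(1)] by auto
  ultimately show ?thesis using that by blast
qed

lemma well_formed_iff: "well_formed ts \<longleftrightarrow> enough ts 0 \<and> length (fold build ts []) = 1"
proof -
  have "enough ts 0 \<longleftrightarrow> (\<forall>k<length ts. ar (ts ! k) \<le> length (position_stack ts k))"
    using enough_iff[of ts "[]"] fold_build_node[of _ ts] by simp
  then show ?thesis using fold_build_node[of "length ts" ts] by (simp add: well_formed_def)
qed

lemma well_formed_formula:
  assumes wf: "well_formed ts" and M: "\<And>t. t \<in> set ts \<Longrightarrow> allowed M B t"
  shows "node ts (length ts - 1) \<in> formulas M B"
    "encode (node ts (length ts - 1)) = concat (map encode_token (rev ts))"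
proof -
  have node: "k < length ts \<Longrightarrow> node ts k \<in> formulas M B" for k
  proof (induction k rule: less_induct)
    case (less k)
    have ch: "node ts j \<in> formulas M B" if "j \<in> set (children ts k)" for j
      using less children_less[OF that] by simp
    have len: "length (children ts k) = ar (ts ! k)"
      using well_formed_length_children[OF wf less.prems] .
    have t: "allowed M B (ts ! k)" using M less.prems by simp
    show ?case
    proof (cases "ts ! k")
      case (TConn f)
      then show ?thesis using node_eq[OF less.prems] t len ch by (auto intro!: formulas.Conn)
    qed (use node_eq[OF less.prems] t len ch in \<open>auto intro!: formulas.intros simp: length_Suc_conv\<close>)
  qed
  then show "node ts (length ts - 1) \<in> formulas M B"
    using well_formed_root(1)[OF wf] by simp
  have enc: "encode (mk t \<phi>s) = encode_token t @ concat (map encode \<phi>s)" if "length \<phi>s = ar t" for t \<phi>s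
    using that by (cases t) (auto simp: length_Suc_conv)
  have "k \<le> length ts \<Longrightarrow>
      concat (map encode (map (node ts) (position_stack ts k))) = concat (map encode_token (rev (take k ts)))" for k
  proof (induction k)
    case (Suc k)
    then have k: "k < length ts" by simp
    let ?st = "map (node ts) (position_stack ts k)"
    have "map (node ts) (position_stack ts (Suc k)) =
        mk (ts ! k) (take (ar (ts ! k)) ?st) # drop (ar (ts ! k)) ?st"
      using node_eq[OF k] by (simp add: children_def take_map drop_map)
    moreover have "length (take (ar (ts ! k)) ?st) = ar (ts ! k)"
      using wf k by (simp add: well_formed_def)
    ultimately have "concat (map encode (map (node ts) (position_stack ts (Suc k)))) =
        encode_token (ts ! k) @ concat (map encode (take (ar (ts ! k)) ?st @ drop (ar (ts ! k)) ?st))"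
      using enc by (simp only: list.map concat.simps map_append concat_append append_assoc)
    then show ?case using Suc k by (simp add: take_Suc_conv_app_nth)
  qed simp
  from this[of "length ts"] show "encode (node ts (length ts - 1)) = concat (map encode_token (rev ts))"
    using well_formed_root(2)[OF wf] by simp
qed

lemma formula_tokens:
  assumes "\<phi> \<in> formulas M B" "M \<subseteq> {Op_X, Op_F, Op_G}"
  obtains ts where "well_formed ts" "\<And>t. t \<in> set ts \<Longrightarrow> allowed M B t" "node ts (length ts - 1) = \<phi>"
proof -
  let ?ts = "postfix \<phi>"
  have *: "fold build ?ts [] = [\<phi>]" "enough ?ts 0" "\<forall>t\<in>set ?ts. allowed M B t"
    using fold_build_postfix[OF assms, of "[]" "[]" 0] by auto
  then have wf: "well_formed ?ts" by (simp add: well_formed_iff)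
  have "Suc (length ?ts - 1) = length ?ts" using well_formed_root(1)[OF wf] by simp
  then have "node ?ts (length ?ts - 1) = \<phi>" using *(1) unfolding node_def by simp
  then show ?thesis using that wf *(3) by blast
qed

text \<open>
  A cell is the part of a tableau state at one subformula. \<open>C0 u\<close> is the truth value on the
  stem of a lasso, \<open>C1 u v s\<close> the truth value on its loop together with the value \<open>v\<close> at the
  start of the loop and a mark \<open>s\<close> that the eventuality was fulfilled on the loop; \<open>CS\<close> and
  \<open>CE\<close> are used before and after the lasso.
\<close>

datatype cell = CS | CE | C0 bool | C1 bool bool bool

fun truth :: "cell \<Rightarrow> bool" where
  "truth CS = False" | "truth CE = False" | "truth (C0 u) = u" | "truth (C1 u v s) = u"

text \<open>The phase of the walk along a lasso to which a pair of cells belongs: waiting, starting,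
  moving along the stem, entering the loop, moving along the loop, leaving. Other pairs get
  0.\<close>

fun kind :: "cell \<times> cell \<Rightarrow> nat" where
  "kind (CS, CS) = 1"
| "kind (CS, C0 u) = 2"
| "kind (C0 u, C0 u') = 3"
| "kind (C0 u, C1 u' v s) = 4"
| "kind (C1 u v s, C1 u' v' s') = 5"
| "kind (C1 u v s, CE) = 6"
| "kind _ = 0"

text \<open>The expansion laws, such as F x iff x or next F x. \<open>u\<close> and
  \<open>u'\<close> are the values at two consecutive states, and so are the two components of the
  pairs for the arguments.\<close>

fun expands :: "token \<Rightarrow> bool \<Rightarrow> bool \<Rightarrow> (bool \<times> bool) list \<Rightarrow> bool" where
  "expands (TVar x) u u' cs = True"
| "expands (TConn f) u u' cs = (u = app f (map fst cs))"
| "expands TNext u u' cs = (u = snd (hd cs))"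
| "expands TFin u u' cs = (u = (fst (hd cs) \<or> u'))"
| "expands TGlob u u' cs = (u = (fst (hd cs) \<and> u'))"

text \<open>No eventuality is pending: a true F is fulfilled here, or a false G is refuted
  here.\<close>

fun fair :: "token \<Rightarrow> bool \<Rightarrow> bool list \<Rightarrow> bool" where
  "fair TFin u cs = (\<not> u \<or> hd cs)"
| "fair TGlob u cs = (u \<or> \<not> hd cs)"
| "fair _ u cs = True"

text \<open>Entering the loop takes no time: the values are kept, copied as entry values, and the
  mark is cleared. The loop may be left only when the entry values have recurred and the mark is
  set.\<close>

fun local_ok :: "token \<Rightarrow> cell \<times> cell \<Rightarrow> (cell \<times> cell) list \<Rightarrow> bool" where
  "local_ok t (CS, y) cs = True"
| "local_ok t (C0 u, C0 u') cs = expands t u u' (map (map_prod truth truth) cs)"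
| "local_ok t (C0 u, C1 u' v s) cs = (u' = u \<and> v = u \<and> \<not> s)"
| "local_ok t (C1 u v s, C1 u' v' s') cs = (expands t u u' (map (map_prod truth truth) cs) \<and> v' = v \<and>
     s' = (s \<or> fair t u (map (truth \<circ> fst) cs)))"
| "local_ok t (C1 u v s, CE) cs = (u = v \<and> s)"
| "local_ok t _ cs = False"

text \<open>A node is compared only with its arguments; as every position but the root has a parent,
  this forces the same phase on the whole vector.\<close>

definition node_ok :: "token \<Rightarrow> cell \<times> cell \<Rightarrow> (cell \<times> cell) list \<Rightarrow> bool" where
  "node_ok t p cs \<longleftrightarrow> kind p \<noteq> 0 \<and> (\<forall>c\<in>set cs. kind c = kind p) \<and> local_ok t p cs"

text \<open>The one condition that does not follow the tree: distinct occurrences of a variable are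
  distinct positions.\<close>

definition consistent :: "token list \<Rightarrow> cell list \<Rightarrow> bool" where
  "consistent ts a \<longleftrightarrow> (\<forall>k<length ts. \<forall>k'<length ts. \<forall>x. ts ! k = TVar x \<and> ts ! k' = TVar x \<longrightarrow>
     truth (a ! k) = truth (a ! k'))"

definition edge :: "token list \<Rightarrow> cell list \<Rightarrow> cell list \<Rightarrow> bool" where
  "edge ts a b \<longleftrightarrow> length a = length ts \<and> length b = length ts \<and>
     (\<forall>k<length ts. node_ok (ts ! k) (a ! k, b ! k) (map (\<lambda>j. (a ! j, b ! j)) (children ts k))) \<and>
     (a ! (length ts - 1) = CS \<longrightarrow> b ! (length ts - 1) \<noteq> C0 False) \<and> consistent ts a"

section \<open>Fair sequences of truth vectors\<close>

definition moves :: "token list \<Rightarrow> bool list \<Rightarrow> bool list \<Rightarrow> bool" where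
  "moves ts u u' \<longleftrightarrow> length u = length ts \<and> length u' = length ts \<and>
     (\<forall>k<length ts. expands (ts ! k) (u ! k) (u' ! k) (map (\<lambda>j. (u ! j, u' ! j)) (children ts k))) \<and>
     (\<forall>k<length ts. \<forall>k'<length ts. \<forall>x. ts ! k = TVar x \<and> ts ! k' = TVar x \<longrightarrow> u ! k = u ! k')"

definition fair_at :: "token list \<Rightarrow> bool list \<Rightarrow> nat \<Rightarrow> bool" where
  "fair_at ts u k \<longleftrightarrow> fair (ts ! k) (u ! k) (map (\<lambda>j. u ! j) (children ts k))"

text \<open>The expansion laws alone would let F x hold forever without x; infinitely recurring
  fairness excludes this, and dually for G. The labels are read off the variable positions, which
  agree by \<open>moves\<close>.\<close>

lemma fair_sequence_sat:
  assumes wf: "well_formed ts" and f: "\<And>i. moves ts (f i) (f (Suc i))"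
    and fair: "\<And>i k. k < length ts \<Longrightarrow> \<exists>j\<ge>i. fair_at ts (f j) k"
  obtains S :: "nat ltl_structure" where "is_structure S"
    "\<And>i k. k < length ts \<Longrightarrow> sat S i (node ts k) = f i ! k"
proof -
  define S :: "nat ltl_structure" where
    "S = \<lparr>states = id, vars = UNIV, label = (\<lambda>i. {x. \<exists>k<length ts. ts ! k = TVar x \<and> f i ! k})\<rparr>"
  have "k < length ts \<Longrightarrow> sat S i (node ts k) = f i ! k" for i k
  proof (induction k arbitrary: i rule: less_induct)
    case (less k)
    have ch: "sat S i (node ts j) = f i ! j" if "j \<in> set (children ts k)" for i j
      using less children_less[OF that] by simp
    have len: "length (children ts k) = ar (ts ! k)"
      using well_formed_length_children[OF wf less.prems] .
    have ex: "expands (ts ! k) (f i ! k) (f (Suc i) ! k) (map (\<lambda>j. (f i ! j, f (Suc i) ! j)) (children ts k))" for i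
      using f[of i] less.prems by (simp add: moves_def)
    show ?case
    proof (cases "ts ! k")
      case (TVar x)
      have eq: "f i ! k' = f i ! k" if "k' < length ts" "ts ! k' = TVar x" for k'
        using f[of i] less.prems that TVar unfolding moves_def by blast
      have "node ts k = Var x" using node_eq[OF less.prems] TVar by simp
      moreover have "(\<exists>k'<length ts. ts ! k' = TVar x \<and> f i ! k') \<longleftrightarrow> f i ! k"
        using eq less.prems TVar by blast
      ultimately show ?thesis by (simp add: S_def)
    next
      case (TConn f')
      have "map (sat S i \<circ> node ts) (children ts k) = map (fst \<circ> (\<lambda>j. (f i ! j, f (Suc i) ! j))) (children ts k)"
        using ch by simp
      then show ?thesis using ex[of i] node_eq[OF less.prems] TConn by (simp del: map_eq_conv)
    next
      case TNext
      then obtain j where "children ts k = [j]" using len by (auto simp: length_Suc_conv)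
      then show ?thesis using ex[of i] ch node_eq[OF less.prems] TNext by simp
    next
      case TFin
      then obtain j where j: "children ts k = [j]" using len by (auto simp: length_Suc_conv)
      have step: "f i ! k = (f i ! j \<or> f (Suc i) ! k)" for i using ex[of i] j TFin by simp
      have "f i ! k \<longleftrightarrow> (\<exists>i'\<ge>i. f i' ! j)"
      proof
        assume i: "f i ! k"
        show "\<exists>i'\<ge>i. f i' ! j"
        proof (rule ccontr)
          assume no: "\<not> ?thesis"
          have "f i' ! k" if "i \<le> i'" for i'
            using that
          proof (induction i' rule: dec_induct)
            case (step i')
            then show ?case using no \<open>\<And>i. f i ! k = (f i ! j \<or> f (Suc i) ! k)\<close>[of i'] by auto
          qed (rule i)
          then show False using fair[OF less.prems, of i] no by (auto simp: fair_at_def TFin j)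
        qed
      next
        assume "\<exists>i'\<ge>i. f i' ! j"
        then obtain i' where "i \<le> i'" "f i' ! j" by blast
        then show "f i ! k" by (induction rule: inc_induct) (use step in blast)+
      qed
      then show ?thesis using ch j node_eq[OF less.prems] TFin by (simp add: until_def)
    next
      case TGlob
      then obtain j where j: "children ts k = [j]" using len by (auto simp: length_Suc_conv)
      have step: "f i ! k = (f i ! j \<and> f (Suc i) ! k)" for i using ex[of i] j TGlob by simp
      have "\<not> f i ! k \<longleftrightarrow> (\<exists>i'\<ge>i. \<not> f i' ! j)"
      proof
        assume i: "\<not> f i ! k"
        show "\<exists>i'\<ge>i. \<not> f i' ! j"
        proof (rule ccontr)
          assume no: "\<not> ?thesis"
          have "\<not> f i' ! k" if "i \<le> i'" for i'
            using that
          proof (induction i' rule: dec_induct)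
            case (step i')
            then show ?case using no \<open>\<And>i. f i ! k = (f i ! j \<and> f (Suc i) ! k)\<close>[of i'] by auto
          qed (rule i)
          then show False using fair[OF less.prems, of i] no by (auto simp: fair_at_def TGlob j)
        qed
      next
        assume "\<exists>i'\<ge>i. \<not> f i' ! j"
        then obtain i' where "i \<le> i'" "\<not> f i' ! j" by blast
        then show "\<not> f i ! k" by (induction rule: inc_induct) (use step in blast)+
      qed
      then have "f i ! k \<longleftrightarrow> (\<forall>i'\<ge>i. f i' ! j)" by blast
      then show ?thesis using ch j node_eq[OF less.prems] TGlob by (simp add: until_def)
    qed
  qed
  moreover have "is_structure S" by (simp add: is_structure_def S_def)
  ultimately show ?thesis using that by blast
qed

lemma sat_sequence:
  fixes S :: "nat ltl_structure"
  assumes wf: "well_formed ts"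
  defines "f \<equiv> \<lambda>i. map (\<lambda>k. sat S i (node ts k)) [0..<length ts]"
  shows "moves ts (f i) (f (Suc i))" "k < length ts \<Longrightarrow> \<exists>j\<ge>i. fair_at ts (f j) k"
proof -
  have ch: "j < length ts" if "j \<in> set (children ts k)" "k < length ts" for j k
    using children_less[OF that(1)] that(2) by simp
  have unary: "\<exists>j. children ts k = [j]" if "k < length ts" "ar (ts ! k) = 1" for k
    using well_formed_length_children[OF wf that(1)] that(2) by (auto simp: length_Suc_conv)
  have "expands (ts ! k) (f i ! k) (f (Suc i) ! k) (map (\<lambda>j. (f i ! j, f (Suc i) ! j)) (children ts k))"
    if k: "k < length ts" for k
  proof (cases "ts ! k")
    case (TConn g)
    have "map (sat S i \<circ> node ts) (children ts k) = map (fst \<circ> (\<lambda>j. (f i ! j, f (Suc i) ! j))) (children ts k)"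
      using ch k by (simp add: f_def)
    then show ?thesis using k node_eq[OF k] TConn by (simp add: f_def del: map_eq_conv)
  next
    case TNext
    then obtain j where "children ts k = [j]" using unary[OF k] by auto
    then show ?thesis using k ch[OF _ k] node_eq[OF k] TNext by (simp add: f_def)
  next
    case TFin
    then obtain j where "children ts k = [j]" using unary[OF k] by auto
    then show ?thesis using k ch[OF _ k] node_eq[OF k] TFin
      by (auto simp: f_def until_def dest: Suc_leD) (metis Suc_leI le_neq_implies_less)
  next
    case TGlob
    then obtain j where "children ts k = [j]" using unary[OF k] by auto
    then show ?thesis using k ch[OF _ k] node_eq[OF k] TGlob
      by (auto simp: f_def until_def dest: Suc_leD) (metis Suc_leI le_neq_implies_less)
  qed simp
  moreover have "f i ! k = f i ! k'" if "k < length ts" "k' < length ts" "ts ! k = TVar x" "ts ! k' = TVar x" for k k' x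
    using that node_eq[OF that(1)] node_eq[OF that(2)] by (simp add: f_def)
  moreover have "length (f i) = length ts" "length (f (Suc i)) = length ts" by (simp_all add: f_def)
  ultimately show "moves ts (f i) (f (Suc i))" unfolding moves_def by blast
  show "\<exists>j\<ge>i. fair_at ts (f j) k" if k: "k < length ts"
  proof (cases "ts ! k")
    case TFin
    then obtain j where j: "children ts k = [j]" using unary[OF k] by auto
    have "fair_at ts (f i') k \<longleftrightarrow> \<not> sat S i' (node ts k) \<or> sat S i' (node ts j)" for i'
      using k ch[OF _ k] j by (simp add: fair_at_def TFin f_def)
    moreover have "sat S i' (node ts k) \<longleftrightarrow> (\<exists>j'\<ge>i'. sat S j' (node ts j))" for i'
      using node_eq[OF k] TFin j by (simp add: until_def)
    ultimately show ?thesis by blast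
  next
    case TGlob
    then obtain j where j: "children ts k = [j]" using unary[OF k] by auto
    have "fair_at ts (f i') k \<longleftrightarrow> sat S i' (node ts k) \<or> \<not> sat S i' (node ts j)" for i'
      using k ch[OF _ k] j by (simp add: fair_at_def TGlob f_def)
    moreover have "sat S i' (node ts k) \<longleftrightarrow> (\<forall>j'\<ge>i'. sat S j' (node ts j))" for i'
      using node_eq[OF k] TGlob j by (simp add: until_def)
    ultimately show ?thesis by blast
  qed (auto simp: fair_at_def)
qed

section \<open>Lasso-shaped models\<close>

definition lasso :: "token list \<Rightarrow> (nat \<Rightarrow> bool list) \<Rightarrow> nat \<Rightarrow> nat \<Rightarrow> bool" where
  "lasso ts f m n \<longleftrightarrow> m < n \<and> f n = f m \<and> (\<forall>i<n. moves ts (f i) (f (Suc i))) \<and> f 0 ! (length ts - 1) \<and>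
     (\<forall>k<length ts. \<exists>i\<in>{m..<n}. fair_at ts (f i) k)"

lemma satisfiable_iff_lasso:
  assumes wf: "well_formed ts"
  shows "satisfiable (node ts (length ts - 1)) \<longleftrightarrow> (\<exists>f m n. lasso ts f m n)"
proof
  have root: "length ts - 1 < length ts" using well_formed_root(1)[OF wf] by simp
  {
    assume "satisfiable (node ts (length ts - 1))"
    then obtain S :: "nat ltl_structure" and i0 where S: "sat S i0 (node ts (length ts - 1))"
      by (auto simp: satisfiable_def)
    define f where "f = (\<lambda>i. map (\<lambda>k. sat S i (node ts k)) [0..<length ts])"
    define g where "g = (\<lambda>i. f (i0 + i))"
    have moves: "moves ts (g i) (g (Suc i))" for i
      using sat_sequence(1)[OF wf, of S "i0 + i"] by (simp add: f_def g_def)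
    have fair: "\<exists>j\<ge>i. fair_at ts (g j) k" if k: "k < length ts" for i k
    proof -
      obtain j where "j \<ge> i0 + i" "fair_at ts (f j) k"
        using sat_sequence(2)[OF wf k, of "i0 + i" S] by (auto simp: f_def)
      then show ?thesis by (intro exI[of _ "j - i0"]) (simp add: g_def)
    qed
    have "finite (range g)"
    proof (rule finite_subset)
      show "range g \<subseteq> {xs. set xs \<subseteq> UNIV \<and> length xs = length ts}" by (auto simp: g_def f_def)
      show "finite {xs :: bool list. set xs \<subseteq> UNIV \<and> length xs = length ts}"
        by (rule finite_lists_length_eq) simp
    qed
    \<comment> \<open>Some vector recurs infinitely often, so the second end of the loop can be
      chosen as late as desired.\<close>
    then obtain m where m: "infinite {i. g i = g m}"
      using pigeonhole_infinite[of UNIV g] by auto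
    have "\<forall>k. \<exists>i. k < length ts \<longrightarrow> m \<le> i \<and> fair_at ts (g i) k" using fair by blast
    then obtain j where j: "\<And>k. k < length ts \<Longrightarrow> m \<le> j k \<and> fair_at ts (g (j k)) k" by metis
    \<comment> \<open>The sum exceeds every single \<open>j k\<close>, so the loop contains a fair
      position for each token.\<close>
    obtain n where n: "g n = g m" "Suc (m + sum j {..<length ts}) \<le> n"
      using m unfolding infinite_nat_iff_unbounded_le by blast
    have "j k \<le> sum j {..<length ts}" if "k < length ts" for k
      using that by (intro member_le_sum) auto
    then have "lasso ts g m n"
      using n moves j S root unfolding lasso_def
      by (auto simp: g_def f_def intro!: bexI[of _ "j _"]) (fastforce simp: g_def f_def)
    then show "\<exists>f m n. lasso ts f m n" by blast
  next
    assume "\<exists>f m n. lasso ts f m n"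
    then obtain f m n where f: "m < n" "f n = f m" "\<And>i. i < n \<Longrightarrow> moves ts (f i) (f (Suc i))"
      "f 0 ! (length ts - 1)" "\<And>k. k < length ts \<Longrightarrow> \<exists>i\<in>{m..<n}. fair_at ts (f i) k"
      by (auto simp: lasso_def)
    define d where "d = n - m"
    \<comment> \<open>The place on the lasso at which the infinite sequence is at time
      \<open>i\<close>.\<close>
    define r where "r = (\<lambda>i. if i < n then i else m + (i - m) mod d)"
    have d: "0 < d" using f(1) by (simp add: d_def)
    have r_less: "r i < n" for i
    proof (cases "i < n")
      case False
      have "(i - m) mod d < n - m" using mod_less_divisor[OF d, of "i - m"] by (simp add: d_def)
      then show ?thesis using False by (simp add: r_def)
    qed (simp add: r_def)
    have r_Suc: "f (r (Suc i)) = f (Suc (r i))" for i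
    proof (cases "Suc i < n")
      case False
      then have i: "m \<le> i" "Suc i - m = Suc (i - m)" using f(1) by auto
      have ri: "r i = m + (i - m) mod d"
        using i(1) False f(1) by (auto simp: r_def d_def)
      have "r (Suc i) = m + Suc (i - m) mod d" using False i by (simp add: r_def)
      show ?thesis
      proof (cases "Suc ((i - m) mod d) = d")
        case True
        then have "r (Suc i) = m" using \<open>r (Suc i) = _\<close> by (simp add: mod_Suc)
        moreover have "Suc (r i) = n" using ri True f(1) by (simp add: d_def)
        ultimately show ?thesis using f(2) by simp
      next
        case False
        then show ?thesis using \<open>r (Suc i) = _\<close> ri by (simp add: mod_Suc)
      qed
    qed (simp add: r_def)
    have "moves ts (f (r i)) (f (r (Suc i)))" for i
      using f(3)[OF r_less[of i]] r_Suc by simp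
    moreover have "\<exists>j\<ge>i. fair_at ts (f (r j)) k" if k: "k < length ts" for i k
    proof -
      obtain i' where i': "m \<le> i'" "i' < n" "fair_at ts (f i') k" using f(5)[OF k] by auto
      \<comment> \<open>The copy of \<open>i'\<close> that lies \<open>Suc i\<close> rounds further,
        hence not before \<open>i\<close>.\<close>
      define j where "j = i' + Suc i * d"
      have "j - m = (i' - m) + Suc i * d" "\<not> j < n"
        using i'(1) by (auto simp: j_def d_def)
      then have "r j = m + (i' - m) mod d" by (simp add: r_def del: mult_Suc)
      also have "\<dots> = i'" using i' by (simp add: d_def)
      finally have "r j = i'" .
      moreover have "i \<le> j" using d by (simp add: j_def trans_le_add2)
      ultimately show ?thesis using i'(3) by blast
    qed
    ultimately obtain S :: "nat ltl_structure" where "is_structure S"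
      "\<And>i k. k < length ts \<Longrightarrow> sat S i (node ts k) = f (r i) ! k"
      using fair_sequence_sat[OF wf, of "\<lambda>i. f (r i)"] by blast
    then show "satisfiable (node ts (length ts - 1))"
      using root f(1,4) unfolding satisfiable_def by (metis gr_implies_not0 neq0_conv r_def)
  }
qed

section \<open>Paths of cell vectors\<close>

lemma kind_uniform:
  assumes wf: "well_formed ts" and e: "edge ts a b" and k: "k < length ts"
  shows "kind (a ! k, b ! k) = kind (a ! (length ts - 1), b ! (length ts - 1))"
proof -
  have "k < length ts \<Longrightarrow> length ts - k = n \<Longrightarrow>
      kind (a ! k, b ! k) = kind (a ! (length ts - 1), b ! (length ts - 1))" for n
  proof (induction n arbitrary: k rule: less_induct)
    case (less n)
    show ?case
    proof (cases "k = length ts - 1")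
      case False
      then obtain k' where k': "k < k'" "k' < length ts" "k \<in> set (children ts k')"
        using parent_exists[OF wf, of k] less.prems by (metis Suc_pred' less_Suc_eq linorder_neqE_nat not_less_zero)
      then have "kind (a ! k, b ! k) = kind (a ! k', b ! k')"
        using e unfolding edge_def node_ok_def by fastforce
      then show ?thesis using less.IH[of "length ts - k'" k'] k' less.prems by simp
    qed simp
  qed
  then show ?thesis using k by blast
qed

definition loop_cells :: "token list \<Rightarrow> bool list \<Rightarrow> bool list \<Rightarrow> (nat \<Rightarrow> bool) \<Rightarrow> cell list" where
  "loop_cells ts u v s = map (\<lambda>k. C1 (u ! k) (v ! k) (s k)) [0..<length ts]"

text \<open>The view of an edge as a change of whole vectors, one rule for each phase. It separates
  the tree-shaped local conditions from the argument about lassos.\<close>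

inductive transition :: "token list \<Rightarrow> cell list \<Rightarrow> cell list \<Rightarrow> bool" for ts where
  idle: "transition ts (replicate (length ts) CS) (replicate (length ts) CS)"
| start: "length u = length ts \<Longrightarrow> u ! (length ts - 1) \<Longrightarrow> transition ts (replicate (length ts) CS) (map C0 u)"
| stem: "moves ts u u' \<Longrightarrow> transition ts (map C0 u) (map C0 u')"
| enter: "length u = length ts \<Longrightarrow> transition ts (map C0 u) (loop_cells ts u u (\<lambda>_. False))"
| loop: "moves ts u u' \<Longrightarrow> length v = length ts \<Longrightarrow> transition ts (loop_cells ts u v s) (loop_cells ts u' v (\<lambda>k. s k \<or> fair_at ts u k))"
| final: "length u = length ts \<Longrightarrow> transition ts (loop_cells ts u u (\<lambda>_. True)) (replicate (length ts) CE)"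

fun saved :: "cell \<Rightarrow> bool" where "saved (C1 u v s) = v" | "saved _ = False"
fun marked :: "cell \<Rightarrow> bool" where "marked (C1 u v s) = s" | "marked _ = False"

lemma edge_transition:
  assumes wf: "well_formed ts" and e: "edge ts a b"
  shows "transition ts a b"
proof -
  let ?n = "length ts"
  have root: "?n - 1 < ?n" using well_formed_root(1)[OF wf] by simp
  have len: "length a = ?n" "length b = ?n" using e by (auto simp: edge_def)
  have ok: "kind (a ! k, b ! k) \<noteq> 0" "local_ok (ts ! k) (a ! k, b ! k) (map (\<lambda>j. (a ! j, b ! j)) (children ts k))"
    if "k < ?n" for k
    using e that by (auto simp: edge_def node_ok_def)
  define u where "u = map truth a"
  define u' where "u' = map truth b"
  have ch: "j < ?n" if "j \<in> set (children ts k)" "k < ?n" for j k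
    using children_less[OF that(1)] that(2) by simp
  have bits: "map (map_prod truth truth) (map (\<lambda>j. (a ! j, b ! j)) (children ts k)) = map (\<lambda>j. (u ! j, u' ! j)) (children ts k)"
    "map (truth \<circ> fst) (map (\<lambda>j. (a ! j, b ! j)) (children ts k)) = map (\<lambda>j. u ! j) (children ts k)"
    if "k < ?n" for k
    using ch[OF _ that] len by (simp_all add: u_def u'_def)
  have cons: "\<forall>k<?n. \<forall>k'<?n. \<forall>x. ts ! k = TVar x \<and> ts ! k' = TVar x \<longrightarrow> u ! k = u ! k'"
  proof (intro allI impI)
    fix k k' x assume k: "k < ?n" "k' < ?n" "ts ! k = TVar x \<and> ts ! k' = TVar x"
    have "consistent ts a" using e unfolding edge_def by blast
    then have "truth (a ! k) = truth (a ! k')" using k unfolding consistent_def by blast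
    then show "u ! k = u ! k'" using k len by (simp add: u_def)
  qed
  have lens: "length u = ?n" "length u' = ?n" using len by (auto simp: u_def u'_def)
  define K where "K = kind (a ! (?n - 1), b ! (?n - 1))"
  have K: "kind (a ! k, b ! k) = K" if "k < ?n" for k
    unfolding K_def by (rule kind_uniform[OF wf e that])
  have "K \<in> {1, 2, 3, 4, 5, 6}"
    using ok(1)[OF root] unfolding K_def by (cases "(a ! (?n - 1), b ! (?n - 1))" rule: kind.cases) auto
  then consider "K = 1" | "K = 2" | "K = 3" | "K = 4" | "K = 5" | "K = 6" by auto
  then show ?thesis
  proof cases
    case 1
    have "a ! k = CS \<and> b ! k = CS" if "k < ?n" for k
      using K[OF that] 1 by (cases "(a ! k, b ! k)" rule: kind.cases) auto
    then have "a = replicate ?n CS" "b = replicate ?n CS"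
      using len by (auto intro!: nth_equalityI)
    then show ?thesis using transition.idle by simp
  next
    case 2
    have *: "a ! k = CS \<and> b ! k = C0 (truth (b ! k))" if "k < ?n" for k
      using K[OF that] 2 by (cases "(a ! k, b ! k)" rule: kind.cases) auto
    then have "a = replicate ?n CS" "b = map C0 u'"
      using len by (auto intro!: nth_equalityI simp: u'_def)
    moreover have "u' ! (?n - 1)"
    proof -
      have "b ! (?n - 1) \<noteq> C0 False" using e *[OF root] unfolding edge_def by blast
      then show ?thesis using *[OF root] root len by (metis (full_types) nth_map u'_def)
    qed
    ultimately show ?thesis using transition.start lens by simp
  next
    case 3
    have *: "a ! k = C0 (truth (a ! k)) \<and> b ! k = C0 (truth (b ! k))" if "k < ?n" for k
      using K[OF that] 3 by (cases "(a ! k, b ! k)" rule: kind.cases) auto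
    then have ab: "a = map C0 u" "b = map C0 u'"
      using len by (auto intro!: nth_equalityI simp: u_def u'_def)
    have "expands (ts ! k) (u ! k) (u' ! k) (map (\<lambda>j. (u ! j, u' ! j)) (children ts k))" if "k < ?n" for k
      using ok(2)[OF that] bits(1)[OF that] that lens by (simp only: ab nth_map local_ok.simps)
    then have "moves ts u u'" using cons lens unfolding moves_def by blast
    then show ?thesis using transition.stem ab by simp
  next
    case 4
    have "a ! k = C0 (u ! k) \<and> b ! k = C1 (u ! k) (u ! k) False" if "k < ?n" for k
      using K[OF that] 4 ok(2)[OF that] that len
      by (cases "(a ! k, b ! k)" rule: kind.cases) (auto simp: u_def)
    then have "a = map C0 u" "b = loop_cells ts u u (\<lambda>_. False)"
      using len by (auto intro!: nth_equalityI simp: loop_cells_def u_def)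
    then show ?thesis using transition.enter lens by simp
  next
    case 5
    define v where "v = map saved a"
    define s where "s = (\<lambda>k. marked (a ! k))"
    have *: "a ! k = C1 (u ! k) (v ! k) (s k) \<and> b ! k = C1 (u' ! k) (v ! k) (s k \<or> fair_at ts u k) \<and>
       expands (ts ! k) (u ! k) (u' ! k) (map (\<lambda>j. (u ! j, u' ! j)) (children ts k))" if k: "k < ?n" for k
    proof -
      obtain x y z x' y' z' where xyz: "a ! k = C1 x y z" "b ! k = C1 x' y' z'"
        using K[OF k] 5 by (cases "(a ! k, b ! k)" rule: kind.cases) auto
      then have "u ! k = x" "v ! k = y" "s k = z" "u' ! k = x'"
        using k len by (auto simp: u_def u'_def v_def s_def)
      moreover have "expands (ts ! k) x x' (map (\<lambda>j. (u ! j, u' ! j)) (children ts k)) \<and> y' = y \<and>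
          z' = (z \<or> fair (ts ! k) x (map (\<lambda>j. u ! j) (children ts k)))"
        using ok(2)[OF k] unfolding xyz local_ok.simps bits[OF k] .
      ultimately show ?thesis unfolding xyz fair_at_def by simp
    qed
    then have "a = loop_cells ts u v s" "b = loop_cells ts u' v (\<lambda>k. s k \<or> fair_at ts u k)"
      using len by (auto intro!: nth_equalityI simp: loop_cells_def)
    moreover have "moves ts u u'" using * cons lens unfolding moves_def by blast
    moreover have "length v = ?n" using len by (simp add: v_def)
    ultimately show ?thesis using transition.loop by simp
  next
    case 6
    have "a ! k = C1 (u ! k) (u ! k) True \<and> b ! k = CE" if "k < ?n" for k
      using K[OF that] 6 ok(2)[OF that] that len
      by (cases "(a ! k, b ! k)" rule: kind.cases) (auto simp: u_def)
    then have "a = loop_cells ts u u (\<lambda>_. True)" "b = replicate ?n CE"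
      using len by (auto intro!: nth_equalityI simp: loop_cells_def)
    then show ?thesis using transition.final lens by simp
  qed
qed

lemma nth_cells:
  assumes "k < length ts"
  shows "replicate (length ts) x ! k = x" "length u = length ts \<Longrightarrow> map C0 u ! k = C0 (u ! k)"
    "loop_cells ts u v s ! k = C1 (u ! k) (v ! k) (s k)"
  using assms by (auto simp: loop_cells_def)

lemma cells_distinct:
  assumes "ts \<noteq> []"
  shows "replicate (length ts) CS \<noteq> map C0 u" "replicate (length ts) CS \<noteq> loop_cells ts u v s"
    "map C0 u' \<noteq> loop_cells ts u v s" "replicate (length ts) CE \<noteq> replicate (length ts) CS"
    "replicate (length ts) CE \<noteq> map C0 u" "replicate (length ts) CE \<noteq> loop_cells ts u v s"
proof -
  obtain n where "length ts = Suc n" using assms by (cases ts) auto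
  moreover have "[0..<Suc n] = 0 # [1..<Suc n]" by (simp add: upt_conv_Cons del: upt_Suc)
  ultimately show "replicate (length ts) CS \<noteq> map C0 u" "replicate (length ts) CS \<noteq> loop_cells ts u v s"
    "map C0 u' \<noteq> loop_cells ts u v s" "replicate (length ts) CE \<noteq> replicate (length ts) CS"
    "replicate (length ts) CE \<noteq> map C0 u" "replicate (length ts) CE \<noteq> loop_cells ts u v s"
    by (cases u; cases u'; simp add: loop_cells_def del: upt_Suc)+
qed

lemma loop_cells_eq:
  assumes "loop_cells ts u v s = loop_cells ts u' v' s'"
    "length u = length ts" "length v = length ts" "length u' = length ts" "length v' = length ts"
  shows "u = u'" "v = v'" "\<And>k. k < length ts \<Longrightarrow> s k = s' k"
proof -
  have "C1 (u ! k) (v ! k) (s k) = C1 (u' ! k) (v' ! k) (s' k)" if "k < length ts" for k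
    using nth_cells(3)[OF that] assms(1) by metis
  then show "u = u'" "v = v'" "\<And>k. k < length ts \<Longrightarrow> s k = s' k"
    using assms by (auto intro!: nth_equalityI)
qed

lemma loop_cells_cong: "(\<And>k. k < length ts \<Longrightarrow> s k = s' k) \<Longrightarrow> loop_cells ts u v s = loop_cells ts u v s'"
  by (simp add: loop_cells_def)

text \<open>Invariant: a reached vector is the initial one, the end of a sequence of moves, or the
  end of such a sequence together with an earlier entry point and exactly the fairness collected
  since. Leaving the loop then exhibits a lasso; if there is none, the final vector would have to
  satisfy the invariant, which it does not.\<close>

lemma transitions_lasso:
  assumes path: "(transition ts)\<^sup>*\<^sup>* (replicate (length ts) CS) (replicate (length ts) CE)" and "ts \<noteq> []"
  shows "\<exists>f m n. lasso ts f m n"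
proof (rule ccontr)
  assume none: "\<not> ?thesis"
  let ?n = "length ts"
  have n: "0 < ?n" using assms(2) by simp
  define prefix where "prefix = (\<lambda>f n. f 0 ! (?n - 1) \<and> (\<forall>i<n. moves ts (f i) (f (Suc i))) \<and>
     (\<forall>i\<le>n. length (f i) = ?n))"
  define inv where "inv = (\<lambda>a. a = replicate ?n CS \<or> (\<exists>f n. prefix f n \<and> a = map C0 (f n)) \<or>
     (\<exists>f m n. prefix f n \<and> m \<le> n \<and>
        a = loop_cells ts (f n) (f m) (\<lambda>k. \<exists>i\<in>{m..<n}. fair_at ts (f i) k)))"
  have length_prefix: "length (f i) = ?n" if "prefix f n" "i \<le> n" for f n i
    using that by (simp add: prefix_def)
  have extend: "prefix (f(Suc n := u)) (Suc n)" if "prefix f n" "moves ts (f n) u" for f n u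
    using that by (auto simp: prefix_def less_Suc_eq le_Suc_eq moves_def)
  have inj: "u = u'" if "map C0 u = map C0 u'" for u u'
    using that inj_map_eq_map[of C0] by (simp add: inj_def)
  note distinct = cells_distinct[OF assms(2)]
  have inv_cases: thesis if "inv a" "a = replicate ?n CS \<Longrightarrow> thesis"
      "\<And>f n. prefix f n \<Longrightarrow> length (f n) = ?n \<Longrightarrow> a = map C0 (f n) \<Longrightarrow> thesis"
      "\<And>f m n. prefix f n \<Longrightarrow> m \<le> n \<Longrightarrow> length (f n) = ?n \<Longrightarrow> length (f m) = ?n \<Longrightarrow>
        a = loop_cells ts (f n) (f m) (\<lambda>k. \<exists>i\<in>{m..<n}. fair_at ts (f i) k) \<Longrightarrow> thesis" for a thesis
    using that length_prefix unfolding inv_def by blast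
  have inv: "inv b" if a: "transition ts a b" "inv a" for a b
    using a(1)
  proof cases
    case idle
    then show ?thesis by (simp add: inv_def)
  next
    case (start u)
    then have "prefix (\<lambda>_. u) 0" by (simp add: prefix_def)
    then show ?thesis using start unfolding inv_def by blast
  next
    case (stem u u')
    then have u: "length u = ?n" by (simp add: moves_def)
    show ?thesis
    proof (rule inv_cases[OF a(2)])
      fix f n assume f: "prefix f n" "a = map C0 (f n)"
      then have "f n = u" using stem inj by metis
      then have "prefix (f(Suc n := u')) (Suc n)" using extend f stem by blast
      moreover have "b = map C0 ((f(Suc n := u')) (Suc n))" using stem by simp
      ultimately show ?thesis unfolding inv_def by blast
    qed (use stem u distinct in \<open>simp_all, metis+\<close>)
  next
    case (enter u)
    show ?thesis
    proof (rule inv_cases[OF a(2)])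
      fix f n assume f: "prefix f n" "a = map C0 (f n)"
      then have "f n = u" using enter inj by metis
      then have "b = loop_cells ts (f n) (f n) (\<lambda>k. \<exists>i\<in>{n..<n}. fair_at ts (f i) k)"
        using enter by simp
      then show ?thesis using f unfolding inv_def by blast
    qed (use enter distinct in \<open>simp_all, metis+\<close>)
  next
    case (loop u u' v s)
    then have u: "length u = ?n" by (simp add: moves_def)
    show ?thesis
    proof (rule inv_cases[OF a(2)])
      fix f m n assume f: "prefix f n" "m \<le> n" "length (f n) = ?n" "length (f m) = ?n"
        "a = loop_cells ts (f n) (f m) (\<lambda>k. \<exists>i\<in>{m..<n}. fair_at ts (f i) k)"
      note eq = loop_cells_eq[OF f(5)[symmetric, unfolded loop(1)] f(3,4) u loop(4)]
      let ?f = "f(Suc n := u')"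
      have "prefix ?f (Suc n)" using extend f(1) loop(3) eq(1) by blast
      moreover have "b = loop_cells ts (?f (Suc n)) (?f m) (\<lambda>k. \<exists>i\<in>{m..<Suc n}. fair_at ts (?f i) k)"
        unfolding loop(2)
      proof (subst loop_cells_cong)
        fix k assume "k < ?n"
        moreover have "(\<exists>i\<in>{m..<Suc n}. fair_at ts (?f i) k) \<longleftrightarrow>
            (\<exists>i\<in>{m..<n}. fair_at ts (f i) k) \<or> fair_at ts (f n) k"
          using f(2) by (auto simp: atLeastLessThanSuc)
        ultimately show "(s k \<or> fair_at ts u k) = (\<exists>i\<in>{m..<Suc n}. fair_at ts (?f i) k)"
          using eq(1) eq(3)[of k] by simp
      qed (use eq f in simp)
      ultimately show ?thesis unfolding inv_def using f(2) le_SucI by blast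
    qed (use loop u distinct in \<open>simp_all, metis+\<close>)
  next
    case (final u)
    show ?thesis
    proof (rule inv_cases[OF a(2)])
      fix f m n assume f: "prefix f n" "m \<le> n" "length (f n) = ?n" "length (f m) = ?n"
        "a = loop_cells ts (f n) (f m) (\<lambda>k. \<exists>i\<in>{m..<n}. fair_at ts (f i) k)"
      note eq = loop_cells_eq[OF f(5)[symmetric, unfolded final(1)] f(3,4) final(3) final(3)]
      have "m < n" using eq(3)[OF n] f(2) by auto
      then have "lasso ts f m n"
        using f eq unfolding lasso_def prefix_def by simp
      then show ?thesis using none by blast
    qed (use final distinct in \<open>simp_all, metis+\<close>)
  qed
  have "inv (replicate ?n CE)"
    using path
  proof (induction rule: rtranclp_induct)
    case base
    then show ?case by (simp add: inv_def)
  next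
    case (step a b)
    then show ?case using inv by blast
  qed
  then show False
    by (rule inv_cases) (use distinct in \<open>metis length_replicate\<close>)+
qed

lemma map_children_cong:
  assumes "k < length ts" "\<And>j. j < length ts \<Longrightarrow> f j = g j"
  shows "map f (children ts k) = map g (children ts k)"
  using assms children_less[of _ ts k] by (auto intro: less_trans)

text \<open>The rules for entering and leaving the loop say nothing about equal variables. Their
  consistency is borrowed from some move that starts with the same truth values.\<close>

lemma transition_edge:
  assumes wf: "well_formed ts" and t: "transition ts a b"
    and m: "\<And>u v s. a = map C0 u \<or> a = loop_cells ts u v s \<Longrightarrow> length u = length ts \<Longrightarrow> \<exists>u'. moves ts u u'"
  shows "edge ts a b"
proof -
  let ?n = "length ts"
  have root: "?n - 1 < ?n" using well_formed_root(1)[OF wf] by simp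
  have edgeI: "edge ts a b"
    if "length a = ?n" "length b = ?n" "\<And>k. k < ?n \<Longrightarrow> kind (a ! k, b ! k) = K" "K \<noteq> 0"
      "\<And>k. k < ?n \<Longrightarrow> local_ok (ts ! k) (a ! k, b ! k) (map (\<lambda>j. (a ! j, b ! j)) (children ts k))"
      "b ! (?n - 1) \<noteq> C0 False \<or> a ! (?n - 1) \<noteq> CS" "consistent ts a" for K
    unfolding edge_def node_ok_def
  proof (intro conjI allI impI ballI)
    fix k c assume k: "k < ?n" "c \<in> set (map (\<lambda>j. (a ! j, b ! j)) (children ts k))"
    then obtain j where j: "j \<in> set (children ts k)" "c = (a ! j, b ! j)" by auto
    then have "j < ?n" using children_less k(1) less_trans by blast
    then show "kind c = kind (a ! k, b ! k)" using that(3) k(1) j(2) by simp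
  qed (use that in auto)
  have cons: "consistent ts a" if "\<And>k. k < ?n \<Longrightarrow> truth (a ! k) = u ! k" "moves ts u u'" for u u'
    unfolding consistent_def
  proof (intro allI impI)
    fix k k' x assume k: "k < ?n" "k' < ?n" "ts ! k = TVar x \<and> ts ! k' = TVar x"
    then have "u ! k = u ! k'" using that(2) unfolding moves_def by blast
    then show "truth (a ! k) = truth (a ! k')" using that(1) k by simp
  qed
  show ?thesis
    using t
  proof cases
    case idle
    show ?thesis by (rule edgeI[of 1]) (use root in \<open>auto simp: idle consistent_def\<close>)
  next
    case (start u)
    show ?thesis by (rule edgeI[of 2]) (use root start in \<open>auto simp: consistent_def\<close>)
  next
    case (stem u u')
    then have len: "length u = ?n" "length u' = ?n" by (simp_all add: moves_def)
    show ?thesis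
    proof (rule edgeI[of 3])
      fix k assume k: "k < ?n"
      have eq: "map (map_prod truth truth) (map (\<lambda>j. (a ! j, b ! j)) (children ts k)) = map (\<lambda>j. (u ! j, u' ! j)) (children ts k)"
        unfolding map_map by (rule map_children_cong[OF k]) (simp add: stem len)
      show "local_ok (ts ! k) (a ! k, b ! k) (map (\<lambda>j. (a ! j, b ! j)) (children ts k))"
      proof -
        have ab: "a ! k = C0 (u ! k)" "b ! k = C0 (u' ! k)" using k len by (simp_all add: stem)
        show ?thesis
          using stem(3) k unfolding ab local_ok.simps eq moves_def by blast
      qed
    next
      show "consistent ts a" by (rule cons[OF _ stem(3)]) (simp add: stem len)
    qed (use root len in \<open>auto simp: stem\<close>)
  next
    case (enter u)
    obtain u' where "moves ts u u'" using m enter by blast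
    from cons[OF _ this] have "consistent ts a" using enter by simp
    then show ?thesis
      by (intro edgeI[of 4]) (use root in \<open>auto simp: enter loop_cells_def\<close>)
  next
    case (loop u u' v s)
    then have len: "length u = ?n" "length u' = ?n" by (simp_all add: moves_def)
    show ?thesis
    proof (rule edgeI[of 5])
      fix k assume k: "k < ?n"
      have eq: "map (map_prod truth truth) (map (\<lambda>j. (a ! j, b ! j)) (children ts k)) = map (\<lambda>j. (u ! j, u' ! j)) (children ts k)"
        "map (truth \<circ> fst) (map (\<lambda>j. (a ! j, b ! j)) (children ts k)) = map (\<lambda>j. u ! j) (children ts k)"
        unfolding map_map by (rule map_children_cong[OF k]; simp add: loop(1,2) nth_cells)+
      show "local_ok (ts ! k) (a ! k, b ! k) (map (\<lambda>j. (a ! j, b ! j)) (children ts k))"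
      proof -
        have ab: "a ! k = C1 (u ! k) (v ! k) (s k)" "b ! k = C1 (u' ! k) (v ! k) (s k \<or> fair_at ts u k)"
          using k by (simp_all add: loop(1,2) nth_cells)
        show ?thesis
          using loop(3) k unfolding ab local_ok.simps eq moves_def fair_at_def by blast
      qed
    next
      show "consistent ts a" by (rule cons[OF _ loop(3)]) (simp add: loop(1) nth_cells)
    qed (use root in \<open>auto simp: loop(1,2) nth_cells loop_cells_def\<close>)
  next
    case (final u)
    obtain u' where "moves ts u u'" using m final by blast
    from cons[OF _ this] have "consistent ts a" using final by (simp add: nth_cells)
    then show ?thesis
      by (intro edgeI[of 6]) (use root in \<open>auto simp: final loop_cells_def\<close>)
  qed
qed

text \<open>Every truth vector on the way is some \<open>f i\<close> with \<open>i < n\<close> and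
  thus starts a move, as \<open>transition_edge\<close> demands; at the very end this is
  \<open>f m\<close>, which equals \<open>f n\<close>.\<close>

lemma lasso_edges:
  assumes wf: "well_formed ts" and "lasso ts f m n"
  shows "(edge ts)\<^sup>*\<^sup>* (replicate (length ts) CS) (replicate (length ts) CE)"
proof -
  have f: "m < n" "f n = f m" "\<And>i. i < n \<Longrightarrow> moves ts (f i) (f (Suc i))" "f 0 ! (length ts - 1)"
    "\<And>k. k < length ts \<Longrightarrow> \<exists>i\<in>{m..<n}. fair_at ts (f i) k"
    using assms(2) by (auto simp: lasso_def)
  have len: "length (f i) = length ts" if "i \<le> n" for i
  proof -
    have "length (f i) = length ts" if "i < n" for i
      using f(3)[OF that] unfolding moves_def by blast
    then show ?thesis using f(1,2) that by (cases "i = n") auto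
  qed
  define s where "s = (\<lambda>j k. \<exists>i\<in>{m..<j}. fair_at ts (f i) k)"
  have edge: "edge ts a b" if "transition ts a b" "\<And>u. a = map C0 u \<Longrightarrow> \<exists>i<n. u = f i"
    "\<And>u v s. length u = length ts \<Longrightarrow> a = loop_cells ts u v s \<Longrightarrow> \<exists>i<n. u = f i" for a b
    by (rule transition_edge[OF wf that(1)]) (use that(2,3) f(3) in metis)
  have inj: "u = u'" if "map C0 u = map C0 u'" for u u'
    using that inj_map_eq_map[of C0] by (simp add: inj_def)
  note distinct = cells_distinct[OF well_formed_root(1)[OF wf]]
  have loop_inj: "u = u'" if "loop_cells ts u v s = loop_cells ts u' v' s'" "length u = length ts" "length u' = length ts"
    for u u' v v' s s'
  proof (rule nth_equalityI)
    fix k assume "k < length u"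
    then show "u ! k = u' ! k" using nth_cells(3)[of k ts] that by (metis cell.inject(2))
  qed (use that in simp)
  have stem: "i \<le> m \<Longrightarrow> (edge ts)\<^sup>*\<^sup>* (replicate (length ts) CS) (map C0 (f i))" for i
  proof (induction i)
    case 0
    have "edge ts (replicate (length ts) CS) (map C0 (f 0))"
      by (rule edge[OF transition.start]) (use len f(4) distinct in auto)
    then show ?case by blast
  next
    case (Suc i)
    have "edge ts (map C0 (f i)) (map C0 (f (Suc i)))"
    proof (rule edge[OF transition.stem])
      show "moves ts (f i) (f (Suc i))" using f(1,3) Suc.prems by simp
      show "\<exists>i'<n. u = f i'" if "map C0 (f i) = map C0 u" for u
        using inj[OF that] Suc.prems f(1) by (intro exI[of _ i]) simp
    qed (use distinct in blast)
    then show ?case using Suc by (meson Suc_leD rtranclp.rtrancl_into_rtrancl)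
  qed
  have loop: "m + i \<le> n \<Longrightarrow> (edge ts)\<^sup>*\<^sup>* (replicate (length ts) CS) (loop_cells ts (f (m + i)) (f m) (s (m + i)))" for i
  proof (induction i)
    case 0
    have "edge ts (map C0 (f m)) (loop_cells ts (f m) (f m) (\<lambda>_. False))"
    proof (rule edge[OF transition.enter])
      show "length (f m) = length ts" using len f(1) by simp
      show "\<exists>i<n. u = f i" if "map C0 (f m) = map C0 u" for u
        using inj[OF that] f(1) by (intro exI[of _ m]) simp
    qed (use distinct in blast)
    moreover have "s m = (\<lambda>_. False)" by (simp add: s_def)
    ultimately show ?case using stem[of m] by (simp add: rtranclp.rtrancl_into_rtrancl)
  next
    case (Suc i)
    have "edge ts (loop_cells ts (f (m + i)) (f m) (s (m + i)))
       (loop_cells ts (f (Suc (m + i))) (f m) (\<lambda>k. s (m + i) k \<or> fair_at ts (f (m + i)) k))"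
    proof (rule edge[OF transition.loop])
      fix u v s' assume u: "length u = length ts" "loop_cells ts (f (m + i)) (f m) (s (m + i)) = loop_cells ts u v s'"
      then have "u = f (m + i)" using loop_inj[OF u(2) _ u(1)] len[of "m + i"] Suc.prems by simp
      then show "\<exists>i<n. u = f i" using Suc.prems by (intro exI[of _ "m + i"]) simp
    next
      show "moves ts (f (m + i)) (f (Suc (m + i)))" using f(3) Suc.prems by simp
      show "length (f m) = length ts" using len f(1) by simp
    qed (use distinct in metis)
    moreover have "(\<lambda>k. s (m + i) k \<or> fair_at ts (f (m + i)) k) = s (m + Suc i)"
      by (auto simp: s_def atLeastLessThanSuc)
    ultimately show ?case using Suc by (simp add: rtranclp.rtrancl_into_rtrancl)
  qed
  have "loop_cells ts (f n) (f m) (s n) = loop_cells ts (f m) (f m) (\<lambda>_. True)"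
    unfolding f(2) by (rule loop_cells_cong) (use f(5) in \<open>simp add: s_def\<close>)
  moreover have "edge ts (loop_cells ts (f m) (f m) (\<lambda>_. True)) (replicate (length ts) CE)"
  proof (rule edge[OF transition.final])
    fix u v s' assume u: "length u = length ts" "loop_cells ts (f m) (f m) (\<lambda>_. True) = loop_cells ts u v s'"
    then have "u = f m" using loop_inj[OF u(2) _ u(1)] len[of m] f(1) by simp
    then show "\<exists>i<n. u = f i" using f(1) by (intro exI[of _ m]) simp
  next
    show "length (f m) = length ts" using len f(1) by simp
  qed (use distinct in metis)
  ultimately show ?thesis using loop[of "n - m"] f(1) by (simp add: rtranclp.rtrancl_into_rtrancl)
qed

theorem satisfiable_iff_edges:
  assumes "well_formed ts"
  shows "satisfiable (node ts (length ts - 1)) \<longleftrightarrow>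
    (edge ts)\<^sup>*\<^sup>* (replicate (length ts) CS) (replicate (length ts) CE)"
proof -
  have "(transition ts)\<^sup>*\<^sup>* a b" if "(edge ts)\<^sup>*\<^sup>* a b" for a b
    using that edge_transition[OF assms] by (induction rule: rtranclp_induct) (auto intro: rtranclp.rtrancl_into_rtrancl)
  then show ?thesis
    using satisfiable_iff_lasso[OF assms] transitions_lasso well_formed_root(1)[OF assms] lasso_edges[OF assms] by blast
qed

section \<open>Running stack programs\<close>

text \<open>The number of steps is forgotten: membership needs termination and a bound on the stacks
  only.\<close>

definition runs :: "nat \<Rightarrow> cmd \<Rightarrow> stacks \<Rightarrow> stacks \<Rightarrow> bool" where
  "runs B c \<sigma> \<tau> \<longleftrightarrow> (\<exists>m. exec (\<lambda>l. l \<le> B) c \<sigma> m \<tau>)"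

lemma runs_Skip: "runs B Skip \<sigma> \<sigma>"
  unfolding runs_def by (blast intro: exec.Skip)

lemma runs_Push: "length (\<sigma> j) < B \<Longrightarrow> runs B (Push j a) \<sigma> (\<sigma>(j := a # \<sigma> j))"
  unfolding runs_def by (blast intro: exec.Push Suc_leI)

lemma runs_Pop: "runs B (Pop j) \<sigma> (\<sigma>(j := tl (\<sigma> j)))"
  unfolding runs_def by (blast intro: exec.Pop)

lemma runs_Seq: "runs B c \<sigma> \<tau> \<Longrightarrow> runs B d \<tau> \<rho> \<Longrightarrow> runs B (Seq c d) \<sigma> \<rho>"
  unfolding runs_def by (blast intro: exec.Seq)

lemma runs_Switch: "runs B (f (hd0 (\<sigma> j))) \<sigma> \<tau> \<Longrightarrow> runs B (Switch j f) \<sigma> \<tau>"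
  unfolding runs_def by (blast intro: exec.Switch)

lemma runs_While_end: "\<sigma> j = [] \<Longrightarrow> runs B (While j c) \<sigma> \<sigma>"
  unfolding runs_def by (blast intro: exec.While_end)

lemma runs_While_step: "\<sigma> j \<noteq> [] \<Longrightarrow> runs B c \<sigma> \<tau> \<Longrightarrow> runs B (While j c) \<tau> \<rho> \<Longrightarrow> runs B (While j c) \<sigma> \<rho>"
  unfolding runs_def by (blast intro: exec.While_step)

lemma runs_eq: "runs B c \<sigma> \<tau> \<Longrightarrow> \<tau> = \<rho> \<Longrightarrow> runs B c \<sigma> \<rho>"
  by simp

lemma runs_For:
  assumes step: "\<And>xs a ys. zs = xs @ a # ys \<Longrightarrow> runs B (f a) ((S xs)(j := ys)) ((S (xs @ [a]))(j := ys))"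
    and "\<sigma> = (S [])(j := zs)" "\<tau> = (S zs)(j := [])"
  shows "runs B (For j f) \<sigma> \<tau>"
proof -
  have "zs = xs @ ys \<Longrightarrow> runs B (For j f) ((S xs)(j := ys)) ((S zs)(j := []))" for xs ys
  proof (induction ys arbitrary: xs)
    case Nil
    then have "zs = xs" by simp
    show ?case unfolding For_def \<open>zs = xs\<close> by (rule runs_While_end) simp
  next
    case (Cons a ys)
    have "runs B (Pop j) ((S xs)(j := a # ys)) ((S xs)(j := ys))"
      using runs_Pop[of B j "(S xs)(j := a # ys)"] by simp
    from runs_Seq[OF this step[OF Cons.prems]]
    have "runs B (Switch j (\<lambda>a. Seq (Pop j) (f a))) ((S xs)(j := a # ys)) ((S (xs @ [a]))(j := ys))"
      by (intro runs_Switch) simp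
    moreover have "runs B (For j f) ((S (xs @ [a]))(j := ys)) ((S zs)(j := []))"
      by (rule Cons.IH) (use Cons.prems in simp)
    ultimately show ?case unfolding For_def by (rule runs_While_step[rotated]) simp
  qed
  from this[of "[]" zs] show ?thesis using assms(2,3) by simp
qed

text \<open>The guard keeps programs well-formed on symbols that do not occur.\<close>

definition put :: "nat \<Rightarrow> nat \<Rightarrow> nat \<Rightarrow> cmd" where
  "put n j a = (if 0 < a \<and> a < n then Push j a else Skip)"

lemma wf_put [simp]: "wf_cmd n K (put n j a)" if "0 < j" "j \<le> K"
  using that by (simp add: put_def)

lemma runs_put: "0 < a \<Longrightarrow> a < n \<Longrightarrow> length (\<sigma> j) < B \<Longrightarrow> runs B (put n j a) \<sigma> (\<sigma>(j := a # \<sigma> j))"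
  by (simp add: put_def runs_Push)

definition clear :: "nat \<Rightarrow> cmd" where
  "clear j = For j (\<lambda>_. Skip)"

lemma wf_clear [simp]: "wf_cmd n K (clear j) \<longleftrightarrow> 0 < j \<and> j \<le> K"
  by (simp add: clear_def)

lemma runs_clear: "runs B (clear j) \<sigma> (\<sigma>(j := []))"
  unfolding clear_def by (rule runs_For[where S = "\<lambda>_. \<sigma>" and zs = "\<sigma> j"]) (auto intro: runs_Skip)

text \<open>\<open>move n i j\<close> reverses stack \<open>i\<close> onto stack \<open>j\<close>.\<close>

definition move :: "nat \<Rightarrow> nat \<Rightarrow> nat \<Rightarrow> cmd" where
  "move n i j = For i (put n j)"

lemma wf_move [simp]: "0 < i \<Longrightarrow> i \<le> K \<Longrightarrow> 0 < j \<Longrightarrow> j \<le> K \<Longrightarrow> wf_cmd n K (move n i j)"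
  by (simp add: move_def)

lemma runs_move:
  assumes "i \<noteq> j" "set (\<sigma> i) \<subseteq> {0<..<n}" "length (\<sigma> i) + length (\<sigma> j) \<le> B"
  shows "runs B (move n i j) \<sigma> (\<sigma>(i := [], j := rev (\<sigma> i) @ \<sigma> j))"
  unfolding move_def
proof (rule runs_For[where S = "\<lambda>xs. \<sigma>(j := rev xs @ \<sigma> j)" and zs = "\<sigma> i"])
  fix xs a ys assume zs: "\<sigma> i = xs @ a # ys"
  show "runs B (put n j a) (\<sigma>(j := rev xs @ \<sigma> j, i := ys)) (\<sigma>(j := rev (xs @ [a]) @ \<sigma> j, i := ys))"
    by (rule runs_eq[OF runs_put]) (use zs assms in \<open>auto simp: fun_eq_iff\<close>)
qed (use assms in \<open>auto simp: fun_eq_iff\<close>)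

text \<open>A loop that keeps its stack: the symbols read are parked on stack \<open>j\<close> and
  moved back at the end.\<close>

definition traverse :: "nat \<Rightarrow> nat \<Rightarrow> nat \<Rightarrow> (nat \<Rightarrow> cmd) \<Rightarrow> cmd" where
  "traverse n i j f = Seq (For i (\<lambda>a. Seq (put n j a) (f a))) (move n j i)"

lemma wf_traverse [simp]:
  "0 < i \<Longrightarrow> i \<le> K \<Longrightarrow> 0 < j \<Longrightarrow> j \<le> K \<Longrightarrow> (\<And>a. wf_cmd n K (f a)) \<Longrightarrow> wf_cmd n K (traverse n i j f)"
  by (simp add: traverse_def)

lemma runs_traverse:
  assumes "i \<noteq> j" "set zs \<subseteq> {0<..<n}" "length zs \<le> B"
    and step: "\<And>xs a ys. zs = xs @ a # ys \<Longrightarrow>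
      runs B (f a) ((S xs)(i := ys, j := a # rev xs)) ((S (xs @ [a]))(i := ys, j := a # rev xs))"
    and "\<sigma> = (S [])(i := zs, j := [])" "\<tau> = (S zs)(i := zs, j := [])"
  shows "runs B (traverse n i j f) \<sigma> \<tau>"
proof -
  let ?\<rho> = "(S zs)(i := [], j := rev zs)"
  have "runs B (For i (\<lambda>a. Seq (put n j a) (f a))) \<sigma> ?\<rho>"
  proof (rule runs_For[where S = "\<lambda>xs. (S xs)(j := rev xs)" and zs = zs])
    fix xs a ys assume zs: "zs = xs @ a # ys"
    let ?\<sigma> = "(S xs)(j := rev xs, i := ys)"
    have "runs B (put n j a) ?\<sigma> (?\<sigma>(j := a # ?\<sigma> j))"
      by (rule runs_put) (use zs assms(1-3) in auto)
    moreover have "?\<sigma>(j := a # ?\<sigma> j) = (S xs)(i := ys, j := a # rev xs)"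
      using assms(1) by (auto simp: fun_eq_iff)
    ultimately have "runs B (put n j a) ?\<sigma> ((S xs)(i := ys, j := a # rev xs))" by simp
    from runs_Seq[OF this step[OF zs]]
    show "runs B (Seq (put n j a) (f a)) ((S xs)(j := rev xs, i := ys)) ((S (xs @ [a]))(j := rev (xs @ [a]), i := ys))"
      using assms(1) by (simp add: fun_upd_twist)
  qed (use assms(1,5) in \<open>auto simp: fun_eq_iff\<close>)
  moreover have "runs B (move n j i) ?\<rho> (?\<rho>(j := [], i := rev (?\<rho> j) @ ?\<rho> i))"
    by (rule runs_move) (use assms(1-3) in auto)
  then have "runs B (move n j i) ?\<rho> \<tau>"
    by (rule runs_eq) (use assms(1,6) in \<open>auto simp: fun_eq_iff\<close>)
  ultimately show ?thesis unfolding traverse_def by (rule runs_Seq)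
qed

section \<open>Evaluation of quantifier trees\<close>

text \<open>
  A path through the tree lists the choices made, the latest first; choice \<open>c\<close> is \<open>2 * c + 1\<close>
  at an existential and \<open>2 * c + 2\<close> at a universal node. In the list of the remaining
  quantifiers, 1 is existential and 2 universal.
\<close>

fun qeval :: "nat \<Rightarrow> (nat list \<Rightarrow> bool) \<Rightarrow> nat list \<Rightarrow> nat list \<Rightarrow> bool" where
  "qeval k R [] xs = R xs"
| "qeval k R (q # qs) xs = (if q = 1 then \<exists>c<k. qeval k R qs ((2 * c + 1) # xs) else \<forall>c<k. qeval k R qs ((2 * c + 2) # xs))"

text \<open>Stacks: 5 remaining quantifiers, 6 path, 7 value of the subtree just left, 8 loop flag.\<close>

definition search_step :: "nat \<Rightarrow> nat \<Rightarrow> cmd \<Rightarrow> cmd" where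
  "search_step n k leaf = Switch 7 (\<lambda>r. if r = 0
     then Switch 5 (\<lambda>q. if q = 0 then leaf else Seq (Pop 5) (Push 6 (if q = 1 then 1 else 2)))
     else Switch 6 (\<lambda>x. if x = 0 then Pop 8 else Seq (Pop 6)
       (if (odd x \<longleftrightarrow> r = 2) \<or> (x - 1) div 2 + 1 \<ge> k then Push 5 (if odd x then 1 else 2)
        else Seq (put n 6 (x + 2)) (Pop 7))))"

definition search :: "nat \<Rightarrow> nat \<Rightarrow> cmd \<Rightarrow> cmd" where
  "search n k leaf = Seq (Push 8 1) (While 8 (search_step n k leaf))"

lemma wf_search: "3 \<le> n \<Longrightarrow> 8 \<le> K \<Longrightarrow> wf_cmd n K leaf \<Longrightarrow> wf_cmd n K (search n k leaf)"
  by (simp add: search_def search_step_def)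

context
  fixes \<sigma> :: stacks and n k :: nat and leaf :: cmd and R :: "nat list \<Rightarrow> bool" and B :: nat and Q :: "nat list"
  assumes leaf: "\<And>xs. length xs = length Q \<Longrightarrow> set xs \<subseteq> {0<..2 * k} \<Longrightarrow> map (\<lambda>x. if odd x then 1 else 2) xs = rev Q \<Longrightarrow>
      runs B leaf (\<sigma>(5 := [], 6 := xs, 7 := [], 8 := [1])) (\<sigma>(5 := [], 6 := xs, 7 := [if R xs then 2 else 1], 8 := [1]))"
    and k: "0 < k" and n: "2 * k < n" and B: "length Q < B" and Q: "set Q \<subseteq> {1, 2}"
begin

definition conf :: "nat list \<Rightarrow> nat list \<Rightarrow> nat list \<Rightarrow> stacks" where
  "conf qs xs r = \<sigma>(5 := qs, 6 := xs, 7 := r, 8 := [1])"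

definition kinds :: "nat list \<Rightarrow> nat list" where
  "kinds xs = map (\<lambda>x. if odd x then 1 else 2) xs"

abbreviation "loop \<equiv> While 8 (search_step n k leaf)"

definition valid_path :: "nat list \<Rightarrow> nat list \<Rightarrow> bool" where
  "valid_path qs xs \<longleftrightarrow> rev (kinds xs) @ qs = Q \<and> set xs \<subseteq> {0<..2 * k}"

lemma loop_step: "runs B (search_step n k leaf) (conf qs xs r) \<tau> \<Longrightarrow> runs B loop \<tau> \<rho> \<Longrightarrow> runs B loop (conf qs xs r) \<rho>"
  by (rule runs_While_step) (simp add: conf_def)

lemma hd0_conf [simp]: "hd0 (conf qs xs r 5) = hd0 qs" "hd0 (conf qs xs r 6) = hd0 xs" "hd0 (conf qs xs r 7) = hd0 r"
  by (simp_all add: conf_def)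

lemma search_step_up:
  assumes "runs B (Seq (Pop 6) (if (odd x \<longleftrightarrow> r = 2) \<or> (x - 1) div 2 + 1 \<ge> k then Push 5 (if odd x then 1 else 2)
      else Seq (put n 6 (x + 2)) (Pop 7))) (conf qs (x # xs) [r]) \<tau>" "x \<noteq> 0" "r \<noteq> 0"
  shows "runs B (search_step n k leaf) (conf qs (x # xs) [r]) \<tau>"
  unfolding search_step_def
  by (rule runs_Switch, simp only: hd0_conf hd0_simps assms(3) if_False, rule runs_Switch)
    (use assms in \<open>simp only: hd0_conf hd0_simps if_False\<close>)

lemma valid_pathD:
  assumes "valid_path qs xs"
  shows "length qs + length xs < B" "set qs \<subseteq> {1, 2}"
proof -
  have "length Q = length xs + length qs" "set qs \<subseteq> set Q"
    using assms by (auto simp: valid_path_def kinds_def)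
  then show "length qs + length xs < B" "set qs \<subseteq> {1, 2}" using B Q by auto
qed

text \<open>Depth-first search without recursion. The parity of a choice tells which quantifier it
  answers. A value on stack 7 means climbing: if it settles the node or no branch is left, the
  quantifier is put back and the value passed up; otherwise the choice is replaced by the next one
  and the value dropped. The continuation \<open>\<tau>\<close> lets the induction speak about the
  remaining iterations of one loop.\<close>

lemma search_subtree:
  assumes "valid_path qs xs" "runs B loop (conf qs xs [if qeval k R qs xs then 2 else 1]) \<tau>"
  shows "runs B loop (conf qs xs []) \<tau>"
  using assms
proof (induction qs arbitrary: xs \<tau>)
  case Nil
  then have "kinds xs = rev Q" "length xs = length Q"
    by (auto simp: valid_path_def kinds_def)
  then have "runs B leaf (conf [] xs []) (conf [] xs [if R xs then 2 else 1])"
    using leaf[of xs] Nil.prems(1) by (simp add: conf_def valid_path_def kinds_def)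
  then have "runs B (search_step n k leaf) (conf [] xs []) (conf [] xs [if R xs then 2 else 1])"
    unfolding search_step_def by (intro runs_Switch) (simp add: conf_def runs_Switch)
  then show ?case using loop_step Nil.prems(2) by simp
next
  case (Cons q qs)
  have q: "q = 1 \<or> q = 2" using valid_pathD(2)[OF Cons.prems(1)] by auto
  define code where "code = (\<lambda>c :: nat. 2 * c + (if q = 1 then 1 else 2 :: nat))"
  \<comment> \<open>A branch that settles its node: true below an existential, false below a
    universal quantifier.\<close>
  define hit where "hit = (\<lambda>c. qeval k R qs (code c # xs) = (q = 1))"
  have val: "qeval k R (q # qs) xs \<longleftrightarrow> ((\<exists>c<k. hit c) \<longleftrightarrow> q = 1)"
    using q by (auto simp: hit_def code_def)
  have valid: "valid_path qs (code c # xs)" if "c < k" for c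
    using Cons.prems(1) that q by (auto simp: valid_path_def kinds_def code_def)
  have len: "length qs + length xs + 1 < B"
    using valid_pathD(1)[OF Cons.prems(1)] by simp
  have c_code: "odd (code c) \<longleftrightarrow> q = 1" "(code c - 1) div 2 = c" "code c \<noteq> 0" "code c + 2 = code (c + 1)" for c
    using q by (auto simp: code_def)
  \<comment> \<open>An inner induction over the branches not yet visited; the outer one deals with
    each subtree.\<close>
  have up: "runs B loop (conf qs (code c # xs) [if qeval k R qs (code c # xs) then 2 else 1]) \<tau>"
    if c: "c < k" "\<And>c'. c' < c \<Longrightarrow> \<not> hit c'" for c
    using c
  proof (induction "k - c" arbitrary: c rule: less_induct)
    case less
    let ?r = "if qeval k R qs (code c # xs) then 2 else 1 :: nat"
    show ?case
    proof (cases "hit c \<or> c + 1 \<ge> k")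
      case True
      have "runs B (search_step n k leaf) (conf qs (code c # xs) [?r]) (conf (q # qs) xs [?r])"
      proof -
        have cond: "(odd (code c) \<longleftrightarrow> ?r = 2) \<or> (code c - 1) div 2 + 1 \<ge> k"
          using True c_code by (auto simp: hit_def)
        have "runs B (Push 5 (if odd (code c) then 1 else 2)) (conf qs xs [?r]) (conf (q # qs) xs [?r])"
          by (rule runs_eq[OF runs_Push]) (use len q c_code(1)[of c] in \<open>auto simp: conf_def fun_eq_iff\<close>)
        moreover have "runs B (Pop 6) (conf qs (code c # xs) [?r]) (conf qs xs [?r])"
          by (rule runs_eq[OF runs_Pop]) (auto simp: conf_def fun_eq_iff)
        ultimately have "runs B (Seq (Pop 6) (if (odd (code c) \<longleftrightarrow> ?r = 2) \<or> (code c - 1) div 2 + 1 \<ge> k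
            then Push 5 (if odd (code c) then 1 else 2) else Seq (put n 6 (code c + 2)) (Pop 7)))
            (conf qs (code c # xs) [?r]) (conf (q # qs) xs [?r])"
          using cond runs_Seq by simp
        then show ?thesis
          by (rule search_step_up) (use c_code(3)[of c] in auto)
      qed
      moreover have "(if qeval k R (q # qs) xs then 2 else 1) = ?r"
      proof (cases "hit c")
        case True
        then have "\<exists>c<k. hit c" using less.prems(1) by blast
        then show ?thesis using val True by (simp add: hit_def del: qeval.simps)
      next
        case False
        then have "\<not> (\<exists>c<k. hit c)"
          using less.prems True by (metis Suc_eq_plus1 Suc_leI le_antisym less_antisym)
        then show ?thesis using val False by (auto simp add: hit_def simp del: qeval.simps)
      qed
      then have "runs B loop (conf (q # qs) xs [?r]) \<tau>" using Cons.prems(2) by (simp only:)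
      ultimately show ?thesis by (rule loop_step)
    next
      case False
      have "runs B (search_step n k leaf) (conf qs (code c # xs) [?r]) (conf qs (code (c + 1) # xs) [])"
      proof -
        have cond: "\<not> ((odd (code c) \<longleftrightarrow> ?r = 2) \<or> (code c - 1) div 2 + 1 \<ge> k)"
          using False c_code by (auto simp: hit_def)
        have "code (c + 1) < n" using False n q by (auto simp: code_def)
        then have "runs B (put n 6 (code c + 2)) (conf qs xs [?r]) (conf qs (code (c + 1) # xs) [?r])"
          by (intro runs_eq[OF runs_put]) (use len c_code(4)[of c] in \<open>auto simp: conf_def fun_eq_iff\<close>)
        moreover have "runs B (Pop 7) (conf qs (code (c + 1) # xs) [?r]) (conf qs (code (c + 1) # xs) [])"
          by (rule runs_eq[OF runs_Pop]) (auto simp: conf_def fun_eq_iff)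
        moreover have "runs B (Pop 6) (conf qs (code c # xs) [?r]) (conf qs xs [?r])"
          by (rule runs_eq[OF runs_Pop]) (auto simp: conf_def fun_eq_iff)
        ultimately have "runs B (Seq (Pop 6) (if (odd (code c) \<longleftrightarrow> ?r = 2) \<or> (code c - 1) div 2 + 1 \<ge> k
            then Push 5 (if odd (code c) then 1 else 2) else Seq (put n 6 (code c + 2)) (Pop 7)))
            (conf qs (code c # xs) [?r]) (conf qs (code (c + 1) # xs) [])"
          using cond runs_Seq by simp
        then show ?thesis
          by (rule search_step_up) (use c_code(3)[of c] in auto)
      qed
      moreover have "runs B loop (conf qs (code (c + 1) # xs) []) \<tau>"
      proof (rule Cons.IH)
        show "valid_path qs (code (c + 1) # xs)" using valid False by simp
        show "runs B loop (conf qs (code (c + 1) # xs) [if qeval k R qs (code (c + 1) # xs) then 2 else 1]) \<tau>"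
          by (rule less.hyps) (use less.prems False in \<open>auto simp: less_Suc_eq\<close>)
      qed
      ultimately show ?thesis by (rule loop_step)
    qed
  qed
  have "runs B (search_step n k leaf) (conf (q # qs) xs []) (conf qs (code 0 # xs) [])"
  proof -
    have "runs B (Pop 5) (conf (q # qs) xs []) (conf qs xs [])"
      by (rule runs_eq[OF runs_Pop]) (auto simp: conf_def fun_eq_iff)
    moreover have "runs B (Push 6 (if q = 1 then 1 else 2)) (conf qs xs []) (conf qs (code 0 # xs) [])"
      by (rule runs_eq[OF runs_Push]) (use len in \<open>auto simp: conf_def fun_eq_iff code_def\<close>)
    ultimately have "runs B (Seq (Pop 5) (Push 6 (if q = 1 then 1 else 2))) (conf (q # qs) xs []) (conf qs (code 0 # xs) [])"
      by (rule runs_Seq)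
    then show ?thesis
      unfolding search_step_def using q by (intro runs_Switch) (auto simp add: conf_def intro!: runs_Switch)
  qed
  moreover have "runs B loop (conf qs (code 0 # xs) []) \<tau>"
    by (rule Cons.IH[OF valid[OF k]]) (use up[of 0] k in simp)
  ultimately show ?case by (rule loop_step)
qed

lemma runs_search:
  assumes "\<sigma> 8 = []"
  shows "runs B (search n k leaf) (\<sigma>(5 := Q, 6 := [], 7 := [])) (\<sigma>(5 := Q, 6 := [], 7 := [if qeval k R Q [] then 2 else 1]))"
proof -
  let ?\<tau> = "\<sigma>(5 := Q, 6 := [], 7 := [if qeval k R Q [] then 2 else 1])"
  have "runs B (Pop 8) (conf Q [] [if qeval k R Q [] then 2 else 1]) ?\<tau>"
    by (rule runs_eq[OF runs_Pop]) (use assms in \<open>auto simp: conf_def fun_eq_iff\<close>)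
  then have "runs B (search_step n k leaf) (conf Q [] [if qeval k R Q [] then 2 else 1]) ?\<tau>"
    unfolding search_step_def by (intro runs_Switch) (simp add: conf_def runs_Switch)
  moreover have "runs B loop ?\<tau> ?\<tau>" using assms by (intro runs_While_end) simp
  ultimately have "runs B loop (conf Q [] [if qeval k R Q [] then 2 else 1]) ?\<tau>" by (rule loop_step)
  then have "runs B loop (conf Q [] []) ?\<tau>"
    by (rule search_subtree[rotated]) (simp add: valid_path_def kinds_def)
  moreover have "runs B (Push 8 1) (\<sigma>(5 := Q, 6 := [], 7 := [])) (conf Q [] [])"
    by (rule runs_eq[OF runs_Push]) (use assms B in \<open>auto simp: conf_def fun_eq_iff\<close>)
  ultimately show ?thesis unfolding search_def by (intro runs_Seq)
qed

end

section \<open>Savitch's algorithm as a quantifier tree\<close>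

lemma qeval_exists_block:
  "qeval k R (replicate l 1 @ qs) xs \<longleftrightarrow>
    (\<exists>u. length u = l \<and> set u \<subseteq> {..<k} \<and> qeval k R qs (rev (map (\<lambda>c. 2 * c + 1) u) @ xs))"
proof (induction l arbitrary: xs)
  case (Suc l)
  have "(\<exists>u. length u = Suc l \<and> set u \<subseteq> {..<k} \<and> P u) \<longleftrightarrow>
      (\<exists>c<k. \<exists>u. length u = l \<and> set u \<subseteq> {..<k} \<and> P (c # u))" for P
  proof -
    have "(\<forall>u. length u = Suc l \<and> set u \<subseteq> {..<k} \<longrightarrow> \<not> P u) \<longleftrightarrow>
        (\<forall>c<k. \<forall>u. length u = l \<and> set u \<subseteq> {..<k} \<longrightarrow> \<not> P (c # u))"
      by (auto simp: length_Suc_conv)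
    then show ?thesis by blast
  qed
  then show ?case using Suc by simp
qed simp

lemma qeval_forall_block:
  "qeval k R (replicate l 2 @ qs) xs \<longleftrightarrow>
    (\<forall>u. length u = l \<and> set u \<subseteq> {..<k} \<longrightarrow> qeval k R qs (rev (map (\<lambda>c. 2 * c + 2) u) @ xs))"
proof (induction l arbitrary: xs)
  case (Suc l)
  have "(\<forall>u. length u = Suc l \<and> set u \<subseteq> {..<k} \<longrightarrow> P u) \<longleftrightarrow>
      (\<forall>c<k. \<forall>u. length u = l \<and> set u \<subseteq> {..<k} \<longrightarrow> P (c # u))" for P
    by (auto simp: length_Suc_conv)
  then show ?case using Suc by simp
qed simp

lemma qeval_False:
  assumes "\<And>xs. \<not> R xs" "0 < k"
  shows "\<not> qeval k R qs xs"
  using assms by (induction qs arbitrary: xs) auto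

text \<open>
  A path encodes a run of Savitch's algorithm: a block of existential choices is a midpoint, the
  universal choice behind it selects the second half (0 replaces the right end) or the first.
  Universal choices not preceded by a block are collected in the last component.
\<close>

definition decode_step :: "nat \<Rightarrow> nat list \<times> nat list \<times> nat list \<times> nat list \<Rightarrow> nat list \<times> nat list \<times> nat list \<times> nat list" where
  "decode_step x = (\<lambda>(M, a, b, z). let c = (x - 1) div 2 in
     if odd x then (Suc c # M, a, b, z) else if M = [] then (M, a, b, Suc c # z)
     else if c = 0 then ([], a, rev M, z) else ([], rev M, b, z))"

definition decode :: "nat list \<Rightarrow> nat list \<Rightarrow> nat list \<Rightarrow> nat list \<times> nat list \<times> nat list \<times> nat list" where
  "decode a b xs = fold decode_step (rev xs) ([], a, b, [])"

definition vectors :: "nat \<Rightarrow> nat \<Rightarrow> nat list set" where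
  "vectors k l = {u. length u = l \<and> set u \<subseteq> {0<..k}}"

lemma finite_vectors: "finite (vectors k l)"
  unfolding vectors_def by (rule finite_subset[OF _ finite_lists_length_eq[of "{0<..k}" l]]) auto

lemma card_vectors: "card (vectors k l) = k ^ l"
proof -
  have "vectors k l = {xs. set xs \<subseteq> {0<..k} \<and> length xs = l}" by (auto simp: vectors_def)
  then show ?thesis using card_lists_length_eq[of "{0<..k}" l] by simp
qed

lemma vectors_Suc: "u \<in> vectors k l \<longleftrightarrow> (\<exists>v. u = map Suc v \<and> length v = l \<and> set v \<subseteq> {..<k})"
proof
  assume u: "u \<in> vectors k l"
  have "map Suc (map (\<lambda>x. x - 1) u) = u"
    unfolding map_map by (rule map_idI) (use u in \<open>auto simp: vectors_def\<close>)
  then show "\<exists>v. u = map Suc v \<and> length v = l \<and> set v \<subseteq> {..<k}"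
  proof (intro exI[of _ "map (\<lambda>x. x - 1) u"] conjI)
    show "set (map (\<lambda>x. x - 1) u) \<subseteq> {..<k}" using u by (fastforce simp: vectors_def)
  qed (use u in \<open>auto simp: vectors_def\<close>)
qed (fastforce simp: vectors_def Suc_le_eq)

lemma decode_exists_block:
  assumes "decode a0 b0 xs = (M, a, b, z)"
  shows "decode a0 b0 (rev (map (\<lambda>c. 2 * c + 1) u) @ xs) = (rev (map Suc u) @ M, a, b, z)"
  using assms
proof (induction u rule: rev_induct)
  case (snoc c u)
  then show ?case by (simp add: decode_def decode_step_def)
qed simp

lemma decode_forall_block:
  assumes "decode a0 b0 xs = ([], a, b, z)"
  shows "decode a0 b0 (rev (map (\<lambda>c. 2 * c + 2) u) @ xs) = ([], a, b, rev (map Suc u) @ z)"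
  using assms
proof (induction u rule: rev_induct)
  case (snoc c u)
  then show ?case by (simp add: decode_def decode_step_def)
qed simp

definition leaf_relation :: "nat \<Rightarrow> nat \<Rightarrow> nat \<Rightarrow> (nat list \<Rightarrow> nat list \<Rightarrow> nat list \<Rightarrow> bool) \<Rightarrow> nat list rel" where
  "leaf_relation k l m P = {(a, b). a \<in> vectors k l \<and> b \<in> vectors k l \<and> (\<forall>z\<in>vectors k m. P z a b)}"

text \<open>Each of the \<open>K\<close> rounds halves the path: \<open>l\<close> existential
  choices spell the midpoint and one universal choice picks a half. The last \<open>m\<close>
  universal choices spell the variable name for which the edge is checked.\<close>

definition savitch_pattern :: "nat \<Rightarrow> nat \<Rightarrow> nat \<Rightarrow> nat list" where
  "savitch_pattern l m K = concat (replicate K (replicate l 1 @ [2])) @ replicate m 2"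

lemma length_savitch_pattern: "length (savitch_pattern l m K) = K * (l + 1) + m"
  by (induction K) (auto simp: savitch_pattern_def)

text \<open>A path of length 2 ^ (K + 1) is two paths of half the length that meet in a midpoint.
  With \<open>0 < l\<close> the midpoint is nonempty, so the decoder can tell the universal choice
  after it from those of the tail; with \<open>2 \<le> k\<close> both halves can be chosen.\<close>

lemma qeval_savitch:
  assumes "0 < l" "2 \<le> k" and R: "\<And>xs M a b z. decode a0 b0 xs = (M, a, b, z) \<Longrightarrow> R xs \<longleftrightarrow> P z a b"
    and "decode a0 b0 xs = ([], a, b, [])" "a \<in> vectors k l" "b \<in> vectors k l"
  shows "qeval k R (savitch_pattern l m K) xs \<longleftrightarrow> (a, b) \<in> leaf_relation k l m P ^^ (2 ^ K)"
  using assms(4-6)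
proof (induction K arbitrary: xs a b)
  case 0
  have "qeval k R (replicate m 2 @ []) xs \<longleftrightarrow>
      (\<forall>u. length u = m \<and> set u \<subseteq> {..<k} \<longrightarrow> P (rev (map Suc u)) a b)"
    unfolding qeval_forall_block using R[OF decode_forall_block[OF 0(1)]] by simp
  also have "\<dots> \<longleftrightarrow> (\<forall>z\<in>vectors k m. P z a b)"
  proof
    assume *: "\<forall>u. length u = m \<and> set u \<subseteq> {..<k} \<longrightarrow> P (rev (map Suc u)) a b"
    show "\<forall>z\<in>vectors k m. P z a b"
    proof
      fix z assume "z \<in> vectors k m"
      then obtain v where "z = map Suc v" "length v = m" "set v \<subseteq> {..<k}" using vectors_Suc by blast
      then show "P z a b" using *[rule_format, of "rev v"] by (simp add: rev_map)
    qed
  next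
    assume *: "\<forall>z\<in>vectors k m. P z a b"
    have "rev (map Suc u) \<in> vectors k m" if "length u = m" "set u \<subseteq> {..<k}" for u
      using that by (auto simp: vectors_def)
    then show "\<forall>u. length u = m \<and> set u \<subseteq> {..<k} \<longrightarrow> P (rev (map Suc u)) a b" using * by blast
  qed
  finally show ?case using 0 by (simp add: savitch_pattern_def leaf_relation_def)
next
  case (Suc K)
  let ?R = "leaf_relation k l m P"
  have pat: "savitch_pattern l m (Suc K) = replicate l 1 @ 2 # savitch_pattern l m K"
    by (simp add: savitch_pattern_def)
  have step: "qeval k R (2 # savitch_pattern l m K) (rev (map (\<lambda>c. 2 * c + 1) u) @ xs) \<longleftrightarrow>
      (a, map Suc u) \<in> ?R ^^ (2 ^ K) \<and> (map Suc u, b) \<in> ?R ^^ (2 ^ K)"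
    if u: "length u = l" "set u \<subseteq> {..<k}" for u
  proof -
    let ?xs = "rev (map (\<lambda>c. 2 * c + 1) u) @ xs"
    have v: "map Suc u \<in> vectors k l" using u by (auto simp: vectors_def)
    have "u \<noteq> []" using u(1) assms(1) by auto
    then have d: "decode a0 b0 ((2 * c + 2) # ?xs) = ([], if c = 0 then a else map Suc u, if c = 0 then map Suc u else b, [])" for c
      using decode_exists_block[OF Suc.prems(1), of u] by (auto simp: decode_def decode_step_def rev_map)
    have "qeval k R (savitch_pattern l m K) ((2 * c + 2) # ?xs) \<longleftrightarrow>
       (if c = 0 then (a, map Suc u) \<in> ?R ^^ (2 ^ K) else (map Suc u, b) \<in> ?R ^^ (2 ^ K))" for c
      using Suc.IH[OF d[of c]] v Suc.prems(2,3) by simp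
    then show ?thesis using assms(2) by (auto dest: spec[of _ 0] spec[of _ 1])
  qed
  have "qeval k R (savitch_pattern l m (Suc K)) xs \<longleftrightarrow>
      (\<exists>v\<in>vectors k l. (a, v) \<in> ?R ^^ (2 ^ K) \<and> (v, b) \<in> ?R ^^ (2 ^ K))"
    unfolding pat qeval_exists_block using step vectors_Suc[of _ k l] by metis
  also have "\<dots> \<longleftrightarrow> (a, b) \<in> ?R ^^ (2 ^ K) O ?R ^^ (2 ^ K)"
  proof -
    have "v \<in> vectors k l" if "(a, v) \<in> ?R ^^ (2 ^ K)" for v
    proof -
      obtain n where "2 ^ K = Suc n" by (metis not0_implies_Suc power_not_zero zero_neq_numeral)
      then show ?thesis using that by (auto simp: leaf_relation_def)
    qed
    then show ?thesis by blast
  qed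
  also have "?R ^^ (2 ^ K) O ?R ^^ (2 ^ K) = ?R ^^ (2 ^ Suc K)"
    by (simp add: relpow_add[symmetric] mult_2)
  finally show ?case .
qed

text \<open>A reachable vector is reached within as many steps as there are pairs of vectors, at
  most 2 ^ (c * l). The loop at \<open>a\<close> pads a shorter path to exactly this length.\<close>

lemma leaf_relation_rtrancl:
  assumes "(a, a) \<in> leaf_relation k l m P" "k * k \<le> 2 ^ c"
  shows "(a, b) \<in> leaf_relation k l m P ^^ (2 ^ (c * l)) \<longleftrightarrow> (a, b) \<in> (leaf_relation k l m P)\<^sup>*"
proof
  let ?R = "leaf_relation k l m P"
  have sub: "?R \<subseteq> vectors k l \<times> vectors k l" by (auto simp: leaf_relation_def)
  then have fin: "finite ?R" using finite_vectors finite_subset by blast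
  have "card ?R \<le> card (vectors k l \<times> vectors k l)"
    using sub finite_vectors by (intro card_mono) auto
  also have "\<dots> = (k * k) ^ l" by (simp add: card_cartesian_product card_vectors power_mult_distrib)
  also have "\<dots> \<le> (2 ^ c) ^ l" using assms(2) by (rule power_mono) simp
  finally have card: "card ?R \<le> 2 ^ (c * l)" by (simp add: power_mult)
  assume "(a, b) \<in> ?R\<^sup>*"
  then obtain n where n: "n \<le> card ?R" "(a, b) \<in> ?R ^^ n"
    using rtrancl_finite_eq_relpow[OF fin] by auto
  have "(a, a) \<in> ?R ^^ i" for i
    by (induction i) (use assms(1) in auto)
  then have "(a, b) \<in> ?R ^^ (2 ^ (c * l) - n) O ?R ^^ n" using n(2) by blast
  then show "(a, b) \<in> ?R ^^ (2 ^ (c * l))"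
    using n(1) card by (simp add: relpow_add[symmetric])
qed (rule relpow_imp_rtrancl)

section \<open>Checking an edge\<close>

text \<open>Symbol \<open>i\<close> stands for the \<open>i\<close>-th entry. The order matters for
  the first three, whose symbols 1, 2 and 3 are used explicitly.\<close>

definition cells :: "cell list" where
  "cells = [CS, CE, C0 False, C0 True, C1 False False False, C1 False False True, C1 False True False,
     C1 False True True, C1 True False False, C1 True False True, C1 True True False, C1 True True True]"

definition cell_of :: "nat \<Rightarrow> cell" where
  "cell_of x = cells ! (x - 1)"

lemma length_cells [simp]: "length cells = 12"
  by (simp add: cells_def)

lemma distinct_cells: "distinct cells"
  by (simp add: cells_def)

lemma set_cells: "set cells = UNIV"
proof -
  have "c \<in> set cells" for c
    by (cases c) (auto simp: cells_def)
  then show ?thesis by auto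
qed

lemma cell_of_inj: "x \<in> {0<..12} \<Longrightarrow> y \<in> {0<..12} \<Longrightarrow> cell_of x = cell_of y \<longleftrightarrow> x = y"
  using distinct_cells by (auto simp: cell_of_def nth_eq_iff_index_eq)

lemma cell_of_surj: "\<exists>x\<in>{0<..12}. cell_of x = c"
proof -
  obtain i where "i < 12" "cells ! i = c"
    using set_cells by (metis UNIV_I in_set_conv_nth length_cells)
  then show ?thesis by (intro bexI[of _ "Suc i"]) (auto simp: cell_of_def)
qed

lemma cell_of_simps: "cell_of 1 = CS" "cell_of 2 = CE" "cell_of 3 = C0 False"
  by (simp_all add: cell_of_def cells_def)

lemma vectors_nth: "a \<in> vectors k l \<Longrightarrow> i < l \<Longrightarrow> a ! i \<in> {0<..k}"
  unfolding vectors_def using nth_mem by blast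

lemma cells_surj: "length c = l \<Longrightarrow> \<exists>a\<in>vectors 12 l. map cell_of a = c"
proof -
  assume l: "length c = l"
  have "\<forall>x. \<exists>y. y \<in> {0<..12} \<and> cell_of y = x" using cell_of_surj by blast
  then obtain g where g: "\<And>x. g x \<in> {0<..12}" "\<And>x. cell_of (g x) = x" by metis
  then show ?thesis using l by (intro bexI[of _ "map g c"]) (auto simp: vectors_def comp_def)
qed

text \<open>
  Symbols on the token stack: 1 and 2 are the digits of variable names, which are enclosed in 3
  and 4 and have their most significant digit on top; \<open>fs\<close> is the list of connectives.
\<close>

fun name :: "nat \<Rightarrow> nat list" where
  "name x = rev (map bit_symbol (binary x))"

declare name.simps [simp del]

definition index_of :: "'a list \<Rightarrow> 'a \<Rightarrow> nat" where
  "index_of xs x = (LEAST i. i < length xs \<and> xs ! i = x)"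

lemma index_of: "x \<in> set xs \<Longrightarrow> index_of xs x < length xs \<and> xs ! index_of xs x = x"
  unfolding index_of_def in_set_conv_nth by (rule LeastI_ex) blast

fun token_symbols :: "bool_fun list \<Rightarrow> token \<Rightarrow> nat list" where
  "token_symbols fs (TVar x) = 3 # name x @ [4]"
| "token_symbols fs TNext = [5]"
| "token_symbols fs TFin = [6]"
| "token_symbols fs TGlob = [7]"
| "token_symbols fs (TConn f) = [8 + index_of fs f]"

text \<open>The guess has a fixed length; the name is its longest prefix of digits and the rest is
  padding.\<close>

fun matches_name :: "nat list \<Rightarrow> token \<Rightarrow> bool" where
  "matches_name z (TVar x) = (takeWhile (\<lambda>s. s = 1 \<or> s = 2) z = name x)"
| "matches_name z _ = False"

section \<open>Checking an edge by one scan of the tokens\<close>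

type_synonym check_state = "(nat \<times> nat) list \<times> nat list \<times> nat list \<times> nat list"

definition check_node :: "token \<Rightarrow> nat \<times> nat \<Rightarrow> (nat \<times> nat) list \<Rightarrow> bool" where
  "check_node t p V \<longleftrightarrow> ar t \<le> length V \<and>
     node_ok t (map_prod cell_of cell_of p) (map (map_prod cell_of cell_of) (take (ar t) V))"

text \<open>The state consists of the stack of cell pairs, the failures, and the marks that the variable
  named by \<open>z\<close> has been seen to be true or false: since \<open>z\<close> is chosen universally, comparing
  the occurrences of one variable at a time is enough.\<close>

definition check_token :: "nat list \<Rightarrow> token \<times> nat \<times> nat \<Rightarrow> check_state \<Rightarrow> check_state" where
  "check_token z = (\<lambda>(t, p) (V, F, T1, T0).
    (let hit = matches_name z t; tr = truth (cell_of (fst p));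
         F = (if hit \<and> (if tr then T0 \<noteq> [] else T1 \<noteq> []) then 1 # F else F) in
     (if check_node t p V then p # drop (ar t) V else drop (ar t) V,
      if check_node t p V then F else 1 # F,
      if hit \<and> tr then 1 # T1 else T1, if hit \<and> \<not> tr then 1 # T0 else T0)))"

definition check :: "nat list \<Rightarrow> (token \<times> nat \<times> nat) list \<Rightarrow> check_state" where
  "check z xs = fold (check_token z) xs ([], [], [], [])"

text \<open>The pair \<open>(1, 3)\<close> encodes a step from \<open>CS\<close> to \<open>C0 False\<close>, where the formula is false in the
  first state.\<close>

definition accepts :: "check_state \<Rightarrow> bool" where
  "accepts = (\<lambda>(V, F, _). F = [] \<and> (\<exists>x y. V = [(x, y)] \<and> \<not> (x = 1 \<and> y = 3)))"

lemma check_Nil: "check z [] = ([], [], [], [])"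
  by (simp add: check_def)

lemma check_snoc: "check z (xs @ [x]) = check_token z x (check z xs)"
  by (simp add: check_def)

lemma ex_less_Suc: "(\<exists>j<Suc k. P j) \<longleftrightarrow> (\<exists>j<k. P j) \<or> P k"
  and all_less_Suc: "(\<forall>j<Suc k. P j) \<longleftrightarrow> (\<forall>j<k. P j) \<and> P k"
  by (auto simp: less_Suc_eq)

lemma clash_less_Suc:
  "(\<exists>j<Suc k. \<exists>j'<Suc k. h j \<and> h j' \<and> t j \<and> \<not> t j') \<longleftrightarrow>
    (\<exists>j<k. \<exists>j'<k. h j \<and> h j' \<and> t j \<and> \<not> t j') \<or>
    h k \<and> (if t k then \<exists>j<k. h j \<and> \<not> t j else \<exists>j<k. h j \<and> t j)"
  unfolding ex_less_Suc by (cases "t k") auto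

text \<open>As long as no failure is recorded, the stack of cell pairs mirrors
  \<open>position_stack\<close>, so the pairs on top belong to the arguments. After a failure
  nothing is claimed about that stack.\<close>

lemma check_prefix:
  assumes len: "length a = length ts" "length b = length ts" and "k \<le> length ts"
    and "check z (take k (zip ts (zip a b))) = (V, F, T1, T0)"
  defines "hit \<equiv> \<lambda>j. matches_name z (ts ! j)"
  shows "T1 \<noteq> [] \<longleftrightarrow> (\<exists>j<k. hit j \<and> truth (cell_of (a ! j)))"
    "T0 \<noteq> [] \<longleftrightarrow> (\<exists>j<k. hit j \<and> \<not> truth (cell_of (a ! j)))"
    "F = [] \<Longrightarrow> V = map (\<lambda>j. (a ! j, b ! j)) (position_stack ts k)"
    "F = [] \<longleftrightarrow> (\<forall>j<k. check_node (ts ! j) (a ! j, b ! j) (map (\<lambda>i. (a ! i, b ! i)) (position_stack ts j))) \<and>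
       \<not> (\<exists>j<k. \<exists>j'<k. hit j \<and> hit j' \<and> truth (cell_of (a ! j)) \<and> \<not> truth (cell_of (a ! j')))"
proof -
  let ?xs = "zip ts (zip a b)"
  let ?tr = "\<lambda>j. truth (cell_of (a ! j))"
  let ?ok = "\<lambda>j. check_node (ts ! j) (a ! j, b ! j) (map (\<lambda>i. (a ! i, b ! i)) (position_stack ts j))"
  define seen1 where "seen1 = (\<lambda>k. \<exists>j<k. hit j \<and> ?tr j)"
  define seen0 where "seen0 = (\<lambda>k. \<exists>j<k. hit j \<and> \<not> ?tr j)"
  define clash where "clash = (\<lambda>k. \<exists>j<k. \<exists>j'<k. hit j \<and> hit j' \<and> ?tr j \<and> \<not> ?tr j')"
  define all_ok where "all_ok = (\<lambda>k. \<forall>j<k. ?ok j)"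
  have extend: "seen1 (Suc k) \<longleftrightarrow> seen1 k \<or> hit k \<and> ?tr k" "seen0 (Suc k) \<longleftrightarrow> seen0 k \<or> hit k \<and> \<not> ?tr k"
    "clash (Suc k) \<longleftrightarrow> clash k \<or> hit k \<and> (if ?tr k then seen0 k else seen1 k)" "all_ok (Suc k) \<longleftrightarrow> all_ok k \<and> ?ok k" for k
    unfolding seen1_def seen0_def clash_def all_ok_def
    by (rule ex_less_Suc ex_less_Suc clash_less_Suc all_less_Suc)+
  have "case check z (take k ?xs) of (V, F, T1, T0) \<Rightarrow>
      (T1 = [] \<longleftrightarrow> \<not> seen1 k) \<and> (T0 = [] \<longleftrightarrow> \<not> seen0 k) \<and>
      (F = [] \<longrightarrow> V = map (\<lambda>j. (a ! j, b ! j)) (position_stack ts k)) \<and>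
      (F = [] \<longleftrightarrow> all_ok k \<and> \<not> clash k)"
    using assms(3)
  proof (induction k)
    case 0
    then show ?case by (simp add: check_Nil seen1_def seen0_def clash_def all_ok_def)
  next
    case (Suc k)
    obtain V F T1 T0 where s: "check z (take k ?xs) = (V, F, T1, T0)" by (metis prod_cases4)
    have k: "k < length ts" using Suc.prems by simp
    have IH: "T1 = [] \<longleftrightarrow> \<not> seen1 k" "T0 = [] \<longleftrightarrow> \<not> seen0 k"
      "F = [] \<Longrightarrow> V = map (\<lambda>j. (a ! j, b ! j)) (position_stack ts k)" "F = [] \<longleftrightarrow> all_ok k \<and> \<not> clash k"
      using Suc.IH k unfolding s by auto
    have x: "take (Suc k) ?xs = take k ?xs @ [(ts ! k, a ! k, b ! k)]"
      using k len by (simp add: take_Suc_conv_app_nth)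
    have c: "check z (take (Suc k) ?xs) = check_token z (ts ! k, a ! k, b ! k) (V, F, T1, T0)"
      unfolding x check_snoc s ..
    have h: "matches_name z (ts ! k) = hit k" by (simp add: hit_def)
    show ?case
    proof (cases "F = []")
      case True
      then show ?thesis
        using IH(1,2,4) unfolding c check_token_def Let_def h prod.case extend IH(3)[OF True]
        by (cases "hit k"; cases "?tr k"; cases "?ok k") (simp_all add: drop_map)
    next
      case False
      then show ?thesis
        using IH(1,2,4) unfolding c check_token_def Let_def h prod.case extend
        by (cases "hit k"; cases "?tr k") auto
    qed
  qed
  then have r: "T1 = [] \<longleftrightarrow> \<not> seen1 k" "T0 = [] \<longleftrightarrow> \<not> seen0 k"
      "F = [] \<Longrightarrow> V = map (\<lambda>j. (a ! j, b ! j)) (position_stack ts k)" "F = [] \<longleftrightarrow> all_ok k \<and> \<not> clash k"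
    unfolding assms(4) prod.case by auto
  show "T1 \<noteq> [] \<longleftrightarrow> (\<exists>j<k. hit j \<and> ?tr j)" using r(1) unfolding seen1_def by blast
  show "T0 \<noteq> [] \<longleftrightarrow> (\<exists>j<k. hit j \<and> \<not> ?tr j)" using r(2) unfolding seen0_def by blast
  show "F = [] \<Longrightarrow> V = map (\<lambda>j. (a ! j, b ! j)) (position_stack ts k)" by (rule r(3))
  show "F = [] \<longleftrightarrow> (\<forall>j<k. ?ok j) \<and> \<not> (\<exists>j<k. \<exists>j'<k. hit j \<and> hit j' \<and> ?tr j \<and> \<not> ?tr j')"
    using r(4) unfolding all_ok_def clash_def .
qed

lemma set_binary_name: "set (name x) \<subseteq> {1, 2}"
  by (auto simp: name.simps bit_symbol_def)

lemma name_inj: "name x = name y \<Longrightarrow> x = y"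
proof -
  assume "name x = name y"
  then have "map bit_symbol (binary x) = map bit_symbol (binary y)" by (simp add: name.simps)
  moreover have "inj bit_symbol" by (auto simp: inj_def bit_symbol_def split: if_splits)
  ultimately have "binary x = binary y" by (simp add: inj_map_eq_map)
  then show "x = y" by (rule binary_inj)
qed

text \<open>The scan checks well-formedness too: missing arguments count as failures, and a single
  pair must remain. Two occurrences of a variable disagree iff some guessed name exposes them, and
  \<open>m\<close> is large enough for every name that occurs.\<close>

lemma accepts_iff:
  assumes len: "a \<in> vectors 12 (length ts)" "b \<in> vectors 12 (length ts)"
    and m: "m = length (concat (map (token_symbols fs) ts))"
  shows "(\<forall>z\<in>vectors 12 m. accepts (check z (zip ts (zip a b)))) \<longleftrightarrow>
    well_formed ts \<and> edge ts (map cell_of a) (map cell_of b)"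
proof -
  let ?n = "length ts"
  have l: "length a = ?n" "length b = ?n" using len by (auto simp: vectors_def)
  let ?tr = "\<lambda>j. truth (cell_of (a ! j))"
  let ?ok = "\<lambda>j. check_node (ts ! j) (a ! j, b ! j) (map (\<lambda>i. (a ! i, b ! i)) (position_stack ts j))"
  define clash where "clash = (\<lambda>z. \<exists>j<?n. \<exists>j'<?n. matches_name z (ts ! j) \<and> matches_name z (ts ! j') \<and> ?tr j \<and> \<not> ?tr j')"
  define root where "root = (\<exists>x y. map (\<lambda>j. (a ! j, b ! j)) (position_stack ts ?n) = [(x, y)] \<and> \<not> (x = 1 \<and> y = 3))"
  have acc: "accepts (check z (zip ts (zip a b))) \<longleftrightarrow> (\<forall>j<?n. ?ok j) \<and> \<not> clash z \<and> root" for z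
  proof -
    obtain V F T1 T0 where s: "check z (zip ts (zip a b)) = (V, F, T1, T0)" by (metis prod_cases4)
    then have "check z (take ?n (zip ts (zip a b))) = (V, F, T1, T0)" using l by simp
    note p = check_prefix[OF l order_refl this]
    show ?thesis using p(3,4) unfolding s accepts_def root_def clash_def by auto
  qed
  have name_length: "length (name x) + 2 \<le> m" if "TVar x \<in> set ts" for x
  proof -
    have "length (token_symbols fs (TVar x)) \<le> m"
      unfolding m length_concat using that
      by (intro member_le_sum_list) (auto intro!: image_eqI[of _ _ "TVar x"])
    then show ?thesis by simp
  qed
  have consistent: "(\<exists>z\<in>vectors 12 m. clash z) \<longleftrightarrow> \<not> consistent ts (map cell_of a)"
  proof
    assume "\<exists>z\<in>vectors 12 m. clash z"
    then obtain z j j' where j: "j < ?n" "j' < ?n" "matches_name z (ts ! j)" "matches_name z (ts ! j')" "?tr j" "\<not> ?tr j'"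
      unfolding clash_def by blast
    obtain x x' where "ts ! j = TVar x" "ts ! j' = TVar x'"
      using j(3,4) by (cases "ts ! j"; cases "ts ! j'") auto
    moreover from this have "x = x'" using j(3,4) name_inj by simp
    ultimately show "\<not> consistent ts (map cell_of a)"
      using j l unfolding consistent_def by (metis nth_map)
  next
    assume "\<not> consistent ts (map cell_of a)"
    then obtain k k' x where "k < ?n" "k' < ?n" "ts ! k = TVar x" "ts ! k' = TVar x" "?tr k \<noteq> ?tr k'"
      using l unfolding consistent_def by (metis nth_map)
    then obtain j j' where j: "j < ?n" "j' < ?n" "ts ! j = TVar x" "ts ! j' = TVar x" "?tr j" "\<not> ?tr j'"
      by (cases "?tr k") auto
    \<comment> \<open>Padding with 3, which is no digit, ends the name.\<close>
    define z where "z = name x @ replicate (m - length (name x)) 3"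
    have "length (name x) < m" using name_length[of x] j(1,3) by (metis Suc_le_lessD add_2_eq_Suc' le_SucI nth_mem Suc_leD)
    then obtain r where r: "replicate (m - length (name x)) 3 = 3 # (r :: nat list)"
      by (metis Suc_diff_Suc replicate_Suc)
    have "takeWhile (\<lambda>s. s = 1 \<or> s = 2) z = name x"
      unfolding z_def r using set_binary_name[of x] by (subst takeWhile_append2) auto
    then have "clash z" using j unfolding clash_def by (intro exI[of _ j] exI[of _ j']) auto
    moreover have "z \<in> vectors 12 m"
      using set_binary_name[of x] \<open>length (name x) < m\<close> by (fastforce simp: vectors_def z_def)
    ultimately show "\<exists>z\<in>vectors 12 m. clash z" by blast
  qed
  have "vectors 12 m \<noteq> {}" by (auto simp: vectors_def intro: exI[of _ "replicate m 1"])
  then have "(\<forall>z\<in>vectors 12 m. accepts (check z (zip ts (zip a b)))) \<longleftrightarrow>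
      (\<forall>j<?n. ?ok j) \<and> consistent ts (map cell_of a) \<and> root"
    using acc consistent by blast
  also have "\<dots> \<longleftrightarrow> well_formed ts \<and> edge ts (map cell_of a) (map cell_of b)"
  proof -
    have ok: "?ok j \<longleftrightarrow> ar (ts ! j) \<le> length (position_stack ts j) \<and>
        node_ok (ts ! j) (map cell_of a ! j, map cell_of b ! j) (map (\<lambda>i. (map cell_of a ! i, map cell_of b ! i)) (children ts j))"
      if j: "j < ?n" for j
    proof -
      have "map (map_prod cell_of cell_of) (take (ar (ts ! j)) (map (\<lambda>i. (a ! i, b ! i)) (position_stack ts j))) =
          map (\<lambda>i. (map cell_of a ! i, map cell_of b ! i)) (children ts j)"
      proof -
        have "i < ?n" if "i \<in> set (children ts j)" for i
          using children_less[OF that] j by simp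
        then have "map (\<lambda>i. (map cell_of a ! i, map cell_of b ! i)) (children ts j) =
            map (map_prod cell_of cell_of \<circ> (\<lambda>i. (a ! i, b ! i))) (children ts j)"
          using l by simp
        then show ?thesis by (simp add: children_def take_map)
      qed
      then show ?thesis using j l by (simp add: check_node_def)
    qed
    show ?thesis
    proof (cases "well_formed ts")
      case True
      note r = well_formed_root[OF True]
      have "?n - 1 < ?n" using r(1) by simp
      then have "a ! (?n - 1) \<in> {0<..12}" "b ! (?n - 1) \<in> {0<..12}"
        using len vectors_nth by blast+
      then have "root \<longleftrightarrow> (map cell_of a ! (?n - 1) = CS \<longrightarrow> map cell_of b ! (?n - 1) \<noteq> C0 False)"
        using cell_of_inj[of _ 1, unfolded cell_of_simps] cell_of_inj[of _ 3, unfolded cell_of_simps] r l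
        by (auto simp: root_def cell_of_simps)
      then show ?thesis using True ok l unfolding edge_def by (auto simp: well_formed_def)
    next
      case False
      then show ?thesis using ok unfolding root_def by (auto simp: well_formed_def)
    qed
  qed
  finally show ?thesis .
qed

lemma edge_loop:
  assumes "well_formed ts"
  shows "edge ts (replicate (length ts) CS) (replicate (length ts) CS)"
  by (rule transition_edge[OF assms transition.idle])
    (use cells_distinct[OF well_formed_root(1)[OF assms]] in metis)

lemma edge_length: "edge ts a b \<Longrightarrow> length a = length ts \<and> length b = length ts"
  by (simp add: edge_def)

lemma leaf_relation_edge:
  assumes wf: "well_formed ts" and m: "m = length (concat (map (token_symbols fs) ts))"
    and a: "a \<in> vectors 12 (length ts)" and b: "b \<in> vectors 12 (length ts)"
  defines "Rel \<equiv> leaf_relation 12 (length ts) m (\<lambda>z a b. accepts (check z (zip ts (zip a b))))"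
  shows "(a, b) \<in> Rel\<^sup>* \<longleftrightarrow> (edge ts)\<^sup>*\<^sup>* (map cell_of a) (map cell_of b)"
proof -
  let ?V = "vectors 12 (length ts)"
  have Rel: "(a, b) \<in> Rel \<longleftrightarrow> a \<in> ?V \<and> b \<in> ?V \<and> edge ts (map cell_of a) (map cell_of b)" for a b
    using accepts_iff[OF _ _ m] wf unfolding Rel_def leaf_relation_def by blast
  have inj: "a = b" if "map cell_of a = map cell_of b" "a \<in> ?V" "b \<in> ?V" for a b
  proof -
    have "inj_on cell_of {0<..12}" using cell_of_inj by (auto simp: inj_on_def)
    moreover have "set a \<union> set b \<subseteq> {0<..12}" using that by (auto simp: vectors_def)
    ultimately show ?thesis using that(1) by (meson inj_on_subset map_inj_on)
  qed
  show ?thesis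
  proof
    assume "(a, b) \<in> Rel\<^sup>*"
    then show "(edge ts)\<^sup>*\<^sup>* (map cell_of a) (map cell_of b)"
      by induction (use Rel in \<open>auto intro: rtranclp.rtrancl_into_rtrancl\<close>)
  next
    have "(edge ts)\<^sup>*\<^sup>* c d \<Longrightarrow> c = map cell_of a \<Longrightarrow> \<exists>b\<in>?V. d = map cell_of b \<and> (a, b) \<in> Rel\<^sup>*" for c d
    proof (induction rule: rtranclp_induct)
      case base
      then show ?case using a by blast
    next
      case (step d e)
      then obtain b where b: "b \<in> ?V" "d = map cell_of b" "(a, b) \<in> Rel\<^sup>*" by blast
      obtain b' where b': "b' \<in> ?V" "map cell_of b' = e"
        using cells_surj edge_length[OF step.hyps(2)] by blast
      then have "(b, b') \<in> Rel" using Rel b step.hyps(2) by blast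
      with b(3) have "(a, b') \<in> Rel\<^sup>*" by (rule rtrancl.rtrancl_into_rtrancl)
      then show ?case using b'(1) b'(2)[symmetric] by blast
    qed
    moreover assume "(edge ts)\<^sup>*\<^sup>* (map cell_of a) (map cell_of b)"
    ultimately obtain b' where "b' \<in> ?V" "map cell_of b = map cell_of b'" "(a, b') \<in> Rel\<^sup>*" by blast
    then show "(a, b) \<in> Rel\<^sup>*" using inj b by blast
  qed
qed

text \<open>The vectors of symbols 1 and 2 are the initial and the final cell vector. The empty
  token list is treated apart, since its midpoints would be empty.\<close>

theorem qeval_satisfiable:
  assumes m: "m = length (concat (map (token_symbols fs) ts))"
    and R: "\<And>xs M a b z. decode (replicate (length ts) 1) (replicate (length ts) 2) xs = (M, a, b, z) \<Longrightarrow>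
      R xs \<longleftrightarrow> accepts (check z (zip ts (zip a b)))"
  shows "qeval 12 R (savitch_pattern (length ts) m (8 * length ts)) [] \<longleftrightarrow>
    well_formed ts \<and> satisfiable (node ts (length ts - 1))"
proof (cases "ts = []")
  case True
  have "\<not> R xs" for xs
  proof -
    obtain M a b z where d: "decode (replicate (length ts) 1) (replicate (length ts) 2) xs = (M, a, b, z)"
      by (metis prod_cases4)
    show ?thesis unfolding R[OF d] by (simp add: True check_Nil accepts_def)
  qed
  then show ?thesis using qeval_False[of R 12] True by (simp add: well_formed_def)
next
  case False
  let ?n = "length ts"
  let ?s = "replicate ?n (1 :: nat)" and ?e = "replicate ?n (2 :: nat)"
  let ?Rel = "leaf_relation 12 ?n m (\<lambda>z a b. accepts (check z (zip ts (zip a b))))"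
  have V: "?s \<in> vectors 12 ?n" "?e \<in> vectors 12 ?n" by (auto simp: vectors_def)
  have q: "qeval 12 R (savitch_pattern ?n m (8 * ?n)) [] \<longleftrightarrow> (?s, ?e) \<in> ?Rel ^^ (2 ^ (8 * ?n))"
    by (rule qeval_savitch[OF _ _ R]) (use False V in \<open>auto simp: decode_def\<close>)
  have cells: "map cell_of ?s = replicate ?n CS" "map cell_of ?e = replicate ?n CE"
    by (simp_all add: map_replicate cell_of_simps[unfolded One_nat_def] cell_of_simps)
  show ?thesis
  proof (cases "well_formed ts")
    case True
    have "(?s, ?s) \<in> ?Rel"
      using accepts_iff[OF V(1,1) m] True edge_loop[OF True] V(1) cells unfolding leaf_relation_def by auto
    \<comment> \<open>Here 12 * 12 is at most 2 ^ 8, and waiting at the initial vector is the loop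
      that pads.\<close>
    then have "(?s, ?e) \<in> ?Rel ^^ (2 ^ (8 * ?n)) \<longleftrightarrow> (?s, ?e) \<in> ?Rel\<^sup>*"
      by (rule leaf_relation_rtrancl) simp
    then show ?thesis
      using q True leaf_relation_edge[OF True m V, unfolded cells] satisfiable_iff_edges[OF True] by blast
  next
    case False
    then have "?Rel = {}" using accepts_iff[OF _ _ m] by (auto simp: leaf_relation_def)
    moreover obtain i where "(2 :: nat) ^ (8 * ?n) = Suc i" by (metis not0_implies_Suc power_not_zero zero_neq_numeral)
    ultimately show ?thesis using q False by simp
  qed
qed

section \<open>Reading a formula\<close>

lemma encode_token_prefix:
  assumes "encode_token t @ u = encode_token t' @ v"
  shows "t = t' \<and> u = v"
  using assms
  by (cases t; cases t') (auto dest: encode_nat_prefix encode_bool_fun_prefix)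

text \<open>The last digit is the most significant one. A leading zero gives a word that encodes no
  variable, so the reader has to reject it.\<close>

lemma binary_canonical: "(\<exists>x. binary x = ds) \<longleftrightarrow> ds = [] \<or> last ds"
proof
  have "binary x = [] \<or> last (binary x)" for x
  proof (induction x rule: less_induct)
    case (less x)
    show ?case
    proof (cases "x = 0")
      case False
      have eq: "binary x = odd x # binary (x div 2)" using False by (subst binary.simps) simp
      show ?thesis
      proof (cases "x = 1")
        case True
        then show ?thesis unfolding eq by (simp add: binary.simps[of 0])
      next
        case False
        with \<open>x \<noteq> 0\<close> have "x div 2 \<noteq> 0" by auto
        then have "binary (x div 2) \<noteq> []" by (subst binary.simps) simp
        then show ?thesis using less[of "x div 2"] \<open>x \<noteq> 0\<close> by (simp add: eq)
      qed
    qed (simp add: binary.simps)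
  qed
  then show "\<exists>x. binary x = ds \<Longrightarrow> ds = [] \<or> last ds" by blast
next
  assume "ds = [] \<or> last ds"
  then show "\<exists>x. binary x = ds"
  proof (induction ds)
    case Nil
    have "binary 0 = []" by (simp add: binary.simps)
    then show ?case by blast
  next
    case (Cons d ds)
    have step: "binary (2 * x + of_bool d) = d # binary x" if "2 * x + of_bool d \<noteq> 0" for x :: nat
      using that by (subst binary.simps) (cases d; simp)
    show ?case
    proof (cases "ds = []")
      case True
      then have "binary (2 * 0 + of_bool d) = d # ds" using Cons.prems step[of 0] by (simp add: binary.simps[of 0])
      then show ?thesis by blast
    next
      case False
      then obtain x where x: "binary x = ds" using Cons by auto
      have "x \<noteq> 0"
      proof
        assume "x = 0"
        then have "ds = []" using x by (simp add: binary.simps)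
        then show False using False by simp
      qed
      then show ?thesis using step[of x] x by auto
    qed
  qed
qed

text \<open>Reading with backtracking: for each bit consumed the failure branch \<open>f\<close> is
  extended by a push that restores it, so alternatives can be tried in turn.\<close>

fun attempt :: "bool list \<Rightarrow> cmd \<Rightarrow> cmd \<Rightarrow> cmd" where
  "attempt [] s f = s"
| "attempt (b # bs) s f = Switch 1 (\<lambda>a. if a = bit_symbol b
     then Seq (Pop 1) (attempt bs s (Seq (Push 1 (bit_symbol b)) f)) else f)"

text \<open>States stay chains of updates; \<open>fun_upd_apply\<close> would unfold them below binders.\<close>

declare fun_upd_apply [simp del] fun_upd_same [simp] fun_upd_other [simp]

lemma attempt_success:
  assumes "\<sigma> 1 = map bit_symbol (xs @ u)" "runs B s (\<sigma>(1 := map bit_symbol u)) \<tau>"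
  shows "runs B (attempt xs s f) \<sigma> \<tau>"
  using assms
proof (induction xs arbitrary: f \<sigma>)
  case Nil
  have eq: "\<sigma>(1 := map bit_symbol u) = \<sigma>" using Nil.prems(1) by (simp add: fun_eq_iff fun_upd_apply)
  show ?case using Nil.prems(2) unfolding eq attempt.simps .
next
  case (Cons b xs)
  let ?\<sigma> = "\<sigma>(1 := map bit_symbol (xs @ u))"
  have "runs B (Pop 1) \<sigma> ?\<sigma>"
    by (rule runs_eq[OF runs_Pop]) (use Cons.prems in \<open>auto simp: fun_eq_iff fun_upd_apply\<close>)
  moreover have "runs B (attempt xs s (Seq (Push 1 (bit_symbol b)) f)) ?\<sigma> \<tau>"
    using Cons.prems by (intro Cons.IH) simp_all
  ultimately have "runs B (Seq (Pop 1) (attempt xs s (Seq (Push 1 (bit_symbol b)) f))) \<sigma> \<tau>"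
    by (rule runs_Seq)
  then show ?case using Cons.prems by (auto intro!: runs_Switch)
qed

lemma attempt_failure:
  assumes "\<sigma> 1 = map bit_symbol u" "\<And>v. u \<noteq> xs @ v" "runs B f \<sigma> \<tau>" "length u \<le> B"
  shows "runs B (attempt xs s f) \<sigma> \<tau>"
  using assms
proof (induction xs arbitrary: f \<sigma> u)
  case Nil
  then show ?case by (metis append_Nil)
next
  case (Cons b xs)
  show ?case
  proof (cases "\<exists>v. u = b # v")
    case True
    then obtain v where v: "u = b # v" by blast
    let ?\<sigma> = "\<sigma>(1 := map bit_symbol v)"
    have "runs B (Push 1 (bit_symbol b)) ?\<sigma> \<sigma>"
      by (rule runs_eq[OF runs_Push]) (use Cons.prems v in \<open>auto simp: fun_eq_iff fun_upd_apply\<close>)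
    then have "runs B (Seq (Push 1 (bit_symbol b)) f) ?\<sigma> \<tau>" using Cons.prems(3) by (rule runs_Seq)
    have "runs B (attempt xs s (Seq (Push 1 (bit_symbol b)) f)) ?\<sigma> \<tau>"
      by (rule Cons.IH[OF _ _ \<open>runs B (Seq _ f) ?\<sigma> \<tau>\<close>, of v]) (use Cons.prems(2,4) v in simp_all)
    moreover have "runs B (Pop 1) \<sigma> ?\<sigma>"
      by (rule runs_eq[OF runs_Pop]) (use Cons.prems v in \<open>auto simp: fun_eq_iff fun_upd_apply\<close>)
    ultimately have "runs B (Seq (Pop 1) (attempt xs s (Seq (Push 1 (bit_symbol b)) f))) \<sigma> \<tau>"
      by (intro runs_Seq)
    then show ?thesis using Cons.prems(1) v by (auto intro!: runs_Switch)
  next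
    case False
    then have "hd0 (\<sigma> 1) \<noteq> bit_symbol b"
      using Cons.prems(1) by (cases u) (auto simp: bit_symbol_def)
    then show ?thesis using Cons.prems(3) by (auto intro!: runs_Switch)
  qed
qed

section \<open>The tokenizer\<close>

definition simple_tokens :: "temporal_op set \<Rightarrow> bool_fun list \<Rightarrow> token list" where
  "simple_tokens M fs = (if Op_X \<in> M then [TNext] else []) @ (if Op_F \<in> M then [TFin] else []) @
     (if Op_G \<in> M then [TGlob] else []) @ map TConn fs"

lemma allowed_iff: "allowed M (set fs) t \<longleftrightarrow> (\<exists>x. t = TVar x) \<or> t \<in> set (simple_tokens M fs)"
  by (cases t) (auto simp: simple_tokens_def)

text \<open>Stacks: 1 input, 2 tokens, 3 failure, 4 loop flag.\<close>

definition give_up :: cmd where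
  "give_up = Seq (Push 3 1) (clear 1)"

text \<open>The bit 1 announces a digit and 0 ends the name. The most significant digit comes last,
  so at the end a leading zero is a symbol 1 on top of stack 2; a name without digits shows its
  bracket 4 there instead.\<close>

definition read_digit :: "nat \<Rightarrow> cmd" where
  "read_digit n = Switch 1 (\<lambda>a.
     if a = 2 then Seq (Pop 1) (Switch 1 (\<lambda>d. if d = 1 \<or> d = 2 then Seq (Pop 1) (put n 2 d) else Seq (Pop 4) give_up))
     else if a = 1 then Seq (Pop 1) (Seq (Pop 4) (Switch 2 (\<lambda>s. if s = 1 then give_up else Push 2 3)))
     else Seq (Pop 4) give_up)"

definition read_variable :: "nat \<Rightarrow> cmd" where
  "read_variable n = Seq (Push 2 4) (Seq (Push 4 1) (While 4 (read_digit n)))"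

definition read_token :: "nat \<Rightarrow> temporal_op set \<Rightarrow> bool_fun list \<Rightarrow> cmd" where
  "read_token n M fs = foldr (\<lambda>t. attempt (encode_token t) (put n 2 (hd (token_symbols fs t)))) (simple_tokens M fs)
     (attempt [False, False, False] (read_variable n) give_up)"

definition tokenize :: "nat \<Rightarrow> temporal_op set \<Rightarrow> bool_fun list \<Rightarrow> cmd" where
  "tokenize n M fs = While 1 (read_token n M fs)"

lemma wf_give_up: "3 \<le> n \<Longrightarrow> 4 \<le> K \<Longrightarrow> wf_cmd n K give_up"
  by (simp add: give_up_def)

lemma wf_attempt: "3 \<le> n \<Longrightarrow> 4 \<le> K \<Longrightarrow> wf_cmd n K s \<Longrightarrow> wf_cmd n K f \<Longrightarrow> wf_cmd n K (attempt xs s f)"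
  by (induction xs arbitrary: f) (auto simp: bit_symbol_def)

lemma wf_tokenize: "5 \<le> n \<Longrightarrow> 4 \<le> K \<Longrightarrow> wf_cmd n K (tokenize n M fs)"
proof -
  assume nK: "5 \<le> n" "4 \<le> K"
  have "wf_cmd n K (read_variable n)"
    using nK wf_give_up by (simp add: read_variable_def read_digit_def)
  then have base: "wf_cmd n K (attempt [False, False, False] (read_variable n) give_up)"
    using nK wf_give_up by (intro wf_attempt) auto
  have "wf_cmd n K (foldr (\<lambda>t. attempt (encode_token t) (put n 2 (hd (token_symbols fs t)))) ts
     (attempt [False, False, False] (read_variable n) give_up))" for ts
    by (induction ts) (use base nK in \<open>auto intro!: wf_attempt\<close>)
  then show ?thesis using nK by (simp add: tokenize_def read_token_def)
qed

lemma runs_give_up: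
  assumes "length (\<sigma> 3) < B"
  shows "runs B give_up \<sigma> (\<sigma>(3 := 1 # \<sigma> 3, 1 := []))"
  unfolding give_up_def by (rule runs_Seq[OF runs_Push[of \<sigma> 3, OF assms] runs_clear])

text \<open>Every failure empties the input, so that the tokenizer stops. The digits
  \<open>ds\<close> are on the stack already, and canonicity is judged for them together with those
  to come.\<close>

lemma runs_read_digits:
  assumes "\<sigma> 1 = map bit_symbol u" "\<sigma> 2 = rev (map bit_symbol ds) @ 4 # T" "\<sigma> 4 = [1]"
    "length (\<sigma> 1) + length (\<sigma> 2) < B" "length (\<sigma> 3) < B" "5 \<le> n"
  shows "(\<exists>es u'. u = concat (map (\<lambda>b. [True, b]) es) @ False # u' \<and> (ds @ es = [] \<or> last (ds @ es)) \<and>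
      runs B (While 4 (read_digit n)) \<sigma> (\<sigma>(1 := map bit_symbol u', 2 := 3 # rev (map bit_symbol (ds @ es)) @ 4 # T, 4 := []))) \<or>
    (\<nexists>es u'. u = concat (map (\<lambda>b. [True, b]) es) @ False # u' \<and> (ds @ es = [] \<or> last (ds @ es))) \<and>
      (\<exists>\<tau>. runs B (While 4 (read_digit n)) \<sigma> \<tau> \<and> \<tau> 1 = [] \<and> hd0 (\<tau> 3) = 1)"
  using assms(1-5)
proof (induction "length u" arbitrary: u ds \<sigma> rule: less_induct)
  case (less u ds \<sigma>)
  let ?loop = "While 4 (read_digit n)"
  have stop: "runs B ?loop \<sigma> \<tau>" if "runs B (read_digit n) \<sigma> \<tau>" "\<tau> 4 = []" for \<tau>
    by (rule runs_While_step[OF _ that(1)]) (use that(2) less.prems in \<open>auto intro: runs_While_end\<close>)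
  have fail: "\<exists>\<tau>. runs B (Seq (Pop 4) give_up) \<rho> \<tau> \<and> \<tau> 1 = [] \<and> hd0 (\<tau> 3) = 1 \<and> \<tau> 4 = []" if "\<rho> 3 = \<sigma> 3" "\<rho> 4 = [1]" for \<rho>
  proof -
    have "runs B (Pop 4) \<rho> (\<rho>(4 := []))" by (rule runs_eq[OF runs_Pop]) (use that in auto)
    from runs_Seq[OF this runs_give_up] show ?thesis using that less.prems(5) by fastforce
  qed
  let ?P = "\<lambda>es u'. u = concat (map (\<lambda>b. [True, b]) es) @ False # u' \<and> (ds @ es = [] \<or> last (ds @ es))"
  have es: "es = [] \<and> u = False # u' \<or> (\<exists>d es' v. es = d # es' \<and> u = True # d # v \<and>
      v = concat (map (\<lambda>b. [True, b]) es') @ False # u')" if "?P es u'" for es u'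
    using that by (cases es) auto
  consider "u = []" | u' where "u = False # u'" | "u = [True]" | d v where "u = True # d # v"
    by (metis (full_types) list.exhaust)
  then show ?case
  proof cases
    case 1
    obtain \<tau> where \<tau>: "runs B (Seq (Pop 4) give_up) \<sigma> \<tau>" "\<tau> 1 = []" "hd0 (\<tau> 3) = 1" "\<tau> 4 = []"
      using fail less.prems(3) by blast
    have "runs B (read_digit n) \<sigma> \<tau>"
      unfolding read_digit_def by (rule runs_Switch) (use \<tau>(1) 1 less.prems(1) in simp)
    then have "runs B ?loop \<sigma> \<tau>" using stop \<tau>(4) by blast
    then show ?thesis using \<tau> es 1 by blast
  next
    case (2 u')
    let ?\<sigma>1 = "\<sigma>(1 := map bit_symbol u')"
    let ?\<sigma>2 = "\<sigma>(1 := map bit_symbol u', 4 := [])"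
    have pops: "runs B (Pop 1) \<sigma> ?\<sigma>1" "runs B (Pop 4) ?\<sigma>1 ?\<sigma>2"
      by (rule runs_eq[OF runs_Pop]; use less.prems 2 in \<open>auto simp: fun_eq_iff fun_upd_apply\<close>)+
    have hd: "hd0 (\<sigma> 2) = 1 \<longleftrightarrow> ds \<noteq> [] \<and> \<not> last ds"
      using less.prems(2) by (cases ds rule: rev_cases) (auto simp: bit_symbol_def)
    have step: "runs B (read_digit n) \<sigma> \<tau>" if "runs B (Switch 2 (\<lambda>s. if s = 1 then give_up else Push 2 3)) ?\<sigma>2 \<tau>" for \<tau>
      unfolding read_digit_def
      by (rule runs_Switch) (use runs_Seq[OF pops(1) runs_Seq[OF pops(2) that]] less.prems(1) 2 in \<open>simp add: bit_symbol_def\<close>)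
    show ?thesis
    proof (cases "ds = [] \<or> last ds")
      case True
      have "runs B (Push 2 3) ?\<sigma>2 (?\<sigma>2(2 := 3 # ?\<sigma>2 2))"
        by (rule runs_Push) (use less.prems(4) in simp)
      then have "runs B (read_digit n) \<sigma> (?\<sigma>2(2 := 3 # ?\<sigma>2 2))"
        using hd True by (intro step runs_Switch) auto
      from stop[OF this] have "runs B ?loop \<sigma> (?\<sigma>2(2 := 3 # ?\<sigma>2 2))" by simp
      moreover have "?\<sigma>2(2 := 3 # ?\<sigma>2 2) = \<sigma>(1 := map bit_symbol u', 2 := 3 # rev (map bit_symbol (ds @ [])) @ 4 # T, 4 := [])"
        using less.prems(2) by (auto simp: fun_eq_iff fun_upd_apply)
      ultimately have "?P [] u' \<and> runs B ?loop \<sigma> (\<sigma>(1 := map bit_symbol u', 2 := 3 # rev (map bit_symbol (ds @ [])) @ 4 # T, 4 := []))"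
        using 2 True by simp
      then show ?thesis by blast
    next
      case False
      have "runs B give_up ?\<sigma>2 (?\<sigma>2(3 := 1 # ?\<sigma>2 3, 1 := []))"
        by (rule runs_give_up) (use less.prems(5) in simp)
      then have "runs B (read_digit n) \<sigma> (?\<sigma>2(3 := 1 # ?\<sigma>2 3, 1 := []))"
        using hd False by (intro step runs_Switch) auto
      from stop[OF this] have "runs B ?loop \<sigma> (?\<sigma>2(3 := 1 # ?\<sigma>2 3, 1 := []))" by simp
      moreover have "\<nexists>es u'. ?P es u'"
        using es 2 False by fastforce
      ultimately show ?thesis by (intro disjI2 conjI exI[of _ "?\<sigma>2(3 := 1 # ?\<sigma>2 3, 1 := [])"]) auto
    qed
  next
    case 3
    let ?\<sigma>1 = "\<sigma>(1 := [])"
    have pop: "runs B (Pop 1) \<sigma> ?\<sigma>1"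
      by (rule runs_eq[OF runs_Pop]) (use less.prems 3 in \<open>auto simp: fun_eq_iff fun_upd_apply\<close>)
    obtain \<tau> where \<tau>: "runs B (Seq (Pop 4) give_up) ?\<sigma>1 \<tau>" "\<tau> 1 = []" "hd0 (\<tau> 3) = 1" "\<tau> 4 = []"
      using fail[of ?\<sigma>1] less.prems(3) by auto
    have "runs B (Switch 1 (\<lambda>d. if d = 1 \<or> d = 2 then Seq (Pop 1) (put n 2 d) else Seq (Pop 4) give_up)) ?\<sigma>1 \<tau>"
      by (rule runs_Switch) (use \<tau>(1) in simp)
    from runs_Seq[OF pop this] have "runs B (read_digit n) \<sigma> \<tau>"
      unfolding read_digit_def by (intro runs_Switch) (use less.prems(1) 3 in \<open>simp add: bit_symbol_def\<close>)
    then have "runs B ?loop \<sigma> \<tau>" using stop \<tau>(4) by blast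
    moreover have "\<nexists>es u'. ?P es u'" using es 3 by fastforce
    ultimately show ?thesis using \<tau> by blast
  next
    case (4 d v)
    let ?\<sigma>1 = "\<sigma>(1 := map bit_symbol (d # v))"
    let ?\<sigma>2 = "\<sigma>(1 := map bit_symbol v)"
    let ?\<sigma>3 = "\<sigma>(1 := map bit_symbol v, 2 := bit_symbol d # \<sigma> 2)"
    have pops: "runs B (Pop 1) \<sigma> ?\<sigma>1" "runs B (Pop 1) ?\<sigma>1 ?\<sigma>2"
      by (rule runs_eq[OF runs_Pop]; use less.prems 4 in \<open>auto simp: fun_eq_iff fun_upd_apply\<close>)+
    have put: "runs B (put n 2 (bit_symbol d)) ?\<sigma>2 ?\<sigma>3"
      by (rule runs_eq[OF runs_put]) (use less.prems assms(6) in \<open>auto simp: bit_symbol_def\<close>)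
    have "runs B (Switch 1 (\<lambda>d. if d = 1 \<or> d = 2 then Seq (Pop 1) (put n 2 d) else Seq (Pop 4) give_up)) ?\<sigma>1 ?\<sigma>3"
      by (rule runs_Switch) (use runs_Seq[OF pops(2) put] in \<open>cases d; simp add: bit_symbol_def\<close>)
    from runs_Seq[OF pops(1) this] have "runs B (read_digit n) \<sigma> ?\<sigma>3"
      unfolding read_digit_def by (intro runs_Switch) (use less.prems(1) 4 in \<open>simp add: bit_symbol_def\<close>)
    from runs_While_step[OF _ this] have step: "runs B ?loop \<sigma> \<tau>" if "runs B ?loop ?\<sigma>3 \<tau>" for \<tau>
      using that less.prems(3) by simp
    let ?Q = "\<lambda>es u'. v = concat (map (\<lambda>b. [True, b]) es) @ False # u' \<and> ((ds @ [d]) @ es = [] \<or> last ((ds @ [d]) @ es))"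
    have IH: "(\<exists>es u'. ?Q es u' \<and> runs B ?loop ?\<sigma>3 (?\<sigma>3(1 := map bit_symbol u', 2 := 3 # rev (map bit_symbol ((ds @ [d]) @ es)) @ 4 # T, 4 := []))) \<or>
       (\<nexists>es u'. ?Q es u') \<and> (\<exists>\<tau>. runs B ?loop ?\<sigma>3 \<tau> \<and> \<tau> 1 = [] \<and> hd0 (\<tau> 3) = 1)"
      using less.hyps[of v ?\<sigma>3 "ds @ [d]"] less.prems 4 by simp
    then consider es u' where "?Q es u'" "runs B ?loop ?\<sigma>3 (?\<sigma>3(1 := map bit_symbol u', 2 := 3 # rev (map bit_symbol ((ds @ [d]) @ es)) @ 4 # T, 4 := []))"
      | \<tau> where "\<nexists>es u'. ?Q es u'" "runs B ?loop ?\<sigma>3 \<tau>" "\<tau> 1 = []" "hd0 (\<tau> 3) = 1"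
      by blast
    then show ?thesis
    proof cases
      case e: (1 es u')
      have "?P (d # es) u'" using e(1) 4 by simp
      moreover have "?\<sigma>3(1 := map bit_symbol u', 2 := 3 # rev (map bit_symbol ((ds @ [d]) @ es)) @ 4 # T, 4 := []) =
          \<sigma>(1 := map bit_symbol u', 2 := 3 # rev (map bit_symbol (ds @ d # es)) @ 4 # T, 4 := [])"
        by (auto simp: fun_eq_iff fun_upd_apply)
      ultimately show ?thesis using step[OF e(2)] by (intro disjI1 exI[of _ "d # es"] exI[of _ u']) simp
    next
      case \<tau>: (2 \<tau>)
      have "\<nexists>es u'. ?P es u'"
      proof
        assume "\<exists>es u'. ?P es u'"
        then obtain es u' where p: "?P es u'" by blast
        then obtain es' where "es = d # es'" "v = concat (map (\<lambda>b. [True, b]) es') @ False # u'" using es[OF p] 4 by auto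
        then have "?Q es' u'" using p by simp
        then show False using \<tau>(1) by blast
      qed
      then show ?thesis using step \<tau>(2-4) by blast
    qed
  qed
qed

lemma read_token_cases:
  assumes \<sigma>: "\<sigma> 1 = map bit_symbol u" "\<sigma> 4 = []" and B: "length u + length (\<sigma> 2) + 2 < B" "length (\<sigma> 3) < B"
    and n: "8 + length fs < n" "5 \<le> n"
  shows "(\<exists>t u'. allowed M (set fs) t \<and> u = encode_token t @ u' \<and>
      runs B (read_token n M fs) \<sigma> (\<sigma>(1 := map bit_symbol u', 2 := token_symbols fs t @ \<sigma> 2))) \<or>
    (\<nexists>t u'. allowed M (set fs) t \<and> u = encode_token t @ u') \<and>
      (\<exists>\<tau>. runs B (read_token n M fs) \<sigma> \<tau> \<and> \<tau> 1 = [] \<and> hd0 (\<tau> 3) = 1)"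
proof -
  define base where "base = attempt [False, False, False] (read_variable n) give_up"
  define prog where "prog = (\<lambda>ts. foldr (\<lambda>t. attempt (encode_token t) (put n 2 (hd (token_symbols fs t)))) ts base)"
  have prog: "read_token n M fs = prog (simple_tokens M fs)"
    by (simp add: read_token_def prog_def base_def)
  have found: "\<exists>t u'. t \<in> set ts \<and> u = encode_token t @ u' \<and>
      runs B (prog ts) \<sigma> (\<sigma>(1 := map bit_symbol u', 2 := token_symbols fs t @ \<sigma> 2))"
    if "\<exists>t\<in>set ts. \<exists>u'. u = encode_token t @ u'" "set ts \<subseteq> set (simple_tokens M fs)" for ts
    using that
  proof (induction ts)
    case (Cons t ts)
    show ?case
    proof (cases "\<exists>u'. u = encode_token t @ u'")
      case True
      then obtain u' where u': "u = encode_token t @ u'" by blast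
      have "t \<in> set (simple_tokens M fs)" using Cons.prems(2) by simp
      then have sym: "token_symbols fs t = [hd (token_symbols fs t)]" "0 < hd (token_symbols fs t)" "hd (token_symbols fs t) < n"
        using index_of[of _ fs] n by (auto simp: simple_tokens_def split: if_splits) fastforce
      let ?\<sigma> = "\<sigma>(1 := map bit_symbol u')"
      have "runs B (put n 2 (hd (token_symbols fs t))) ?\<sigma> (?\<sigma>(2 := hd (token_symbols fs t) # ?\<sigma> 2))"
        by (rule runs_put) (use sym B in auto)
      then have "runs B (put n 2 (hd (token_symbols fs t))) ?\<sigma> (\<sigma>(1 := map bit_symbol u', 2 := token_symbols fs t @ \<sigma> 2))"
        by (rule runs_eq) (subst sym(1), simp)
      from attempt_success[OF _ this, of "encode_token t"] have
        "runs B (prog (t # ts)) \<sigma> (\<sigma>(1 := map bit_symbol u', 2 := token_symbols fs t @ \<sigma> 2))"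
        using \<sigma>(1) u' by (simp add: prog_def)
      then show ?thesis using u' list.set_intros(1) by (intro exI[of _ t] exI[of _ u'] conjI) auto
    next
      case False
      then obtain t' u' where "t' \<in> set ts" "u = encode_token t' @ u'"
        "runs B (prog ts) \<sigma> (\<sigma>(1 := map bit_symbol u', 2 := token_symbols fs t' @ \<sigma> 2))"
        using Cons by auto
      moreover have "runs B (prog (t # ts)) \<sigma> \<tau>" if "runs B (prog ts) \<sigma> \<tau>" for \<tau>
        unfolding prog_def foldr.simps comp_def
        by (rule attempt_failure[where u = u and \<sigma> = \<sigma>, OF \<sigma>(1)]) (use False that B in \<open>auto simp: prog_def\<close>)
      ultimately show ?thesis by fastforce
    qed
  qed simp
  have skip: "runs B (prog ts) \<sigma> \<tau>" if "\<not> (\<exists>t\<in>set ts. \<exists>u'. u = encode_token t @ u')" "runs B base \<sigma> \<tau>" for ts \<tau>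
    using that
  proof (induction ts)
    case (Cons t ts)
    then show ?case unfolding prog_def foldr.simps comp_def
      by (intro attempt_failure[where u = u and \<sigma> = \<sigma>, OF \<sigma>(1)]) (use B in auto)
  qed (simp add: prog_def)
  show ?thesis
  proof (cases "\<exists>t\<in>set (simple_tokens M fs). \<exists>u'. u = encode_token t @ u'")
    case True
    from found[OF this] show ?thesis unfolding prog using allowed_iff by blast
  next
    case False
    note skip = skip[OF False]
    have only_var: "\<exists>x. t = TVar x" if "allowed M (set fs) t" "u = encode_token t @ u'" for t u'
      using that False allowed_iff by blast
    show ?thesis
    proof (cases "\<exists>v. u = [False, False, False] @ v")
      case True
      then obtain v where v: "u = [False, False, False] @ v" by blast
      let ?\<sigma>1 = "\<sigma>(1 := map bit_symbol v)"
      let ?\<sigma>2 = "\<sigma>(1 := map bit_symbol v, 2 := 4 # \<sigma> 2, 4 := [1])"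
      have "runs B (Push 2 4) ?\<sigma>1 (?\<sigma>1(2 := 4 # ?\<sigma>1 2))" by (rule runs_Push) (use B in simp)
      moreover have "runs B (Push 4 1) (?\<sigma>1(2 := 4 # ?\<sigma>1 2)) ?\<sigma>2"
        by (rule runs_eq[OF runs_Push]) (use B \<sigma> in \<open>auto simp: fun_eq_iff fun_upd_apply\<close>)
      ultimately have var: "runs B base \<sigma> \<tau>" if "runs B (While 4 (read_digit n)) ?\<sigma>2 \<tau>" for \<tau>
        unfolding base_def read_variable_def
        by (intro attempt_success[of _ _ v]) (use v \<sigma>(1) runs_Seq that in \<open>auto intro!: runs_Seq\<close>)
      let ?Q = "\<lambda>es u'. v = concat (map (\<lambda>b. [True, b]) es) @ False # u' \<and> ([] @ es = [] \<or> last ([] @ es))"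
      let ?\<rho> = "\<lambda>es u'. ?\<sigma>2(1 := map bit_symbol u', 2 := 3 # rev (map bit_symbol ([] @ es)) @ 4 # \<sigma> 2, 4 := [])"
      have "(\<exists>es u'. v = concat (map (\<lambda>b. [True, b]) es) @ False # u' \<and> ([] @ es = [] \<or> last ([] @ es)) \<and>
          runs B (While 4 (read_digit n)) ?\<sigma>2 (?\<rho> es u')) \<or>
        (\<nexists>es u'. ?Q es u') \<and> (\<exists>\<tau>. runs B (While 4 (read_digit n)) ?\<sigma>2 \<tau> \<and> \<tau> 1 = [] \<and> hd0 (\<tau> 3) = 1)"
        by (rule runs_read_digits) (use B v n in simp_all)
      then consider es u' where "?Q es u'" "runs B (While 4 (read_digit n)) ?\<sigma>2 (?\<rho> es u')"
        | \<tau> where "\<nexists>es u'. ?Q es u'" "runs B (While 4 (read_digit n)) ?\<sigma>2 \<tau>" "\<tau> 1 = []" "hd0 (\<tau> 3) = 1"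
        by blast
      then show ?thesis
      proof cases
        case e: (1 es u')
        then obtain x where x: "binary x = es" using binary_canonical[of es] by auto
        have "u = encode_token (TVar x) @ u'" using v e(1) x by (simp add: encode_nat_def)
        moreover have "?\<rho> es u' = \<sigma>(1 := map bit_symbol u', 2 := token_symbols fs (TVar x) @ \<sigma> 2)"
          using \<sigma>(2) x by (auto simp: fun_eq_iff fun_upd_apply name.simps)
        ultimately show ?thesis using skip[OF var[OF e(2)]] unfolding prog
          by (intro disjI1 exI[of _ "TVar x"] exI[of _ u']) simp
      next
        case \<tau>: (2 \<tau>)
        have "\<nexists>t u'. allowed M (set fs) t \<and> u = encode_token t @ u'"
        proof
          assume "\<exists>t u'. allowed M (set fs) t \<and> u = encode_token t @ u'"
          then obtain x u' where "u = encode_token (TVar x) @ u'" using only_var by blast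
          then have "v = concat (map (\<lambda>b. [True, b]) (binary x)) @ False # u'" using v by (simp add: encode_nat_def)
          then show False using \<tau>(1) binary_canonical[of "binary x"] by auto
        qed
        then show ?thesis using skip[OF var[OF \<tau>(2)]] \<tau>(3,4) unfolding prog by blast
      qed
    next
      case no_var: False
      have "runs B base \<sigma> (\<sigma>(3 := 1 # \<sigma> 3, 1 := []))"
        unfolding base_def by (rule attempt_failure[where u = u and \<sigma> = \<sigma>, OF \<sigma>(1) _ runs_give_up]) (use no_var B in auto)
      moreover have "\<nexists>t u'. allowed M (set fs) t \<and> u = encode_token t @ u'"
        using only_var no_var by fastforce
      ultimately show ?thesis using skip unfolding prog
        by (intro disjI2 conjI exI[of _ "\<sigma>(3 := 1 # \<sigma> 3, 1 := [])"]) auto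
    qed
  qed
qed

text \<open>The codes of tokens are prefix-free, so the first token of any decomposition is the one
  just read, and a failure later on is final.\<close>

lemma runs_tokenize:
  assumes "\<sigma> 1 = map bit_symbol u" "\<sigma> 4 = []" "2 * length u + length (\<sigma> 2) + 2 < B" "length (\<sigma> 3) < B"
    "8 + length fs < n" "5 \<le> n"
  shows "(\<exists>ts. (\<forall>t\<in>set ts. allowed M (set fs) t) \<and> u = concat (map encode_token (rev ts)) \<and>
      runs B (tokenize n M fs) \<sigma> (\<sigma>(1 := [], 2 := concat (map (token_symbols fs) ts) @ \<sigma> 2))) \<or>
    (\<nexists>ts. (\<forall>t\<in>set ts. allowed M (set fs) t) \<and> u = concat (map encode_token (rev ts))) \<and>
      (\<exists>\<tau>. runs B (tokenize n M fs) \<sigma> \<tau> \<and> hd0 (\<tau> 3) = 1)"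
  using assms(1-4)
proof (induction "length u" arbitrary: u \<sigma> rule: less_induct)
  case (less u \<sigma>)
  show ?case
  proof (cases "u = []")
    case True
    then have "runs B (tokenize n M fs) \<sigma> \<sigma>"
      unfolding tokenize_def by (intro runs_While_end) (use less.prems in simp)
    moreover have "\<sigma>(1 := [], 2 := concat (map (token_symbols fs) []) @ \<sigma> 2) = \<sigma>"
      using True less.prems by (auto simp: fun_eq_iff fun_upd_apply)
    ultimately show ?thesis using True by (intro disjI1 exI[of _ "[]"]) simp
  next
    case False
    have step: "runs B (tokenize n M fs) \<sigma> \<rho>" if "runs B (read_token n M fs) \<sigma> \<tau>" "runs B (tokenize n M fs) \<tau> \<rho>" for \<tau> \<rho>
      by (rule runs_While_step[OF _ that[unfolded tokenize_def], folded tokenize_def]) (use False less.prems(1) in simp)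
    have "length u + length (\<sigma> 2) + 2 < B" using less.prems(3) by simp
    from read_token_cases[OF less.prems(1,2) this less.prems(4) assms(5,6), of M] show ?thesis
    proof (elim disjE exE conjE)
      fix t u' assume t: "allowed M (set fs) t" "u = encode_token t @ u'"
        "runs B (read_token n M fs) \<sigma> (\<sigma>(1 := map bit_symbol u', 2 := token_symbols fs t @ \<sigma> 2))"
      let ?\<sigma> = "\<sigma>(1 := map bit_symbol u', 2 := token_symbols fs t @ \<sigma> 2)"
      have size: "length (token_symbols fs t) \<le> 2 * length (encode_token t)" "encode_token t \<noteq> []"
        by (cases t; simp add: encode_nat_def name.simps length_concat comp_def sum_list_triv)+
      have "length u' < length u" using t(2) size(2) by simp
      have len: "2 * length u' + length (?\<sigma> 2) + 2 < B" using less.prems(3) t(2) size(1) by simp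
      have "(\<exists>ts. (\<forall>t\<in>set ts. allowed M (set fs) t) \<and> u' = concat (map encode_token (rev ts)) \<and>
          runs B (tokenize n M fs) ?\<sigma> (?\<sigma>(1 := [], 2 := concat (map (token_symbols fs) ts) @ ?\<sigma> 2))) \<or>
        (\<nexists>ts. (\<forall>t\<in>set ts. allowed M (set fs) t) \<and> u' = concat (map encode_token (rev ts))) \<and>
          (\<exists>\<tau>. runs B (tokenize n M fs) ?\<sigma> \<tau> \<and> hd0 (\<tau> 3) = 1)"
        by (rule less.hyps[where \<sigma> = ?\<sigma>, OF \<open>length u' < length u\<close> _ _ len]) (use less.prems in simp_all)
      then show ?thesis
      proof (elim disjE exE conjE)
        fix ts assume ts: "\<forall>t\<in>set ts. allowed M (set fs) t" "u' = concat (map encode_token (rev ts))"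
          "runs B (tokenize n M fs) ?\<sigma> (?\<sigma>(1 := [], 2 := concat (map (token_symbols fs) ts) @ ?\<sigma> 2))"
        have "?\<sigma>(1 := [], 2 := concat (map (token_symbols fs) ts) @ ?\<sigma> 2) =
            \<sigma>(1 := [], 2 := concat (map (token_symbols fs) (ts @ [t])) @ \<sigma> 2)"
          by (auto simp: fun_eq_iff fun_upd_apply)
        from runs_eq[OF step[OF t(3) ts(3)] this] show ?thesis
          using ts(1,2) t(1,2) by (intro disjI1 exI[of _ "ts @ [t]"]) simp
      next
        fix \<tau> assume \<tau>: "\<nexists>ts. (\<forall>t\<in>set ts. allowed M (set fs) t) \<and> u' = concat (map encode_token (rev ts))"
          "runs B (tokenize n M fs) ?\<sigma> \<tau>" "hd0 (\<tau> 3) = 1"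
        have "\<nexists>ts. (\<forall>t\<in>set ts. allowed M (set fs) t) \<and> u = concat (map encode_token (rev ts))"
        proof
          assume "\<exists>ts. (\<forall>t\<in>set ts. allowed M (set fs) t) \<and> u = concat (map encode_token (rev ts))"
          then obtain ts where ts: "\<forall>t\<in>set ts. allowed M (set fs) t" "u = concat (map encode_token (rev ts))" by blast
          then obtain s ts' where ts': "ts = ts' @ [s]" using False by (cases ts rule: rev_cases) auto
          then have "encode_token s @ concat (map encode_token (rev ts')) = encode_token t @ u'"
            using ts(2) t(2) by simp
          then have "u' = concat (map encode_token (rev ts'))" using encode_token_prefix by blast
          then show False using \<tau>(1) ts(1) ts' by auto
        qed
        then show ?thesis using step[OF t(3) \<tau>(2)] \<tau>(3) by blast
      qed
    next
      fix \<tau> assume \<tau>: "\<nexists>t u'. allowed M (set fs) t \<and> u = encode_token t @ u'"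
        "runs B (read_token n M fs) \<sigma> \<tau>" "\<tau> 1 = []" "hd0 (\<tau> 3) = 1"
      have "runs B (tokenize n M fs) \<tau> \<tau>" unfolding tokenize_def using \<tau>(3) by (rule runs_While_end)
      moreover have "\<nexists>ts. (\<forall>t\<in>set ts. allowed M (set fs) t) \<and> u = concat (map encode_token (rev ts))"
      proof
        assume "\<exists>ts. (\<forall>t\<in>set ts. allowed M (set fs) t) \<and> u = concat (map encode_token (rev ts))"
        then obtain ts where ts: "\<forall>t\<in>set ts. allowed M (set fs) t" "u = concat (map encode_token (rev ts))" by blast
        then obtain t ts' where "ts = ts' @ [t]" using False by (cases ts rule: rev_cases) auto
        then show False using ts \<tau>(1) by auto
      qed
      ultimately show ?thesis using step[OF \<tau>(2)] \<tau>(4) by blast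
    qed
  qed
qed

section \<open>The leaves of the quantifier tree\<close>

lemma decode_invariant:
  assumes "fold decode_step ys ([], a, b, []) = (M, a', b', z)"
    "set ys \<subseteq> {0<..2 * k}" "set a \<union> set b \<subseteq> {0<..k}"
  shows "length M \<le> length ys" "length z \<le> length ys" "set M \<union> set a' \<union> set b' \<union> set z \<subseteq> {0<..k}"
proof -
  have "case fold decode_step ys ([], a, b, []) of (M, a', b', z) \<Rightarrow>
    length M \<le> length ys \<and> length z \<le> length ys \<and> set M \<union> set a' \<union> set b' \<union> set z \<subseteq> {0<..k}"
    using assms(2)
  proof (induction ys rule: rev_induct)
    case Nil
    then show ?case using assms(3) by simp
  next
    case (snoc x ys)
    obtain M a' b' z where s: "fold decode_step ys ([], a, b, []) = (M, a', b', z)" by (metis prod_cases4)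
    have IH: "length M \<le> length ys" "length z \<le> length ys" "set M \<union> set a' \<union> set b' \<union> set z \<subseteq> {0<..k}"
      using snoc unfolding s by auto
    have "0 < x" "x \<le> 2 * k" using snoc.prems by auto
    then have "(x - 1) div 2 < k" by auto
    moreover have step: "fold decode_step (ys @ [x]) ([], a, b, []) = decode_step x (M, a', b', z)" by (simp add: s)
    ultimately show ?case using IH unfolding step by (simp add: decode_step_def Let_def)
  qed
  then show "length M \<le> length ys" "length z \<le> length ys" "set M \<union> set a' \<union> set b' \<union> set z \<subseteq> {0<..k}"
    unfolding assms(1) by auto
qed

text \<open>The parities of the path repeat the quantifiers, so each block has exactly
  \<open>l\<close> entries when the universal choice behind it makes it a vector.\<close>

lemma decode_lengths:
  assumes "map (\<lambda>x. if odd x then 1 else 2) xs = rev (savitch_pattern l m K)"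
    and "length a = l" "length b = l" "decode a b xs = (M, a', b', z)"
  shows "length a' = l" "length b' = l"
proof -
  let ?kind = "\<lambda>x :: nat. if odd x then 1 else 2 :: nat"
  have odds: "fold decode_step us (M, a, b, z) = (rev (map (\<lambda>x. Suc ((x - 1) div 2)) us) @ M, a, b, z)"
    if "map ?kind us = replicate j 1" for us j M a b z
  proof -
    have "set (map ?kind us) \<subseteq> {1}" unfolding that by auto
    then have "\<forall>x\<in>set us. odd x" by (auto split: if_splits)
    then show ?thesis by (induction us arbitrary: M) (simp_all add: decode_step_def Let_def)
  qed
  have evens: "fold decode_step us ([], a, b, z) = ([], a, b, rev (map (\<lambda>x. Suc ((x - 1) div 2)) us) @ z)"
    if "map ?kind us = replicate j 2" for us j a b z
  proof -
    have "set (map ?kind us) \<subseteq> {2}" unfolding that by auto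
    then have "\<forall>x\<in>set us. even x" by (auto split: if_splits)
    then show ?thesis by (induction us arbitrary: z) (simp_all add: decode_step_def Let_def)
  qed
  have "\<exists>a' b' z'. fold decode_step ys ([], a, b, z) = ([], a', b', z') \<and> length a' = l \<and> length b' = l"
    if "map ?kind ys = savitch_pattern l m K" "length a = l" "length b = l" for ys a b z
    using that
  proof (induction K arbitrary: ys a b z)
    case 0
    then show ?case using evens[of ys m] by (simp add: savitch_pattern_def)
  next
    case (Suc K)
    have "savitch_pattern l m (Suc K) = replicate l 1 @ 2 # savitch_pattern l m K"
      by (simp add: savitch_pattern_def)
    then obtain us x vs where ys: "ys = us @ x # vs" "map ?kind us = replicate l 1" "?kind x = 2"
      "map ?kind vs = savitch_pattern l m K"
      using Suc.prems(1) by (auto simp: map_eq_append_conv map_eq_Cons_conv)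
    have len: "length us = l" using arg_cong[OF ys(2), of length] by simp
    have "even x" using ys(3) by (auto split: if_splits)
    let ?M = "rev (map (\<lambda>x. Suc ((x - 1) div 2)) us)"
    have "fold decode_step ys ([], a, b, z) = fold decode_step vs (decode_step x (?M, a, b, z))"
      using odds[OF ys(2), of "[]" a b z] by (simp add: ys(1))
    moreover have "\<exists>a' b' z'. decode_step x (?M, a, b, z) = ([], a', b', z') \<and> length a' = l \<and> length b' = l"
      using \<open>even x\<close> len Suc.prems(2,3) by (cases "us = []"; cases "(x - 1) div 2 = 0") (auto simp: decode_step_def Let_def)
    then obtain a' b' z' where "decode_step x (?M, a, b, z) = ([], a', b', z')" "length a' = l" "length b' = l"
      by blast
    ultimately show ?case using Suc.IH[OF ys(4), of a' b' z'] by simp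
  qed
  moreover have "map ?kind (rev xs) = savitch_pattern l m K"
    using assms(1) by (metis rev_map rev_rev_ident)
  ultimately have "\<exists>a' b' z'. decode a b xs = ([], a', b', z') \<and> length a' = l \<and> length b' = l"
    using assms(2,3) unfolding decode_def by blast
  then show "length a' = l" "length b' = l" using assms(4) by auto
qed

text \<open>
  Stacks: 9 reversed path, 10 block being read, 11 and 12 the vectors of the edge, 13 name,
  14 matched part of the name, 15 tokens already read, 16 cell pairs, 17 failures,
  18 mismatches of the name, 19 and 20 marks for true and false.
\<close>

definition decode_symbol :: "nat \<Rightarrow> nat \<Rightarrow> cmd" where
  "decode_symbol n x = (let c = Suc ((x - 1) div 2) in
     if odd x then put n 10 c
     else Switch 10 (\<lambda>m. if m = 0 then put n 13 c
       else if c = 1 then Seq (clear 12) (move n 10 12) else Seq (clear 11) (move n 10 11)))"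

definition decode_path :: "nat \<Rightarrow> cmd" where
  "decode_path n = Seq (move n 6 9) (For 9 (\<lambda>x. Seq (put n 6 x) (decode_symbol n x)))"

definition load :: "stacks \<Rightarrow> nat list \<times> nat list \<times> nat list \<times> nat list \<Rightarrow> stacks" where
  "load \<sigma> = (\<lambda>(M, a, b, z). \<sigma>(10 := M, 11 := a, 12 := b, 13 := z))"

lemma runs_decode_symbol:
  assumes "set M \<subseteq> {0<..<n}" "Suc ((x - 1) div 2) < n" "length M < B" "length z < B"
  shows "runs B (decode_symbol n x) (load \<sigma> (M, a, b, z)) (load \<sigma> (decode_step x (M, a, b, z)))"
proof -
  let ?c = "Suc ((x - 1) div 2)" and ?\<sigma> = "load \<sigma> (M, a, b, z)"
  have get: "?\<sigma> 10 = M" "?\<sigma> 11 = a" "?\<sigma> 12 = b" "?\<sigma> 13 = z" by (simp_all add: load_def)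
  consider "odd x" | "even x" "M = []" | "even x" "M \<noteq> []" "(x - 1) div 2 = 0" | "even x" "M \<noteq> []" "(x - 1) div 2 \<noteq> 0" by blast
  then show ?thesis
  proof cases
    case 1
    have "runs B (put n 10 ?c) ?\<sigma> (?\<sigma>(10 := ?c # ?\<sigma> 10))"
      by (rule runs_put) (use assms get in simp_all)
    then show ?thesis unfolding decode_symbol_def Let_def if_P[OF 1]
      by (rule runs_eq) (use 1 in \<open>simp add: decode_step_def load_def fun_eq_iff fun_upd_apply\<close>)
  next
    case 2
    have "runs B (put n 13 ?c) ?\<sigma> (?\<sigma>(13 := ?c # ?\<sigma> 13))"
      by (rule runs_put) (use assms get in simp_all)
    moreover have "?\<sigma>(13 := ?c # ?\<sigma> 13) = load \<sigma> (decode_step x (M, a, b, z))"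
      using 2 by (simp add: decode_step_def load_def fun_eq_iff fun_upd_apply)
    ultimately show ?thesis unfolding decode_symbol_def Let_def
      using 2 get by (simp add: runs_Switch)
  next
    case 3
    have "hd0 M \<noteq> 0" using assms(1) 3(2) by (cases M) auto
    let ?\<tau> = "?\<sigma>(12 := [])"
    have "runs B (move n 10 12) ?\<tau> (?\<tau>(10 := [], 12 := rev (?\<tau> 10) @ ?\<tau> 12))"
      by (rule runs_move) (use assms get in simp_all)
    from runs_Seq[OF runs_clear this]
    have "runs B (Seq (clear 12) (move n 10 12)) ?\<sigma> (load \<sigma> (decode_step x (M, a, b, z)))"
      by (rule runs_eq) (use 3 in \<open>simp add: decode_step_def load_def fun_eq_iff fun_upd_apply\<close>)
    then show ?thesis unfolding decode_symbol_def Let_def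
      using 3 get \<open>hd0 M \<noteq> 0\<close> by (simp add: runs_Switch)
  next
    case 4
    have "hd0 M \<noteq> 0" using assms(1) 4(2) by (cases M) auto
    let ?\<tau> = "?\<sigma>(11 := [])"
    have "runs B (move n 10 11) ?\<tau> (?\<tau>(10 := [], 11 := rev (?\<tau> 10) @ ?\<tau> 11))"
      by (rule runs_move) (use assms get in simp_all)
    from runs_Seq[OF runs_clear this]
    have "runs B (Seq (clear 11) (move n 10 11)) ?\<sigma> (load \<sigma> (decode_step x (M, a, b, z)))"
      by (rule runs_eq) (use 4 in \<open>simp add: decode_step_def load_def fun_eq_iff fun_upd_apply\<close>)
    then show ?thesis unfolding decode_symbol_def Let_def
      using 4 get \<open>hd0 M \<noteq> 0\<close> by (simp add: runs_Switch)
  qed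
qed

lemma runs_decode_path:
  assumes "set xs \<subseteq> {0<..2 * k}" "set a \<union> set b \<subseteq> {0<..k}" "2 * k < n" "length xs < B"
    and "\<sigma> 6 = xs" "\<sigma> 9 = []" "\<sigma> 10 = []" "\<sigma> 11 = a" "\<sigma> 12 = b" "\<sigma> 13 = []"
  shows "runs B (decode_path n) \<sigma> (load \<sigma> (decode a b xs))"
proof -
  have "runs B (move n 6 9) \<sigma> (\<sigma>(6 := [], 9 := rev (\<sigma> 6) @ \<sigma> 9))"
    by (rule runs_move) (use assms in \<open>auto simp: subset_iff\<close>)
  then have move: "runs B (move n 6 9) \<sigma> (\<sigma>(6 := [], 9 := rev xs))" using assms(5,6) by simp
  have "runs B (For 9 (\<lambda>x. Seq (put n 6 x) (decode_symbol n x))) (\<sigma>(6 := [], 9 := rev xs)) (load \<sigma> (decode a b xs))"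
  proof (rule runs_For[where S = "\<lambda>ys. load (\<sigma>(6 := rev ys)) (fold decode_step ys ([], a, b, []))" and zs = "rev xs"])
    fix ys x vs assume xs: "rev xs = ys @ x # vs"
    obtain M a' b' z where s: "fold decode_step ys ([], a, b, []) = (M, a', b', z)" by (metis prod_cases4)
    have "set (rev xs) = set xs" "length (rev xs) = length xs" by (rule set_rev, rule length_rev)
    then have ys: "set ys \<subseteq> {0<..2 * k}" "0 < x" "x \<le> 2 * k" "length ys < length xs"
      using assms(1) unfolding xs by auto
    note inv = decode_invariant[OF s ys(1) assms(2)]
    let ?\<sigma> = "load (\<sigma>(6 := rev ys, 9 := vs)) (M, a', b', z)"
    have put: "runs B (put n 6 x) ?\<sigma> (?\<sigma>(6 := x # ?\<sigma> 6))"
      by (rule runs_put) (use ys assms(3,4) in \<open>simp_all add: load_def\<close>)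
    have eq: "?\<sigma>(6 := x # ?\<sigma> 6) = load (\<sigma>(6 := rev (ys @ [x]), 9 := vs)) (M, a', b', z)"
      by (simp add: load_def fun_eq_iff fun_upd_apply)
    have dec: "runs B (decode_symbol n x) (load (\<sigma>(6 := rev (ys @ [x]), 9 := vs)) (M, a', b', z))
        (load (\<sigma>(6 := rev (ys @ [x]), 9 := vs)) (decode_step x (M, a', b', z)))"
      by (rule runs_decode_symbol) (use inv ys assms(3,4) in \<open>auto simp: subset_iff\<close>)
    note runs_Seq[OF runs_eq[OF put eq] dec]
    moreover have "(load \<rho> s)(9 := vs) = load (\<rho>(9 := vs)) s" for \<rho> s
      by (simp add: load_def fun_eq_iff fun_upd_apply split: prod.split)
    ultimately show "runs B (Seq (put n 6 x) (decode_symbol n x))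
        ((load (\<sigma>(6 := rev ys)) (fold decode_step ys ([], a, b, [])))(9 := vs))
        ((load (\<sigma>(6 := rev (ys @ [x]))) (fold decode_step (ys @ [x]) ([], a, b, [])))(9 := vs))"
      by (simp add: s)
  next
    show "\<sigma>(6 := [], 9 := rev xs) = (load (\<sigma>(6 := rev [])) (fold decode_step [] ([], a, b, [])))(9 := rev xs)"
      using assms by (simp add: load_def fun_eq_iff fun_upd_apply)
    show "load \<sigma> (decode a b xs) = (load (\<sigma>(6 := rev (rev xs))) (fold decode_step (rev xs) ([], a, b, [])))(9 := [])"
      using assms(5,6) by (simp add: load_def decode_def fun_eq_iff fun_upd_apply split: prod.split)
  qed
  with move show ?thesis unfolding decode_path_def by (rule runs_Seq)
qed

section \<open>The scan as a stack program\<close>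

definition pair :: "nat \<times> nat \<Rightarrow> nat" where
  "pair = (\<lambda>(x, y). 12 * (x - 1) + y)"

definition unpair :: "nat \<Rightarrow> nat \<times> nat" where
  "unpair v = ((v - 1) div 12 + 1, (v - 1) mod 12 + 1)"

text \<open>A pair of cells is a single stack symbol, which is the origin of the bound 144 on the
  alphabet.\<close>

lemma unpair_pair:
  assumes "p \<in> {0<..12} \<times> {0<..12}"
  shows "unpair (pair p) = p" "0 < pair p" "pair p \<le> 144"
proof -
  obtain x y where p: "p = (Suc x, Suc y)" "x < 12" "y < 12"
    using assms by (cases p; cases "fst p"; cases "snd p") auto
  have "(12 * x + y) div 12 = x" "(12 * x + y) mod 12 = y" using p by (auto intro: div_nat_eqI mod_nat_eqI)
  then show "unpair (pair p) = p" "0 < pair p" "pair p \<le> 144" using p by (auto simp: pair_def unpair_def)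
qed

abbreviation "cell_pair \<equiv> map_prod cell_of cell_of"

text \<open>The popped pairs \<open>ps\<close> are kept in the control instead of on a stack. The
  arity is that of a fixed token, so finitely many residual programs suffice.\<close>

fun gather :: "nat \<Rightarrow> token \<Rightarrow> nat \<times> nat \<Rightarrow> nat \<Rightarrow> (nat \<times> nat) list \<Rightarrow> cmd" where
  "gather n t p 0 ps = (if node_ok t (cell_pair p) (map cell_pair (rev ps)) then put n 16 (pair p) else Push 17 1)"
| "gather n t p (Suc k) ps = Switch 16 (\<lambda>v. if v = 0 then Push 17 1 else Seq (Pop 16) (gather n t p k (unpair v # ps)))"

lemma runs_gather:
  fixes t :: token
  assumes "\<sigma> 16 = map pair V" "set V \<subseteq> {0<..12} \<times> {0<..12}" "p \<in> {0<..12} \<times> {0<..12}" "144 < n"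
    and "length V < B" "length (\<sigma> 17) < B"
  defines "ok \<equiv> \<lambda>k ps V. k \<le> length V \<and> node_ok t (cell_pair p) (map cell_pair (rev ps @ take k V))"
  shows "runs B (gather n t p k ps) \<sigma> (\<sigma>(16 := map pair (if ok k ps V then p # drop k V else drop k V),
    17 := if ok k ps V then \<sigma> 17 else 1 # \<sigma> 17))"
  using assms(1,2,5,6)
proof (induction k arbitrary: ps V \<sigma>)
  case 0
  have *: "pair p < n" "0 < pair p" using unpair_pair[OF assms(3)] assms(4) by simp_all
  show ?case
  proof (cases "ok 0 ps V")
    case True
    then have "gather n t p 0 ps = put n 16 (pair p)" by (simp add: ok_def)
    moreover have "runs B (put n 16 (pair p)) \<sigma> (\<sigma>(16 := pair p # \<sigma> 16))"
      by (rule runs_put) (use * 0 in simp_all)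
    ultimately show ?thesis using True 0 by (simp add: fun_upd_idem)
  next
    case False
    then have "gather n t p 0 ps = Push 17 1" by (simp add: ok_def)
    moreover have "runs B (Push 17 1) \<sigma> (\<sigma>(17 := 1 # \<sigma> 17))" by (rule runs_Push) (use 0 in simp)
    ultimately show ?thesis using False 0 by (simp add: fun_upd_idem)
  qed
next
  case (Suc k)
  show ?case
  proof (cases V)
    case Nil
    have "runs B (Push 17 1) \<sigma> (\<sigma>(17 := 1 # \<sigma> 17))" by (rule runs_Push) (use Suc.prems in simp)
    then have "runs B (gather n t p (Suc k) ps) \<sigma> (\<sigma>(17 := 1 # \<sigma> 17))"
      unfolding gather.simps by (intro runs_Switch) (simp add: Suc.prems(1) Nil)
    then show ?thesis using Nil Suc.prems(1) by (simp add: ok_def fun_upd_idem)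
  next
    case (Cons q V')
    let ?\<sigma> = "\<sigma>(16 := map pair V')"
    have q: "unpair (pair q) = q" "pair q \<noteq> 0" using unpair_pair[of q] Suc.prems(2) Cons by simp_all
    have ok: "ok (Suc k) ps V = ok k (q # ps) V'" by (simp add: ok_def Cons)
    have "runs B (Pop 16) \<sigma> ?\<sigma>" by (rule runs_eq[OF runs_Pop]) (simp add: Suc.prems(1) Cons)
    moreover have "runs B (gather n t p k (q # ps)) ?\<sigma> (?\<sigma>(16 := map pair (if ok k (q # ps) V' then p # drop k V' else drop k V'),
        17 := if ok k (q # ps) V' then ?\<sigma> 17 else 1 # ?\<sigma> 17))"
      by (rule Suc.IH) (use Suc.prems Cons in simp_all)
    ultimately have "runs B (Seq (Pop 16) (gather n t p k (q # ps))) \<sigma>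
        (?\<sigma>(16 := map pair (if ok k (q # ps) V' then p # drop k V' else drop k V'),
        17 := if ok k (q # ps) V' then ?\<sigma> 17 else 1 # ?\<sigma> 17))" by (rule runs_Seq)
    then have "runs B (gather n t p (Suc k) ps) \<sigma> (?\<sigma>(16 := map pair (if ok k (q # ps) V' then p # drop k V' else drop k V'),
        17 := if ok k (q # ps) V' then ?\<sigma> 17 else 1 # ?\<sigma> 17))"
      unfolding gather.simps by (intro runs_Switch) (simp add: Suc.prems(1) Cons q)
    then show ?thesis unfolding ok by (rule runs_eq) (simp add: Cons)
  qed
qed

definition mark :: "bool \<Rightarrow> cmd" where
  "mark b = Seq (Switch (if b then 20 else 19) (\<lambda>s. if s = 0 then Skip else Push 17 1)) (Push (if b then 19 else 20) 1)"

definition visit :: "nat \<Rightarrow> token \<Rightarrow> bool \<Rightarrow> cmd" where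
  "visit n t h = Switch 11 (\<lambda>x. Switch 12 (\<lambda>y. Seq (Pop 11) (Seq (Pop 12)
     (Seq (if h then mark (truth (cell_of x)) else Skip) (gather n t (x, y) (ar t) [])))))"

text \<open>\<open>T\<close> are the symbols still to be read, \<open>T'\<close> those already read, \<open>ps\<close> the remaining cell pairs.\<close>

definition conf_check :: "stacks \<Rightarrow> nat list \<Rightarrow> nat list \<Rightarrow> (nat \<times> nat) list \<Rightarrow> nat list \<Rightarrow> check_state \<Rightarrow> stacks" where
  "conf_check \<sigma> T T' ps z = (\<lambda>(V, F, T1, T0). \<sigma>(2 := T, 15 := T', 11 := map fst ps, 12 := map snd ps,
     13 := z, 16 := map pair V, 17 := F, 19 := T1, 20 := T0))"

text \<open>Room for \<open>l\<close> more tokens. Each adds at most one entry to a stack, except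
  for two on the failures: one for its node and one for conflicting values of its variable.\<close>

definition fits :: "nat \<Rightarrow> nat \<Rightarrow> check_state \<Rightarrow> bool" where
  "fits B l = (\<lambda>(V, F, T1, T0). set V \<subseteq> {0<..12} \<times> {0<..12} \<and> set F \<union> set T1 \<union> set T0 \<subseteq> {1} \<and>
     length V + l < B \<and> length F + 2 * l < B \<and> length T1 + l < B \<and> length T0 + l < B)"

lemma fits_check_token:
  assumes "fits B (Suc l) s" "p \<in> {0<..12} \<times> {0<..12}"
  shows "fits B l (check_token z (t, p) s)"
  using assms by (cases s) (auto simp: fits_def check_token_def Let_def dest: in_set_dropD split: prod.split)

lemma runs_mark:
  assumes "length (\<sigma> 17) < B" "length (\<sigma> 19) < B" "length (\<sigma> 20) < B" "set (\<sigma> 19) \<union> set (\<sigma> 20) \<subseteq> {1}"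
  shows "runs B (mark b) \<sigma> (\<sigma>(17 := if (if b then \<sigma> 20 \<noteq> [] else \<sigma> 19 \<noteq> []) then 1 # \<sigma> 17 else \<sigma> 17,
    19 := if b then 1 # \<sigma> 19 else \<sigma> 19, 20 := if b then \<sigma> 20 else 1 # \<sigma> 20))"
proof -
  let ?j = "if b then 20 else 19 :: nat" and ?i = "if b then 19 else 20 :: nat"
  let ?\<tau> = "\<sigma>(17 := if \<sigma> ?j \<noteq> [] then 1 # \<sigma> 17 else \<sigma> 17)"
  have "runs B (if hd0 (\<sigma> ?j) = 0 then Skip else Push 17 1) \<sigma> ?\<tau>"
  proof (cases "\<sigma> ?j")
    case Nil
    then show ?thesis by (auto simp: fun_upd_idem intro: runs_Skip)
  next
    case (Cons a as)
    then have "hd0 (\<sigma> ?j) = 1" using assms(4) by (cases b) auto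
    then show ?thesis using Cons runs_Push[of \<sigma> 17 B 1] assms(1) by simp
  qed
  then have "runs B (Switch ?j (\<lambda>s. if s = 0 then Skip else Push 17 1)) \<sigma> ?\<tau>" by (rule runs_Switch)
  moreover have "runs B (Push ?i 1) ?\<tau> (?\<tau>(?i := 1 # ?\<tau> ?i))"
    by (rule runs_Push) (use assms in simp)
  ultimately have "runs B (mark b) \<sigma> (?\<tau>(?i := 1 # ?\<tau> ?i))" unfolding mark_def by (rule runs_Seq)
  then show ?thesis by (rule runs_eq) (auto simp: fun_eq_iff fun_upd_apply)
qed

lemma runs_visit:
  assumes "fits B (Suc l) s" "p \<in> {0<..12} \<times> {0<..12}" "144 < n" "h = matches_name z t"
    and t: "ar t' = ar t" "\<And>p cs. node_ok t' p cs = node_ok t p cs"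
  shows "runs B (visit n t' h) (conf_check \<sigma> T T' (p # ps) z' s) (conf_check \<sigma> T T' ps z' (check_token z (t, p) s))"
proof -
  obtain V F T1 T0 where s: "s = (V, F, T1, T0)" by (metis prod_cases4)
  obtain x y where p: "p = (x, y)" by (cases p)
  let ?\<sigma> = "\<lambda>ps F T1 T0. conf_check \<sigma> T T' ps z' (V, F, T1, T0)"
  let ?b = "truth (cell_of x)"
  let ?F = "if h \<and> (if ?b then T0 \<noteq> [] else T1 \<noteq> []) then 1 # F else F"
  let ?T1 = "if h \<and> ?b then 1 # T1 else T1" and ?T0 = "if h \<and> \<not> ?b then 1 # T0 else T0"
  have fits: "set V \<subseteq> {0<..12} \<times> {0<..12}" "set T1 \<union> set T0 \<subseteq> {1}" "length V < B" "length F + 1 < B" "length T1 < B" "length T0 < B"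
    using assms(1) by (auto simp: s fits_def)
  have "runs B (Pop 11) (?\<sigma> (p # ps) F T1 T0) ((?\<sigma> (p # ps) F T1 T0)(11 := map fst ps))"
    by (rule runs_eq[OF runs_Pop]) (simp add: conf_check_def)
  moreover have "runs B (Pop 12) ((?\<sigma> (p # ps) F T1 T0)(11 := map fst ps)) (?\<sigma> ps F T1 T0)"
    by (rule runs_eq[OF runs_Pop]) (simp add: conf_check_def fun_eq_iff fun_upd_apply)
  moreover have "runs B (if h then mark ?b else Skip) (?\<sigma> ps F T1 T0) (?\<sigma> ps ?F ?T1 ?T0)"
  proof (cases h)
    case True
    have "runs B (mark ?b) (?\<sigma> ps F T1 T0) (?\<sigma> ps ?F ?T1 ?T0)"
      by (rule runs_eq[OF runs_mark]) (use fits True in \<open>simp_all add: conf_check_def fun_eq_iff fun_upd_apply\<close>)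
    then show ?thesis using True by simp
  qed (simp add: runs_Skip)
  moreover have "runs B (gather n t' (x, y) (ar t') []) (?\<sigma> ps ?F ?T1 ?T0) (conf_check \<sigma> T T' ps z' (check_token z (t, p) s))"
  proof -
    let ?\<rho> = "?\<sigma> ps ?F ?T1 ?T0"
    have ok: "(ar t' \<le> length V \<and> node_ok t' (cell_pair (x, y)) (map cell_pair (rev [] @ take (ar t') V))) = check_node t p V"
      by (simp add: check_node_def t p)
    have get: "?\<rho> 16 = map pair V" "length (?\<rho> 17) < B" using fits by (simp_all add: conf_check_def)
    have "runs B (gather n t' (x, y) (ar t') []) ?\<rho> (?\<rho>(16 := map pair (if check_node t p V then (x, y) # drop (ar t') V else drop (ar t') V),
        17 := if check_node t p V then ?\<rho> 17 else 1 # ?\<rho> 17))"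
      unfolding ok[symmetric] by (rule runs_gather[OF get(1) _ _ _ _ get(2)]) (use fits assms(2,3) p in simp_all)
    then show ?thesis
      by (rule runs_eq) (cases "check_node t p V"; simp add: conf_check_def check_token_def Let_def s t(1) p assms(4) fun_eq_iff fun_upd_apply)
  qed
  ultimately have "runs B (Seq (Pop 11) (Seq (Pop 12) (Seq (if h then mark ?b else Skip) (gather n t' (x, y) (ar t') []))))
      (?\<sigma> (p # ps) F T1 T0) (conf_check \<sigma> T T' ps z' (check_token z (t, p) s))"
    by (intro runs_Seq)
  moreover have "hd0 (?\<sigma> (p # ps) F T1 T0 11) = x" "hd0 (?\<sigma> (p # ps) F T1 T0 12) = y"
    by (simp_all add: conf_check_def p)
  ultimately show ?thesis unfolding visit_def s by (intro runs_Switch) (simp only:)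
qed

lemma runs_For_Cons:
  assumes "\<sigma> j = a # ys" "runs B (f a) (\<sigma>(j := ys)) \<rho>" "runs B (For j f) \<rho> \<tau>"
  shows "runs B (For j f) \<sigma> \<tau>"
proof -
  have "runs B (Pop j) \<sigma> (\<sigma>(j := ys))" by (rule runs_eq[OF runs_Pop]) (simp add: assms(1))
  then have "runs B (Seq (Pop j) (f a)) \<sigma> \<rho>" using assms(2) by (rule runs_Seq)
  then have "runs B (Switch j (\<lambda>a. Seq (Pop j) (f a))) \<sigma> \<rho>" by (intro runs_Switch) (simp add: assms(1))
  then show ?thesis unfolding For_def
    by (rule runs_While_step[rotated, OF _ assms(3)[unfolded For_def]]) (simp add: assms(1))
qed

definition token_of :: "bool_fun list \<Rightarrow> nat \<Rightarrow> token" where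
  "token_of fs a = (if a = 5 then TNext else if a = 6 then TFin else if a = 7 then TGlob else TConn (fs ! (a - 8)))"

text \<open>The matched part of the guess waits on stack 14 and is put back at the closing bracket
  4, so each variable is compared with the whole guess. The visit then uses \<open>TVar 0\<close>
  for every variable, since a finite control cannot hold the name.\<close>

definition check_symbol :: "nat \<Rightarrow> bool_fun list \<Rightarrow> nat \<Rightarrow> cmd" where
  "check_symbol n fs a =
    (if a = 3 then Skip
     else if a = 1 \<or> a = 2 then Switch 13 (\<lambda>s. if s = a then Seq (Pop 13) (put n 14 a) else Push 18 1)
     else if a = 4 then Seq (Switch 13 (\<lambda>s. if s = 1 \<or> s = 2 then Push 18 1 else Skip))
       (Seq (move n 14 13) (Switch 18 (\<lambda>m. Seq (clear 18) (visit n (TVar 0) (m = 0)))))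
     else visit n (token_of fs a) False)"

definition check_loop :: "nat \<Rightarrow> bool_fun list \<Rightarrow> cmd" where
  "check_loop n fs = For 2 (\<lambda>a. Seq (put n 15 a) (check_symbol n fs a))"

lemma runs_check_loop:
  assumes "\<sigma> 2 = a # T" "0 < a" "a < n" "length (\<sigma> 15) < B"
    "runs B (check_symbol n fs a) (\<sigma>(2 := T, 15 := a # \<sigma> 15)) \<rho>" "runs B (check_loop n fs) \<rho> \<tau>"
  shows "runs B (check_loop n fs) \<sigma> \<tau>"
proof -
  let ?\<sigma> = "\<sigma>(2 := T)"
  have "runs B (put n 15 a) ?\<sigma> (?\<sigma>(15 := a # ?\<sigma> 15))" by (rule runs_put) (use assms in simp_all)
  then have "runs B (Seq (put n 15 a) (check_symbol n fs a)) ?\<sigma> \<rho>"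
    by (rule runs_Seq) (use assms(5) in simp)
  then show ?thesis using assms(6) unfolding check_loop_def by (rule runs_For_Cons[of \<sigma> 2, OF assms(1)])
qed

text \<open>\<open>z\<close> and \<open>zz\<close> are the unread and the read part of the guessed name, \<open>ms\<close> the mismatches.\<close>

definition conf_name :: "stacks \<Rightarrow> nat list \<Rightarrow> nat list \<Rightarrow> nat list \<Rightarrow> nat list \<Rightarrow> nat list \<Rightarrow> stacks" where
  "conf_name \<sigma> T T' z zz ms = \<sigma>(2 := T, 15 := T', 13 := z, 14 := zz, 18 := ms)"

text \<open>After a mismatch the comparison continues and may even consume more of the guess; only
  the record of the mismatch and the possibility of restoring the guess matter.\<close>

lemma runs_digits:
  assumes "set ds \<subseteq> {1, 2}" "length T' + length ds < B" "length zz + length z < B" "length ms + length ds < B" "4 < n"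
  shows "\<exists>z1 zz1 ms1. rev zz1 @ z1 = rev zz @ z \<and> (hd0 ms1 = 0 \<longleftrightarrow> hd0 ms = 0 \<and> (\<exists>u. z = ds @ u)) \<and>
    (hd0 ms1 = 0 \<longrightarrow> z = ds @ z1) \<and> length ms1 \<le> length ms + length ds \<and>
    (\<forall>\<tau>. runs B (check_loop n fs) (conf_name \<sigma> T (rev ds @ T') z1 zz1 ms1) \<tau> \<longrightarrow>
      runs B (check_loop n fs) (conf_name \<sigma> (ds @ T) T' z zz ms) \<tau>)"
  using assms(1-4)
proof (induction ds arbitrary: T' z zz ms)
  case Nil
  show ?case by (intro exI[of _ z] exI[of _ zz] exI[of _ ms]) auto
next
  case (Cons d ds)
  let ?I = "\<lambda>ds T' z zz ms z1 zz1 ms1. rev zz1 @ z1 = rev zz @ z \<and> (hd0 ms1 = 0 \<longleftrightarrow> hd0 ms = 0 \<and> (\<exists>u. z = ds @ u)) \<and>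
    (hd0 ms1 = 0 \<longrightarrow> z = ds @ z1) \<and> length ms1 \<le> length ms + length ds \<and>
    (\<forall>\<tau>. runs B (check_loop n fs) (conf_name \<sigma> T (rev ds @ T') z1 zz1 ms1) \<tau> \<longrightarrow>
      runs B (check_loop n fs) (conf_name \<sigma> (ds @ T) T' z zz ms) \<tau>)"
  have d: "d = 1 \<or> d = 2" "0 < d" "d < n" using Cons.prems(1) assms(5) by auto
  let ?\<sigma> = "conf_name \<sigma> (d # ds @ T) T' z zz ms"
  have get: "?\<sigma> 2 = d # ds @ T" "?\<sigma> 15 = T'" "?\<sigma> 13 = z" "?\<sigma> 14 = zz" "?\<sigma> 18 = ms"
    by (simp_all add: conf_name_def)
  let ?\<sigma>' = "?\<sigma>(2 := ds @ T, 15 := d # ?\<sigma> 15)"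
  have symbol: "check_symbol n fs d = Switch 13 (\<lambda>s. if s = d then Seq (Pop 13) (put n 14 d) else Push 18 1)"
    using d by (auto simp: check_symbol_def)
  have step: "runs B (check_loop n fs) ?\<sigma> \<tau>"
    if "runs B (check_symbol n fs d) ?\<sigma>' \<rho>" "runs B (check_loop n fs) \<rho> \<tau>" for \<rho> \<tau>
    by (rule runs_check_loop[OF get(1) d(2,3) _ that]) (use Cons.prems(2) get in simp)
  show ?case
  proof (cases "hd0 z = d")
    case True
    then obtain z' where z: "z = d # z'" using d(2) by (cases z) auto
    have "runs B (Pop 13) ?\<sigma>' (?\<sigma>'(13 := z'))" by (rule runs_eq[OF runs_Pop]) (simp add: conf_name_def z)
    moreover have "runs B (put n 14 d) (?\<sigma>'(13 := z')) (conf_name \<sigma> (ds @ T) (d # T') z' (d # zz) ms)"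
      by (rule runs_eq[OF runs_put])
        (use d(2,3) Cons.prems(3) z in \<open>simp_all add: conf_name_def fun_eq_iff fun_upd_apply\<close>)
    ultimately have "runs B (Seq (Pop 13) (put n 14 d)) ?\<sigma>' (conf_name \<sigma> (ds @ T) (d # T') z' (d # zz) ms)"
      by (rule runs_Seq)
    then have "runs B (check_symbol n fs d) ?\<sigma>' (conf_name \<sigma> (ds @ T) (d # T') z' (d # zz) ms)"
      unfolding symbol by (intro runs_Switch) (simp add: conf_name_def z)
    note step = step[OF this]
    have "\<exists>z1 zz1 ms1. ?I ds (d # T') z' (d # zz) ms z1 zz1 ms1"
      by (rule Cons.IH) (use Cons.prems z in simp_all)
    then obtain z1 zz1 ms1 where i: "?I ds (d # T') z' (d # zz) ms z1 zz1 ms1" by (elim exE)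
    then have "?I (d # ds) T' z zz ms z1 zz1 ms1"
      using step by (simp add: z)
    then show ?thesis by (intro exI)
  next
    case False
    have "runs B (Push 18 1) ?\<sigma>' (conf_name \<sigma> (ds @ T) (d # T') z zz (1 # ms))"
      by (rule runs_eq[OF runs_Push])
        (use Cons.prems(4) in \<open>simp_all add: conf_name_def fun_eq_iff fun_upd_apply\<close>)
    then have "runs B (check_symbol n fs d) ?\<sigma>' (conf_name \<sigma> (ds @ T) (d # T') z zz (1 # ms))"
      unfolding symbol using False by (intro runs_Switch) (simp add: get)
    note step = step[OF this]
    have "\<nexists>u. z = (d # ds) @ u" using False by auto
    have "\<exists>z1 zz1 ms1. ?I ds (d # T') z zz (1 # ms) z1 zz1 ms1"
      by (rule Cons.IH) (use Cons.prems in simp_all)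
    then obtain z1 zz1 ms1 where i: "?I ds (d # T') z zz (1 # ms) z1 zz1 ms1" by (elim exE)
    then have "?I (d # ds) T' z zz ms z1 zz1 ms1"
      using step \<open>\<nexists>u. z = (d # ds) @ u\<close> by simp
    then show ?thesis by (intro exI)
  qed
qed

lemma takeWhile_eq_iff:
  assumes "\<forall>x\<in>set ds. P x"
  shows "takeWhile P z = ds \<longleftrightarrow> (\<exists>u. z = ds @ u \<and> (u = [] \<or> \<not> P (hd u)))"
proof
  assume "takeWhile P z = ds"
  then show "\<exists>u. z = ds @ u \<and> (u = [] \<or> \<not> P (hd u))"
    using hd_dropWhile[of P z] takeWhile_dropWhile_id[of P z] by metis
next
  assume "\<exists>u. z = ds @ u \<and> (u = [] \<or> \<not> P (hd u))"
  then obtain u where "z = ds @ u" "takeWhile P u = []" by (metis takeWhile_eq_Nil_iff)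
  then show "takeWhile P z = ds" using assms by (simp add: takeWhile_append2)
qed

lemma conf_name_check:
  "\<sigma> 14 = [] \<Longrightarrow> \<sigma> 18 = [] \<Longrightarrow> conf_name (conf_check \<sigma> T0 T0' ps z0 s) T T' z [] [] = conf_check \<sigma> T T' ps z s"
  by (cases s) (simp add: conf_name_def conf_check_def fun_eq_iff fun_upd_apply)

text \<open>This justifies that all variables are visited as \<open>TVar 0\<close>; their names
  enter only through the comparison with the guess.\<close>

lemma node_ok_TVar: "node_ok (TVar x) p cs = node_ok (TVar y) p cs"
  unfolding node_ok_def by (cases "(TVar x, p, cs)" rule: local_ok.cases) auto

lemma runs_check_variable:
  assumes s: "fits B (Suc l) s" "p \<in> {0<..12} \<times> {0<..12}" and n: "144 < n"
    and \<sigma>: "\<sigma> 14 = []" "\<sigma> 18 = []" and z: "set z \<subseteq> {0<..<n}" "length z < B"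
    and B: "length T' + length (name x) + 2 < B"
    and cont: "runs B (check_loop n fs) (conf_check \<sigma> T (4 # rev (name x) @ 3 # T') ps z (check_token z (TVar x, p) s)) \<tau>"
  shows "runs B (check_loop n fs) (conf_check \<sigma> (3 # name x @ 4 # T) T' (p # ps) z s) \<tau>"
proof -
  let ?ds = "name x" and ?\<sigma> = "conf_check \<sigma> (3 # name x @ 4 # T) T' (p # ps) z s"
  let ?conf = "conf_name ?\<sigma>"
  have get: "?\<sigma> 2 = 3 # ?ds @ 4 # T" "?\<sigma> 15 = T'"
    by (cases s; simp add: conf_check_def)+
  let ?I = "\<lambda>z1 zz1 ms1. rev zz1 @ z1 = rev [] @ z \<and> (hd0 ms1 = 0 \<longleftrightarrow> hd0 [] = 0 \<and> (\<exists>u. z = ?ds @ u)) \<and>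
    (hd0 ms1 = 0 \<longrightarrow> z = ?ds @ z1) \<and> length ms1 \<le> length ([] :: nat list) + length ?ds \<and>
    (\<forall>\<tau>. runs B (check_loop n fs) (?conf (4 # T) (rev ?ds @ 3 # T') z1 zz1 ms1) \<tau> \<longrightarrow>
      runs B (check_loop n fs) (?conf (?ds @ 4 # T) (3 # T') z [] []) \<tau>)"
  have "\<exists>z1 zz1 ms1. ?I z1 zz1 ms1"
    by (rule runs_digits[where ms = "[]"]) (use B z(2) n set_binary_name in simp_all)
  then obtain z1 zz1 ms1 where I: "?I z1 zz1 ms1" by (elim exE)
  then have i: "rev zz1 @ z1 = z" "hd0 ms1 = 0 \<longleftrightarrow> (\<exists>u. z = ?ds @ u)"
    "hd0 ms1 = 0 \<longrightarrow> z = ?ds @ z1" "length ms1 \<le> length ?ds"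
    "runs B (check_loop n fs) (?conf (4 # T) (rev ?ds @ 3 # T') z1 zz1 ms1) \<tau> \<Longrightarrow>
      runs B (check_loop n fs) (?conf (?ds @ 4 # T) (3 # T') z [] []) \<tau>" by simp_all
  have size: "set zz1 \<union> set z1 \<subseteq> {0<..<n}" "length zz1 + length z1 < B" using z unfolding i(1)[symmetric] by auto
  let ?T' = "4 # rev ?ds @ 3 # T'"
  \<comment> \<open>If the guess goes on with a digit, the name read is only a proper prefix of the
    guessed one and counts as a mismatch.\<close>
  define ms2 where "ms2 = (if hd0 z1 = 1 \<or> hd0 z1 = 2 then 1 # ms1 else ms1)"
  let ?P = "\<lambda>s :: nat. s = 1 \<or> s = 2"
  have stop: "u = [] \<or> \<not> ?P (hd u) \<longleftrightarrow> \<not> ?P (hd0 u)" for u by (cases u) auto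
  have "(hd0 ms2 = 0) \<longleftrightarrow> (\<exists>u. z = ?ds @ u \<and> (u = [] \<or> \<not> ?P (hd u)))"
    unfolding stop ms2_def using i(2,3) by (auto split: if_splits)
  also have "\<dots> \<longleftrightarrow> matches_name z (TVar x)"
    using takeWhile_eq_iff[of ?ds ?P z] set_binary_name[of x] by auto
  finally have hit: "(hd0 ms2 = 0) = matches_name z (TVar x)" .
  have "runs B (if ?P (hd0 (?conf T ?T' z1 zz1 ms1 13)) then Push 18 1 else Skip) (?conf T ?T' z1 zz1 ms1) (?conf T ?T' z1 zz1 ms2)"
  proof (cases "?P (hd0 z1)")
    case True
    have "runs B (Push 18 1) (?conf T ?T' z1 zz1 ms1) (?conf T ?T' z1 zz1 ms2)"
      by (rule runs_eq[OF runs_Push])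
        (use i(4) B True in \<open>simp_all add: conf_name_def ms2_def fun_eq_iff fun_upd_apply\<close>)
    moreover have "?conf T ?T' z1 zz1 ms1 13 = z1" by (simp add: conf_name_def)
    ultimately show ?thesis using True by simp
  next
    case False
    moreover have "?conf T ?T' z1 zz1 ms1 13 = z1" by (simp add: conf_name_def)
    ultimately show ?thesis by (simp add: ms2_def runs_Skip)
  qed
  then have a: "runs B (Switch 13 (\<lambda>s. if ?P s then Push 18 1 else Skip)) (?conf T ?T' z1 zz1 ms1) (?conf T ?T' z1 zz1 ms2)"
    by (rule runs_Switch)
  have b: "runs B (move n 14 13) (?conf T ?T' z1 zz1 ms2) (?conf T ?T' z [] ms2)"
    by (rule runs_eq[OF runs_move])
      (use size in \<open>simp_all add: conf_name_def i(1) fun_eq_iff fun_upd_apply\<close>)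
  have "runs B (clear 18) (?conf T ?T' z [] ms2) (?conf T ?T' z [] [])"
    by (rule runs_eq[OF runs_clear]) (simp add: conf_name_def fun_eq_iff fun_upd_apply)
  then have c1: "runs B (clear 18) (?conf T ?T' z [] ms2) (conf_check \<sigma> T ?T' (p # ps) z s)"
    by (simp only: conf_name_check[OF \<sigma>])
  have c2: "runs B (visit n (TVar 0) (hd0 ms2 = 0)) (conf_check \<sigma> T ?T' (p # ps) z s) (conf_check \<sigma> T ?T' ps z (check_token z (TVar x, p) s))"
    by (rule runs_visit[OF s n hit]) (simp, rule node_ok_TVar)
  have "?conf T ?T' z [] ms2 18 = ms2" by (simp add: conf_name_def)
  then have c: "runs B (Switch 18 (\<lambda>m. Seq (clear 18) (visit n (TVar 0) (m = 0)))) (?conf T ?T' z [] ms2)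
      (conf_check \<sigma> T ?T' ps z (check_token z (TVar x, p) s))"
    by (intro runs_Switch) (simp only: runs_Seq[OF c1 c2])
  have "runs B (check_symbol n fs 4) (?conf T ?T' z1 zz1 ms1) (conf_check \<sigma> T ?T' ps z (check_token z (TVar x, p) s))"
    using runs_Seq[OF a runs_Seq[OF b c]] by (simp add: check_symbol_def)
  moreover have "(?conf (4 # T) (rev ?ds @ 3 # T') z1 zz1 ms1)(2 := T, 15 := 4 # (?conf (4 # T) (rev ?ds @ 3 # T') z1 zz1 ms1) 15) =
      ?conf T ?T' z1 zz1 ms1"
    by (simp add: conf_name_def fun_eq_iff fun_upd_apply)
  ultimately have "runs B (check_loop n fs) (?conf (4 # T) (rev ?ds @ 3 # T') z1 zz1 ms1) \<tau>"
    by (intro runs_check_loop[OF _ _ _ _ _ cont, of _ 4 T]) (use B n in \<open>simp_all add: conf_name_def\<close>)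
  from i(5)[OF this] have digits: "runs B (check_loop n fs) (?conf (?ds @ 4 # T) (3 # T') z [] []) \<tau>" .
  have "runs B (check_symbol n fs 3) (?\<sigma>(2 := ?ds @ 4 # T, 15 := 3 # ?\<sigma> 15)) (?conf (?ds @ 4 # T) (3 # T') z [] [])"
    by (rule runs_eq[of _ _ _ "?\<sigma>(2 := ?ds @ 4 # T, 15 := 3 # ?\<sigma> 15)"])
      (use \<sigma> in \<open>cases s; simp add: check_symbol_def runs_Skip conf_name_def conf_check_def fun_eq_iff fun_upd_apply\<close>)+
  from runs_check_loop[where \<sigma> = ?\<sigma>, OF get(1) _ _ _ this digits] show ?thesis
    using B n get(2) by simp
qed

lemma runs_check_tokens:
  assumes "length ps = length us" "set ps \<subseteq> {0<..12} \<times> {0<..12}" "fits B (length us) s"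
    and "\<And>t. t \<in> set us \<Longrightarrow> allowed M (set fs) t"
    and "length T' + length (concat (map (token_symbols fs) us)) + 1 < B"
    and n: "144 < n" "8 + length fs < n" and \<sigma>: "\<sigma> 14 = []" "\<sigma> 18 = []" and z: "set z \<subseteq> {0<..<n}" "length z < B"
  shows "runs B (check_loop n fs) (conf_check \<sigma> (concat (map (token_symbols fs) us)) T' ps z s)
    (conf_check \<sigma> [] (rev (concat (map (token_symbols fs) us)) @ T') [] z (fold (check_token z) (zip us ps) s))"
  using assms(1-5)
proof (induction us arbitrary: ps T' s)
  case Nil
  have "runs B (check_loop n fs) (conf_check \<sigma> [] T' [] z s) (conf_check \<sigma> [] T' [] z s)"
    unfolding check_loop_def For_def by (rule runs_While_end) (simp add: conf_check_def split: prod.split)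
  then show ?case using Nil by simp
next
  case (Cons t us)
  obtain p ps' where ps: "ps = p # ps'" "length ps' = length us" using Cons.prems(1) by (cases ps) auto
  have p: "p \<in> {0<..12} \<times> {0<..12}" "set ps' \<subseteq> {0<..12} \<times> {0<..12}" using Cons.prems(2) ps by auto
  have fits: "fits B (Suc (length us)) s" using Cons.prems(3) by simp
  let ?T = "concat (map (token_symbols fs) us)"
  let ?s = "check_token z (t, p) s"
  have IH: "runs B (check_loop n fs) (conf_check \<sigma> ?T (rev (token_symbols fs t) @ T') ps' z ?s)
      (conf_check \<sigma> [] (rev ?T @ rev (token_symbols fs t) @ T') [] z (fold (check_token z) (zip us ps') ?s))"
    by (rule Cons.IH[OF ps(2) p(2) fits_check_token[OF fits p(1)]]) (use Cons.prems(4,5) in simp_all)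
  have "runs B (check_loop n fs) (conf_check \<sigma> (token_symbols fs t @ ?T) T' (p # ps') z s)
      (conf_check \<sigma> [] (rev ?T @ rev (token_symbols fs t) @ T') [] z (fold (check_token z) (zip us ps') ?s))" (is "runs B _ ?\<sigma> ?\<tau>")
  proof (cases "\<exists>x. t = TVar x")
    case True
    then obtain x where x: "t = TVar x" by blast
    have "runs B (check_loop n fs) (conf_check \<sigma> (3 # name x @ 4 # ?T) T' (p # ps') z s) ?\<tau>"
      by (rule runs_check_variable[OF fits p(1) n(1) \<sigma> z]) (use IH Cons.prems(5) x in simp_all)
    then show ?thesis by (simp add: x)
  next
    case False
    then obtain a where a: "token_symbols fs t = [a]" by (cases t) auto
    have t: "t \<in> {TNext, TFin, TGlob} \<or> (\<exists>f\<in>set fs. t = TConn f)"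
      using Cons.prems(4)[of t] False by (cases t) auto
    have "4 < a \<and> a < n \<and> token_of fs a = t"
    proof (cases "\<exists>f\<in>set fs. t = TConn f")
      case True
      then obtain f where "f \<in> set fs" "t = TConn f" by blast
      then show ?thesis using a index_of[of f fs] n by (auto simp: token_of_def)
    next
      case False
      then show ?thesis using t a n by (auto simp: token_of_def)
    qed
    then have a': "4 < a" "a < n" "token_of fs a = t" by simp_all
    have get: "?\<sigma> 2 = a # ?T" "?\<sigma> 15 = T'" by (cases s; simp add: conf_check_def a)+
    have "check_symbol n fs a = visit n t False" using a' by (auto simp: check_symbol_def)
    moreover have "runs B (visit n t False) (conf_check \<sigma> ?T (a # T') (p # ps') z s) (conf_check \<sigma> ?T (a # T') ps' z ?s)"
      by (rule runs_visit[OF fits p(1) n(1)]) (use False in \<open>cases t; simp\<close>)+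
    moreover have "?\<sigma>(2 := ?T, 15 := a # ?\<sigma> 15) = conf_check \<sigma> ?T (a # T') (p # ps') z s"
      by (cases s) (simp add: conf_check_def a fun_eq_iff fun_upd_apply)
    ultimately have step: "runs B (check_symbol n fs a) (?\<sigma>(2 := ?T, 15 := a # ?\<sigma> 15)) (conf_check \<sigma> ?T (a # T') ps' z ?s)"
      by simp
    show ?thesis
      by (rule runs_check_loop[where \<sigma> = ?\<sigma>, OF get(1) _ a'(2) _ step]) (use IH a a' get(2) Cons.prems(5) in simp_all)
  qed
  then show ?case by (simp add: ps)
qed

section \<open>The decision procedure\<close>

text \<open>Each token has exactly one symbol from 4 on, a variable its closing bracket, so tokens
  can be counted without parsing them.\<close>

definition roots :: "nat list \<Rightarrow> nat" where
  "roots T = length (filter (\<lambda>s. 4 \<le> s) T)"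

lemma roots_simps [simp]: "roots [] = 0" "roots (xs @ ys) = roots xs + roots ys"
  "roots (a # xs) = (if 4 \<le> a then Suc (roots xs) else roots xs)"
  by (simp_all add: roots_def)

lemma roots_tokens: "roots (concat (map (token_symbols fs) ts)) = length ts"
proof (induction ts)
  case (Cons t ts)
  have "roots (name x) = 0" for x using set_binary_name[of x] by (auto simp: roots_def filter_empty_conv)
  then have "roots (token_symbols fs t) = 1" by (cases t) simp_all
  then show ?case using Cons by simp
qed simp

lemma roots_le: "roots T \<le> length T"
  by (simp add: roots_def)

lemma set_token_symbols:
  assumes "allowed M (set fs) t" "8 + length fs < n"
  shows "set (token_symbols fs t) \<subseteq> {0<..<n}"
proof (cases t)
  case (TVar x)
  have "set (name x) \<subseteq> {0<..<n}" using set_binary_name[of x] assms(2) by auto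
  then show ?thesis using assms(2) TVar by simp
next
  case (TConn f)
  then show ?thesis using index_of[of f fs] assms by simp
qed (use assms(2) in auto)

definition start_vectors :: "nat \<Rightarrow> cmd" where
  "start_vectors n = traverse n 2 15 (\<lambda>a. if 4 \<le> a then Seq (Push 11 1) (Push 12 2) else Skip)"

text \<open>Popping once tests that exactly one pair is left; 0 stands for an empty stack.\<close>

definition verdict :: cmd where
  "verdict = Switch 17 (\<lambda>f. if f \<noteq> 0 then Push 7 1 else Switch 16 (\<lambda>v. Seq (Pop 16) (Switch 16 (\<lambda>w.
     if v \<noteq> 0 \<and> w = 0 \<and> unpair v \<noteq> (1, 3) then Push 7 2 else Push 7 1))))"

definition clear_all :: "nat list \<Rightarrow> cmd" where
  "clear_all js = foldr (\<lambda>j. Seq (clear j)) js Skip"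

text \<open>The vectors are rebuilt from the path at each leaf and erased afterwards, so between
  leaves only the tokens and the search stacks occupy space.\<close>

definition leaf :: "nat \<Rightarrow> bool_fun list \<Rightarrow> cmd" where
  "leaf n fs = Seq (start_vectors n) (Seq (decode_path n) (Seq (check_loop n fs) (Seq (move n 15 2)
     (Seq verdict (clear_all [10, 11, 12, 13, 16, 17, 19, 20])))))"

lemma runs_start_vectors:
  assumes "set T \<subseteq> {0<..<n}" "length T < B" "\<sigma> 2 = T" "\<sigma> 15 = []" "\<sigma> 11 = []" "\<sigma> 12 = []"
  shows "runs B (start_vectors n) \<sigma> (\<sigma>(11 := replicate (roots T) 1, 12 := replicate (roots T) 2))"
  unfolding start_vectors_def
proof (rule runs_traverse[where S = "\<lambda>xs. \<sigma>(11 := replicate (roots xs) 1, 12 := replicate (roots xs) 2)" and zs = T])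
  fix xs a ys assume T: "T = xs @ a # ys"
  let ?\<sigma> = "\<sigma>(11 := replicate (roots xs) 1, 12 := replicate (roots xs) 2, 2 := ys, 15 := a # rev xs)"
  let ?\<tau> = "\<sigma>(11 := replicate (roots (xs @ [a])) 1, 12 := replicate (roots (xs @ [a])) 2, 2 := ys, 15 := a # rev xs)"
  have len: "roots xs < B" using roots_le[of xs] assms(2) T by simp
  show "runs B (if 4 \<le> a then Seq (Push 11 1) (Push 12 2) else Skip) ?\<sigma> ?\<tau>"
  proof (cases "4 \<le> a")
    case True
    have "runs B (Push 11 1) ?\<sigma> (?\<sigma>(11 := 1 # ?\<sigma> 11))" by (rule runs_Push) (use len in simp)
    moreover have "runs B (Push 12 2) (?\<sigma>(11 := 1 # ?\<sigma> 11)) ?\<tau>"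
      by (rule runs_eq[OF runs_Push]) (use len True in \<open>simp_all add: fun_eq_iff fun_upd_apply\<close>)
    ultimately show ?thesis using True by (simp add: runs_Seq)
  next
    case False
    then show ?thesis by (simp add: runs_Skip)
  qed
qed (use assms in \<open>simp_all add: fun_eq_iff fun_upd_apply\<close>)

lemma runs_clear_all: "runs B (clear_all js) \<sigma> (\<lambda>j. if j \<in> set js then [] else \<sigma> j)"
proof (induction js arbitrary: \<sigma>)
  case Nil
  show ?case unfolding clear_all_def by (simp add: runs_Skip)
next
  case (Cons i js)
  have "runs B (Seq (clear i) (clear_all js)) \<sigma> (\<lambda>j. if j \<in> set js then [] else (\<sigma>(i := [])) j)"
    by (rule runs_Seq[OF runs_clear Cons.IH])
  then show ?case unfolding clear_all_def foldr.simps comp_def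
    by (rule runs_eq) (simp add: fun_eq_iff fun_upd_apply)
qed

lemma runs_verdict:
  assumes "\<sigma> 16 = map pair V" "\<sigma> 17 = F" "set V \<subseteq> {0<..12} \<times> {0<..12}" "set F \<subseteq> {1}" "\<sigma> 7 = []" "0 < B"
  shows "\<exists>V'. runs B verdict \<sigma> (\<sigma>(16 := V', 7 := [if accepts (V, F, T1, T0) then 2 else 1]))"
proof (cases "F = []")
  case False
  then have "hd0 F \<noteq> 0" using assms(4) by (cases F) auto
  moreover have "runs B (Push 7 1) \<sigma> (\<sigma>(7 := 1 # \<sigma> 7))" by (rule runs_Push) (use assms in simp)
  ultimately have "runs B verdict \<sigma> (\<sigma>(7 := 1 # \<sigma> 7))"
    unfolding verdict_def by (intro runs_Switch) (simp add: assms(2))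
  moreover have "\<sigma>(7 := 1 # \<sigma> 7) = \<sigma>(16 := \<sigma> 16, 7 := [if accepts (V, F, T1, T0) then 2 else 1])"
    using False assms(5) by (simp add: accepts_def)
  ultimately show ?thesis by metis
next
  case True
  let ?\<sigma> = "\<sigma>(16 := tl (\<sigma> 16))"
  have pos: "pair p \<noteq> 0" "unpair (pair p) = p" if "p \<in> set V" for p using unpair_pair[of p] assms(3) that by auto
  have accepts: "accepts (V, F, T1, T0) \<longleftrightarrow> hd0 (\<sigma> 16) \<noteq> 0 \<and> hd0 (?\<sigma> 16) = 0 \<and> unpair (hd0 (\<sigma> 16)) \<noteq> (1, 3)"
  proof (cases V)
    case Nil
    then show ?thesis by (simp add: accepts_def assms(1))
  next
    case (Cons p V')
    then show ?thesis using pos True by (cases p; cases V') (auto simp: accepts_def assms(1))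
  qed
  let ?c = "if hd0 (\<sigma> 16) \<noteq> 0 \<and> hd0 (?\<sigma> 16) = 0 \<and> unpair (hd0 (\<sigma> 16)) \<noteq> (1, 3) then Push 7 2 else Push 7 1"
  have "?c = Push 7 (if accepts (V, F, T1, T0) then 2 else 1)" unfolding accepts by simp
  moreover have "runs B (Push 7 a) ?\<sigma> (?\<sigma>(7 := [a]))" for a
    by (rule runs_eq[OF runs_Push]) (use assms in simp_all)
  ultimately have "runs B ?c ?\<sigma> (?\<sigma>(7 := [if accepts (V, F, T1, T0) then 2 else 1]))" by simp
  then have "runs B (Switch 16 (\<lambda>w. if hd0 (\<sigma> 16) \<noteq> 0 \<and> w = 0 \<and> unpair (hd0 (\<sigma> 16)) \<noteq> (1, 3) then Push 7 2 else Push 7 1)) ?\<sigma>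
      (?\<sigma>(7 := [if accepts (V, F, T1, T0) then 2 else 1]))" by (rule runs_Switch)
  from runs_Seq[OF runs_Pop this] have "runs B verdict \<sigma> (?\<sigma>(7 := [if accepts (V, F, T1, T0) then 2 else 1]))"
    unfolding verdict_def using True assms(2) by (intro runs_Switch) (simp add: runs_Switch)
  then show ?thesis by blast
qed

definition leaf_value :: "token list \<Rightarrow> nat list \<Rightarrow> bool" where
  "leaf_value ts xs = (case decode (replicate (length ts) 1) (replicate (length ts) 2) xs of
     (M, a, b, z) \<Rightarrow> accepts (check z (zip ts (zip a b))))"

lemma fits_check:
  assumes "fits B (length xs) s" "\<And>t p. (t, p) \<in> set xs \<Longrightarrow> p \<in> {0<..12} \<times> {0<..12}"
  shows "fits B 0 (fold (check_token z) xs s)"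
  using assms
proof (induction xs arbitrary: s)
  case (Cons x xs)
  obtain t p where x: "x = (t, p)" by (cases x)
  have "fits B (length xs) (check_token z (t, p) s)"
    by (rule fits_check_token) (use Cons.prems(1) Cons.prems(2)[of t p] x in simp_all)
  then have "fits B 0 (fold (check_token z) xs (check_token z (t, p) s))"
    by (rule Cons.IH) (use Cons.prems(2) in \<open>meson list.set_intros(2)\<close>)
  then show ?case by (simp add: x)
qed simp

lemma runs_leaf:
  assumes ts: "\<And>t. t \<in> set ts \<Longrightarrow> allowed M (set fs) t" and T: "T = concat (map (token_symbols fs) ts)"
    and xs: "set xs \<subseteq> {0<..24}" "map (\<lambda>x. if odd x then 1 else 2) xs = rev (savitch_pattern (length ts) m K)"
    and n: "144 < n" "8 + length fs < n"
    and B: "length xs < B" "length T + 1 < B" "2 * length ts < B"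
    and \<sigma>: "\<sigma> 2 = T" "\<sigma> 6 = xs" "\<sigma> 7 = []" "\<And>j. j \<in> {9..20} \<Longrightarrow> \<sigma> j = []"
  shows "runs B (leaf n fs) \<sigma> (\<sigma>(7 := [if leaf_value ts xs then 2 else 1]))"
proof -
  let ?l = "length ts"
  have setT: "set T \<subseteq> {0<..<n}" using set_token_symbols[OF ts n(2)] unfolding T by auto
  have roots: "roots T = ?l" unfolding T by (rule roots_tokens)
  let ?\<sigma>1 = "\<sigma>(11 := replicate ?l 1, 12 := replicate ?l 2)"
  have 1: "runs B (start_vectors n) \<sigma> ?\<sigma>1"
    using runs_start_vectors[where \<sigma> = \<sigma>, OF setT _ \<sigma>(1), of B] B(2) \<sigma>(4) roots by simp
  obtain N a b z where d: "decode (replicate ?l 1) (replicate ?l 2) xs = (N, a, b, z)" by (metis prod_cases4)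
  have 2: "runs B (decode_path n) ?\<sigma>1 (load ?\<sigma>1 (N, a, b, z))"
    unfolding d[symmetric] by (rule runs_decode_path[where k = 12]) (use xs(1) n B \<sigma> in auto)
  have start: "set (replicate ?l 1) \<union> set (replicate ?l 2) \<subseteq> {0<..(12 :: nat)}" by auto
  have inv: "length z \<le> length xs" "set a \<union> set b \<union> set z \<subseteq> {0<..12}"
    using decode_invariant[OF d[unfolded decode_def], of 12] xs(1) start by simp_all
  have len: "length a = ?l" "length b = ?l" using decode_lengths[OF xs(2) _ _ d] by simp_all
  let ?ps = "zip a b"
  let ?\<rho> = "\<sigma>(10 := N)"
  have ps: "length ?ps = ?l" "map fst ?ps = a" "map snd ?ps = b" "set ?ps \<subseteq> {0<..12} \<times> {0<..12}"
    using len inv by (auto dest: set_zip_leftD set_zip_rightD)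
  have load: "load ?\<sigma>1 (N, a, b, z) = conf_check ?\<rho> T [] ?ps z ([], [], [], [])"
    using \<sigma> ps by (auto simp: load_def conf_check_def fun_eq_iff fun_upd_apply)
  have fits: "fits B ?l ([], [], [], [])" using B by (simp add: fits_def)
  obtain V F T1 T0 where s: "check z (zip ts ?ps) = (V, F, T1, T0)" by (metis prod_cases4)
  have z: "set z \<subseteq> {0<..<n}" using inv(2) n(1) by auto
  have 3: "runs B (check_loop n fs) (load ?\<sigma>1 (N, a, b, z)) (conf_check ?\<rho> [] (rev T) [] z (V, F, T1, T0))"
    using runs_check_tokens[OF ps(1,4) fits ts, where T' = "[]" and \<sigma> = ?\<rho> and z = z and n = n] n B \<sigma>(4) inv(1) z
    unfolding load T[symmetric] s[symmetric] check_def by simp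
  let ?\<sigma>4 = "conf_check ?\<rho> T [] [] z (V, F, T1, T0)"
  have 4: "runs B (move n 15 2) (conf_check ?\<rho> [] (rev T) [] z (V, F, T1, T0)) ?\<sigma>4"
    by (rule runs_eq[OF runs_move])
      (use setT B in \<open>simp_all add: conf_check_def fun_eq_iff fun_upd_apply\<close>)
  have "fits B 0 (V, F, T1, T0)"
    unfolding s[symmetric] check_def
    by (rule fits_check) (use fits ps len in \<open>auto dest: set_zip_rightD\<close>)
  then have "set V \<subseteq> {0<..12} \<times> {0<..12}" "set F \<subseteq> {1}" by (auto simp: fits_def)
  then obtain V' where 5: "runs B verdict ?\<sigma>4 (?\<sigma>4(16 := V', 7 := [if accepts (V, F, T1, T0) then 2 else 1]))"
    using runs_verdict[of ?\<sigma>4 V F B T1 T0] B \<sigma>(3) by (auto simp: conf_check_def)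
  have val: "leaf_value ts xs = accepts (V, F, T1, T0)" unfolding leaf_value_def d prod.case s ..
  let ?js = "[10, 11, 12, 13, 16, 17, 19, 20] :: nat list"
  have "runs B (leaf n fs) \<sigma> (\<lambda>j. if j \<in> set ?js then [] else (?\<sigma>4(16 := V', 7 := [if accepts (V, F, T1, T0) then 2 else 1])) j)"
    unfolding leaf_def by (intro runs_Seq[OF 1] runs_Seq[OF 2] runs_Seq[OF 3] runs_Seq[OF 4] runs_Seq[OF 5] runs_clear_all)
  then show ?thesis
    unfolding val by (rule runs_eq) (use \<sigma> in \<open>auto simp: conf_check_def fun_eq_iff fun_upd_apply\<close>)
qed

section \<open>The quantifier pattern and the main program\<close>

fun repeat :: "nat \<Rightarrow> cmd \<Rightarrow> cmd" where
  "repeat 0 c = Skip"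
| "repeat (Suc k) c = Seq c (repeat k c)"

text \<open>A stack grows from its end, so the universal tail is pushed before the blocks. The copy
  of the tokens on stack 21 drives the outer loop with eight blocks per token, while the inner
  traversals use the tokens on stack 2.\<close>

definition push_pattern :: "nat \<Rightarrow> cmd" where
  "push_pattern n = Seq (traverse n 2 15 (\<lambda>a. Push 5 2)) (Seq (traverse n 2 15 (put n 21))
     (For 21 (\<lambda>a. if 4 \<le> a
        then repeat 8 (Seq (Push 5 2) (traverse n 2 15 (\<lambda>a. if 4 \<le> a then Push 5 1 else Skip)))
        else Skip)))"

lemma savitch_pattern_Suc: "savitch_pattern l m (Suc K) = replicate l 1 @ 2 # savitch_pattern l m K"
  by (simp add: savitch_pattern_def)

lemma runs_push_pattern:
  assumes T: "set T \<subseteq> {0<..<n}" "length T < B" and B: "length (savitch_pattern (roots T) (length T) (8 * roots T)) < B"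
    and \<sigma>: "\<sigma> 2 = T" "\<sigma> 5 = []" "\<sigma> 15 = []" "\<sigma> 21 = []"
  shows "runs B (push_pattern n) \<sigma> (\<sigma>(5 := savitch_pattern (roots T) (length T) (8 * roots T)))"
proof -
  let ?l = "roots T" and ?m = "length T"
  let ?Q = "savitch_pattern ?l ?m"
  let ?block = "Seq (Push 5 2) (traverse n 2 15 (\<lambda>a. if 4 \<le> a then Push 5 1 else Skip))"
  have 1: "runs B (traverse n 2 15 (\<lambda>a. Push 5 2)) \<sigma> (\<sigma>(5 := ?Q 0))"
  proof (rule runs_traverse[where S = "\<lambda>xs. \<sigma>(5 := replicate (length xs) 2)" and zs = T])
    fix xs a ys assume "T = xs @ a # ys"
    then show "runs B (Push 5 2) (\<sigma>(5 := replicate (length xs) 2, 2 := ys, 15 := a # rev xs))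
        (\<sigma>(5 := replicate (length (xs @ [a])) 2, 2 := ys, 15 := a # rev xs))"
      by (intro runs_eq[OF runs_Push]) (use T(2) in \<open>simp_all add: fun_eq_iff fun_upd_apply\<close>)
  qed (use assms in \<open>simp_all add: savitch_pattern_def fun_eq_iff fun_upd_apply\<close>)
  have 2: "runs B (traverse n 2 15 (put n 21)) (\<sigma>(5 := ?Q 0)) (\<sigma>(5 := ?Q 0, 21 := rev T))"
  proof (rule runs_traverse[where S = "\<lambda>xs. \<sigma>(5 := ?Q 0, 21 := rev xs)" and zs = T])
    fix xs a ys assume "T = xs @ a # ys"
    then show "runs B (put n 21 a) (\<sigma>(5 := ?Q 0, 21 := rev xs, 2 := ys, 15 := a # rev xs))
        (\<sigma>(5 := ?Q 0, 21 := rev (xs @ [a]), 2 := ys, 15 := a # rev xs))"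
      by (intro runs_eq[OF runs_put]) (use T in \<open>simp_all add: fun_eq_iff fun_upd_apply\<close>)
  qed (use assms in \<open>simp_all add: fun_eq_iff fun_upd_apply\<close>)
  have block: "runs B ?block (\<sigma>(5 := ?Q K, 21 := us)) (\<sigma>(5 := ?Q (Suc K), 21 := us))" if K: "K < 8 * ?l" for K us
  proof -
    have "length (?Q (Suc K)) < B" using K B unfolding length_savitch_pattern
      by (intro order.strict_trans1[OF _ B[unfolded length_savitch_pattern]] add_mono mult_le_mono) auto
    then have len: "?l + Suc (length (?Q K)) < B" by (simp add: savitch_pattern_Suc)
    have "runs B (Push 5 2) (\<sigma>(5 := ?Q K, 21 := us)) (\<sigma>(5 := 2 # ?Q K, 21 := us))"
      by (rule runs_eq[OF runs_Push]) (use len in \<open>simp_all add: fun_eq_iff fun_upd_apply\<close>)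
    moreover have "runs B (traverse n 2 15 (\<lambda>a. if 4 \<le> a then Push 5 1 else Skip)) (\<sigma>(5 := 2 # ?Q K, 21 := us)) (\<sigma>(5 := ?Q (Suc K), 21 := us))"
    proof (rule runs_traverse[where S = "\<lambda>xs. \<sigma>(5 := replicate (roots xs) 1 @ 2 # ?Q K, 21 := us)" and zs = T])
      fix xs a ys assume xs: "T = xs @ a # ys"
      let ?S = "\<lambda>xs'. \<sigma>(5 := replicate (roots xs') 1 @ 2 # ?Q K, 21 := us, 2 := ys, 15 := a # rev xs)"
      show "runs B (if 4 \<le> a then Push 5 1 else Skip) (?S xs) (?S (xs @ [a]))"
      proof (cases "4 \<le> a")
        case True
        have "runs B (Push 5 1) (?S xs) (?S (xs @ [a]))"
          by (rule runs_eq[OF runs_Push]) (use xs True len in \<open>simp_all add: fun_eq_iff fun_upd_apply\<close>)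
        then show ?thesis using True by simp
      qed (simp add: runs_Skip)
    qed (use assms in \<open>simp_all add: savitch_pattern_Suc fun_eq_iff fun_upd_apply\<close>)
    ultimately show ?thesis by (rule runs_Seq)
  qed
  have blocks: "runs B (repeat k ?block) (\<sigma>(5 := ?Q K, 21 := us)) (\<sigma>(5 := ?Q (k + K), 21 := us))" if "k + K \<le> 8 * ?l" for k K us
    using that
  proof (induction k arbitrary: K)
    case (Suc k)
    then show ?case using runs_Seq[OF block Suc.IH[of "Suc K"]] by simp
  qed (simp add: runs_Skip)
  have 3: "runs B (For 21 (\<lambda>a. if 4 \<le> a then repeat 8 ?block else Skip)) (\<sigma>(5 := ?Q 0, 21 := rev T)) (\<sigma>(5 := ?Q (8 * ?l)))"
  proof (rule runs_For[where S = "\<lambda>xs. \<sigma>(5 := ?Q (8 * roots xs))" and zs = "rev T"])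
    fix xs a ys assume xs: "rev T = xs @ a # ys"
    have "roots T = roots (rev T)" by (simp add: roots_def flip: rev_filter)
    then have le: "roots (xs @ [a]) \<le> ?l" unfolding xs by simp
    show "runs B (if 4 \<le> a then repeat 8 ?block else Skip) (\<sigma>(5 := ?Q (8 * roots xs), 21 := ys)) (\<sigma>(5 := ?Q (8 * roots (xs @ [a])), 21 := ys))"
      using blocks[of 8 "8 * roots xs" ys] le by (cases "4 \<le> a") (simp_all add: runs_Skip)
  next
    have "roots T = roots (rev T)" by (simp add: roots_def flip: rev_filter)
    then show "\<sigma>(5 := ?Q (8 * ?l)) = \<sigma>(5 := ?Q (8 * roots (rev T)), 21 := [])"
      using \<sigma> by (simp add: fun_eq_iff fun_upd_apply)
  qed simp
  show ?thesis unfolding push_pattern_def by (intro runs_Seq[OF 1] runs_Seq[OF 2] 3)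
qed

text \<open>A nonempty stack 3 means that the input is no sequence of tokens; an empty stack 7 then
  makes the machine reject.\<close>

definition decide :: "nat \<Rightarrow> temporal_op set \<Rightarrow> bool_fun list \<Rightarrow> cmd" where
  "decide n M fs = Seq (tokenize n M fs) (Switch 3 (\<lambda>s. if s = 0 then Seq (push_pattern n) (search n 12 (leaf n fs)) else clear 7))"

lemma wf_decide:
  assumes "5 \<le> n"
  shows "wf_cmd n 21 (decide n M fs)"
proof -
  have gather: "wf_cmd n 21 (gather n t p k ps)" for t p k ps
    by (induction k arbitrary: ps) (use assms in auto)
  then have visit: "wf_cmd n 21 (visit n t h)" for t h
    using assms by (simp add: visit_def mark_def)
  then have "wf_cmd n 21 (check_loop n fs)"
    using assms by (simp add: check_loop_def check_symbol_def)
  moreover have "wf_cmd n 21 (start_vectors n)" "wf_cmd n 21 (decode_path n)" "wf_cmd n 21 verdict"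
    using assms by (simp_all add: start_vectors_def decode_path_def decode_symbol_def verdict_def Let_def)
  ultimately have "wf_cmd n 21 (leaf n fs)"
    using assms by (simp add: leaf_def clear_all_def)
  then have "wf_cmd n 21 (search n 12 (leaf n fs))" using assms by (intro wf_search) simp_all
  moreover have "wf_cmd n 21 (repeat k c)" if "wf_cmd n 21 c" for k c
    using that by (induction k) simp_all
  then have "wf_cmd n 21 (push_pattern n)" using assms by (simp add: push_pattern_def)
  moreover have "wf_cmd n 21 (tokenize n M fs)" by (rule wf_tokenize) (use assms in simp_all)
  ultimately show ?thesis by (simp add: decide_def)
qed

section \<open>Correctness and the space bound\<close>

lemma encode_tokens_inj: "concat (map encode_token ts) = concat (map encode_token ts') \<Longrightarrow> ts = ts'"
proof (induction ts arbitrary: ts')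
  case Nil
  have "encode_token t \<noteq> []" for t by (cases t) simp_all
  then show ?case using Nil by (cases ts') auto
next
  case (Cons t ts)
  have "encode_token t \<noteq> []" by (cases t) simp_all
  then obtain t' us where ts': "ts' = t' # us" using Cons.prems by (cases ts') auto
  then show ?case using Cons.prems Cons.IH encode_token_prefix[of t _ t'] by simp
qed

lemma in_SAT_iff:
  assumes M: "M \<subseteq> {Op_X, Op_F, Op_G}" and ts: "\<And>t. t \<in> set ts \<Longrightarrow> allowed M B t"
  shows "concat (map encode_token (rev ts)) \<in> SAT M B \<longleftrightarrow> well_formed ts \<and> satisfiable (node ts (length ts - 1))"
proof
  assume "concat (map encode_token (rev ts)) \<in> SAT M B"
  then obtain \<phi> where \<phi>: "\<phi> \<in> formulas M B" "satisfiable \<phi>" "concat (map encode_token (rev ts)) = encode \<phi>"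
    by (auto simp: SAT_def)
  obtain us where us: "well_formed us" "\<And>t. t \<in> set us \<Longrightarrow> allowed M B t" "node us (length us - 1) = \<phi>"
    using formula_tokens[OF \<phi>(1) M] by metis
  have "encode \<phi> = concat (map encode_token (rev us))" using well_formed_formula(2)[OF us(1,2)] us(3) by simp
  from encode_tokens_inj[OF \<phi>(3)[unfolded this]] have "ts = us" by simp
  then show "well_formed ts \<and> satisfiable (node ts (length ts - 1))" using us(1,3) \<phi>(2) by simp
next
  assume "well_formed ts \<and> satisfiable (node ts (length ts - 1))"
  then show "concat (map encode_token (rev ts)) \<in> SAT M B"
    using well_formed_formula[of ts M B] ts encode_in_SAT_iff by metis
qed

lemma SAT_tokens:
  assumes M: "M \<subseteq> {Op_X, Op_F, Op_G}" and "w \<in> SAT M B"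
  shows "\<exists>ts. (\<forall>t\<in>set ts. allowed M B t) \<and> w = concat (map encode_token (rev ts))"
proof -
  obtain \<phi> where \<phi>: "\<phi> \<in> formulas M B" "w = encode \<phi>" using assms(2) by (auto simp: SAT_def)
  obtain us where us: "well_formed us" "\<And>t. t \<in> set us \<Longrightarrow> allowed M B t" "node us (length us - 1) = \<phi>"
    using formula_tokens[OF \<phi>(1) M] by metis
  then show ?thesis using well_formed_formula(2)[OF us(1,2)] \<phi>(2) by blast
qed

lemma token_lengths:
  "length (concat (map (token_symbols fs) ts)) \<le> 2 * length (concat (map encode_token (rev ts)))"
  "length ts \<le> length (concat (map (token_symbols fs) ts))"
proof -
  have "length (concat (map (token_symbols fs) ts)) \<le> 2 * length (concat (map encode_token (rev ts))) \<and>
      length ts \<le> length (concat (map (token_symbols fs) ts))"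
  proof (induction ts)
    case (Cons t ts)
    have "length (token_symbols fs t) \<le> 2 * length (encode_token t) \<and> 1 \<le> length (token_symbols fs t)"
      by (cases t; simp add: encode_nat_def name.simps length_concat comp_def sum_list_triv)
    then show ?case using Cons by simp
  qed simp
  then show "length (concat (map (token_symbols fs) ts)) \<le> 2 * length (concat (map encode_token (rev ts)))"
    "length ts \<le> length (concat (map (token_symbols fs) ts))" by simp_all
qed

lemma runs_decide:
  assumes M: "M \<subseteq> {Op_X, Op_F, Op_G}" and n: "144 < n" "8 + length fs < n"
    and B: "32 * (length w)\<^sup>2 + 20 * length w + 10 \<le> B"
  shows "\<exists>\<tau>. runs B (decide n M fs) (input_stacks w) \<tau> \<and> (hd0 (\<tau> 7) = 2 \<longleftrightarrow> w \<in> SAT M (set fs))"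
proof -
  let ?\<sigma> = "input_stacks w"
  have input: "?\<sigma> 1 = map bit_symbol w" "\<And>j. j \<noteq> 1 \<Longrightarrow> ?\<sigma> j = []" by (simp_all add: input_stacks_def)
  have "(\<exists>ts. (\<forall>t\<in>set ts. allowed M (set fs) t) \<and> w = concat (map encode_token (rev ts)) \<and>
      runs B (tokenize n M fs) ?\<sigma> (?\<sigma>(1 := [], 2 := concat (map (token_symbols fs) ts) @ ?\<sigma> 2))) \<or>
    (\<nexists>ts. (\<forall>t\<in>set ts. allowed M (set fs) t) \<and> w = concat (map encode_token (rev ts))) \<and>
      (\<exists>\<tau>. runs B (tokenize n M fs) ?\<sigma> \<tau> \<and> hd0 (\<tau> 3) = 1)"
    by (rule runs_tokenize) (use input B n in simp_all)
  then consider ts where "\<forall>t\<in>set ts. allowed M (set fs) t" "w = concat (map encode_token (rev ts))"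
      "runs B (tokenize n M fs) ?\<sigma> (?\<sigma>(1 := [], 2 := concat (map (token_symbols fs) ts) @ ?\<sigma> 2))"
    | \<tau> where "\<nexists>ts. (\<forall>t\<in>set ts. allowed M (set fs) t) \<and> w = concat (map encode_token (rev ts))"
      "runs B (tokenize n M fs) ?\<sigma> \<tau>" "hd0 (\<tau> 3) = 1"
    by blast
  then show ?thesis
  proof cases
    case (2 \<tau>)
    have "runs B (Switch 3 (\<lambda>s. if s = 0 then Seq (push_pattern n) (search n 12 (leaf n fs)) else clear 7)) \<tau> (\<tau>(7 := []))"
      by (rule runs_Switch) (simp add: 2(3) runs_clear)
    from runs_Seq[OF 2(2) this] have "runs B (decide n M fs) ?\<sigma> (\<tau>(7 := []))" by (simp add: decide_def)
    moreover have "w \<notin> SAT M (set fs)" using SAT_tokens[OF M] 2(1) by blast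
    ultimately show ?thesis by (intro exI[of _ "\<tau>(7 := [])"]) simp
  next
    case (1 ts)
    let ?T = "concat (map (token_symbols fs) ts)"
    let ?l = "length ts"
    let ?Q = "savitch_pattern ?l (length ?T) (8 * ?l)"
    define \<rho> where "\<rho> = ?\<sigma>(1 := [], 2 := ?T)"
    have \<rho>: "\<rho> 2 = ?T" "\<And>j. j \<noteq> 2 \<Longrightarrow> \<rho> j = []" by (simp_all add: \<rho>_def fun_upd_apply input)
    have tok: "runs B (tokenize n M fs) ?\<sigma> \<rho>" using 1(3) by (simp add: \<rho>_def input)
    have allowed: "allowed M (set fs) t" if "t \<in> set ts" for t using 1(1) that by blast
    have setT: "set ?T \<subseteq> {0<..<n}" using set_token_symbols[OF allowed n(2)] by auto
    have T: "length ?T \<le> 2 * length w" "?l \<le> 2 * length w"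
      using token_lengths[where fs = fs and ts = ts] unfolding 1(2) by simp_all
    \<comment> \<open>The longest stack is the pattern: with at most \<open>2 * length w\<close>
      tokens and symbols its length is at most 32 |w|^2 + 18 |w|, which explains the quadratic
      bound.\<close>
    have "length ?Q \<le> 8 * (2 * length w) * (2 * length w + 1) + 2 * length w"
      unfolding length_savitch_pattern by (intro add_mono mult_le_mono T) simp_all
    also have "\<dots> < B" using B by (simp add: power2_eq_square algebra_simps)
    finally have Q: "length ?Q < B" .
    have roots: "roots ?T = ?l" by (rule roots_tokens)
    have pat: "runs B (push_pattern n) \<rho> (\<rho>(5 := ?Q))"
      using runs_push_pattern[where \<sigma> = \<rho> and n = n and B = B and T = ?T] setT T(1) B Q \<rho> by (simp add: roots)
    let ?r = "if qeval 12 (leaf_value ts) ?Q [] then 2 else 1 :: nat"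
    have "runs B (search n 12 (leaf n fs)) (\<rho>(5 := ?Q, 6 := [], 7 := [])) (\<rho>(5 := ?Q, 6 := [], 7 := [?r]))"
    proof (rule runs_search)
      fix xs :: "nat list"
      assume xs: "length xs = length ?Q" "set xs \<subseteq> {0<..2 * 12}" "map (\<lambda>x. if odd x then 1 else 2) xs = rev ?Q"
      let ?\<rho> = "\<rho>(5 := [], 6 := xs, 7 := [], 8 := [1])"
      have "runs B (leaf n fs) ?\<rho> (?\<rho>(7 := [if leaf_value ts xs then 2 else 1]))"
        by (rule runs_leaf[OF allowed refl _ xs(3) n]) (use xs Q T B \<rho> in simp_all)
      then show "runs B (leaf n fs) ?\<rho> (\<rho>(5 := [], 6 := xs, 7 := [if leaf_value ts xs then 2 else 1], 8 := [1]))"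
        by (rule runs_eq) (simp add: fun_eq_iff fun_upd_apply)
    qed (use n Q \<rho> in \<open>auto simp: savitch_pattern_def\<close>)
    moreover have "\<rho>(5 := ?Q, 6 := [], 7 := []) = \<rho>(5 := ?Q)" using \<rho> by (simp add: fun_eq_iff fun_upd_apply)
    ultimately have search: "runs B (search n 12 (leaf n fs)) (\<rho>(5 := ?Q)) (\<rho>(5 := ?Q, 6 := [], 7 := [?r]))" by simp
    have "runs B (Switch 3 (\<lambda>s. if s = 0 then Seq (push_pattern n) (search n 12 (leaf n fs)) else clear 7)) \<rho> (\<rho>(5 := ?Q, 6 := [], 7 := [?r]))"
      by (rule runs_Switch) (use runs_Seq[OF pat search] \<rho> in simp)
    from runs_Seq[OF tok this] have "runs B (decide n M fs) ?\<sigma> (\<rho>(5 := ?Q, 6 := [], 7 := [?r]))" by (simp add: decide_def)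
    moreover have "qeval 12 (leaf_value ts) ?Q [] \<longleftrightarrow> well_formed ts \<and> satisfiable (node ts (?l - 1))"
      by (rule qeval_satisfiable[OF refl]) (simp add: leaf_value_def)
    then have "qeval 12 (leaf_value ts) ?Q [] \<longleftrightarrow> w \<in> SAT M (set fs)"
      unfolding 1(2) using in_SAT_iff[OF M allowed] by simp
    ultimately show ?thesis by (intro exI[of _ "\<rho>(5 := ?Q, 6 := [], 7 := [?r])"]) simp
  qed
qed

lemma SAT_in_PSPACE:
  assumes "finite B" and M: "M \<subseteq> {Op_X, Op_F, Op_G}"
  shows "SAT M B \<in> PSPACE"
proof -
  obtain fs where fs: "set fs = B" using finite_list[OF assms(1)] by blast
  \<comment> \<open>Room for the 144 cell pairs and for the symbols of the connectives, which start
    at 8.\<close>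
  define n where "n = 200 + length fs"
  let ?p = "[:10, 20, 32:] :: nat poly"
  have p: "poly ?p k = 32 * k\<^sup>2 + 20 * k + 10" for k by (simp add: power2_eq_square algebra_simps)
  show ?thesis
  proof (rule PSPACE_program)
    show "wf_cmd n 21 (decide n M fs)" by (rule wf_decide) (simp add: n_def)
    fix w :: "bool list"
    show "\<exists>m \<tau>. exec (\<lambda>l. l \<le> poly ?p (length w)) (decide n M fs) (input_stacks w) m \<tau> \<and> (hd0 (\<tau> 7) = 2 \<longleftrightarrow> w \<in> SAT M B)"
      using runs_decide[OF M, of n fs w "poly ?p (length w)"] unfolding p fs runs_def by (auto simp: n_def)
    show "length w \<le> poly ?p (length w)" unfolding p by simp
  qed (simp_all add: n_def)
qed

theorem theorem3p2:
  fixes B :: "bool_fun set"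
  assumes "finite B" and "S1 \<subseteq> clone B"
  shows "PSPACE_complete (SAT {Op_G, Op_X} B) \<and> PSPACE_complete (SAT {Op_F, Op_X} B)"
  unfolding PSPACE_complete_def
  using SAT_in_PSPACE[OF assms(1)] PSPACE_reducible[OF _ assms(2)] by (auto simp: insert_commute)

end
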